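(* Let $M$ be a left $R$-module and $n\geq 1$. Then the following statements are equivalent. (1) $\mathrm{co}\Omega^n(M)$ is $n$-$C$-cotorsionfree. (2) There exists an exact sequence $0\rightarrow M\rightarrow X\rightarrow Y\rightarrow 0$ in $\mathrm{Mod}\, R$ such that $X$ is $n$-$C$-cospherical and $\mathrm{Add}_RC$-$\mathrm{id}_R(Y)\leq n-1$.
   Context: $R$ and $S$ are fixed associative unital rings; $\mathrm{Mod}\, R$ denotes the left $R$-modules. ${}_RC_S$ is a fixed semidualizing $(R,S)$-bimodule, i.e.: ${}_RC$ and $C_S$ each admit a projective resolution (over $R$, resp. over $S$ on the right) with all terms finitely generated; the homothety maps $R\to \mathrm{Hom}_{S}(C,C)$ and $S\to \mathrm{Hom}_R(C,C)$ are isomorphisms; and $\mathrm{Ext}^{i}_R(C,C)=0=\mathrm{Ext}^{i}_{S}(C,C)$ for all $i\geq 1$. Write $(-)_*=\mathrm{Hom}_R(C,-)$, a functor from left $R$-modules to left $S$-modules. For $M\in\mathrm{Mod}\, R$ let $0\to M\to I^0(M)\xrightarrow{f^0} I^1(M)\xrightarrow{f^1}\cdots$ be its minimal injective resolution. For $n\ge1$, $\mathrm{co}\Omega^n(M):=\mathrm{Im} f^{n-1}$ is the $n$-th cosyzygy of $M$. The cotranspose of $M$ is the left $S$-module $\mathrm{cTr}_C M:=\mathrm{Coker}(f^0_*: I^0(M)_*\to I^1(M)_* )$. $M$ is $n$-$C$-cotorsionfree if $\mathrm{Tor}^S_i(C,\mathrm{cTr}_C M)=0$ for all $1\leq i\leq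 n$. $M$ is $n$-$C$-cospherical if $\mathrm{Ext}_R^i(C,M)=0$ for all $1\le i\le n$. $\mathrm{Add}_R C$ is the class of direct summands of direct sums of (arbitrarily many) copies of $C$. $\mathrm{Add}_RC$-$\mathrm{id}_R(Y)$ is the infimum of the integers $m\ge0$ for which there is an exact sequence $0\to Y\to X^0\to X^1\to\cdots\to X^m\to 0$ in $\mathrm{Mod}\, R$ with all $X^i\in \mathrm{Add}_RC$. *)

theory Defs
  imports "HOL-Algebra.Module" "HOL-Algebra.AbelCoset" "HOL-Algebra.Free_Abelian_Groups"
    "HOL-Algebra.Generated_Groups" "HOL-Library.Extended_Nat"
begin

text \<open>
  Conventions.  Rings are associative and unital, not necessarily commutative; the zero ring is
  allowed.  Modules use the record type of \<^theory>\<open>HOL-Algebra.Module\<close>, whose fields \<open>mult\<close> and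
  \<open>one\<close> carry no meaning.  The locale \<open>module\<close> of that theory requires a commutative ring, hence
  the locale \<open>left_module\<close> below.  A right \<open>S\<close>-module is a left module over the opposite
  ring of \<open>S\<close>.

  Universe.  The category of left \<open>R\<close>-modules is modelled by the modules whose carrier is a subset
  of a type \<open>'u\<close>, the carrier of \<open>R\<close> being a subset of the same type.  Notions that quantify over
  modules (injective, projective, resolutions, ...) refer to this universe.  For infinite \<open>'u\<close>
  the universe contains free covers of its modules, and injectivity and projectivity do not depend
  on the choice of \<open>'u\<close> (Baer's criterion; summands of free modules).  Given rings and modules
  of any types, there is a type \<open>'u\<close> holding copies of them and of a minimal injective resolution.
\<close>

section \<open>Modules and homomorphisms\<close>

locale left_module = R?: ring R + M?: abelian_group M
  for R :: "('r, 'x) ring_scheme" (structure) and M :: "('r, 'a, 'y) module_scheme" (structure) +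
  assumes smult_closed:
      "\<lbrakk>r \<in> carrier R; x \<in> carrier M\<rbrakk> \<Longrightarrow> r \<odot>\<^bsub>M\<^esub> x \<in> carrier M"
    and smult_l_distr:
      "\<lbrakk>r \<in> carrier R; s \<in> carrier R; x \<in> carrier M\<rbrakk> \<Longrightarrow>
       (r \<oplus>\<^bsub>R\<^esub> s) \<odot>\<^bsub>M\<^esub> x = r \<odot>\<^bsub>M\<^esub> x \<oplus>\<^bsub>M\<^esub> s \<odot>\<^bsub>M\<^esub> x"
    and smult_r_distr:
      "\<lbrakk>r \<in> carrier R; x \<in> carrier M; y \<in> carrier M\<rbrakk> \<Longrightarrow>
       r \<odot>\<^bsub>M\<^esub> (x \<oplus>\<^bsub>M\<^esub> y) = r \<odot>\<^bsub>M\<^esub> x \<oplus>\<^bsub>M\<^esub> r \<odot>\<^bsub>M\<^esub> y"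
    and smult_assoc:
      "\<lbrakk>r \<in> carrier R; s \<in> carrier R; x \<in> carrier M\<rbrakk> \<Longrightarrow>
       (r \<otimes>\<^bsub>R\<^esub> s) \<odot>\<^bsub>M\<^esub> x = r \<odot>\<^bsub>M\<^esub> (s \<odot>\<^bsub>M\<^esub> x)"
    and smult_one: "x \<in> carrier M \<Longrightarrow> \<one>\<^bsub>R\<^esub> \<odot>\<^bsub>M\<^esub> x = x"

definition op_ring :: "('a, 'b) ring_scheme \<Rightarrow> ('a, 'b) ring_scheme" where
  "op_ring R = R\<lparr>monoid.mult := \<lambda>x y. y \<otimes>\<^bsub>R\<^esub> x\<rparr>"

text \<open>Homomorphisms are extensional functions (\<open>undefined\<close> off the domain), so that equality of
  homomorphisms is equality of functions.\<close>

definition mod_hom ::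
  "('r, 'x) ring_scheme \<Rightarrow> ('r, 'a, 'y) module_scheme \<Rightarrow> ('r, 'b, 'z) module_scheme \<Rightarrow> ('a \<Rightarrow> 'b) set"
  where "mod_hom R A B =
    {h \<in> carrier A \<rightarrow>\<^sub>E carrier B.
       (\<forall>x\<in>carrier A. \<forall>y\<in>carrier A. h (x \<oplus>\<^bsub>A\<^esub> y) = h x \<oplus>\<^bsub>B\<^esub> h y) \<and>
       (\<forall>r\<in>carrier R. \<forall>x\<in>carrier A. h (r \<odot>\<^bsub>A\<^esub> x) = r \<odot>\<^bsub>B\<^esub> h x)}"

definition mod_iso ::
  "('r, 'x) ring_scheme \<Rightarrow> ('r, 'a, 'y) module_scheme \<Rightarrow> ('r, 'b, 'z) module_scheme \<Rightarrow> bool"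
  where "mod_iso R A B \<longleftrightarrow> (\<exists>h\<in>mod_hom R A B. bij_betw h (carrier A) (carrier B))"

definition hom_group ::
  "('r, 'x) ring_scheme \<Rightarrow> ('r, 'a, 'y) module_scheme \<Rightarrow> ('r, 'b, 'z) module_scheme
    \<Rightarrow> ('a \<Rightarrow> 'b) monoid"
  where "hom_group R A B =
    \<lparr>carrier = mod_hom R A B,
     monoid.mult = (\<lambda>f g. \<lambda>x\<in>carrier A. f x \<oplus>\<^bsub>B\<^esub> g x),
     one = (\<lambda>x\<in>carrier A. \<zero>\<^bsub>B\<^esub>)\<rparr>"

definition quotient_module ::
  "('r, 'a, 'y) module_scheme \<Rightarrow> 'a set \<Rightarrow> ('r, 'a set) module"
  where "quotient_module M N =
    \<lparr>carrier = a_rcosets\<^bsub>M\<^esub> N, monoid.mult = undefined, one = undefined,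
     ring.zero = N, add = set_add M, smult = (\<lambda>r X. \<Union>x\<in>X. N +>\<^bsub>M\<^esub> (r \<odot>\<^bsub>M\<^esub> x))\<rparr>"

definition short_exact ::
  "('r, 'x) ring_scheme \<Rightarrow> ('r, 'a) module \<Rightarrow> ('r, 'b) module \<Rightarrow> ('r, 'c) module
    \<Rightarrow> ('a \<Rightarrow> 'b) \<Rightarrow> ('b \<Rightarrow> 'c) \<Rightarrow> bool"
  where "short_exact R A B D f g \<longleftrightarrow>
    f \<in> mod_hom R A B \<and> g \<in> mod_hom R B D \<and>
    inj_on f (carrier A) \<and> f ` carrier A = a_kernel B D g \<and> g ` carrier B = carrier D"

definition finitely_generated :: "('r, 'x) ring_scheme \<Rightarrow> ('r, 'a) module \<Rightarrow> bool" where
  "finitely_generated R M \<longleftrightarrow>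
    (\<exists>A. finite A \<and> A \<subseteq> carrier M \<and> (\<forall>N. submodule N R M \<and> A \<subseteq> N \<longrightarrow> N = carrier M))"

definition essential_submodule ::
  "('r, 'x) ring_scheme \<Rightarrow> 'a set \<Rightarrow> ('r, 'a) module \<Rightarrow> bool"
  where "essential_submodule R N M \<longleftrightarrow>
    submodule N R M \<and> (\<forall>K. submodule K R M \<and> K \<inter> N = {\<zero>\<^bsub>M\<^esub>} \<longrightarrow> K = {\<zero>\<^bsub>M\<^esub>})"

definition projective_module :: "'u ring \<Rightarrow> ('u, 'u) module \<Rightarrow> bool" where
  "projective_module R P \<longleftrightarrow> left_module R P \<and>
    (\<forall>(A :: ('u, 'u) module) (B :: ('u, 'u) module).
       left_module R A \<and> left_module R B \<longrightarrow>
       (\<forall>g\<in>mod_hom R A B. \<forall>h\<in>mod_hom R P B. g ` carrier A = carrier B \<longrightarrow>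
          (\<exists>k\<in>mod_hom R P A. \<forall>x\<in>carrier P. g (k x) = h x)))"

definition injective_module :: "'u ring \<Rightarrow> ('u, 'u) module \<Rightarrow> bool" where
  "injective_module R I \<longleftrightarrow> left_module R I \<and>
    (\<forall>(A :: ('u, 'u) module) (B :: ('u, 'u) module).
       left_module R A \<and> left_module R B \<longrightarrow>
       (\<forall>g\<in>mod_hom R A B. \<forall>h\<in>mod_hom R A I. inj_on g (carrier A) \<longrightarrow>
          (\<exists>k\<in>mod_hom R B I. \<forall>x\<in>carrier A. k (g x) = h x)))"

section \<open>Resolutions\<close>

text \<open>Exactness of \<open>\<dots> \<rightarrow> P 2 \<rightarrow> P 1 \<rightarrow> P 0 \<rightarrow> A \<rightarrow> 0\<close> with \<open>d i : P (i + 1) \<rightarrow> P i\<close>.\<close>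

definition projective_resolution ::
  "'u ring \<Rightarrow> ('u, 'u) module \<Rightarrow> (nat \<Rightarrow> ('u, 'u) module) \<Rightarrow> (nat \<Rightarrow> 'u \<Rightarrow> 'u) \<Rightarrow> ('u \<Rightarrow> 'u) \<Rightarrow> bool"
  where "projective_resolution R A P d e \<longleftrightarrow>
    (\<forall>i. projective_module R (P i)) \<and>
    (\<forall>i. d i \<in> mod_hom R (P (Suc i)) (P i)) \<and> e \<in> mod_hom R (P 0) A \<and>
    e ` carrier (P 0) = carrier A \<and>
    d 0 ` carrier (P (Suc 0)) = a_kernel (P 0) A e \<and>
    (\<forall>i. d (Suc i) ` carrier (P (Suc (Suc i))) = a_kernel (P (Suc i)) (P i) (d i))"

text \<open>Exactness of \<open>0 \<rightarrow> M \<rightarrow> X 0 \<rightarrow> X 1 \<rightarrow> X 2 \<rightarrow> \<dots>\<close> with \<open>f i : X i \<rightarrow> X (i + 1)\<close>.\<close>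

definition coresolution ::
  "('r, 'x) ring_scheme \<Rightarrow> ('r, 'a) module \<Rightarrow> (nat \<Rightarrow> ('r, 'b) module) \<Rightarrow> ('a \<Rightarrow> 'b)
    \<Rightarrow> (nat \<Rightarrow> 'b \<Rightarrow> 'b) \<Rightarrow> bool"
  where "coresolution R M X e f \<longleftrightarrow>
    (\<forall>i. left_module R (X i)) \<and>
    e \<in> mod_hom R M (X 0) \<and> (\<forall>i. f i \<in> mod_hom R (X i) (X (Suc i))) \<and>
    inj_on e (carrier M) \<and>
    e ` carrier M = a_kernel (X 0) (X (Suc 0)) (f 0) \<and>
    (\<forall>i. f i ` carrier (X i) = a_kernel (X (Suc i)) (X (Suc (Suc i))) (f (Suc i)))"

text \<open>Minimality: \<open>I 0\<close> is an injective envelope of \<open>M\<close>, and \<open>I (i + 1)\<close> is an injective envelope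
  of the image of \<open>f i\<close>, an injective envelope being an essential embedding into an injective module.\<close>

definition minimal_injective_resolution ::
  "'u ring \<Rightarrow> ('u, 'u) module \<Rightarrow> (nat \<Rightarrow> ('u, 'u) module) \<Rightarrow> ('u \<Rightarrow> 'u) \<Rightarrow> (nat \<Rightarrow> 'u \<Rightarrow> 'u) \<Rightarrow> bool"
  where "minimal_injective_resolution R M I e f \<longleftrightarrow>
    coresolution R M I e f \<and> (\<forall>i. injective_module R (I i)) \<and>
    essential_submodule R (e ` carrier M) (I 0) \<and>
    (\<forall>i. essential_submodule R (f i ` carrier (I i)) (I (Suc i)))"

text \<open>\<open>cosyzygy I f n\<close> is the \<open>n\<close>-th cosyzygy \<open>Im f\<^sup>n\<^sup>-\<^sup>1\<close> (for \<open>n \<ge> 1\<close>) of the module resolved by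
  \<open>I\<close> and \<open>f\<close>.\<close>

definition cosyzygy ::
  "(nat \<Rightarrow> ('r, 'a) module) \<Rightarrow> (nat \<Rightarrow> 'a \<Rightarrow> 'a) \<Rightarrow> nat \<Rightarrow> ('r, 'a) module"
  where "cosyzygy I f n = (I n)\<lparr>carrier := f (n - 1) ` carrier (I (n - 1))\<rparr>"

section \<open>Ext and Tor\<close>

text \<open>The homology group \<open>Ker g / Im f\<close> of \<open>F \<rightarrow> G \<rightarrow> H\<close> at \<open>G\<close>.\<close>

definition homology_at ::
  "'a monoid \<Rightarrow> 'b monoid \<Rightarrow> 'c monoid \<Rightarrow> ('a \<Rightarrow> 'b) \<Rightarrow> ('b \<Rightarrow> 'c) \<Rightarrow> 'b set monoid"
  where "homology_at F G H f g = (G\<lparr>carrier := kernel G H g\<rparr>) Mod (f ` carrier F)"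

text \<open>A chosen projective resolution \<open>(P, d)\<close>; the derived functors below do not depend on the
  choice up to isomorphism.\<close>

definition chosen_projective_resolution ::
  "'u ring \<Rightarrow> ('u, 'u) module \<Rightarrow> (nat \<Rightarrow> ('u, 'u) module) \<times> (nat \<Rightarrow> 'u \<Rightarrow> 'u)"
  where "chosen_projective_resolution R A = (SOME (P, d). \<exists>e. projective_resolution R A P d e)"

definition Ext ::
  "'u ring \<Rightarrow> nat \<Rightarrow> ('u, 'u) module \<Rightarrow> ('u, 'b) module \<Rightarrow> ('u \<Rightarrow> 'b) set monoid"
  where "Ext R i A B =
    (let (P, d) = chosen_projective_resolution R A;
         H = (\<lambda>j. hom_group R (P j) B);
         \<delta> = (\<lambda>j h. compose (carrier (P (Suc j))) h (d j))
     in case i of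
          0 \<Rightarrow> homology_at (singleton_group \<one>\<^bsub>H 0\<^esub>) (H 0) (H 1) id (\<delta> 0)
        | Suc j \<Rightarrow> homology_at (H j) (H (Suc j)) (H (Suc (Suc j))) (\<delta> j) (\<delta> (Suc j)))"

text \<open>The tensor product of a right \<open>S\<close>-module \<open>P\<close> (a left module over \<open>op_ring S\<close>, so that the
  element \<open>p s\<close> is written \<open>s \<odot>\<^bsub>P\<^esub> p\<close>) and a left \<open>S\<close>-module \<open>N\<close>, as the free abelian group
  on the pairs modulo bilinearity and balancing.\<close>

definition tensor_relations ::
  "('s, 'x) ring_scheme \<Rightarrow> ('s, 'p) module \<Rightarrow> ('s, 'n) module \<Rightarrow> ('p \<times> 'n \<Rightarrow>\<^sub>0 int) set"
  where "tensor_relations S P N =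
    {frag_of (p \<oplus>\<^bsub>P\<^esub> q, x) - frag_of (p, x) - frag_of (q, x) | p q x.
       p \<in> carrier P \<and> q \<in> carrier P \<and> x \<in> carrier N} \<union>
    {frag_of (p, x \<oplus>\<^bsub>N\<^esub> y) - frag_of (p, x) - frag_of (p, y) | p x y.
       p \<in> carrier P \<and> x \<in> carrier N \<and> y \<in> carrier N} \<union>
    {frag_of (s \<odot>\<^bsub>P\<^esub> p, x) - frag_of (p, s \<odot>\<^bsub>N\<^esub> x) | s p x.
       s \<in> carrier S \<and> p \<in> carrier P \<and> x \<in> carrier N}"

definition tensor_subgroup ::
  "('s, 'x) ring_scheme \<Rightarrow> ('s, 'p) module \<Rightarrow> ('s, 'n) module \<Rightarrow> ('p \<times> 'n \<Rightarrow>\<^sub>0 int) set"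
  where "tensor_subgroup S P N =
    generate (free_Abelian_group (carrier P \<times> carrier N)) (tensor_relations S P N)"

definition tensor ::
  "('s, 'x) ring_scheme \<Rightarrow> ('s, 'p) module \<Rightarrow> ('s, 'n) module \<Rightarrow> ('p \<times> 'n \<Rightarrow>\<^sub>0 int) set monoid"
  where "tensor S P N =
    free_Abelian_group (carrier P \<times> carrier N) Mod tensor_subgroup S P N"

text \<open>The map \<open>h \<otimes> N : P \<otimes> N \<rightarrow> Q \<otimes> N\<close> induced by \<open>h : P \<rightarrow> Q\<close>.\<close>

definition tensor_map ::
  "('s, 'x) ring_scheme \<Rightarrow> ('s, 'q) module \<Rightarrow> ('s, 'n) module \<Rightarrow> ('p \<Rightarrow> 'q)
    \<Rightarrow> ('p \<times> 'n \<Rightarrow>\<^sub>0 int) set \<Rightarrow> ('q \<times> 'n \<Rightarrow>\<^sub>0 int) set"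
  where "tensor_map S Q N h X =
    (\<Union>u\<in>X. tensor_subgroup S Q N #>\<^bsub>free_Abelian_group (carrier Q \<times> carrier N)\<^esub>
              frag_extend (\<lambda>(p, x). frag_of (h p, x)) u)"

definition Tor ::
  "'u ring \<Rightarrow> nat \<Rightarrow> ('u, 'u) module \<Rightarrow> ('u, 'n) module \<Rightarrow> ('u \<times> 'n \<Rightarrow>\<^sub>0 int) set set monoid"
  where "Tor S i A N =
    (let (P, d) = chosen_projective_resolution (op_ring S) A;
         T = (\<lambda>j. tensor S (P j) N);
         t = (\<lambda>j. tensor_map S (P j) N (d j))
     in case i of
          0 \<Rightarrow> homology_at (T 1) (T 0) (singleton_group \<one>\<^bsub>T 0\<^esub>) (t 0) (\<lambda>_. \<one>\<^bsub>T 0\<^esub>)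
        | Suc j \<Rightarrow> homology_at (T (Suc (Suc j))) (T (Suc j)) (T j) (t (Suc j)) (t j))"

section \<open>Semidualizing bimodules\<close>

record ('r, 's, 'c) bimodule = "('r, 'c) module" +
  rsmult :: "'c \<Rightarrow> 's \<Rightarrow> 'c"

definition left_mod :: "('r, 's, 'c) bimodule \<Rightarrow> ('r, 'c) module" where
  "left_mod C = module.truncate C"

definition right_mod :: "('r, 's, 'c) bimodule \<Rightarrow> ('s, 'c) module" where
  "right_mod C =
    \<lparr>carrier = carrier C, monoid.mult = monoid.mult C, one = one C, ring.zero = ring.zero C, add = add C,
     smult = (\<lambda>s c. rsmult C c s)\<rparr>"

definition is_bimodule ::
  "('r, 'x) ring_scheme \<Rightarrow> ('s, 'y) ring_scheme \<Rightarrow> ('r, 's, 'c) bimodule \<Rightarrow> bool"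
  where "is_bimodule R S C \<longleftrightarrow>
    ring R \<and> ring S \<and> left_module R (left_mod C) \<and> left_module (op_ring S) (right_mod C) \<and>
    (\<forall>r\<in>carrier R. \<forall>s\<in>carrier S. \<forall>c\<in>carrier C.
       rsmult C (r \<odot>\<^bsub>C\<^esub> c) s = r \<odot>\<^bsub>C\<^esub> rsmult C c s)"

definition has_fg_projective_resolution :: "'u ring \<Rightarrow> ('u, 'u) module \<Rightarrow> bool" where
  "has_fg_projective_resolution R A \<longleftrightarrow>
    (\<exists>P d e. projective_resolution R A P d e \<and> (\<forall>i. finitely_generated R (P i)))"

definition semidualizing :: "'u ring \<Rightarrow> 'u ring \<Rightarrow> ('u, 'u, 'u) bimodule \<Rightarrow> bool" where
  "semidualizing R S C \<longleftrightarrow>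
    is_bimodule R S C \<and>
    has_fg_projective_resolution R (left_mod C) \<and>
    has_fg_projective_resolution (op_ring S) (right_mod C) \<and>
    (\<lambda>r. \<lambda>c\<in>carrier C. r \<odot>\<^bsub>C\<^esub> c)
      \<in> iso (add_monoid R) (hom_group (op_ring S) (right_mod C) (right_mod C)) \<and>
    (\<lambda>s. \<lambda>c\<in>carrier C. rsmult C c s)
      \<in> iso (add_monoid S) (hom_group R (left_mod C) (left_mod C)) \<and>
    (\<forall>i\<ge>1. trivial_group (Ext R i (left_mod C) (left_mod C))) \<and>
    (\<forall>i\<ge>1. trivial_group (Ext (op_ring S) i (right_mod C) (right_mod C)))"

text \<open>The left \<open>S\<close>-module \<open>X\<^sub>* = Hom\<^sub>R(C, X)\<close> and the map induced by \<open>f : X \<rightarrow> Y\<close>.\<close>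

definition star_mod ::
  "('r, 'x) ring_scheme \<Rightarrow> ('r, 's, 'c) bimodule \<Rightarrow> ('r, 'a) module \<Rightarrow> ('s, 'c \<Rightarrow> 'a) module"
  where "star_mod R C X =
    (let H = hom_group R (left_mod C) X
     in \<lparr>carrier = carrier H, monoid.mult = undefined, one = undefined, ring.zero = one H, add = monoid.mult H,
         smult = (\<lambda>s h. \<lambda>c\<in>carrier C. h (rsmult C c s))\<rparr>)"

definition star_map :: "('r, 's, 'c) bimodule \<Rightarrow> ('a \<Rightarrow> 'b) \<Rightarrow> ('c \<Rightarrow> 'a) \<Rightarrow> 'c \<Rightarrow> 'b" where
  "star_map C f = compose (carrier C) f"

text \<open>The cotranspose is formed with a chosen minimal injective resolution, which is unique up to
  isomorphism.\<close>

definition cotranspose ::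
  "'u ring \<Rightarrow> ('u, 's, 'c) bimodule \<Rightarrow> ('u, 'u) module \<Rightarrow> ('s, ('c \<Rightarrow> 'u) set) module"
  where "cotranspose R C M =
    (let (I, f) = (SOME (I, f). \<exists>e. minimal_injective_resolution R M I e f)
     in quotient_module (star_mod R C (I 1))
          (star_map C (f 0) ` carrier (star_mod R C (I 0))))"

definition cotorsionfree ::
  "'u ring \<Rightarrow> 'u ring \<Rightarrow> ('u, 'u, 'u) bimodule \<Rightarrow> nat \<Rightarrow> ('u, 'u) module \<Rightarrow> bool"
  where "cotorsionfree R S C n M \<longleftrightarrow>
    (\<forall>i\<in>{1..n}. trivial_group (Tor S i (right_mod C) (cotranspose R C M)))"

definition cospherical ::
  "'u ring \<Rightarrow> ('u, 's, 'u) bimodule \<Rightarrow> nat \<Rightarrow> ('u, 'u) module \<Rightarrow> bool"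
  where "cospherical R C n M \<longleftrightarrow> (\<forall>i\<in>{1..n}. trivial_group (Ext R i (left_mod C) M))"

section \<open>The class Add C\<close>

definition direct_sum_copies ::
  "('r, 'c) module \<Rightarrow> 'k set \<Rightarrow> ('r, 'k \<Rightarrow> 'c) module"
  where "direct_sum_copies C J =
    (let D = sum_group J (\<lambda>_. add_monoid C)
     in \<lparr>carrier = carrier D, monoid.mult = undefined, one = undefined, ring.zero = one D, add = monoid.mult D,
         smult = (\<lambda>r x. \<lambda>j\<in>J. r \<odot>\<^bsub>C\<^esub> x j)\<rparr>)"

text \<open>Index sets \<open>J\<close> inside \<open>'u\<close> suffice when \<open>'u\<close> is infinite: the elements of a summand with
  carrier in \<open>'u\<close> involve at most \<open>|'u|\<close> coordinates.\<close>

definition in_Add :: "'u ring \<Rightarrow> ('u, 'u) module \<Rightarrow> ('u, 'u) module \<Rightarrow> bool" where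
  "in_Add R C X \<longleftrightarrow> left_module R X \<and>
    (\<exists>(J :: 'u set) A B.
       let D = direct_sum_copies C J
       in submodule A R D \<and> submodule B R D \<and>
          A \<inter> B = {\<zero>\<^bsub>D\<^esub>} \<and> A <+>\<^bsub>D\<^esub> B = carrier D \<and>
          mod_iso R X (D\<lparr>carrier := A\<rparr>))"

text \<open>The sequence \<open>0 \<rightarrow> Y \<rightarrow> X 0 \<rightarrow> \<dots> \<rightarrow> X m \<rightarrow> 0\<close> is continued by zero modules.\<close>

definition Add_coresolution_length ::
  "'u ring \<Rightarrow> ('u, 'u) module \<Rightarrow> ('u, 'u) module \<Rightarrow> nat \<Rightarrow> bool"
  where "Add_coresolution_length R C Y m \<longleftrightarrow>
    (\<exists>(X :: nat \<Rightarrow> ('u, 'u) module) e f. coresolution R Y X e f \<and>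
       (\<forall>i\<le>m. in_Add R C (X i)) \<and> (\<forall>i>m. carrier (X i) = {\<zero>\<^bsub>X i\<^esub>}))"

text \<open>The infimum of the empty set is \<open>\<infinity>\<close>.\<close>

definition Add_id :: "'u ring \<Rightarrow> ('u, 'u) module \<Rightarrow> ('u, 'u) module \<Rightarrow> enat" where
  "Add_id R C Y = Inf {enat m | m. Add_coresolution_length R C Y m}"

end

theory Submission
  imports Defs
begin

text \<open>
  Let \<open>\<dots> \<rightarrow> Q\<^sub>2 \<rightarrow> Q\<^sub>1 \<rightarrow> C \<rightarrow> 0\<close> and \<open>\<dots> \<rightarrow> B\<^sub>2 \<rightarrow> B\<^sub>1 \<rightarrow> C \<rightarrow> 0\<close> be resolutions by finitely generated
  projectives over \<open>S\<close> (on the right) and over \<open>R\<close>.  Since \<open>C\<close> is semidualizing, \<open>E\<^sub>i = Hom\<^sub>S(Q\<^sub>i, C)\<close>,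
  with \<open>Q\<^sub>0 = C\<close>, gives an exact complex \<open>0 \<rightarrow> R \<rightarrow> E\<^sub>1 \<rightarrow> E\<^sub>2 \<rightarrow> \<dots>\<close> of summands of powers of \<open>C\<close>.
  The isomorphism \<open>Q\<^sub>i \<otimes> X\<^sub>* = Hom\<^sub>R(E\<^sub>i, X)\<close> translates \<open>Tor\<^sub>i(C, cTr K) = 0\<close> for \<open>1 \<le> i \<le> n\<close> into the
  exactness of \<open>Hom\<^sub>R(E\<^sub>i, K)\<close> in \<open>n\<close> consecutive degrees: every map \<open>E\<^sub>i \<rightarrow> K\<close> that vanishes on the kernel
  of \<open>E\<^sub>i \<rightarrow> E\<^sub>i\<^sub>+\<^sub>1\<close> factors through \<open>E\<^sub>i \<rightarrow> E\<^sub>i\<^sub>+\<^sub>1\<close>, for \<open>0 \<le> i < n\<close>.  Being \<open>n\<close>-\<open>C\<close>-cospherical is the same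
  condition for \<open>B\<close>.

  Modules in \<open>Add C\<close> and injective modules satisfy both conditions in all degrees.  Hence, along
  \<open>0 \<rightarrow> X \<rightarrow> W \<oplus> I \<rightarrow> X' \<rightarrow> 0\<close> with \<open>W\<close> in \<open>Add C\<close>, \<open>I\<close> injective and every map \<open>C \<rightarrow> X'\<close> lifting to \<open>W \<oplus> I\<close>,
  passing from \<open>X'\<close> to \<open>X\<close> trades one degree of cotorsionfreeness for one degree of
  cosphericity.  The theorem follows by induction on \<open>n\<close>.  Given \<open>0 \<rightarrow> co\<Omega> M \<rightarrow> X' \<rightarrow> Y' \<rightarrow> 0\<close>, an \<open>Add C\<close>-precover
  \<open>W \<rightarrow> X'\<close> is onto because \<open>X'\<close> is \<open>1\<close>-\<open>C\<close>-cotorsionfree, and \<open>X\<close> is the kernel of \<open>W \<oplus> I\<^sup>0(M) \<rightarrow> X'\<close>.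
  Conversely, given \<open>0 \<rightarrow> M \<rightarrow> X \<rightarrow> Y \<rightarrow> 0\<close> and \<open>0 \<rightarrow> Y \<rightarrow> W \<rightarrow> Y' \<rightarrow> 0\<close>, \<open>X'\<close> is the cokernel of the induced
  embedding \<open>X \<rightarrow> W \<oplus> I\<^sup>0(M)\<close>.
\<close>

section \<open>Modules and their homomorphisms\<close>

text \<open>Derived functors are left behind as early as possible: vanishing of Ext and of Tor
  becomes one elementary condition, \<open>ext_along\<close>, on two complexes, so that the chases
  done once in \<open>hom_shift\<close> serve both and no long exact sequence is needed. Tor in
  degree i becomes exactness of Hom(E, K) in degree i - 1: the cotranspose of K is the cokernel of
  \<open>I^0_* \<rightarrow> I^1_*\<close>, and two shifts along
  \<open>0 \<rightarrow> K \<rightarrow> I^0 \<rightarrow> I^1\<close> lower the degree i + 1, where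
  \<open>Q\<close> computes Tor, by two. So Tor in degree 1 already concerns \<open>E 0 = R\<close>,
  where it makes every element of K lie in the image of a map \<open>E 1 \<rightarrow> K\<close>.
  The statement for n alone does not pass through the induction, since each step exchanges a degree.
  A second parameter k is carried: the n-th cosyzygy of M satisfies \<open>ctf (n + k)\<close>
  exactly when a suitable X has \<open>csph n\<close> and \<open>ctf k\<close>. The theorem is k =
  0. Precovers, products and duals leave the type \<open>'u\<close> and have to be brought back.
  This succeeds because homomorphisms out of finitely generated modules are determined by finitely
  many values and an infinite type encodes its finite lists.\<close>

lemma left_module_intro:
  fixes M (structure)
  assumes "ring R"
    and "\<And>x y. \<lbrakk>x \<in> carrier M; y \<in> carrier M\<rbrakk> \<Longrightarrow> x \<oplus> y \<in> carrier M"
    and "\<zero> \<in> carrier M"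
    and "\<And>x y z. \<lbrakk>x \<in> carrier M; y \<in> carrier M; z \<in> carrier M\<rbrakk> \<Longrightarrow> (x \<oplus> y) \<oplus> z = x \<oplus> (y \<oplus> z)"
    and "\<And>x y. \<lbrakk>x \<in> carrier M; y \<in> carrier M\<rbrakk> \<Longrightarrow> x \<oplus> y = y \<oplus> x"
    and "\<And>x. x \<in> carrier M \<Longrightarrow> \<zero> \<oplus> x = x"
    and "\<And>x. x \<in> carrier M \<Longrightarrow> \<exists>y\<in>carrier M. y \<oplus> x = \<zero>"
    and "\<And>r x. \<lbrakk>r \<in> carrier R; x \<in> carrier M\<rbrakk> \<Longrightarrow> r \<odot> x \<in> carrier M"
    and "\<And>r s x. \<lbrakk>r \<in> carrier R; s \<in> carrier R; x \<in> carrier M\<rbrakk> \<Longrightarrow>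
       (r \<oplus>\<^bsub>R\<^esub> s) \<odot> x = r \<odot> x \<oplus> s \<odot> x"
    and "\<And>r x y. \<lbrakk>r \<in> carrier R; x \<in> carrier M; y \<in> carrier M\<rbrakk> \<Longrightarrow>
       r \<odot> (x \<oplus> y) = r \<odot> x \<oplus> r \<odot> y"
    and "\<And>r s x. \<lbrakk>r \<in> carrier R; s \<in> carrier R; x \<in> carrier M\<rbrakk> \<Longrightarrow>
       (r \<otimes>\<^bsub>R\<^esub> s) \<odot> x = r \<odot> (s \<odot> x)"
    and "\<And>x. x \<in> carrier M \<Longrightarrow> \<one>\<^bsub>R\<^esub> \<odot> x = x"
  shows "left_module R M"
proof -
  have "abelian_group M"
    by (rule abelian_groupI) (use assms in auto)
  with assms show ?thesis
    unfolding left_module_def left_module_axioms_def by blast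
qed

lemma mod_simps:
  assumes "left_module R M"
  shows "\<And>x y. \<lbrakk>x \<in> carrier M; y \<in> carrier M\<rbrakk> \<Longrightarrow> x \<oplus>\<^bsub>M\<^esub> y \<in> carrier M"
    and "\<zero>\<^bsub>M\<^esub> \<in> carrier M"
    and "\<And>x. x \<in> carrier M \<Longrightarrow> \<ominus>\<^bsub>M\<^esub> x \<in> carrier M"
    and "\<And>x y. \<lbrakk>x \<in> carrier M; y \<in> carrier M\<rbrakk> \<Longrightarrow> x \<ominus>\<^bsub>M\<^esub> y \<in> carrier M"
    and "\<And>r x. \<lbrakk>r \<in> carrier R; x \<in> carrier M\<rbrakk> \<Longrightarrow> r \<odot>\<^bsub>M\<^esub> x \<in> carrier M"
    and "\<And>x. x \<in> carrier M \<Longrightarrow> \<one>\<^bsub>R\<^esub> \<odot>\<^bsub>M\<^esub> x = x"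
    and "\<And>x. x \<in> carrier M \<Longrightarrow> \<zero>\<^bsub>M\<^esub> \<oplus>\<^bsub>M\<^esub> x = x"
    and "\<And>x. x \<in> carrier M \<Longrightarrow> x \<oplus>\<^bsub>M\<^esub> \<zero>\<^bsub>M\<^esub> = x"
    and "\<And>x. x \<in> carrier M \<Longrightarrow> x \<ominus>\<^bsub>M\<^esub> x = \<zero>\<^bsub>M\<^esub>"
    and "\<And>x. x \<in> carrier M \<Longrightarrow> x \<ominus>\<^bsub>M\<^esub> \<zero>\<^bsub>M\<^esub> = x"
    and "\<And>x y. \<lbrakk>x \<in> carrier M; y \<in> carrier M\<rbrakk> \<Longrightarrow> (x \<ominus>\<^bsub>M\<^esub> y) \<oplus>\<^bsub>M\<^esub> y = x"
    and "\<And>x y. \<lbrakk>x \<in> carrier M; y \<in> carrier M\<rbrakk> \<Longrightarrow> (x \<oplus>\<^bsub>M\<^esub> y) \<ominus>\<^bsub>M\<^esub> y = x"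
    and "\<And>x y. \<lbrakk>x \<in> carrier M; y \<in> carrier M\<rbrakk> \<Longrightarrow> (x \<oplus>\<^bsub>M\<^esub> y) \<ominus>\<^bsub>M\<^esub> x = y"
    and "\<And>x y. \<lbrakk>x \<in> carrier M; y \<in> carrier M\<rbrakk> \<Longrightarrow> x \<ominus>\<^bsub>M\<^esub> (x \<ominus>\<^bsub>M\<^esub> y) = y"
    and "\<And>r. r \<in> carrier R \<Longrightarrow> r \<odot>\<^bsub>M\<^esub> \<zero>\<^bsub>M\<^esub> = \<zero>\<^bsub>M\<^esub>"
    and "\<And>x. x \<in> carrier M \<Longrightarrow> \<zero>\<^bsub>R\<^esub> \<odot>\<^bsub>M\<^esub> x = \<zero>\<^bsub>M\<^esub>"
proof -
  interpret M: left_module R M by fact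
  show "\<And>r. r \<in> carrier R \<Longrightarrow> r \<odot>\<^bsub>M\<^esub> \<zero>\<^bsub>M\<^esub> = \<zero>\<^bsub>M\<^esub>"
    by (metis M.add.l_cancel_one M.l_zero M.zero_closed M.smult_closed M.smult_r_distr)
  show "\<And>x. x \<in> carrier M \<Longrightarrow> \<zero>\<^bsub>R\<^esub> \<odot>\<^bsub>M\<^esub> x = \<zero>\<^bsub>M\<^esub>"
    by (metis M.add.l_cancel_one M.R.l_zero M.R.zero_closed M.smult_closed M.smult_l_distr)
  show "\<And>x. x \<in> carrier M \<Longrightarrow> x \<ominus>\<^bsub>M\<^esub> \<zero>\<^bsub>M\<^esub> = x"
    by (simp add: a_minus_def M.add.inv_one)
  show "\<And>x y. \<lbrakk>x \<in> carrier M; y \<in> carrier M\<rbrakk> \<Longrightarrow> x \<ominus>\<^bsub>M\<^esub> (x \<ominus>\<^bsub>M\<^esub> y) = y"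
    by (simp add: a_minus_def M.minus_add M.r_neg2)
  show "\<And>x y. \<lbrakk>x \<in> carrier M; y \<in> carrier M\<rbrakk> \<Longrightarrow> (x \<oplus>\<^bsub>M\<^esub> y) \<ominus>\<^bsub>M\<^esub> x = y"
    by (simp add: a_minus_def M.a_assoc M.a_comm[of x] M.r_neg1) (metis M.a_ac M.a_inv_closed M.r_neg M.r_zero)
qed (use assms in \<open>auto simp: left_module_def left_module_axioms_def a_minus_def
    abelian_monoid.l_zero abelian_monoid.r_zero abelian_group.r_neg abelian_group.l_neg
    abelian_monoid.a_closed abelian_monoid.zero_closed abelian_group.a_inv_closed abelian_group_def
    abelian_monoid.a_assoc\<close>)

lemma mod_ring: "left_module R M \<Longrightarrow> ring R"
  and mod_abelian_group: "left_module R M \<Longrightarrow> abelian_group M"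
  by (auto simp: left_module_def)

lemma mod_assoc: "\<lbrakk>left_module R M; x \<in> carrier M; y \<in> carrier M; z \<in> carrier M\<rbrakk> \<Longrightarrow>
    x \<oplus>\<^bsub>M\<^esub> y \<oplus>\<^bsub>M\<^esub> z = x \<oplus>\<^bsub>M\<^esub> (y \<oplus>\<^bsub>M\<^esub> z)"
  and mod_comm: "\<lbrakk>left_module R M; x \<in> carrier M; y \<in> carrier M\<rbrakk> \<Longrightarrow> x \<oplus>\<^bsub>M\<^esub> y = y \<oplus>\<^bsub>M\<^esub> x"
  by (auto simp: left_module_def abelian_group_def abelian_monoid.a_assoc
      abelian_monoid.a_comm)

lemma mod_diff_eq_zero_iff:
  assumes "left_module R M" "x \<in> carrier M" "y \<in> carrier M"
  shows "x \<ominus>\<^bsub>M\<^esub> y = \<zero>\<^bsub>M\<^esub> \<longleftrightarrow> x = y"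
  using assms by (metis mod_simps(2,7,9,11))

lemma mod_diff_unique:
  assumes "left_module R M" "x \<in> carrier M" "y \<in> carrier M" "z \<oplus>\<^bsub>M\<^esub> y = x" "z \<in> carrier M"
  shows "x \<ominus>\<^bsub>M\<^esub> y = z"
  using mod_simps(12)[OF assms(1), of z y] assms by simp

lemma mod_homI:
  assumes "\<And>x. x \<in> carrier A \<Longrightarrow> h x \<in> carrier B"
    and "\<And>x y. \<lbrakk>x \<in> carrier A; y \<in> carrier A\<rbrakk> \<Longrightarrow> h (x \<oplus>\<^bsub>A\<^esub> y) = h x \<oplus>\<^bsub>B\<^esub> h y"
    and "\<And>r x. \<lbrakk>r \<in> carrier R; x \<in> carrier A\<rbrakk> \<Longrightarrow> h (r \<odot>\<^bsub>A\<^esub> x) = r \<odot>\<^bsub>B\<^esub> h x"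
    and "left_module R A"
  shows "restrict h (carrier A) \<in> mod_hom R A B"
  using assms by (auto simp: mod_hom_def mod_simps)

lemma hom_simps:
  assumes "h \<in> mod_hom R A B" "left_module R A" "left_module R B"
  shows "\<And>x. x \<in> carrier A \<Longrightarrow> h x \<in> carrier B"
    and "\<And>x y. \<lbrakk>x \<in> carrier A; y \<in> carrier A\<rbrakk> \<Longrightarrow> h (x \<oplus>\<^bsub>A\<^esub> y) = h x \<oplus>\<^bsub>B\<^esub> h y"
    and "\<And>r x. \<lbrakk>r \<in> carrier R; x \<in> carrier A\<rbrakk> \<Longrightarrow> h (r \<odot>\<^bsub>A\<^esub> x) = r \<odot>\<^bsub>B\<^esub> h x"
    and "h \<zero>\<^bsub>A\<^esub> = \<zero>\<^bsub>B\<^esub>"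
    and "\<And>x y. \<lbrakk>x \<in> carrier A; y \<in> carrier A\<rbrakk> \<Longrightarrow> h (x \<ominus>\<^bsub>A\<^esub> y) = h x \<ominus>\<^bsub>B\<^esub> h y"
    and "restrict h (carrier A) = h"
proof -
  note [simp] = mod_simps[OF assms(2)] mod_simps[OF assms(3)]
  show c: "\<And>x. x \<in> carrier A \<Longrightarrow> h x \<in> carrier B"
    and a: "\<And>x y. \<lbrakk>x \<in> carrier A; y \<in> carrier A\<rbrakk> \<Longrightarrow> h (x \<oplus>\<^bsub>A\<^esub> y) = h x \<oplus>\<^bsub>B\<^esub> h y"
    and "\<And>r x. \<lbrakk>r \<in> carrier R; x \<in> carrier A\<rbrakk> \<Longrightarrow> h (r \<odot>\<^bsub>A\<^esub> x) = r \<odot>\<^bsub>B\<^esub> h x"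
    and "restrict h (carrier A) = h"
    using assms(1) by (auto simp: mod_hom_def)
  show "h (x \<ominus>\<^bsub>A\<^esub> y) = h x \<ominus>\<^bsub>B\<^esub> h y" if "x \<in> carrier A" "y \<in> carrier A" for x y
    by (rule mod_diff_unique[OF assms(3), symmetric]) (use that c a[of "x \<ominus>\<^bsub>A\<^esub> y" y] in auto)
  from this[of "\<zero>\<^bsub>A\<^esub>" "\<zero>\<^bsub>A\<^esub>"] c show "h \<zero>\<^bsub>A\<^esub> = \<zero>\<^bsub>B\<^esub>"
    by simp
qed

lemma mod_hom_eqI:
  assumes "f \<in> mod_hom R A B" "g \<in> mod_hom R A B" "\<And>x. x \<in> carrier A \<Longrightarrow> f x = g x"
  shows "f = g"
  using assms unfolding mod_hom_def by (auto intro: extensionalityI simp: PiE_def)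

lemma mod_hom_compose:
  assumes "f \<in> mod_hom R A B" "g \<in> mod_hom R B D"
    and "left_module R A" "left_module R B" "left_module R D"
  shows "(\<lambda>x\<in>carrier A. g (f x)) \<in> mod_hom R A D"
  using assms by (intro mod_homI) (auto simp: hom_simps)

lemma mod_hom_add:
  assumes "f \<in> mod_hom R A B" "g \<in> mod_hom R A B" "left_module R A" "left_module R B"
  shows "(\<lambda>x\<in>carrier A. f x \<oplus>\<^bsub>B\<^esub> g x) \<in> mod_hom R A B"
proof -
  interpret B: left_module R B by fact
  note [simp] = mod_simps[OF assms(3)] hom_simps[OF assms(1,3,4)] hom_simps[OF assms(2,3,4)]
  show ?thesis
    by (intro mod_homI) (auto simp: B.smult_r_distr B.a_ac assms)
qed

lemma mod_hom_zero:
  assumes "left_module R A" "left_module R B"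
  shows "(\<lambda>x\<in>carrier A. \<zero>\<^bsub>B\<^esub>) \<in> mod_hom R A B"
  using assms by (intro mod_homI) (auto simp: mod_simps)

lemma mod_hom_id:
  assumes "left_module R A"
  shows "(\<lambda>x\<in>carrier A. x) \<in> mod_hom R A A"
  using assms by (intro mod_homI) auto

lemma mod_hom_diff:
  assumes "f \<in> mod_hom R A B" "g \<in> mod_hom R A B" "left_module R A" "left_module R B"
  shows "(\<lambda>x\<in>carrier A. f x \<ominus>\<^bsub>B\<^esub> g x) \<in> mod_hom R A B"
proof -
  interpret B: left_module R B by fact
  note [simp] = mod_simps[OF assms(3)] mod_simps[OF assms(4)]
    hom_simps[OF assms(1,3,4)] hom_simps[OF assms(2,3,4)]
  show ?thesis
  proof (intro mod_homI assms(3))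
    fix x y assume "x \<in> carrier A" "y \<in> carrier A"
    then show "f (x \<oplus>\<^bsub>A\<^esub> y) \<ominus>\<^bsub>B\<^esub> g (x \<oplus>\<^bsub>A\<^esub> y) = (f x \<ominus>\<^bsub>B\<^esub> g x) \<oplus>\<^bsub>B\<^esub> (f y \<ominus>\<^bsub>B\<^esub> g y)"
      by (simp add: a_minus_def B.minus_add B.a_ac)
  next
    fix r x assume rx: "r \<in> carrier R" "x \<in> carrier A"
    show "f (r \<odot>\<^bsub>A\<^esub> x) \<ominus>\<^bsub>B\<^esub> g (r \<odot>\<^bsub>A\<^esub> x) = r \<odot>\<^bsub>B\<^esub> (f x \<ominus>\<^bsub>B\<^esub> g x)"
      by (rule mod_diff_unique[OF assms(4)])
        (use rx in \<open>auto simp: B.smult_r_distr[symmetric]\<close>)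
  qed auto
qed

lemma mod_hom_finsum:
  assumes "finite J" "\<And>j. j \<in> J \<Longrightarrow> f j \<in> mod_hom R A B" "left_module R A" "left_module R B"
  shows "(\<lambda>x\<in>carrier A. \<Oplus>\<^bsub>B\<^esub>j\<in>J. f j x) \<in> mod_hom R A B"
  using assms(1,2)
proof (induction J)
  case empty
  interpret B: left_module R B by fact
  show ?case using mod_hom_zero[OF assms(3,4)] by (simp only: B.finsum_empty)
next
  case (insert j J)
  interpret B: left_module R B by fact
  have "(\<lambda>x\<in>carrier A. \<Oplus>\<^bsub>B\<^esub>j\<in>insert j J. f j x)
      = (\<lambda>x\<in>carrier A. f j x \<oplus>\<^bsub>B\<^esub> (\<lambda>x\<in>carrier A. \<Oplus>\<^bsub>B\<^esub>j\<in>J. f j x) x)"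
    using insert(1,2) hom_simps(1)[OF insert(4) assms(3,4)]
    by (intro restrict_ext) (simp del: restrict_apply add: Pi_def, simp)
  also have "\<dots> \<in> mod_hom R A B"
    by (rule mod_hom_add[OF insert(4)[OF insertI1] insert(3)[OF insert(4)[OF insertI2]] assms(3,4)])
  finally show ?case .
qed

lemma hom_finsum:
  assumes "h \<in> mod_hom R A B" "left_module R A" "left_module R B"
    and "finite J" "\<And>j. j \<in> J \<Longrightarrow> x j \<in> carrier A"
  shows "h (\<Oplus>\<^bsub>A\<^esub>j\<in>J. x j) = (\<Oplus>\<^bsub>B\<^esub>j\<in>J. h (x j))"
  using assms(4,5)
proof (induction J)
  case empty
  interpret A: left_module R A by fact
  interpret B: left_module R B by fact
  show ?case using assms by (simp add: hom_simps)
next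
  case (insert j J)
  interpret A: left_module R A by fact
  interpret B: left_module R B by fact
  note [simp] = hom_simps[OF assms(1-3)]
  have "h (\<Oplus>\<^bsub>A\<^esub>j\<in>insert j J. x j) = h (x j \<oplus>\<^bsub>A\<^esub> (\<Oplus>\<^bsub>A\<^esub>j\<in>J. x j))"
    using insert by (subst A.finsum_insert) auto
  also have "\<dots> = h (x j) \<oplus>\<^bsub>B\<^esub> (\<Oplus>\<^bsub>B\<^esub>j\<in>J. h (x j))"
    using insert by (simp add: A.finsum_closed Pi_def)
  also have "\<dots> = (\<Oplus>\<^bsub>B\<^esub>j\<in>insert j J. h (x j))"
    using insert by (subst B.finsum_insert) auto
  finally show ?case .
qed

subsection \<open>Submodules, kernels, images and quotients\<close>

text \<open>Closure under negatives comes from closure under scalars, since -x = (-1) x.\<close>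

lemma submodule_iff:
  assumes "left_module R M"
  shows "submodule N R M \<longleftrightarrow> N \<subseteq> carrier M \<and> \<zero>\<^bsub>M\<^esub> \<in> N \<and>
    (\<forall>x\<in>N. \<forall>y\<in>N. x \<oplus>\<^bsub>M\<^esub> y \<in> N) \<and> (\<forall>r\<in>carrier R. \<forall>x\<in>N. r \<odot>\<^bsub>M\<^esub> x \<in> N)"
    (is "?L \<longleftrightarrow> ?R")
proof
  assume ?L
  then show ?R
    by (auto simp: submodule_def submodule_axioms_def subgroup_def)
next
  interpret M: left_module R M by fact
  assume R: ?R
  have "\<ominus>\<^bsub>M\<^esub> x \<in> N" if "x \<in> N" for x
  proof -
    have x: "x \<in> carrier M" using R that by auto
    have "(\<ominus>\<^bsub>R\<^esub> \<one>\<^bsub>R\<^esub>) \<odot>\<^bsub>M\<^esub> x \<oplus>\<^bsub>M\<^esub> x = (\<ominus>\<^bsub>R\<^esub> \<one>\<^bsub>R\<^esub> \<oplus>\<^bsub>R\<^esub> \<one>\<^bsub>R\<^esub>) \<odot>\<^bsub>M\<^esub> x"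
      using x by (simp add: M.smult_l_distr M.smult_one)
    also have "\<dots> = \<zero>\<^bsub>M\<^esub>"
      using x by (simp add: M.R.l_neg mod_simps(16)[OF assms])
    finally have "(\<ominus>\<^bsub>R\<^esub> \<one>\<^bsub>R\<^esub>) \<odot>\<^bsub>M\<^esub> x = \<ominus>\<^bsub>M\<^esub> x"
      using x by (intro M.minus_equality[symmetric]) (auto simp: M.smult_closed)
    then show ?thesis using R that by (metis M.R.a_inv_closed M.R.one_closed)
  qed
  with R show ?L
    by (auto simp: submodule_def submodule_axioms_def subgroup_def a_inv_def)
qed

lemma left_module_submodule:
  assumes "left_module R M" "submodule N R M"
  shows "left_module R (M\<lparr>carrier := N\<rparr>)"
proof -
  interpret M: left_module R M by fact
  have N: "N \<subseteq> carrier M" "\<And>x. x \<in> N \<Longrightarrow> \<ominus>\<^bsub>M\<^esub> x \<in> N"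
    using assms(2) by (auto simp: submodule_def subgroup_def a_inv_def)
  show ?thesis
  proof (rule left_module_intro)
    show "\<exists>y\<in>carrier (M\<lparr>carrier := N\<rparr>). y \<oplus>\<^bsub>M\<lparr>carrier := N\<rparr>\<^esub> x = \<zero>\<^bsub>M\<lparr>carrier := N\<rparr>\<^esub>"
      if "x \<in> carrier (M\<lparr>carrier := N\<rparr>)" for x
      using that N M.l_neg by auto
  qed (use N assms in \<open>auto simp: submodule_iff M.ring_axioms M.a_assoc M.smult_l_distr subset_iff
        M.smult_r_distr M.smult_assoc M.smult_one intro: M.a_comm\<close>)
qed

lemma a_kernel_iff: "x \<in> a_kernel A B h \<longleftrightarrow> x \<in> carrier A \<and> h x = \<zero>\<^bsub>B\<^esub>"
  by (simp add: a_kernel_def')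

lemma submodule_kernel:
  assumes "h \<in> mod_hom R A B" "left_module R A" "left_module R B"
  shows "submodule (a_kernel A B h) R A"
  using assms by (auto simp: submodule_iff a_kernel_iff hom_simps mod_simps)

lemma submodule_image:
  assumes "h \<in> mod_hom R A B" "left_module R A" "left_module R B"
  shows "submodule (h ` carrier A) R B"
proof -
  note [simp] = mod_simps[OF assms(2)] mod_simps[OF assms(3)] hom_simps(2-4)[OF assms, symmetric]
  show ?thesis
    unfolding submodule_iff[OF assms(3)]
    using hom_simps(1)[OF assms] by auto
qed

lemma mod_hom_restrict_image:
  assumes "h \<in> mod_hom R A B" "h ` carrier A \<subseteq> N"
  shows "h \<in> mod_hom R A (B\<lparr>carrier := N\<rparr>)"
  using assms by (auto simp: mod_hom_def PiE_iff)

lemma mod_hom_enlarge: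
  assumes "h \<in> mod_hom R A (B\<lparr>carrier := N\<rparr>)" "N \<subseteq> carrier B"
  shows "h \<in> mod_hom R A B"
  using assms by (auto simp: mod_hom_def PiE_iff)

lemma mod_hom_restrict_domain:
  assumes "h \<in> mod_hom R A B" "left_module R A" "left_module R B" "submodule N R A"
  shows "restrict h N \<in> mod_hom R (A\<lparr>carrier := N\<rparr>) B"
proof -
  have "N \<subseteq> carrier A" using assms by (simp add: submodule_iff)
  then show ?thesis
    using mod_homI[of "A\<lparr>carrier := N\<rparr>" h B R] left_module_submodule[OF assms(2,4)]
      hom_simps[OF assms(1-3)]
    by (auto simp: subset_iff)
qed

text \<open>Two preimages of an element under g differ by something that g, hence h, kills. So any
  choice of preimages gives the same k, and a suitable choice makes additivity and linearity
  visible.\<close>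

lemma mod_hom_factor:
  assumes "g \<in> mod_hom R A B" "g ` carrier A = carrier B" "h \<in> mod_hom R A X"
    and A: "left_module R A" and B: "left_module R B" and X: "left_module R X"
    and ker: "\<And>x. \<lbrakk>x \<in> carrier A; g x = \<zero>\<^bsub>B\<^esub>\<rbrakk> \<Longrightarrow> h x = \<zero>\<^bsub>X\<^esub>"
  shows "\<exists>k\<in>mod_hom R B X. \<forall>x\<in>carrier A. k (g x) = h x"
proof -
  note [simp] = mod_simps[OF A] mod_simps[OF B] mod_simps[OF X]
    hom_simps[OF assms(1) A B] hom_simps[OF assms(3) A X]
  have eq: "h x = h y" if "x \<in> carrier A" "y \<in> carrier A" "g x = g y" for x y
  proof -
    have "h (x \<ominus>\<^bsub>A\<^esub> y) = \<zero>\<^bsub>X\<^esub>" using that by (intro ker) auto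
    with that show ?thesis by (simp add: mod_diff_eq_zero_iff[OF X])
  qed
  define k where "k b = h (SOME x. x \<in> carrier A \<and> g x = b)" for b
  have k: "k (g x) = h x" if "x \<in> carrier A" for x
    unfolding k_def by (metis (mono_tags, lifting) someI_ex eq that)
  have ex: "\<exists>x\<in>carrier A. b = g x" if "b \<in> carrier B" for b
    using that assms(2) by blast
  have "restrict k (carrier B) \<in> mod_hom R B X"
  proof (rule mod_homI)
    show "k b \<in> carrier X" if "b \<in> carrier B" for b
      using ex[OF that] by (auto simp: k)
    show "k (b \<oplus>\<^bsub>B\<^esub> c) = k b \<oplus>\<^bsub>X\<^esub> k c" if bc: "b \<in> carrier B" "c \<in> carrier B" for b c
    proof -
      obtain x y where xy: "x \<in> carrier A" "y \<in> carrier A" "b = g x" "c = g y"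
        using ex[OF bc(1)] ex[OF bc(2)] by blast
      have "k (g (x \<oplus>\<^bsub>A\<^esub> y)) = h (x \<oplus>\<^bsub>A\<^esub> y)" using xy(1,2) by (intro k) simp
      then show ?thesis unfolding xy(3,4) k[OF xy(1)] k[OF xy(2)] using xy(1,2) by simp
    qed
    show "k (r \<odot>\<^bsub>B\<^esub> b) = r \<odot>\<^bsub>X\<^esub> k b" if rb: "r \<in> carrier R" "b \<in> carrier B" for r b
    proof -
      obtain x where x: "x \<in> carrier A" "b = g x" using ex[OF rb(2)] by blast
      have "k (g (r \<odot>\<^bsub>A\<^esub> x)) = h (r \<odot>\<^bsub>A\<^esub> x)" using x(1) rb(1) by (intro k) simp
      then show ?thesis unfolding x(2) k[OF x(1)] using x(1) rb(1) by simp
    qed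
  qed (rule B)
  with k show ?thesis by (intro bexI[of _ "restrict k (carrier B)"]) auto
qed

lemma mod_hom_inv:
  assumes "g \<in> mod_hom R A B" "bij_betw g (carrier A) (carrier B)"
    and A: "left_module R A" and B: "left_module R B"
  obtains k where "k \<in> mod_hom R B A" "\<And>x. x \<in> carrier A \<Longrightarrow> k (g x) = x"
    "\<And>y. y \<in> carrier B \<Longrightarrow> g (k y) = y" "bij_betw k (carrier B) (carrier A)"
proof -
  \<comment> \<open>The inverse arises by factoring the identity of A through the bijection
    g.\<close>
  have "\<exists>k\<in>mod_hom R B A. \<forall>x\<in>carrier A. k (g x) = (\<lambda>x\<in>carrier A. x) x"
  proof (rule mod_hom_factor[OF assms(1) _ mod_hom_id[OF A] A B A])
    show "g ` carrier A = carrier B" using assms(2) by (simp add: bij_betw_def)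
    show "(\<lambda>x\<in>carrier A. x) x = \<zero>\<^bsub>A\<^esub>" if "x \<in> carrier A" "g x = \<zero>\<^bsub>B\<^esub>" for x
      using that inj_onD[OF bij_betw_imp_inj_on[OF assms(2)], of x "\<zero>\<^bsub>A\<^esub>"]
      by (simp add: hom_simps[OF assms(1) A B] mod_simps[OF A])
  qed
  then obtain k where k: "k \<in> mod_hom R B A" "\<And>x. x \<in> carrier A \<Longrightarrow> k (g x) = x"
    by auto
  have g: "g ` carrier A = carrier B" using assms(2) by (simp add: bij_betw_def)
  have gk: "g (k y) = y" if y: "y \<in> carrier B" for y
  proof -
    obtain x where "x \<in> carrier A" "y = g x" using y g by blast
    then show ?thesis using k(2) by simp
  qed
  have "bij_betw k (carrier B) (carrier A)"
    by (rule bij_betw_byWitness[of _ g])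
      (use k(2) gk hom_simps(1)[OF k(1) B A] hom_simps(1)[OF assms(1) A B] in auto)
  from that[OF k gk this] show thesis .
qed

lemma quotient_module_props:
  assumes M: "left_module R M" and N: "submodule N R M"
  defines "Q \<equiv> quotient_module M N" and "\<pi> \<equiv> (\<lambda>x\<in>carrier M. N +>\<^bsub>M\<^esub> x)"
  shows "left_module R Q" and "\<pi> \<in> mod_hom R M Q" and "\<pi> ` carrier M = carrier Q"
    and "\<And>x. x \<in> carrier M \<Longrightarrow> \<pi> x = \<zero>\<^bsub>Q\<^esub> \<longleftrightarrow> x \<in> N"
proof -
  interpret M: left_module R M by fact
  have sg: "subgroup N (add_monoid M)"
    using N by (simp add: submodule_def)
  interpret N: abelian_subgroup N M
    by (rule abelian_subgroupI3[OF additive_subgroup.intro[OF sg] mod_abelian_group[OF M]])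
  have Nsub: "N \<subseteq> carrier M" using N by (simp add: submodule_iff[OF M])
  have Nsm: "r \<odot>\<^bsub>M\<^esub> x \<in> N" if "r \<in> carrier R" "x \<in> N" for r x
    using N that by (simp add: submodule_iff[OF M])
  have add: "(N +>\<^bsub>M\<^esub> x) \<oplus>\<^bsub>Q\<^esub> (N +>\<^bsub>M\<^esub> y) = N +>\<^bsub>M\<^esub> (x \<oplus>\<^bsub>M\<^esub> y)" 
    if "x \<in> carrier M" "y \<in> carrier M" for x y
    unfolding Q_def quotient_module_def by (simp add: N.a_rcos_sum that)
  have sm: "r \<odot>\<^bsub>Q\<^esub> (N +>\<^bsub>M\<^esub> x) = N +>\<^bsub>M\<^esub> (r \<odot>\<^bsub>M\<^esub> x)"
    if rx: "r \<in> carrier R" "x \<in> carrier M" for r x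
  proof -
    \<comment> \<open>The record defines the scalar action on a coset as a union of cosets over all
      its members; these cosets coincide, so the union is a single one.\<close>
    have *: "N +>\<^bsub>M\<^esub> (r \<odot>\<^bsub>M\<^esub> y) = N +>\<^bsub>M\<^esub> (r \<odot>\<^bsub>M\<^esub> x)" if y: "y \<in> N +>\<^bsub>M\<^esub> x" for y
    proof -
      from y obtain h where h: "h \<in> N" "y = h \<oplus>\<^bsub>M\<^esub> x"
        by (auto simp: a_r_coset_def')
      have "r \<odot>\<^bsub>M\<^esub> y = r \<odot>\<^bsub>M\<^esub> h \<oplus>\<^bsub>M\<^esub> r \<odot>\<^bsub>M\<^esub> x"
        using h(1) Nsub rx unfolding h(2) by (intro M.smult_r_distr) auto
      then have "r \<odot>\<^bsub>M\<^esub> y \<in> N +>\<^bsub>M\<^esub> (r \<odot>\<^bsub>M\<^esub> x)"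
        using Nsm[OF rx(1) h(1)] by (auto simp: a_r_coset_def')
      then show ?thesis
        using M.add.repr_independence[OF _ M.smult_closed[OF rx] sg] by (simp add: a_r_coset_def)
    qed
    have "x \<in> N +>\<^bsub>M\<^esub> x" using M.add.rcos_self[OF rx(2) sg] by (simp add: a_r_coset_def)
    with * have "(\<Union>y\<in>N +>\<^bsub>M\<^esub> x. N +>\<^bsub>M\<^esub> (r \<odot>\<^bsub>M\<^esub> y)) = N +>\<^bsub>M\<^esub> (r \<odot>\<^bsub>M\<^esub> x)"
      by blast
    then show ?thesis
      unfolding Q_def quotient_module_def by simp
  qed
  have car: "carrier Q = (\<lambda>x. N +>\<^bsub>M\<^esub> x) ` carrier M"
    unfolding Q_def quotient_module_def by (auto simp: A_RCOSETS_def')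
  have z: "\<zero>\<^bsub>Q\<^esub> = N" unfolding Q_def quotient_module_def by simp
  have z': "\<zero>\<^bsub>Q\<^esub> = N +>\<^bsub>M\<^esub> \<zero>\<^bsub>M\<^esub>"
    using z M.add.coset_mult_one[OF Nsub] by (simp add: a_r_coset_def)
  show Q: "left_module R Q"
  proof (rule left_module_intro)
    fix X assume "X \<in> carrier Q"
    then obtain x where x: "x \<in> carrier M" "X = N +>\<^bsub>M\<^esub> x" by (auto simp: car)
    then have "(N +>\<^bsub>M\<^esub> (\<ominus>\<^bsub>M\<^esub> x)) \<oplus>\<^bsub>Q\<^esub> X = \<zero>\<^bsub>Q\<^esub>"
      by (simp add: add z' M.l_neg)
    then show "\<exists>y\<in>carrier Q. y \<oplus>\<^bsub>Q\<^esub> X = \<zero>\<^bsub>Q\<^esub>"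
      using x by (auto simp: car)
  qed (auto simp: car add sm z' M.a_ac M.smult_closed M.smult_one
      M.smult_l_distr M.smult_r_distr M.smult_assoc M.ring_axioms)
  show "\<pi> \<in> mod_hom R M Q"
    unfolding \<pi>_def by (rule mod_homI) (auto simp: car add sm M)
  show "\<pi> ` carrier M = carrier Q"
    unfolding \<pi>_def car by auto
  show "\<pi> x = \<zero>\<^bsub>Q\<^esub> \<longleftrightarrow> x \<in> N" if "x \<in> carrier M" for x
    using that M.add.coset_join2[OF that sg] M.add.rcos_self[OF that sg] unfolding \<pi>_def z
    by (auto simp: a_r_coset_def)
qed

lemma submodule_subset: "submodule N R M \<Longrightarrow> N \<subseteq> carrier M"
  by (auto simp: submodule_def subgroup_def)

text \<open>Structure is carried along an injection of the carrier. This returns modules built from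
  cosets, pairs or functions to the type of the universe.\<close>

lemma transport_module:
  fixes \<iota> :: "'a \<Rightarrow> 'b"
  assumes M: "left_module R M" and inj: "inj_on \<iota> (carrier M)"
  obtains M' :: "('r, 'b) module" and t where "left_module R M'" "t \<in> mod_hom R M M'"
    "bij_betw t (carrier M) (carrier M')"
proof -
  interpret M: left_module R M by fact
  define j where "j = inv_into (carrier M) \<iota>"
  have j: "j (\<iota> x) = x" if "x \<in> carrier M" for x
    using that inj by (simp add: j_def)
  define M' :: "('r, 'b) module" where "M' = \<lparr>carrier = \<iota> ` carrier M, monoid.mult = undefined, one = undefined,
     ring.zero = \<iota> \<zero>\<^bsub>M\<^esub>, add = (\<lambda>x y. \<iota> (j x \<oplus>\<^bsub>M\<^esub> j y)), smult = (\<lambda>r x. \<iota> (r \<odot>\<^bsub>M\<^esub> j x))\<rparr>"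
  have M': "left_module R M'"
  proof (rule left_module_intro)
    fix x assume "x \<in> carrier M'"
    then obtain y where y: "y \<in> carrier M" "x = \<iota> y" by (auto simp: M'_def)
    then have "\<iota> (\<ominus>\<^bsub>M\<^esub> y) \<oplus>\<^bsub>M'\<^esub> x = \<zero>\<^bsub>M'\<^esub>"
      by (simp add: M'_def j M.l_neg)
    with y show "\<exists>y\<in>carrier M'. y \<oplus>\<^bsub>M'\<^esub> x = \<zero>\<^bsub>M'\<^esub>"
      by (intro bexI) (auto simp: M'_def)
  qed (auto simp: M'_def j M.ring_axioms M.a_ac M.smult_closed M.smult_l_distr M.smult_r_distr
      M.smult_assoc M.smult_one)
  moreover have "restrict \<iota> (carrier M) \<in> mod_hom R M M'"
    by (intro mod_homI M) (auto simp: M'_def j)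
  moreover have "bij_betw (restrict \<iota> (carrier M)) (carrier M) (carrier M')"
    using inj by (auto simp: M'_def bij_betw_def inj_on_def)
  ultimately show thesis using that by blast
qed

text \<open>A coset is coded by one of its elements, so a quotient fits into the type of the
  original module, whatever its cardinality.\<close>

lemma quotient_in_universe:
  fixes M :: "('r, 'a) module"
  assumes M: "left_module R M" and N: "submodule N R M"
  obtains Q :: "('r, 'a) module" and \<pi> where "left_module R Q" "\<pi> \<in> mod_hom R M Q"
    "\<pi> ` carrier M = carrier Q" "\<And>x. x \<in> carrier M \<Longrightarrow> \<pi> x = \<zero>\<^bsub>Q\<^esub> \<longleftrightarrow> x \<in> N"
proof -
  let ?Q = "quotient_module M N"
  note q = quotient_module_props[OF assms]
  let ?p = "\<lambda>x\<in>carrier M. N +>\<^bsub>M\<^esub> x"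
  have "inj_on (inv_into (carrier M) ?p) (carrier ?Q)"
    using q(3) by (metis inj_on_inv_into order_refl)
  from transport_module[OF q(1) this]
  obtain Q :: "('r, 'a) module" and t where t: "left_module R Q" "t \<in> mod_hom R ?Q Q"
    "bij_betw t (carrier ?Q) (carrier Q)" .
  note [simp] = hom_simps[OF t(2) q(1) t(1)]
  have pin: "?p x \<in> carrier ?Q" if "x \<in> carrier M" for x using q(3) that by blast
  let ?\<pi> = "\<lambda>x\<in>carrier M. t (?p x)"
  have "?\<pi> \<in> mod_hom R M Q"
    by (rule mod_hom_compose[OF q(2) t(2) M q(1) t(1)])
  moreover have "?\<pi> ` carrier M = t ` (?p ` carrier M)"
    by auto
  then have "?\<pi> ` carrier M = carrier Q"
    using t(3) unfolding q(3) by (simp add: bij_betw_def)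
  moreover have "?\<pi> x = \<zero>\<^bsub>Q\<^esub> \<longleftrightarrow> x \<in> N" if x: "x \<in> carrier M" for x
  proof -
    have "t (?p x) = \<zero>\<^bsub>Q\<^esub> \<longleftrightarrow> ?p x = \<zero>\<^bsub>?Q\<^esub>"
      using bij_betw_imp_inj_on[OF t(3)] pin[OF x] hom_simps(4)[OF t(2) q(1) t(1)]
      by (metis inj_on_eq_iff mod_simps(2)[OF q(1)])
    with q(4)[OF x] x show ?thesis by simp
  qed
  ultimately show thesis using that t(1) by blast
qed

section \<open>Binary products inside the universe\<close>

definition is_prod ::
  "('r, 'x) ring_scheme \<Rightarrow> ('r, 'a) module \<Rightarrow> ('r, 'b) module \<Rightarrow> ('r, 'c) module
    \<Rightarrow> ('a \<Rightarrow> 'b) \<Rightarrow> ('a \<Rightarrow> 'c) \<Rightarrow> bool"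
  where "is_prod R U A B p q \<longleftrightarrow> left_module R U \<and> p \<in> mod_hom R U A \<and> q \<in> mod_hom R U B \<and>
    bij_betw (\<lambda>u. (p u, q u)) (carrier U) (carrier A \<times> carrier B)"

lemma is_prod_ex:
  assumes "is_prod R U A B p q" "a \<in> carrier A" "b \<in> carrier B"
  shows "\<exists>u\<in>carrier U. p u = a \<and> q u = b"
proof -
  have "(a, b) \<in> (\<lambda>u. (p u, q u)) ` carrier U"
    using assms by (simp add: is_prod_def bij_betw_def)
  then show ?thesis by auto
qed

lemma is_prod_eqI:
  assumes "is_prod R U A B p q" "u \<in> carrier U" "v \<in> carrier U" "p u = p v" "q u = q v"
  shows "u = v"
  using assms inj_onD[of "\<lambda>u. (p u, q u)" "carrier U" u v] by (auto simp: is_prod_def bij_betw_def)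

lemma is_prod_pair:
  assumes U: "is_prod R U A B p q" and A: "left_module R A" and B: "left_module R B"
    and Z: "left_module R Z" and f: "f \<in> mod_hom R Z A" and g: "g \<in> mod_hom R Z B"
  shows "\<exists>h\<in>mod_hom R Z U. \<forall>z\<in>carrier Z. p (h z) = f z \<and> q (h z) = g z"
proof -
  have LU: "left_module R U" and p: "p \<in> mod_hom R U A" and q: "q \<in> mod_hom R U B"
    using U by (auto simp: is_prod_def)
  note [simp] = mod_simps[OF LU] mod_simps[OF Z] hom_simps[OF p LU A] hom_simps[OF q LU B]
    hom_simps[OF f Z A] hom_simps[OF g Z B]
  have "\<forall>z\<in>carrier Z. \<exists>u. u \<in> carrier U \<and> p u = f z \<and> q u = g z"
    using is_prod_ex[OF U hom_simps(1)[OF f Z A] hom_simps(1)[OF g Z B]] by auto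
  then obtain h where h: "\<And>z. z \<in> carrier Z \<Longrightarrow> h z \<in> carrier U"
    "\<And>z. z \<in> carrier Z \<Longrightarrow> p (h z) = f z" "\<And>z. z \<in> carrier Z \<Longrightarrow> q (h z) = g z"
    by metis
  have "restrict h (carrier Z) \<in> mod_hom R Z U"
    by (intro mod_homI Z is_prod_eqI[OF U]) (auto simp: h)
  then show ?thesis using h by (intro bexI) auto
qed

definition prod_module :: "('r, 'a) module \<Rightarrow> ('r, 'b) module \<Rightarrow> ('r, 'a \<times> 'b) module" where
  "prod_module A B = \<lparr>carrier = carrier A \<times> carrier B, monoid.mult = undefined, one = undefined,
     ring.zero = (\<zero>\<^bsub>A\<^esub>, \<zero>\<^bsub>B\<^esub>), add = (\<lambda>(a, b) (a', b'). (a \<oplus>\<^bsub>A\<^esub> a', b \<oplus>\<^bsub>B\<^esub> b')),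
     smult = (\<lambda>r (a, b). (r \<odot>\<^bsub>A\<^esub> a, r \<odot>\<^bsub>B\<^esub> b))\<rparr>"

lemma left_module_prod:
  assumes "left_module R A" "left_module R B"
  shows "left_module R (prod_module A B)"
proof -
  interpret A: left_module R A by fact
  interpret B: left_module R B by fact
  show ?thesis
  proof (rule left_module_intro)
    show "\<exists>y\<in>carrier (prod_module A B). y \<oplus>\<^bsub>prod_module A B\<^esub> x = \<zero>\<^bsub>prod_module A B\<^esub>"
      if "x \<in> carrier (prod_module A B)" for x
      using that by (intro bexI[of _ "(\<ominus>\<^bsub>A\<^esub> fst x, \<ominus>\<^bsub>B\<^esub> snd x)"])
        (auto simp: prod_module_def A.l_neg B.l_neg)
  qed (auto simp: prod_module_def A.ring_axioms A.a_ac B.a_ac A.smult_closed B.smult_closed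
      A.smult_l_distr B.smult_l_distr A.smult_r_distr B.smult_r_distr A.smult_assoc B.smult_assoc
      A.smult_one B.smult_one)
qed

text \<open>The infinity of \<open>'u\<close> enters only through this injection: pairs, tuples of
  values and finitely supported families are all coded as lists.\<close>

lemma infinite_list_encoding:
  assumes "infinite (UNIV :: 'u set)"
  obtains enc :: "'u list \<Rightarrow> 'u" where "inj enc"
proof -
  have "|lists (UNIV :: 'u set)| \<le>o |UNIV :: 'u set|"
    using card_of_lists_infinite[OF assms] by (simp add: ordIso_iff_ordLeq)
  then obtain enc :: "'u list \<Rightarrow> 'u" where "inj_on enc (lists UNIV)"
    using card_of_ordLeq[of "lists (UNIV :: 'u set)" "UNIV :: 'u set"] by auto
  with that show thesis by simp
qed

text \<open>The coded product is passed on through its projections alone, so the coding of pairs by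
  lists of length two never resurfaces.\<close>

lemma prod_in_universe:
  fixes A B :: "('r, 'u) module"
  assumes inf: "infinite (UNIV :: 'u set)" and A: "left_module R A" and B: "left_module R B"
  obtains U :: "('r, 'u) module" and p q where "is_prod R U A B p q"
proof -
  obtain enc :: "'u list \<Rightarrow> 'u" where enc: "inj enc"
    using infinite_list_encoding[OF inf] .
  let ?P = "prod_module A B"
  have P: "left_module R ?P" by (rule left_module_prod[OF A B])
  have "inj_on (\<lambda>(a, b). enc [a, b]) (carrier ?P)"
    using enc by (auto simp: inj_on_def inj_def)
  from transport_module[OF P this] obtain U :: "('r, 'u) module" and t
    where t: "left_module R U" "t \<in> mod_hom R ?P U" "bij_betw t (carrier ?P) (carrier U)" .
  from mod_hom_inv[OF t(2,3) P t(1)] obtain k where k: "k \<in> mod_hom R U ?P"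
    "\<And>y. y \<in> carrier U \<Longrightarrow> t (k y) = y" "bij_betw k (carrier U) (carrier ?P)" by metis
  have f: "restrict fst (carrier ?P) \<in> mod_hom R ?P A"
    and s: "restrict snd (carrier ?P) \<in> mod_hom R ?P B"
    by (intro mod_homI P; auto simp: prod_module_def)+
  have kc: "k u \<in> carrier ?P" if "u \<in> carrier U" for u
    using k(3) that by (auto simp: bij_betw_def)
  let ?p = "\<lambda>u\<in>carrier U. restrict fst (carrier ?P) (k u)"
  let ?q = "\<lambda>u\<in>carrier U. restrict snd (carrier ?P) (k u)"
  have "bij_betw (\<lambda>u. (?p u, ?q u)) (carrier U) (carrier A \<times> carrier B)"
  proof -
    have "bij_betw k (carrier U) (carrier A \<times> carrier B)"
      using k(3) by (simp add: prod_module_def)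
    then show ?thesis
      by (rule iffD1[OF bij_betw_cong, rotated]) (use kc in auto)
  qed
  with mod_hom_compose[OF k(1) f t(1) P A] mod_hom_compose[OF k(1) s t(1) P B] t(1)
  have "is_prod R U A B ?p ?q" by (simp add: is_prod_def)
  with that show thesis .
qed

section \<open>Extension and lifting of homomorphisms\<close>

text \<open>If \<open>Y \<rightarrow> Z \<rightarrow> Z'\<close> is exact at \<open>Z\<close>, this
  says that Hom(-, X) of it is exact at \<open>Z\<close>. Phrased through the kernel of
  \<open>b\<close>, the condition does not mention the preceding map.\<close>

definition ext_along ::
  "('r, 'x) ring_scheme \<Rightarrow> ('r, 'a) module \<Rightarrow> ('r, 'b) module \<Rightarrow> ('a \<Rightarrow> 'b) \<Rightarrow> ('r, 'c) module \<Rightarrow> bool"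
  where "ext_along R Z Z' b X \<longleftrightarrow>
    (\<forall>h\<in>mod_hom R Z X. (\<forall>z\<in>carrier Z. b z = \<zero>\<^bsub>Z'\<^esub> \<longrightarrow> h z = \<zero>\<^bsub>X\<^esub>) \<longrightarrow>
       (\<exists>k\<in>mod_hom R Z' X. \<forall>z\<in>carrier Z. k (b z) = h z))"

definition lifts ::
  "('r, 'x) ring_scheme \<Rightarrow> ('r, 'z) module \<Rightarrow> ('r, 'a) module \<Rightarrow> ('r, 'b) module \<Rightarrow> ('a \<Rightarrow> 'b) \<Rightarrow> bool"
  where "lifts R Z U X \<pi> \<longleftrightarrow>
    (\<forall>\<phi>\<in>mod_hom R Z X. \<exists>\<psi>\<in>mod_hom R Z U. \<forall>z\<in>carrier Z. \<pi> (\<psi> z) = \<phi> z)"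

lemma ext_alongD:
  assumes "ext_along R Z Z' b X" "h \<in> mod_hom R Z X"
    and "\<And>z. \<lbrakk>z \<in> carrier Z; b z = \<zero>\<^bsub>Z'\<^esub>\<rbrakk> \<Longrightarrow> h z = \<zero>\<^bsub>X\<^esub>"
  obtains k where "k \<in> mod_hom R Z' X" "\<And>z. z \<in> carrier Z \<Longrightarrow> k (b z) = h z"
  using assms unfolding ext_along_def by blast

lemma liftsD:
  assumes "lifts R Z U X \<pi>" "\<phi> \<in> mod_hom R Z X"
  obtains \<psi> where "\<psi> \<in> mod_hom R Z U" "\<And>z. z \<in> carrier Z \<Longrightarrow> \<pi> (\<psi> z) = \<phi> z"
  using assms unfolding lifts_def by blast

lemma ext_along_surj:
  assumes "c \<in> mod_hom R Z Z'" "c ` carrier Z = carrier Z'" "left_module R Z" "left_module R Z'"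
    "left_module R X"
  shows "ext_along R Z Z' c X"
  unfolding ext_along_def using mod_hom_factor[OF assms(1,2) _ assms(3-5)] by blast

lemma short_exact_factor:
  assumes "short_exact R X U X' i \<pi>" and "left_module R X" "left_module R U" "left_module R Z"
    and h: "h \<in> mod_hom R Z U" and ker: "\<And>z. z \<in> carrier Z \<Longrightarrow> \<pi> (h z) = \<zero>\<^bsub>X'\<^esub>"
  obtains k where "k \<in> mod_hom R Z X" "\<And>z. z \<in> carrier Z \<Longrightarrow> i (k z) = h z"
proof -
  have i: "i \<in> mod_hom R X U" "inj_on i (carrier X)" "i ` carrier X = a_kernel U X' \<pi>"
    using assms(1) by (auto simp: short_exact_def)
  let ?I = "U\<lparr>carrier := i ` carrier X\<rparr>"
  have I: "left_module R ?I"
    by (rule left_module_submodule[OF assms(3) submodule_image[OF i(1) assms(2,3)]])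
  have "i \<in> mod_hom R X ?I" "bij_betw i (carrier X) (carrier ?I)"
    using i by (auto intro: mod_hom_restrict_image simp: bij_betw_def)
  from mod_hom_inv[OF this assms(2) I] obtain j where j: "j \<in> mod_hom R ?I X"
    "\<And>y. y \<in> carrier ?I \<Longrightarrow> i (j y) = y" by metis
  have hI: "h z \<in> i ` carrier X" if "z \<in> carrier Z" for z
    unfolding i(3) using that ker hom_simps(1)[OF h assms(4,3)] by (auto simp: a_kernel_iff)
  then have "h \<in> mod_hom R Z ?I"
    by (intro mod_hom_restrict_image[OF h]) auto
  from mod_hom_compose[OF this j(1) assms(4) I assms(2)] show thesis
    by (rule that) (use j(2) hI in auto)
qed

text \<open>The connecting homomorphism in elementary terms: for \<open>Z2 \<rightarrow> Z3 \<rightarrow> Z4\<close> exact and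
  \<open>0 \<rightarrow> X \<rightarrow> U \<rightarrow> X' \<rightarrow> 0\<close> exact, the homology of \<open>Hom(Z, X)\<close> at \<open>Z2\<close> is that of \<open>Hom(Z, X')\<close> at
  \<open>Z3\<close> whenever \<open>Hom(Z, U)\<close> is exact.\<close>

locale hom_shift =
  fixes R :: "('r, 'x) ring_scheme" and X :: "('r, 'a) module" and U :: "('r, 'b) module"
    and X' :: "('r, 'c) module" and i \<pi>
    and Z2 :: "('r, 'p) module" and Z3 :: "('r, 'q) module" and Z4 :: "('r, 's) module" and b c
  assumes ses: "short_exact R X U X' i \<pi>"
    and X: "left_module R X" and U: "left_module R U" and X': "left_module R X'"
    and Z2: "left_module R Z2" and Z3: "left_module R Z3" and Z4: "left_module R Z4"
    and b: "b \<in> mod_hom R Z2 Z3" and c: "c \<in> mod_hom R Z3 Z4"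
    and exact: "\<And>z. z \<in> carrier Z3 \<Longrightarrow> c z = \<zero>\<^bsub>Z4\<^esub> \<longleftrightarrow> z \<in> b ` carrier Z2"
begin

lemma i: "i \<in> mod_hom R X U" and \<pi>: "\<pi> \<in> mod_hom R U X'" and i_inj: "inj_on i (carrier X)"
  and ker: "\<And>u. u \<in> carrier U \<Longrightarrow> \<pi> u = \<zero>\<^bsub>X'\<^esub> \<longleftrightarrow> u \<in> i ` carrier X"
  using ses by (auto simp: short_exact_def a_kernel_iff)

lemma \<pi>i: "x \<in> carrier X \<Longrightarrow> \<pi> (i x) = \<zero>\<^bsub>X'\<^esub>"
  using ker[of "i x"] hom_simps(1)[OF i X U] by auto

lemmas simps = mod_simps[OF X] mod_simps[OF U] mod_simps[OF X'] mod_simps[OF Z2] mod_simps[OF Z3]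
  mod_simps[OF Z4] hom_simps[OF b Z2 Z3] hom_simps[OF c Z3 Z4] hom_simps[OF i X U]
  hom_simps[OF \<pi> U X']

lemma cb: "z \<in> carrier Z2 \<Longrightarrow> c (b z) = \<zero>\<^bsub>Z4\<^esub>"
  using exact[of "b z"] by (auto simp: simps)

text \<open>Extend \<open>i h\<close> to a map k from Z3 to U. As \<pi> k vanishes on the image of
  b, it comes from Z4 and there lifts to U. Subtracting this lift, composed with c, moves k into the
  kernel of \<pi>, that is into X, and changes nothing on the image of b because c b = 0.\<close>

lemma ext_along_kernel:
  assumes "lifts R Z4 U X' \<pi>" "ext_along R Z2 Z3 b U" "ext_along R Z3 Z4 c X'"
  shows "ext_along R Z2 Z3 b X"
  unfolding ext_along_def
proof (intro ballI impI)
  note [simp] = simps \<pi>i cb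
  fix h assume h: "h \<in> mod_hom R Z2 X" and hk: "\<forall>z\<in>carrier Z2. b z = \<zero>\<^bsub>Z3\<^esub> \<longrightarrow> h z = \<zero>\<^bsub>X\<^esub>"
  note [simp] = hom_simps[OF h Z2 X]
  obtain k where k: "k \<in> mod_hom R Z3 U" "\<And>z. z \<in> carrier Z2 \<Longrightarrow> k (b z) = i (h z)"
    using ext_alongD[OF assms(2) mod_hom_compose[OF h i Z2 X U]] hk by auto
  note [simp] = hom_simps[OF k(1) Z3 U]
  obtain l where l: "l \<in> mod_hom R Z4 X'" "\<And>z. z \<in> carrier Z3 \<Longrightarrow> l (c z) = \<pi> (k z)"
  proof (rule ext_alongD[OF assms(3) mod_hom_compose[OF k(1) \<pi> Z3 U X']])
    fix z assume z: "z \<in> carrier Z3" "c z = \<zero>\<^bsub>Z4\<^esub>"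
    with exact obtain y where "y \<in> carrier Z2" "z = b y" by auto
    then show "(\<lambda>x\<in>carrier Z3. \<pi> (k x)) z = \<zero>\<^bsub>X'\<^esub>" by (simp add: k(2))
  qed auto
  obtain l' where l': "l' \<in> mod_hom R Z4 U" "\<And>z. z \<in> carrier Z4 \<Longrightarrow> \<pi> (l' z) = l z"
    using liftsD[OF assms(1) l(1)] by auto
  note [simp] = hom_simps[OF l'(1) Z4 U] l(2) l'(2)
  define g where "g = (\<lambda>z\<in>carrier Z3. k z \<ominus>\<^bsub>U\<^esub> (\<lambda>z\<in>carrier Z3. l' (c z)) z)"
  have "g \<in> mod_hom R Z3 U"
    unfolding g_def by (intro mod_hom_diff mod_hom_compose[OF c l'(1)] k Z3 U Z4)
  from short_exact_factor[OF ses X U Z3 this]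
  obtain g' where g': "g' \<in> mod_hom R Z3 X" "\<And>z. z \<in> carrier Z3 \<Longrightarrow> i (g' z) = g z"
    by (auto simp: g_def)
  have "g' (b z) = h z" if "z \<in> carrier Z2" for z
  proof (rule inj_onD[OF i_inj])
    show "i (g' (b z)) = i (h z)" using that k(2) by (simp add: g'(2) g_def)
  qed (use that hom_simps(1)[OF g'(1) Z3 X] in auto)
  with g'(1) show "\<exists>k\<in>mod_hom R Z3 X. \<forall>z\<in>carrier Z2. k (b z) = h z" by blast
qed

text \<open>Lift h to h' over U. Composed with b it takes values in X, and that map extends along b
  to k; then h' - i k kills the kernel of c and descends along c. The lift to U, not only its image
  in X', is recorded because \<open>lifts_of_ext_along\<close> needs it.\<close>

lemma lift_of_ext_along:
  assumes "lifts R Z3 U X' \<pi>" "ext_along R Z3 Z4 c U" "ext_along R Z2 Z3 b X"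
    and h: "h \<in> mod_hom R Z3 X'" and hk: "\<And>z. \<lbrakk>z \<in> carrier Z3; c z = \<zero>\<^bsub>Z4\<^esub>\<rbrakk> \<Longrightarrow> h z = \<zero>\<^bsub>X'\<^esub>"
  obtains l where "l \<in> mod_hom R Z4 U" "\<And>z. z \<in> carrier Z3 \<Longrightarrow> \<pi> (l (c z)) = h z"
proof -
  note [simp] = simps \<pi>i cb
  note [simp] = hom_simps[OF h Z3 X']
  obtain h' where h': "h' \<in> mod_hom R Z3 U" "\<And>z. z \<in> carrier Z3 \<Longrightarrow> \<pi> (h' z) = h z"
    using liftsD[OF assms(1) h] by auto
  note [simp] = hom_simps[OF h'(1) Z3 U] h'(2)
  have hb: "h (b z) = \<zero>\<^bsub>X'\<^esub>" if "z \<in> carrier Z2" for z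
    using that by (intro hk) auto
  obtain g where g: "g \<in> mod_hom R Z2 X" "\<And>z. z \<in> carrier Z2 \<Longrightarrow> i (g z) = h' (b z)"
    using short_exact_factor[OF ses X U Z2 mod_hom_compose[OF b h'(1) Z2 Z3 U]] hb by auto
  note [simp] = hom_simps[OF g(1) Z2 X]
  have "g z = \<zero>\<^bsub>X\<^esub>" if "z \<in> carrier Z2" "b z = \<zero>\<^bsub>Z3\<^esub>" for z
    by (rule inj_onD[OF i_inj]) (use that g(2) in auto)
  then obtain k where k: "k \<in> mod_hom R Z3 X" "\<And>z. z \<in> carrier Z2 \<Longrightarrow> k (b z) = g z"
    using ext_alongD[OF assms(3) g(1)] by auto
  note [simp] = hom_simps[OF k(1) Z3 X]
  define m where "m = (\<lambda>z\<in>carrier Z3. h' z \<ominus>\<^bsub>U\<^esub> (\<lambda>z\<in>carrier Z3. i (k z)) z)"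
  have m: "m \<in> mod_hom R Z3 U"
    unfolding m_def by (intro mod_hom_diff mod_hom_compose[OF k(1) i] h' Z3 U X)
  have "m z = \<zero>\<^bsub>U\<^esub>" if z: "z \<in> carrier Z3" "c z = \<zero>\<^bsub>Z4\<^esub>" for z
  proof -
    obtain y where "y \<in> carrier Z2" "z = b y" using exact[OF z(1)] z(2) by auto
    then show ?thesis by (simp add: m_def k g)
  qed
  then obtain l where l: "l \<in> mod_hom R Z4 U" "\<And>z. z \<in> carrier Z3 \<Longrightarrow> l (c z) = m z"
    using ext_alongD[OF assms(2) m] by auto
  show thesis
    by (rule that[OF l(1)]) (simp add: l(2) m_def)
qed

lemma ext_along_cokernel:
  assumes "lifts R Z3 U X' \<pi>" "ext_along R Z3 Z4 c U" "ext_along R Z2 Z3 b X"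
  shows "ext_along R Z3 Z4 c X'"
  unfolding ext_along_def
proof (intro ballI impI)
  fix h assume h: "h \<in> mod_hom R Z3 X'" "\<forall>z\<in>carrier Z3. c z = \<zero>\<^bsub>Z4\<^esub> \<longrightarrow> h z = \<zero>\<^bsub>X'\<^esub>"
  obtain l where l: "l \<in> mod_hom R Z4 U" "\<And>z. z \<in> carrier Z3 \<Longrightarrow> \<pi> (l (c z)) = h z"
    using lift_of_ext_along[OF assms h(1)] h(2) by blast
  show "\<exists>k\<in>mod_hom R Z4 X'. \<forall>z\<in>carrier Z3. k (c z) = h z"
    by (rule bexI[OF _ mod_hom_compose[OF l(1) \<pi> Z4 U X']]) (use l simps in auto)
qed

text \<open>With c onto, it is enough to lift the composite with c. In use c is
  \<open>B 1 \<rightarrow> C\<close> and b is \<open>B 2 \<rightarrow> B 1\<close>, so that the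
  hypothesis on X says that the first Ext of C and X vanishes.\<close>

lemma lifts_of_ext_along:
  assumes "lifts R Z3 U X' \<pi>" "ext_along R Z3 Z4 c U" "ext_along R Z2 Z3 b X"
    and surj: "c ` carrier Z3 = carrier Z4"
  shows "lifts R Z4 U X' \<pi>"
  unfolding lifts_def
proof
  note [simp] = simps
  fix \<phi> assume \<phi>: "\<phi> \<in> mod_hom R Z4 X'"
  note [simp] = hom_simps[OF \<phi> Z4 X']
  obtain l where l: "l \<in> mod_hom R Z4 U"
    "\<And>z. z \<in> carrier Z3 \<Longrightarrow> \<pi> (l (c z)) = (\<lambda>z\<in>carrier Z3. \<phi> (c z)) z"
    using lift_of_ext_along[OF assms(1-3) mod_hom_compose[OF c \<phi> Z3 Z4 X']] by auto
  have "\<pi> (l z) = \<phi> z" if "z \<in> carrier Z4" for z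
    using that l(2) unfolding surj[symmetric] by auto
  with l(1) show "\<exists>\<psi>\<in>mod_hom R Z4 U. \<forall>z\<in>carrier Z4. \<pi> (\<psi> z) = \<phi> z" by blast
qed

end

text \<open>The degenerate case \<open>Z2 = 0\<close> of the preceding shift.\<close>

lemma ext_along_of_inj:
  assumes "\<pi> \<in> mod_hom R U X" "lifts R Z U X \<pi>" "ext_along R Z Z' b U" "inj_on b (carrier Z)"
    "b \<in> mod_hom R Z Z'"
    "left_module R U" "left_module R X" "left_module R Z" "left_module R Z'"
  shows "ext_along R Z Z' b X"
  unfolding ext_along_def
proof (intro ballI impI)
  fix h assume h: "h \<in> mod_hom R Z X"
  obtain h' where h': "h' \<in> mod_hom R Z U" "\<And>z. z \<in> carrier Z \<Longrightarrow> \<pi> (h' z) = h z"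
    using liftsD[OF assms(2) h] by auto
  have "h' z = \<zero>\<^bsub>U\<^esub>" if "z \<in> carrier Z" "b z = \<zero>\<^bsub>Z'\<^esub>" for z
  proof -
    have "z = \<zero>\<^bsub>Z\<^esub>"
      by (rule inj_onD[OF assms(4)]) (use that in \<open>auto simp: hom_simps[OF assms(5,8,9)] mod_simps[OF assms(8)]\<close>)
    then show ?thesis by (simp add: hom_simps[OF h'(1) assms(8,6)])
  qed
  then obtain k where k: "k \<in> mod_hom R Z' U" "\<And>z. z \<in> carrier Z \<Longrightarrow> k (b z) = h' z"
    using ext_alongD[OF assms(3) h'(1)] by auto
  show "\<exists>k\<in>mod_hom R Z' X. \<forall>z\<in>carrier Z. k (b z) = h z"
    by (rule bexI[OF _ mod_hom_compose[OF k(1) assms(1) assms(9,6,7)]])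
      (use k h' hom_simps(1)[OF assms(5,8,9)] in auto)
qed

lemma ext_along_prod:
  assumes U: "is_prod R U A B p q" and "left_module R A" "left_module R B" "left_module R Z"
    "left_module R Z'" "b \<in> mod_hom R Z Z'"
    and "ext_along R Z Z' b A" "ext_along R Z Z' b B"
  shows "ext_along R Z Z' b U"
  unfolding ext_along_def
proof (intro ballI impI)
  have LU: "left_module R U" and p: "p \<in> mod_hom R U A" and q: "q \<in> mod_hom R U B"
    using U by (auto simp: is_prod_def)
  fix h assume h: "h \<in> mod_hom R Z U" "\<forall>z\<in>carrier Z. b z = \<zero>\<^bsub>Z'\<^esub> \<longrightarrow> h z = \<zero>\<^bsub>U\<^esub>"
  note [simp] = hom_simps[OF h(1) assms(4) LU] hom_simps[OF p LU assms(2)] hom_simps[OF q LU assms(3)]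
    hom_simps[OF assms(6,4,5)]
  obtain k where k: "k \<in> mod_hom R Z' A" "\<And>z. z \<in> carrier Z \<Longrightarrow> k (b z) = p (h z)"
    using ext_alongD[OF assms(7) mod_hom_compose[OF h(1) p assms(4) LU assms(2)]] h(2) by auto
  obtain l where l: "l \<in> mod_hom R Z' B" "\<And>z. z \<in> carrier Z \<Longrightarrow> l (b z) = q (h z)"
    using ext_alongD[OF assms(8) mod_hom_compose[OF h(1) q assms(4) LU assms(3)]] h(2) by auto
  obtain m where m: "m \<in> mod_hom R Z' U" "\<And>z. z \<in> carrier Z' \<Longrightarrow> p (m z) = k z"
    "\<And>z. z \<in> carrier Z' \<Longrightarrow> q (m z) = l z"
    using is_prod_pair[OF U assms(2,3,5) k(1) l(1)] by auto
  note [simp] = hom_simps(1)[OF m(1) assms(5) LU]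
  have "m (b z) = h z" if "z \<in> carrier Z" for z
    by (rule is_prod_eqI[OF U]) (use that m k l in auto)
  with m(1) show "\<exists>k\<in>mod_hom R Z' U. \<forall>z\<in>carrier Z. k (b z) = h z" by blast
qed

text \<open>Injectivity is tested inside \<open>'u\<close>, while Z and Z' may be duals outside it.
  Only Z' has to be coded: Z is replaced by its image in the copy of Z', through which h factors
  because h kills the kernel of b.\<close>

lemma ext_along_injective:
  fixes I :: "('u, 'u) module" and Z :: "('u, 'a) module" and Z' :: "('u, 'b) module"
    and \<iota> :: "'b \<Rightarrow> 'u"
  assumes "injective_module R I" and Z: "left_module R Z" and Z': "left_module R Z'"
    and b: "b \<in> mod_hom R Z Z'" and inj: "inj_on \<iota> (carrier Z')"
  shows "ext_along R Z Z' b I"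
  unfolding ext_along_def
proof (intro ballI impI)
  have I: "left_module R I" and inj_ext: "\<And>A B g h. \<lbrakk>left_module R (A :: ('u, 'u) module);
      left_module R (B :: ('u, 'u) module); g \<in> mod_hom R A B; h \<in> mod_hom R A I;
      inj_on g (carrier A)\<rbrakk> \<Longrightarrow> \<exists>k\<in>mod_hom R B I. \<forall>x\<in>carrier A. k (g x) = h x"
    using assms(1) by (auto simp: injective_module_def)
  fix h assume h: "h \<in> mod_hom R Z I" "\<forall>z\<in>carrier Z. b z = \<zero>\<^bsub>Z'\<^esub> \<longrightarrow> h z = \<zero>\<^bsub>I\<^esub>"
  obtain B :: "('u, 'u) module" and t where t: "left_module R B" "t \<in> mod_hom R Z' B"
    "bij_betw t (carrier Z') (carrier B)"
    using transport_module[OF Z' inj] .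
  define tb where "tb = (\<lambda>z\<in>carrier Z. t (b z))"
  have tb: "tb \<in> mod_hom R Z B"
    unfolding tb_def by (rule mod_hom_compose[OF b t(2) Z Z' t(1)])
  note [simp] = mod_simps[OF Z] mod_simps[OF Z'] hom_simps[OF t(2) Z' t(1)] hom_simps[OF b Z Z']
  have tinj: "t z = \<zero>\<^bsub>B\<^esub> \<Longrightarrow> z = \<zero>\<^bsub>Z'\<^esub>" if "z \<in> carrier Z'" for z
    using inj_onD[OF bij_betw_imp_inj_on[OF t(3)], of z "\<zero>\<^bsub>Z'\<^esub>"] that by simp
  let ?A = "B\<lparr>carrier := tb ` carrier Z\<rparr>"
  have sub: "submodule (tb ` carrier Z) R B" by (rule submodule_image[OF tb Z t(1)])
  have A: "left_module R ?A" by (rule left_module_submodule[OF t(1) sub])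
  have "\<exists>k\<in>mod_hom R ?A I. \<forall>z\<in>carrier Z. k (tb z) = h z"
    by (rule mod_hom_factor[OF mod_hom_restrict_image[OF tb] _ h(1) Z A I])
      (use tinj h(2) in \<open>auto simp: tb_def\<close>)
  then obtain k where k: "k \<in> mod_hom R ?A I" "\<And>z. z \<in> carrier Z \<Longrightarrow> k (tb z) = h z" by auto
  have "restrict (\<lambda>x\<in>carrier B. x) (tb ` carrier Z) \<in> mod_hom R ?A B"
    by (rule mod_hom_restrict_domain[OF mod_hom_id[OF t(1)] t(1) t(1) sub])
  from inj_ext[OF A t(1) this k(1)]
  obtain m where m: "m \<in> mod_hom R B I" "\<And>x. x \<in> tb ` carrier Z \<Longrightarrow> m x = k x"
    using submodule_subset[OF sub] by (force simp: inj_on_def subset_iff)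
  show "\<exists>k\<in>mod_hom R Z' I. \<forall>z\<in>carrier Z. k (b z) = h z"
    by (rule bexI[OF _ mod_hom_compose[OF t(2) m(1) Z' t(1) I]])
      (use m(2) k(2) in \<open>auto simp: tb_def\<close>)
qed

section \<open>The class Add C\<close>

lemma direct_sum_copies_simps:
  assumes "left_module R C"
  shows "carrier (direct_sum_copies C J) =
      {x \<in> J \<rightarrow>\<^sub>E carrier C. finite {j\<in>J. x j \<noteq> \<zero>\<^bsub>C\<^esub>}}"
    and "\<zero>\<^bsub>direct_sum_copies C J\<^esub> = (\<lambda>j\<in>J. \<zero>\<^bsub>C\<^esub>)"
    and "x \<oplus>\<^bsub>direct_sum_copies C J\<^esub> y = (\<lambda>j\<in>J. x j \<oplus>\<^bsub>C\<^esub> y j)"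
    and "r \<odot>\<^bsub>direct_sum_copies C J\<^esub> x = (\<lambda>j\<in>J. r \<odot>\<^bsub>C\<^esub> x j)"
proof -
  interpret C: left_module R C by fact
  show "carrier (direct_sum_copies C J) =
      {x \<in> J \<rightarrow>\<^sub>E carrier C. finite {j\<in>J. x j \<noteq> \<zero>\<^bsub>C\<^esub>}}"
    using C.a_group by (simp add: direct_sum_copies_def Let_def carrier_sum_group)
qed (simp_all add: direct_sum_copies_def Let_def)

lemma left_module_direct_sum_copies:
  assumes "left_module R C"
  shows "left_module R (direct_sum_copies C J)"
proof -
  interpret C: left_module R C by fact
  note [simp] = direct_sum_copies_simps[OF assms]
  have fin: "finite {j\<in>J. P j}" if "finite {j\<in>J. Q j}" "finite {j\<in>J. Q' j}"
    "\<And>j. P j \<Longrightarrow> Q j \<or> Q' j" for P Q Q'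
    by (rule finite_subset[OF _ finite_UnI[OF that(1,2)]]) (use that(3) in auto)
  show ?thesis
  proof (rule left_module_intro)
    fix x y assume x: "x \<in> carrier (direct_sum_copies C J)" and y: "y \<in> carrier (direct_sum_copies C J)"
    have "finite {j \<in> J. x j \<oplus>\<^bsub>C\<^esub> y j \<noteq> \<zero>\<^bsub>C\<^esub>}"
      by (rule fin[of "\<lambda>j. x j \<noteq> \<zero>\<^bsub>C\<^esub>" "\<lambda>j. y j \<noteq> \<zero>\<^bsub>C\<^esub>"]) (use x y in auto)
    then show "x \<oplus>\<^bsub>direct_sum_copies C J\<^esub> y \<in> carrier (direct_sum_copies C J)"
      using x y by (auto simp: PiE_iff cong: conj_cong)
    show "x \<oplus>\<^bsub>direct_sum_copies C J\<^esub> y = y \<oplus>\<^bsub>direct_sum_copies C J\<^esub> x"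
      using x y by (auto simp: PiE_iff C.a_comm intro!: restrict_ext)
  next
    fix x assume x: "x \<in> carrier (direct_sum_copies C J)"
    have "finite {j \<in> J. \<ominus>\<^bsub>C\<^esub> x j \<noteq> \<zero>\<^bsub>C\<^esub>}"
      by (rule fin[of "\<lambda>j. x j \<noteq> \<zero>\<^bsub>C\<^esub>" "\<lambda>j. x j \<noteq> \<zero>\<^bsub>C\<^esub>"]) (use x in auto)
    then show "\<exists>y\<in>carrier (direct_sum_copies C J).
        y \<oplus>\<^bsub>direct_sum_copies C J\<^esub> x = \<zero>\<^bsub>direct_sum_copies C J\<^esub>"
      using x by (intro bexI[of _ "\<lambda>j\<in>J. \<ominus>\<^bsub>C\<^esub> x j"])
        (auto simp: PiE_iff C.l_neg intro!: restrict_ext cong: conj_cong)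
  next
    fix r x assume r: "r \<in> carrier R" and x: "x \<in> carrier (direct_sum_copies C J)"
    have "finite {j \<in> J. r \<odot>\<^bsub>C\<^esub> x j \<noteq> \<zero>\<^bsub>C\<^esub>}"
      by (rule fin[of "\<lambda>j. x j \<noteq> \<zero>\<^bsub>C\<^esub>" "\<lambda>j. x j \<noteq> \<zero>\<^bsub>C\<^esub>"]) (use x r mod_simps(15)[OF assms r] in auto)
    then show "r \<odot>\<^bsub>direct_sum_copies C J\<^esub> x \<in> carrier (direct_sum_copies C J)"
      using x r by (auto simp: PiE_iff C.smult_closed cong: conj_cong)
  next
    fix x assume "x \<in> carrier (direct_sum_copies C J)"
    then show "\<zero>\<^bsub>direct_sum_copies C J\<^esub> \<oplus>\<^bsub>direct_sum_copies C J\<^esub> x = x"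
      "\<one>\<^bsub>R\<^esub> \<odot>\<^bsub>direct_sum_copies C J\<^esub> x = x"
      by (auto simp: PiE_iff extensional_def C.smult_one restrict_def fun_eq_iff)
  qed (auto simp: C.R.ring_axioms PiE_iff C.a_assoc C.smult_closed C.smult_l_distr C.smult_r_distr C.smult_assoc
      intro!: restrict_ext)
qed

lemma submodule_closed:
  assumes "submodule N R M"
  shows "\<And>x y. \<lbrakk>x \<in> N; y \<in> N\<rbrakk> \<Longrightarrow> x \<oplus>\<^bsub>M\<^esub> y \<in> N"
    and "\<And>r x. \<lbrakk>r \<in> carrier R; x \<in> N\<rbrakk> \<Longrightarrow> r \<odot>\<^bsub>M\<^esub> x \<in> N"
    and "\<zero>\<^bsub>M\<^esub> \<in> N"
    and "\<And>x. x \<in> N \<Longrightarrow> \<ominus>\<^bsub>M\<^esub> x \<in> N"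
  using assms by (auto simp: submodule_def submodule_axioms_def subgroup_def a_inv_def)

lemma complement_projection:
  assumes D: "left_module R D" and A: "submodule A R D" and B: "submodule B R D"
    and int: "A \<inter> B = {\<zero>\<^bsub>D\<^esub>}" and sum: "A <+>\<^bsub>D\<^esub> B = carrier D"
  obtains q where "q \<in> mod_hom R D (D\<lparr>carrier := A\<rparr>)" "\<And>a. a \<in> A \<Longrightarrow> q a = a"
proof -
  interpret D: left_module R D by fact
  have Asub: "A \<subseteq> carrier D" and Bsub: "B \<subseteq> carrier D"
    using A B by (auto dest: submodule_subset)
  note cl = submodule_closed[OF A] and clB = submodule_closed[OF B]
  have uniq: "a = a'" if h: "a \<in> A" "a' \<in> A" "b \<in> B" "b' \<in> B" "a \<oplus>\<^bsub>D\<^esub> b = a' \<oplus>\<^bsub>D\<^esub> b'" for a a' b b'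
  proof -
    have c: "a \<in> carrier D" "a' \<in> carrier D" "b \<in> carrier D" "b' \<in> carrier D"
      using h Asub Bsub by auto
    have "a = (a' \<oplus>\<^bsub>D\<^esub> b') \<ominus>\<^bsub>D\<^esub> b"
      using h(5)[symmetric] c by (simp add: mod_simps(12)[OF D])
    also have "\<dots> = a' \<oplus>\<^bsub>D\<^esub> (b' \<ominus>\<^bsub>D\<^esub> b)"
      using c by (simp add: a_minus_def D.a_assoc)
    finally have "a \<ominus>\<^bsub>D\<^esub> a' = b' \<ominus>\<^bsub>D\<^esub> b"
      using mod_simps(13)[OF D c(2), of "b' \<ominus>\<^bsub>D\<^esub> b"] c by simp
    moreover have "a \<ominus>\<^bsub>D\<^esub> a' \<in> A" "b' \<ominus>\<^bsub>D\<^esub> b \<in> B"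
      unfolding a_minus_def by (intro cl h, intro clB h)
    ultimately have "a \<ominus>\<^bsub>D\<^esub> a' \<in> A \<inter> B"
      by simp
    then have "a \<ominus>\<^bsub>D\<^esub> a' = \<zero>\<^bsub>D\<^esub>" unfolding int by simp
    then show ?thesis using c by (simp add: mod_diff_eq_zero_iff[OF D])
  qed
  have "\<forall>d\<in>carrier D. \<exists>a. a \<in> A \<and> (\<exists>b\<in>B. d = a \<oplus>\<^bsub>D\<^esub> b)"
    unfolding sum[symmetric] set_add_def' by blast
  then obtain q where q: "\<And>d. d \<in> carrier D \<Longrightarrow> q d \<in> A"
    "\<And>d. d \<in> carrier D \<Longrightarrow> \<exists>b\<in>B. d = q d \<oplus>\<^bsub>D\<^esub> b" by metis
  have qI: "q (a \<oplus>\<^bsub>D\<^esub> b) = a" if ab: "a \<in> A" "b \<in> B" for a b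
  proof -
    have "a \<oplus>\<^bsub>D\<^esub> b \<in> carrier D" using ab Asub Bsub by auto
    from q(1)[OF this] q(2)[OF this] show ?thesis using uniq ab by metis
  qed
  have "restrict q (carrier D) \<in> mod_hom R D (D\<lparr>carrier := A\<rparr>)"
  proof (rule mod_homI)
    fix x y assume xy: "x \<in> carrier D" "y \<in> carrier D"
    obtain b c where b: "b \<in> B" "x = q x \<oplus>\<^bsub>D\<^esub> b" and c: "c \<in> B" "y = q y \<oplus>\<^bsub>D\<^esub> c"
      using q(2)[OF xy(1)] q(2)[OF xy(2)] by blast
    have car: "q x \<in> carrier D" "q y \<in> carrier D" "b \<in> carrier D" "c \<in> carrier D"
      using q(1)[OF xy(1)] q(1)[OF xy(2)] b c Asub Bsub by auto
    have "x \<oplus>\<^bsub>D\<^esub> y = (q x \<oplus>\<^bsub>D\<^esub> b) \<oplus>\<^bsub>D\<^esub> (q y \<oplus>\<^bsub>D\<^esub> c)"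
      using b(2) c(2) by metis
    also have "\<dots> = (q x \<oplus>\<^bsub>D\<^esub> q y) \<oplus>\<^bsub>D\<^esub> (b \<oplus>\<^bsub>D\<^esub> c)"
      using car by (simp add: D.a_ac)
    finally have "q (x \<oplus>\<^bsub>D\<^esub> y) = q x \<oplus>\<^bsub>D\<^esub> q y"
      using qI[OF cl(1)[OF q(1)[OF xy(1)] q(1)[OF xy(2)]] clB(1)[OF b(1) c(1)]] by simp
    then show "q (x \<oplus>\<^bsub>D\<^esub> y) = q x \<oplus>\<^bsub>D\<lparr>carrier := A\<rparr>\<^esub> q y" by simp
  next
    fix r x assume rx: "r \<in> carrier R" "x \<in> carrier D"
    obtain b where b: "b \<in> B" "x = q x \<oplus>\<^bsub>D\<^esub> b" using q(2)[OF rx(2)] by blast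
    have "r \<odot>\<^bsub>D\<^esub> x = r \<odot>\<^bsub>D\<^esub> (q x \<oplus>\<^bsub>D\<^esub> b)" using b(2) by metis
    also have "\<dots> = r \<odot>\<^bsub>D\<^esub> q x \<oplus>\<^bsub>D\<^esub> r \<odot>\<^bsub>D\<^esub> b"
      using q(1)[OF rx(2)] b Asub Bsub rx by (intro D.smult_r_distr) auto
    finally have "q (r \<odot>\<^bsub>D\<^esub> x) = r \<odot>\<^bsub>D\<^esub> q x"
      using qI[OF cl(2)[OF rx(1) q(1)[OF rx(2)]] clB(2)[OF rx(1) b(1)]] by simp
    then show "q (r \<odot>\<^bsub>D\<^esub> x) = r \<odot>\<^bsub>D\<lparr>carrier := A\<rparr>\<^esub> q x" by simp
  qed (use q(1) D in auto)
  moreover have "q a = a" if "a \<in> A" for a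
  proof -
    have "q (a \<oplus>\<^bsub>D\<^esub> \<zero>\<^bsub>D\<^esub>) = a" using int that by (intro qI) auto
    then show ?thesis using that Asub by auto
  qed
  ultimately show thesis using Asub by (intro that[of "restrict q (carrier D)"]) auto
qed

text \<open>The trace of finite generation that the constructions use: it confines a map into a
  direct sum to finitely many coordinates, and it lets homomorphisms be coded by finite tuples of
  values.\<close>

definition hom_separating ::
  "('r, 'x) ring_scheme \<Rightarrow> ('r, 'a) module \<Rightarrow> ('r, 'b) module \<Rightarrow> bool"
  where "hom_separating R Z X \<longleftrightarrow> (\<exists>A. finite A \<and> A \<subseteq> carrier Z \<and>
    (\<forall>h\<in>mod_hom R Z X. (\<forall>a\<in>A. h a = \<zero>\<^bsub>X\<^esub>) \<longrightarrow> (\<forall>z\<in>carrier Z. h z = \<zero>\<^bsub>X\<^esub>)))"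

lemma finitely_generated_hom_separating:
  assumes "finitely_generated R Z" "left_module R Z" "left_module R X"
  shows "hom_separating R Z X"
proof -
  from assms(1) obtain A where A: "finite A" "A \<subseteq> carrier Z"
    "\<forall>N. submodule N R Z \<and> A \<subseteq> N \<longrightarrow> N = carrier Z"
    unfolding finitely_generated_def by (elim exE conjE)
  have "h z = \<zero>\<^bsub>X\<^esub>" if "h \<in> mod_hom R Z X" "\<forall>a\<in>A. h a = \<zero>\<^bsub>X\<^esub>" "z \<in> carrier Z" for h z
  proof -
    have "A \<subseteq> a_kernel Z X h" using that(2) A(2) by (auto simp: a_kernel_iff)
    with A(3) submodule_kernel[OF that(1) assms(2,3)] have "a_kernel Z X h = carrier Z" by blast
    then show ?thesis using that(3) a_kernel_iff[of z Z X h] by simp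
  qed
  with A(1,2) show ?thesis unfolding hom_separating_def by blast
qed

lemma finitely_generated_image:
  assumes "finitely_generated R Z" "h \<in> mod_hom R Z X" "h ` carrier Z = carrier X"
    "left_module R Z" "left_module R X"
  shows "finitely_generated R X"
proof -
  from assms(1) obtain A where A: "finite A" "A \<subseteq> carrier Z"
    "\<forall>N. submodule N R Z \<and> A \<subseteq> N \<longrightarrow> N = carrier Z"
    unfolding finitely_generated_def by (elim exE conjE)
  note [simp] = hom_simps[OF assms(2,4,5)] mod_simps[OF assms(4)]
  have "N = carrier X" if N: "submodule N R X" "h ` A \<subseteq> N" for N
  proof -
    have "submodule {z \<in> carrier Z. h z \<in> N} R Z"
      using N(1) by (auto simp: submodule_iff[OF assms(4)] submodule_iff[OF assms(5)])
    moreover have "A \<subseteq> {z \<in> carrier Z. h z \<in> N}" using A(2) N(2) by auto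
    ultimately have "{z \<in> carrier Z. h z \<in> N} = carrier Z" using A(3) by blast
    then have "carrier X \<subseteq> N" unfolding assms(3)[symmetric] by blast
    with submodule_subset[OF N(1)] show ?thesis by auto
  qed
  moreover have "finite (h ` A)" "h ` A \<subseteq> carrier X" using A by auto
  ultimately show ?thesis unfolding finitely_generated_def by blast
qed

lemma hom_separatingE:
  assumes "hom_separating R Z X" "left_module R Z" "left_module R X"
  obtains A where "finite A" "A \<subseteq> carrier Z"
    "\<forall>g\<in>mod_hom R Z X. \<forall>h\<in>mod_hom R Z X. (\<forall>a\<in>A. g a = h a) \<longrightarrow> g = h"
proof -
  from assms(1) obtain A where A: "finite A" "A \<subseteq> carrier Z"
    "\<forall>h\<in>mod_hom R Z X. (\<forall>a\<in>A. h a = \<zero>\<^bsub>X\<^esub>) \<longrightarrow> (\<forall>z\<in>carrier Z. h z = \<zero>\<^bsub>X\<^esub>)"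
    unfolding hom_separating_def by (elim exE conjE)
  have "g = h" if gh: "g \<in> mod_hom R Z X" "h \<in> mod_hom R Z X" "\<forall>a\<in>A. g a = h a" for g h
  proof (rule mod_hom_eqI[OF gh(1,2)])
    note c = hom_simps(1)[OF gh(1) assms(2,3)] hom_simps(1)[OF gh(2) assms(2,3)]
    fix z assume z: "z \<in> carrier Z"
    have "(\<lambda>z\<in>carrier Z. g z \<ominus>\<^bsub>X\<^esub> h z) z = \<zero>\<^bsub>X\<^esub>"
      by (rule A(3)[rule_format, OF mod_hom_diff[OF gh(1,2) assms(2,3)] _ z])
        (use gh(3) A(2) c in \<open>auto simp: subset_iff mod_simps(9)[OF assms(3)]\<close>)
    then show "g z = h z" using z c by (simp add: mod_diff_eq_zero_iff[OF assms(3)])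
  qed
  then show thesis by (intro that[OF A(1,2)]) blast
qed

text \<open>Embed X as a summand in a direct sum of copies of C, extend each coordinate and project
  back. The obstacle is finite support: \<open>hom_separating\<close> confines a map into the sum to
  the finitely many coordinates that do not vanish on a detecting set.\<close>

lemma ext_along_in_Add:
  fixes C X :: "('u, 'u) module"
  assumes add: "in_Add R C X" and C: "left_module R C" and Z: "left_module R Z" and Z': "left_module R Z'"
    and b: "b \<in> mod_hom R Z Z'" and ext: "ext_along R Z Z' b C" and sep: "hom_separating R Z C"
  shows "ext_along R Z Z' b X"
  unfolding ext_along_def
proof (intro ballI impI)
  have X: "left_module R X" using add unfolding in_Add_def by (rule conjunct1)
  obtain J :: "'u set" and A B where A: "submodule A R (direct_sum_copies C J)"
    and B: "submodule B R (direct_sum_copies C J)"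
    and AB: "A \<inter> B = {\<zero>\<^bsub>direct_sum_copies C J\<^esub>}"
      "A <+>\<^bsub>direct_sum_copies C J\<^esub> B = carrier (direct_sum_copies C J)"
    and iso: "mod_iso R X ((direct_sum_copies C J)\<lparr>carrier := A\<rparr>)"
    using add unfolding in_Add_def Let_def by blast
  define D where "D = direct_sum_copies C J"
  have D: "left_module R D" unfolding D_def by (rule left_module_direct_sum_copies[OF C])
  note Ds = direct_sum_copies_simps[OF C, of J, folded D_def]
  let ?A = "D\<lparr>carrier := A\<rparr>"
  have LA: "left_module R ?A" using left_module_submodule[OF D] A D_def by simp
  have Asub: "A \<subseteq> carrier D" using submodule_subset[OF A] by (simp add: D_def)
  obtain g where g: "g \<in> mod_hom R X ?A" "bij_betw g (carrier X) (carrier ?A)"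
    using iso by (auto simp: mod_iso_def D_def)
  obtain g' where g': "g' \<in> mod_hom R ?A X" "\<And>x. x \<in> carrier X \<Longrightarrow> g' (g x) = x"
    using mod_hom_inv[OF g X LA] by metis
  obtain q where q: "q \<in> mod_hom R D ?A" "\<And>a. a \<in> A \<Longrightarrow> q a = a"
    using complement_projection[OF D] A B AB by (metis D_def)
  fix h assume h: "h \<in> mod_hom R Z X" and hk: "\<forall>z\<in>carrier Z. b z = \<zero>\<^bsub>Z'\<^esub> \<longrightarrow> h z = \<zero>\<^bsub>X\<^esub>"
  have gD: "g \<in> mod_hom R X D" by (rule mod_hom_enlarge[OF g(1) Asub])
  define H where "H = (\<lambda>z\<in>carrier Z. g (h z))"
  have H: "H \<in> mod_hom R Z D"
    unfolding H_def by (rule mod_hom_compose[OF h gD Z X D])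
  note [simp] = hom_simps[OF h Z X] hom_simps[OF H Z D] hom_simps[OF gD X D] hom_simps[OF b Z Z']
    mod_simps[OF C] mod_simps[OF Z] mod_simps[OF Z']
  have Hc: "H z \<in> J \<rightarrow>\<^sub>E carrier C" "finite {j\<in>J. H z j \<noteq> \<zero>\<^bsub>C\<^esub>}" if "z \<in> carrier Z" for z
    using hom_simps(1)[OF H Z D that] by (auto simp: Ds)
  note [simp] = PiE_mem[OF Hc(1)]
  define Hj where "Hj j = (\<lambda>z\<in>carrier Z. H z j)" for j
  have Hj: "Hj j \<in> mod_hom R Z C" if "j \<in> J" for j
    unfolding Hj_def by (intro mod_homI Z) (auto simp: that Ds)
  from sep obtain F where F: "finite F" "F \<subseteq> carrier Z"
    "\<forall>h\<in>mod_hom R Z C. (\<forall>a\<in>F. h a = \<zero>\<^bsub>C\<^esub>) \<longrightarrow> (\<forall>z\<in>carrier Z. h z = \<zero>\<^bsub>C\<^esub>)"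
    unfolding hom_separating_def by (elim exE conjE)
  define S where "S = (\<Union>a\<in>F. {j\<in>J. H a j \<noteq> \<zero>\<^bsub>C\<^esub>})"
  have S: "finite S" unfolding S_def using F Hc(2) by auto
  have out: "H z j = \<zero>\<^bsub>C\<^esub>" if "z \<in> carrier Z" "j \<in> J" "j \<notin> S" for z j
    using F(3)[rule_format, OF Hj[OF that(2)], of z] F(2) that by (auto simp: Hj_def S_def subset_iff)
  have "\<exists>k\<in>mod_hom R Z' C. \<forall>z\<in>carrier Z. k (b z) = H z j" if "j \<in> J" for j
  proof -
    have "Hj j z = \<zero>\<^bsub>C\<^esub>" if "z \<in> carrier Z" "b z = \<zero>\<^bsub>Z'\<^esub>" for z
      using that hk hom_simps(4)[OF gD X D] \<open>j \<in> J\<close> by (simp add: Hj_def H_def Ds)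
    from ext_alongD[OF ext Hj[OF that] this]
    obtain k where "k \<in> mod_hom R Z' C" "\<And>z. z \<in> carrier Z \<Longrightarrow> k (b z) = Hj j z" by blast
    then show ?thesis by (auto simp: Hj_def)
  qed
  then obtain k where k: "\<And>j. j \<in> J \<Longrightarrow> k j \<in> mod_hom R Z' C"
    "\<And>j z. \<lbrakk>j \<in> J; z \<in> carrier Z\<rbrakk> \<Longrightarrow> k j (b z) = H z j" by metis
  note ks = hom_simps[OF k(1) Z' C]
  \<comment> \<open>An extension of a zero coordinate need not be zero; taking zero outside S keeps
    the support finite.\<close>
  define K where "K = (\<lambda>z. \<lambda>j\<in>J. if j \<in> S then k j z else \<zero>\<^bsub>C\<^esub>)"
  have "restrict K (carrier Z') \<in> mod_hom R Z' D"
  proof (rule mod_homI)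
    show "K z \<in> carrier D" if "z \<in> carrier Z'" for z
    proof -
      have "finite {j\<in>J. K z j \<noteq> \<zero>\<^bsub>C\<^esub>}"
        by (rule finite_subset[OF _ S]) (auto simp: K_def split: if_splits)
      moreover have "K z \<in> J \<rightarrow>\<^sub>E carrier C" using that ks(1) by (auto simp: K_def)
      ultimately show ?thesis by (simp add: Ds)
    qed
  qed (auto simp: Ds K_def ks Z' intro!: restrict_ext)
  note K = mod_hom_compose[OF mod_hom_compose[OF this q(1) Z' D LA] g'(1) Z' LA X]
  have "K (b z) = H z" if "z \<in> carrier Z" for z
    by (rule PiE_ext[of _ J "\<lambda>_. carrier C"])
      (use that Hc(1)[OF that] out k(2) ks(1) in \<open>auto simp: K_def PiE_iff\<close>)
  moreover have "g' (q (H z)) = h z" if "z \<in> carrier Z" for z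
  proof -
    have "g (h z) \<in> A" using g(2) that by (auto simp: bij_betw_def)
    then show ?thesis using that q(2) g'(2) by (simp add: H_def)
  qed
  ultimately show "\<exists>k\<in>mod_hom R Z' X. \<forall>z\<in>carrier Z. k (b z) = h z"
    by (intro bexI[OF _ K]) auto
qed

section \<open>Direct sums of copies of C and precovers\<close>

lemma direct_sum_universal:
  fixes J :: "'j set" and C :: "('r, 'c) module" and X :: "('r, 'd) module"
  assumes C: "left_module R C" and X: "left_module R X" and h: "\<And>j. j \<in> J \<Longrightarrow> h j \<in> mod_hom R C X"
  obtains \<sigma> where "\<sigma> \<in> mod_hom R (direct_sum_copies C J) X"
    "\<And>j c. \<lbrakk>j \<in> J; c \<in> carrier C\<rbrakk> \<Longrightarrow> \<sigma> (\<lambda>k\<in>J. if k = j then c else \<zero>\<^bsub>C\<^esub>) = h j c"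
proof -
  interpret X: left_module R X by fact
  interpret C: left_module R C by fact
  define D where "D = direct_sum_copies C J"
  have D: "left_module R D" unfolding D_def by (rule left_module_direct_sum_copies[OF C])
  note Ds = direct_sum_copies_simps[OF C, of J, folded D_def]
  note hs = hom_simps[OF h C X]
  define supp where "supp x = {j\<in>J. x j \<noteq> \<zero>\<^bsub>C\<^esub>}" for x :: "'j \<Rightarrow> 'c"
  define \<sigma> where "\<sigma> x = (\<Oplus>\<^bsub>X\<^esub>j\<in>supp x. h j (x j))" for x
  have cl: "h j (x j) \<in> carrier X" if "x \<in> carrier D" "j \<in> J" for x j
    using that hs(1) by (auto simp: Ds)
  \<comment> \<open>The supports of x, y and x + y differ. Summing over any finite set that contains
    the support makes termwise comparison possible.\<close>
  have \<sigma>S: "\<sigma> x = (\<Oplus>\<^bsub>X\<^esub>j\<in>S. h j (x j))" if S: "finite S" "supp x \<subseteq> S" "S \<subseteq> J" "x \<in> carrier D" for x S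
    unfolding \<sigma>_def
    by (rule X.add.finprod_mono_neutral_cong_left)
      (use S cl in \<open>auto simp: supp_def hs(4) subset_iff Ds\<close>)
  have fs: "finite (supp x)" "supp x \<subseteq> J" if "x \<in> carrier D" for x
    using that by (auto simp: Ds supp_def)
  have "restrict \<sigma> (carrier D) \<in> mod_hom R D X"
  proof (rule mod_homI[OF _ _ _ D])
    show "\<sigma> x \<in> carrier X" if "x \<in> carrier D" for x
      unfolding \<sigma>_def using fs(2)[OF that] cl[OF that] by (intro X.finsum_closed) auto
    show "\<sigma> (x \<oplus>\<^bsub>D\<^esub> y) = \<sigma> x \<oplus>\<^bsub>X\<^esub> \<sigma> y" if xy: "x \<in> carrier D" "y \<in> carrier D" for x y
    proof -
      let ?S = "supp x \<union> supp y"
      have xyD: "x \<oplus>\<^bsub>D\<^esub> y \<in> carrier D" using xy mod_simps(1)[OF D] by auto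
      have S: "finite ?S" "?S \<subseteq> J" using fs[OF xy(1)] fs[OF xy(2)] by auto
      have "supp (x \<oplus>\<^bsub>D\<^esub> y) \<subseteq> ?S" by (auto simp: supp_def Ds)
      then have "\<sigma> (x \<oplus>\<^bsub>D\<^esub> y) = (\<Oplus>\<^bsub>X\<^esub>j\<in>?S. h j ((x \<oplus>\<^bsub>D\<^esub> y) j))"
        using S xyD by (intro \<sigma>S) auto
      also have "\<dots> = (\<Oplus>\<^bsub>X\<^esub>j\<in>?S. h j (x j) \<oplus>\<^bsub>X\<^esub> h j (y j))"
      proof (rule X.finsum_cong')
        show "(\<lambda>j. h j (x j) \<oplus>\<^bsub>X\<^esub> h j (y j)) \<in> ?S \<rightarrow> carrier X" using S cl xy by auto
        fix j assume "j \<in> ?S"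
        with S xy have "j \<in> J" "x j \<in> carrier C" "y j \<in> carrier C" by (auto simp: Ds PiE_iff)
        then show "h j ((x \<oplus>\<^bsub>D\<^esub> y) j) = h j (x j) \<oplus>\<^bsub>X\<^esub> h j (y j)"
          by (simp add: Ds hs(2))
      qed simp
      also have "\<dots> = (\<Oplus>\<^bsub>X\<^esub>j\<in>?S. h j (x j)) \<oplus>\<^bsub>X\<^esub> (\<Oplus>\<^bsub>X\<^esub>j\<in>?S. h j (y j))"
        using S cl xy by (intro X.finsum_addf) auto
      also have "\<dots> = \<sigma> x \<oplus>\<^bsub>X\<^esub> \<sigma> y"
        using \<sigma>S[OF S(1) _ S(2) xy(1)] \<sigma>S[OF S(1) _ S(2) xy(2)] by simp
      finally show ?thesis .
    qed
    show "\<sigma> (r \<odot>\<^bsub>D\<^esub> x) = r \<odot>\<^bsub>X\<^esub> \<sigma> x" if rx: "r \<in> carrier R" "x \<in> carrier D" for r x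
    proof -
      have rxD: "r \<odot>\<^bsub>D\<^esub> x \<in> carrier D" using rx mod_simps(5)[OF D] by auto
      note S = fs[OF rx(2)]
      have "supp (r \<odot>\<^bsub>D\<^esub> x) \<subseteq> supp x" 
        using rx by (auto simp: supp_def Ds mod_simps(15)[OF C])
      then have "\<sigma> (r \<odot>\<^bsub>D\<^esub> x) = (\<Oplus>\<^bsub>X\<^esub>j\<in>supp x. h j ((r \<odot>\<^bsub>D\<^esub> x) j))"
        using S rxD by (intro \<sigma>S) auto
      also have "\<dots> = (\<Oplus>\<^bsub>X\<^esub>j\<in>supp x. r \<odot>\<^bsub>X\<^esub> h j (x j))"
      proof (rule X.finsum_cong')
        show "(\<lambda>j. r \<odot>\<^bsub>X\<^esub> h j (x j)) \<in> supp x \<rightarrow> carrier X"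
          using S cl rx X.smult_closed by auto
        fix j assume "j \<in> supp x"
        with S rx have "j \<in> J" "x j \<in> carrier C" by (auto simp: Ds PiE_iff)
        then show "h j ((r \<odot>\<^bsub>D\<^esub> x) j) = r \<odot>\<^bsub>X\<^esub> h j (x j)"
          using rx by (simp add: Ds hs(3))
      qed simp
      also have "\<dots> = r \<odot>\<^bsub>X\<^esub> \<sigma> x"
      proof -
        have "(\<Oplus>\<^bsub>X\<^esub>j\<in>T. r \<odot>\<^bsub>X\<^esub> g j) = r \<odot>\<^bsub>X\<^esub> (\<Oplus>\<^bsub>X\<^esub>j\<in>T. g j)"
          if "finite T" "g \<in> T \<rightarrow> carrier X" for T :: "'j set" and g
          using that
        proof (induction T)
          case empty
          then show ?case using mod_simps(15)[OF X rx(1)] by simp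
        next
          case (insert t T)
          then show ?case using rx(1)
            by (simp add: X.smult_r_distr X.smult_closed Pi_def X.finsum_closed)
        qed
        then show ?thesis unfolding \<sigma>_def using S cl rx(2) by (simp add: Pi_def subset_iff)
      qed
      finally show ?thesis .
    qed
  qed
  moreover have "\<sigma> (\<lambda>k\<in>J. if k = j then c else \<zero>\<^bsub>C\<^esub>) = h j c" 
    and "(\<lambda>k\<in>J. if k = j then c else \<zero>\<^bsub>C\<^esub>) \<in> carrier D" if j: "j \<in> J" "c \<in> carrier C" for j c
  proof -
    let ?x = "\<lambda>k\<in>J. if k = j then c else \<zero>\<^bsub>C\<^esub>"
    have sx: "supp ?x \<subseteq> {j}" by (auto simp: supp_def split: if_splits)
    have "?x \<in> J \<rightarrow>\<^sub>E carrier C" using j by auto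
    with finite_subset[OF sx] show x: "?x \<in> carrier D"
      unfolding Ds supp_def by simp
    show "\<sigma> ?x = h j c"
      using \<sigma>S[OF _ sx _ x] j hs(1)[OF j] by simp
  qed
  ultimately show thesis by (intro that[of "restrict \<sigma> (carrier D)"]) (auto simp: D_def)
qed

lemma in_Add_of_iso:
  fixes C W :: "('u, 'u) module" and J :: "'u set"
  assumes "left_module R C" "left_module R W" "mod_iso R W (direct_sum_copies C J)"
  shows "in_Add R C W"
proof -
  let ?D = "direct_sum_copies C J"
  have D: "left_module R ?D" by (rule left_module_direct_sum_copies[OF assms(1)])
  interpret D: left_module R ?D by fact
  have "submodule (carrier ?D) R ?D" "submodule {\<zero>\<^bsub>?D\<^esub>} R ?D"
    by (auto simp: submodule_iff[OF D] mod_simps[OF D])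
  moreover have "carrier ?D \<inter> {\<zero>\<^bsub>?D\<^esub>} = {\<zero>\<^bsub>?D\<^esub>}" by auto
  moreover have "carrier ?D <+>\<^bsub>?D\<^esub> {\<zero>\<^bsub>?D\<^esub>} = carrier ?D"
    by (auto simp: set_add_def' mod_simps[OF D])
  moreover have "mod_iso R W (?D\<lparr>carrier := carrier ?D\<rparr>)" using assms(3) by simp
  ultimately show ?thesis unfolding in_Add_def Let_def using assms(2) by blast
qed

lemma zero_in_Add:
  fixes C Y :: "('u, 'u) module"
  assumes C: "left_module R C" and Y: "left_module R Y" and "carrier Y = {\<zero>\<^bsub>Y\<^esub>}"
  shows "in_Add R C Y"
proof (rule in_Add_of_iso[OF C Y])
  let ?D = "direct_sum_copies C ({} :: 'u set)"
  have D: "left_module R ?D" by (rule left_module_direct_sum_copies[OF C])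
  have "carrier ?D = {\<zero>\<^bsub>?D\<^esub>}"
    by (auto simp: direct_sum_copies_simps[OF C])
  then have "bij_betw (\<lambda>y\<in>carrier Y. \<zero>\<^bsub>?D\<^esub>) (carrier Y) (carrier ?D)"
    using assms(3) by (auto simp: bij_betw_def)
  with mod_hom_zero[OF Y D] show "mod_iso R Y ?D" unfolding mod_iso_def by blast
qed

text \<open>One copy of C is taken for each homomorphism from C to X, so that every such
  homomorphism is the restriction of the total map to its own copy. \<open>hom_separating\<close>
  keeps the index set, and then the direct sum, inside \<open>'u\<close>.\<close>

lemma Add_precover:
  fixes C X :: "('u, 'u) module"
  assumes inf: "infinite (UNIV :: 'u set)" and C: "left_module R C" and X: "left_module R X"
    and sep: "hom_separating R C X"
  obtains W :: "('u, 'u) module" and p where "in_Add R C W" "p \<in> mod_hom R W X" "lifts R C W X p"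
proof -
  obtain enc :: "'u list \<Rightarrow> 'u" where enc: "inj enc"
    using infinite_list_encoding[OF inf] .
  obtain A where A: "finite A" "A \<subseteq> carrier C"
    "\<forall>g\<in>mod_hom R C X. \<forall>h\<in>mod_hom R C X. (\<forall>a\<in>A. g a = h a) \<longrightarrow> g = h"
    using hom_separatingE[OF sep C X] .
  obtain xs where xs: "set xs = A" using finite_list[OF A(1)] by auto
  \<comment> \<open>Homomorphisms out of C are told apart by their values on the list xs; this
    places the index set J inside \<open>'u\<close>.\<close>
  define code where "code h = enc (map h xs)" for h :: "'u \<Rightarrow> 'u"
  have code: "inj_on code (mod_hom R C X)"
    by (rule inj_onI, rule A(3)[rule_format]) (use xs in \<open>auto simp: code_def inj_eq[OF enc]\<close>)
  define J where "J = code ` mod_hom R C X"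
  define h where "h = inv_into (mod_hom R C X) code"
  have h: "h j \<in> mod_hom R C X" if "j \<in> J" for j
    using that unfolding h_def J_def by (rule inv_into_into)
  have hc: "h (code \<phi>) = \<phi>" if "\<phi> \<in> mod_hom R C X" for \<phi>
    unfolding h_def using code that by simp
  let ?D = "direct_sum_copies C J"
  have D: "left_module R ?D" by (rule left_module_direct_sum_copies[OF C])
  note Ds = direct_sum_copies_simps[OF C, of J]
  obtain \<sigma> where \<sigma>: "\<sigma> \<in> mod_hom R ?D X"
    "\<And>j c. \<lbrakk>j \<in> J; c \<in> carrier C\<rbrakk> \<Longrightarrow> \<sigma> (\<lambda>k\<in>J. if k = j then c else \<zero>\<^bsub>C\<^esub>) = h j c"
  proof (rule direct_sum_universal[of R C X J h, OF C X h])
  qed auto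
  define supp where "supp x = {j\<in>J. x j \<noteq> \<zero>\<^bsub>C\<^esub>}" for x :: "'u \<Rightarrow> 'u"
  \<comment> \<open>An element is coded by a list of its pairs (index, value) over the support. The
    order of the list is arbitrary, so injectivity is argued with sets of pairs.\<close>
  define gr where "gr x = enc (map (\<lambda>j. enc [j, x j]) (SOME l. set l = supp x))" for x
  have "inj_on gr (carrier ?D)"
  proof (rule inj_onI)
    fix x y assume x: "x \<in> carrier ?D" and y: "y \<in> carrier ?D" and eq: "gr x = gr y"
    have l: "set (SOME l. set l = supp z) = supp z" if "z \<in> carrier ?D" for z
      by (rule someI_ex[OF finite_list]) (use that in \<open>auto simp: Ds supp_def\<close>)
    have "map (\<lambda>j. enc [j, x j]) (SOME l. set l = supp x) = map (\<lambda>j. enc [j, y j]) (SOME l. set l = supp y)"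
      using eq by (simp add: gr_def inj_eq[OF enc])
    from arg_cong[where f = set, OF this]
    have "(\<lambda>j. enc [j, x j]) ` supp x = (\<lambda>j. enc [j, y j]) ` supp y"
      by (simp only: set_map l[OF x] l[OF y])
    then have "(\<lambda>(j, c). enc [j, c]) ` ((\<lambda>j. (j, x j)) ` supp x) = (\<lambda>(j, c). enc [j, c]) ` ((\<lambda>j. (j, y j)) ` supp y)"
      by (simp add: image_image)
    moreover have "inj (\<lambda>(j, c). enc [j, c])" by (auto simp: inj_def inj_eq[OF enc])
    ultimately have g: "(\<lambda>j. (j, x j)) ` supp x = (\<lambda>j. (j, y j)) ` supp y"
      by (simp only: inj_image_eq_iff)
    have "x j = y j" if "j \<in> J" for j
    proof (cases "j \<in> supp x \<or> j \<in> supp y")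
      case True
      then have "(j, x j) \<in> (\<lambda>j. (j, y j)) ` supp y \<or> (j, y j) \<in> (\<lambda>j. (j, x j)) ` supp x"
        using g by blast
      then show ?thesis by auto
    next
      case False
      then show ?thesis using that by (simp add: supp_def)
    qed
    with x y show "x = y" by (auto simp: Ds intro: PiE_ext)
  qed
  from transport_module[OF D this] obtain W :: "('u, 'u) module" and t
    where W: "left_module R W" "t \<in> mod_hom R ?D W" "bij_betw t (carrier ?D) (carrier W)" .
  obtain t' where t': "t' \<in> mod_hom R W ?D" "\<And>x. x \<in> carrier ?D \<Longrightarrow> t' (t x) = x"
    "bij_betw t' (carrier W) (carrier ?D)"
    using mod_hom_inv[OF W(2,3) D W(1)] by metis
  let ?p = "\<lambda>w\<in>carrier W. \<sigma> (t' w)"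
  have p: "?p \<in> mod_hom R W X" by (rule mod_hom_compose[OF t'(1) \<sigma>(1) W(1) D X])
  have "lifts R C W X ?p"
    unfolding lifts_def
  proof
    fix \<phi> assume \<phi>: "\<phi> \<in> mod_hom R C X"
    define j where "j = code \<phi>"
    have j: "j \<in> J" using \<phi> by (simp add: j_def J_def)
    define inc where "inc c = (\<lambda>k\<in>J. if k = j then c else \<zero>\<^bsub>C\<^esub>)" for c
    have incD: "inc c \<in> carrier ?D" if "c \<in> carrier C" for c
    proof -
      have "finite {k \<in> J. inc c k \<noteq> \<zero>\<^bsub>C\<^esub>}"
        by (rule finite_subset[of _ "{j}"]) (auto simp: inc_def split: if_splits)
      moreover have "inc c \<in> J \<rightarrow>\<^sub>E carrier C"
        using that by (auto simp: inc_def mod_simps[OF C])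
      ultimately show ?thesis by (simp add: Ds)
    qed
    have "restrict inc (carrier C) \<in> mod_hom R C ?D"
      by (intro mod_homI C incD) (auto simp: Ds inc_def mod_simps[OF C] intro!: restrict_ext)
    from mod_hom_compose[OF this W(2) C D W(1)]
    show "\<exists>\<psi>\<in>mod_hom R C W. \<forall>z\<in>carrier C. ?p (\<psi> z) = \<phi> z"
    proof (rule bexI[rotated], intro ballI)
      fix c assume c: "c \<in> carrier C"
      have "\<sigma> (inc c) = \<phi> c" using \<sigma>(2)[OF j c] hc[OF \<phi>] by (simp add: inc_def j_def)
      then show "?p ((\<lambda>x\<in>carrier C. t (restrict inc (carrier C) x)) c) = \<phi> c"
        using c incD[OF c] t'(2) hom_simps(1)[OF W(2) D W(1)] by simp
    qed
  qed
  moreover have "in_Add R C W"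
    by (rule in_Add_of_iso[OF C W(1)]) (use t' in \<open>auto simp: mod_iso_def\<close>)
  ultimately show thesis using that p by blast
qed

section \<open>Projective resolutions\<close>

text \<open>A projective resolution with the resolved module as its term in degree \<open>0\<close>.\<close>

definition augmented_resolution ::
  "'u ring \<Rightarrow> (nat \<Rightarrow> ('u, 'u) module) \<Rightarrow> (nat \<Rightarrow> 'u \<Rightarrow> 'u) \<Rightarrow> bool"
  where "augmented_resolution R Q d \<longleftrightarrow>
    (\<forall>i. left_module R (Q i)) \<and> (\<forall>i. projective_module R (Q (Suc i))) \<and>
    (\<forall>i. d i \<in> mod_hom R (Q (Suc i)) (Q i)) \<and> d 0 ` carrier (Q 1) = carrier (Q 0) \<and>
    (\<forall>i. d (Suc i) ` carrier (Q (Suc (Suc i))) = a_kernel (Q (Suc i)) (Q i) (d i))"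

lemma augmented_resolution_of_projective:
  assumes "projective_resolution R A P d e" "left_module R A"
  shows "augmented_resolution R (case_nat A P) (case_nat e d)"
proof -
  have "left_module R (P i)" for i
    using assms(1) by (auto simp: projective_resolution_def projective_module_def)
  with assms show ?thesis
    unfolding augmented_resolution_def projective_resolution_def
    by (auto split: nat.split)
qed

locale aug_res =
  fixes R :: "'u ring" and Q :: "nat \<Rightarrow> ('u, 'u) module" and d :: "nat \<Rightarrow> 'u \<Rightarrow> 'u"
  assumes aug: "augmented_resolution R Q d"
begin

lemma mods: "left_module R (Q i)" and proj: "projective_module R (Q (Suc i))"
  and homs: "d i \<in> mod_hom R (Q (Suc i)) (Q i)"
  and surj0: "d 0 ` carrier (Q (Suc 0)) = carrier (Q 0)"
  using aug by (auto simp: augmented_resolution_def)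

lemma exact: "x \<in> carrier (Q (Suc i)) \<Longrightarrow>
    d i x = \<zero>\<^bsub>Q i\<^esub> \<longleftrightarrow> x \<in> d (Suc i) ` carrier (Q (Suc (Suc i)))"
  using aug by (auto simp: augmented_resolution_def a_kernel_iff)

lemmas dsimps = hom_simps[OF homs mods mods]

lemma dd: "x \<in> carrier (Q (Suc (Suc i))) \<Longrightarrow> d i (d (Suc i) x) = \<zero>\<^bsub>Q i\<^esub>"
  using exact[of "d (Suc i) x" i] dsimps(1) by blast

end

text \<open>Projectivity speaks of surjections; cutting Y down to the image of b turns any b into
  one.\<close>

lemma projective_lift:
  fixes P X Y :: "('u, 'u) module"
  assumes P: "projective_module R P" and X: "left_module R X" and Y: "left_module R Y"
    and b: "b \<in> mod_hom R X Y" and g: "g \<in> mod_hom R P Y" "g ` carrier P \<subseteq> b ` carrier X"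
  obtains k where "k \<in> mod_hom R P X" "\<And>x. x \<in> carrier P \<Longrightarrow> b (k x) = g x"
proof -
  let ?I = "Y\<lparr>carrier := b ` carrier X\<rparr>"
  have I: "left_module R ?I"
    by (rule left_module_submodule[OF Y submodule_image[OF b X Y]])
  have "b \<in> mod_hom R X ?I" "g \<in> mod_hom R P ?I" "b ` carrier X = carrier ?I"
    using g by (auto intro: mod_hom_restrict_image b g)
  with P X I have "\<exists>k\<in>mod_hom R P X. \<forall>x\<in>carrier P. b (k x) = g x"
    unfolding projective_module_def by blast
  with that show thesis by blast
qed

lemma projective_lifts:
  fixes P U X :: "('u, 'u) module"
  assumes "projective_module R P" "left_module R U" "left_module R X"
    and "\<pi> \<in> mod_hom R U X" "\<pi> ` carrier U = carrier X"
  shows "lifts R P U X \<pi>"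
  unfolding lifts_def
proof
  have P: "left_module R P" using assms(1) by (simp add: projective_module_def)
  fix g assume g: "g \<in> mod_hom R P X"
  have "g ` carrier P \<subseteq> \<pi> ` carrier U"
    using hom_simps(1)[OF g P assms(3)] assms(5) by auto
  show "\<exists>\<psi>\<in>mod_hom R P U. \<forall>z\<in>carrier P. \<pi> (\<psi> z) = g z"
    by (rule projective_lift[OF assms(1-4) g \<open>g ` carrier P \<subseteq> \<pi> ` carrier U\<close>]) auto
qed

section \<open>Comparison of projective resolutions\<close>

lemma comparison_map:
  assumes "aug_res R Q d" "aug_res R Q' d'" and \<phi>0: "\<phi>0 \<in> mod_hom R (Q 0) (Q' 0)"
  obtains \<phi> where "\<phi> 0 = \<phi>0" "\<And>i. \<phi> i \<in> mod_hom R (Q i) (Q' i)"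
    "\<And>i x. x \<in> carrier (Q (Suc i)) \<Longrightarrow> d' i (\<phi> (Suc i) x) = \<phi> i (d i x)"
proof -
  interpret Q: aug_res R Q d by fact
  interpret Q': aug_res R Q' d' by fact
  \<comment> \<open>The invariant also records that \<phi> carries boundaries into the image of d',
    for this is what the next lift from a projective requires.\<close>
  define P where "P n \<phi> \<longleftrightarrow> \<phi> \<in> mod_hom R (Q n) (Q' n) \<and> (n = 0 \<longrightarrow> \<phi> = \<phi>0) \<and>
    (\<forall>x\<in>carrier (Q (Suc n)). \<phi> (d n x) \<in> d' n ` carrier (Q' (Suc n)))" for n \<phi>
  define S where "S n \<phi> \<phi>' \<longleftrightarrow> (\<forall>x\<in>carrier (Q (Suc n)). d' n (\<phi>' x) = \<phi> (d n x))"
    for n and \<phi> \<phi>' :: "'a \<Rightarrow> 'a"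
  have "\<exists>f. \<forall>n. P n (f n) \<and> S n (f n) (f (Suc n))"
  proof (rule dependent_nat_choice)
    have "P 0 \<phi>0"
      unfolding P_def
      using \<phi>0 hom_simps(1)[OF \<phi>0 Q.mods Q'.mods] Q.dsimps(1) Q'.surj0 by auto
    then show "\<exists>\<phi>. P 0 \<phi>" by blast
  next
    fix \<phi> n assume P: "P n \<phi>"
    then have \<phi>: "\<phi> \<in> mod_hom R (Q n) (Q' n)" by (simp add: P_def)
    have g: "(\<lambda>x\<in>carrier (Q (Suc n)). \<phi> (d n x)) \<in> mod_hom R (Q (Suc n)) (Q' n)"
      by (rule mod_hom_compose[OF Q.homs \<phi> Q.mods Q.mods Q'.mods])
    have "(\<lambda>x\<in>carrier (Q (Suc n)). \<phi> (d n x)) ` carrier (Q (Suc n)) \<subseteq> d' n ` carrier (Q' (Suc n))"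
      using P by (auto simp: P_def)
    from projective_lift[OF Q.proj Q'.mods Q'.mods Q'.homs g this]
    obtain \<psi> where \<psi>: "\<psi> \<in> mod_hom R (Q (Suc n)) (Q' (Suc n))"
      "\<And>x. x \<in> carrier (Q (Suc n)) \<Longrightarrow> d' n (\<psi> x) = \<phi> (d n x)"
      by auto
    have "\<psi> (d (Suc n) x) \<in> d' (Suc n) ` carrier (Q' (Suc (Suc n)))"
      if x: "x \<in> carrier (Q (Suc (Suc n)))" for x
    proof -
      have "d' n (\<psi> (d (Suc n) x)) = \<zero>\<^bsub>Q' n\<^esub>"
        using \<psi>(2) x Q.dsimps(1) Q.dd[OF x] hom_simps(4)[OF \<phi> Q.mods Q'.mods] by simp
      then show ?thesis
        using Q'.exact hom_simps(1)[OF \<psi>(1) Q.mods Q'.mods] Q.dsimps(1)[OF x] by blast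
    qed
    with \<psi> show "\<exists>\<psi>. P (Suc n) \<psi> \<and> S n \<phi> \<psi>"
      by (auto simp: P_def S_def)
  qed
  then obtain \<phi> where "\<And>n. P n (\<phi> n)" "\<And>n. S n (\<phi> n) (\<phi> (Suc n))" by blast
  then show thesis by (intro that[of \<phi>]) (auto simp: P_def S_def)
qed

lemma comparison_homotopy:
  assumes "aug_res R Q d" and T0: "\<And>x. x \<in> carrier (Q 0) \<Longrightarrow> T 0 x = x"
    and T: "\<And>i. T i \<in> mod_hom R (Q i) (Q i)"
    and Td: "\<And>i x. x \<in> carrier (Q (Suc i)) \<Longrightarrow> d i (T (Suc i) x) = T i (d i x)"
  obtains s where "\<And>i. s i \<in> mod_hom R (Q i) (Q (Suc i))"
    "\<And>i x. x \<in> carrier (Q (Suc i)) \<Longrightarrow>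
       T (Suc i) x = x \<oplus>\<^bsub>Q (Suc i)\<^esub> (d (Suc i) (s (Suc i) x) \<oplus>\<^bsub>Q (Suc i)\<^esub> s i (d i x))"
proof -
  interpret Q: aug_res R Q d by fact
  note [simp] = mod_simps[OF Q.mods] Q.dsimps hom_simps[OF T Q.mods Q.mods] T0 Td Q.dd
  \<comment> \<open>The part of T - id that s d does not yet account for. The next homotopy map has
    to lift it through d, so the invariant P asks that it consist of boundaries.\<close>
  define \<theta> where "\<theta> n s x = (T (Suc n) x \<ominus>\<^bsub>Q (Suc n)\<^esub> x) \<ominus>\<^bsub>Q (Suc n)\<^esub> s (d n x)" for n s x
  define P where "P n s \<longleftrightarrow> s \<in> mod_hom R (Q n) (Q (Suc n)) \<and>
    (\<forall>x\<in>carrier (Q (Suc n)). \<theta> n s x \<in> d (Suc n) ` carrier (Q (Suc (Suc n))))" for n s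
  define S where "S n s s' \<longleftrightarrow> (\<forall>x\<in>carrier (Q (Suc n)). d (Suc n) (s' x) = \<theta> n s x)"
    for n and s s' :: "'a \<Rightarrow> 'a"
  have "\<exists>f. \<forall>n. P n (f n) \<and> S n (f n) (f (Suc n))"
  proof (rule dependent_nat_choice)
    \<comment> \<open>The homotopy starts with zero because T is the identity in degree 0.\<close>
    have "P 0 (\<lambda>x\<in>carrier (Q 0). \<zero>\<^bsub>Q (Suc 0)\<^esub>)"
      unfolding P_def \<theta>_def
      by (auto simp: mod_hom_zero Q.mods Q.exact[symmetric])
    then show "\<exists>s. P 0 s" by blast
  next
    fix s n assume P: "P n s"
    then have s: "s \<in> mod_hom R (Q n) (Q (Suc n))" by (simp add: P_def)
    note [simp] = hom_simps[OF s Q.mods Q.mods]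
    let ?\<theta> = "\<lambda>x\<in>carrier (Q (Suc n)). (\<lambda>x\<in>carrier (Q (Suc n)). T (Suc n) x
      \<ominus>\<^bsub>Q (Suc n)\<^esub> (\<lambda>x\<in>carrier (Q (Suc n)). x) x) x
      \<ominus>\<^bsub>Q (Suc n)\<^esub> (\<lambda>x\<in>carrier (Q (Suc n)). s (d n x)) x"
    have g: "?\<theta> \<in> mod_hom R (Q (Suc n)) (Q (Suc n))"
      by (intro mod_hom_diff mod_hom_id mod_hom_compose[OF Q.homs s] T Q.mods)
    have "?\<theta> ` carrier (Q (Suc n)) \<subseteq> d (Suc n) ` carrier (Q (Suc (Suc n)))"
      using P by (auto simp: P_def \<theta>_def)
    from projective_lift[OF Q.proj Q.mods Q.mods Q.homs g this]
    obtain s' where s': "s' \<in> mod_hom R (Q (Suc n)) (Q (Suc (Suc n)))"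
      "\<And>x. x \<in> carrier (Q (Suc n)) \<Longrightarrow> d (Suc n) (s' x) = \<theta> n s x"
      by (auto simp: \<theta>_def)
    note [simp] = hom_simps[OF s'(1) Q.mods Q.mods]
    have "\<theta> (Suc n) s' x \<in> d (Suc (Suc n)) ` carrier (Q (Suc (Suc (Suc n))))"
      if x: "x \<in> carrier (Q (Suc (Suc n)))" for x
    proof -
      have "d (Suc n) (\<theta> (Suc n) s' x) = (T (Suc n) (d (Suc n) x) \<ominus>\<^bsub>Q (Suc n)\<^esub> d (Suc n) x)
          \<ominus>\<^bsub>Q (Suc n)\<^esub> \<theta> n s (d (Suc n) x)"
        using x by (simp add: \<theta>_def[of "Suc n"] s'(2))
      also have "\<dots> = \<zero>\<^bsub>Q (Suc n)\<^esub>"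
        using x by (simp add: \<theta>_def)
      finally show ?thesis
        using x Q.exact[of "\<theta> (Suc n) s' x" "Suc n"] by (simp add: \<theta>_def)
    qed
    with s' show "\<exists>s'. P (Suc n) s' \<and> S n s s'"
      by (auto simp: P_def S_def)
  qed
  then obtain s where s: "\<And>n. P n (s n)" "\<And>n. S n (s n) (s (Suc n))" by blast
  have sh: "s i \<in> mod_hom R (Q i) (Q (Suc i))" for i using s(1)[of i] by (simp add: P_def)
  note [simp] = hom_simps[OF sh Q.mods Q.mods]
  have "T (Suc i) x = x \<oplus>\<^bsub>Q (Suc i)\<^esub> (d (Suc i) (s (Suc i) x) \<oplus>\<^bsub>Q (Suc i)\<^esub> s i (d i x))"
    if x: "x \<in> carrier (Q (Suc i))" for i x
  proof -
    have "d (Suc i) (s (Suc i) x) = (T (Suc i) x \<ominus>\<^bsub>Q (Suc i)\<^esub> x) \<ominus>\<^bsub>Q (Suc i)\<^esub> s i (d i x)"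
      using s(2)[of i] x by (simp add: S_def \<theta>_def)
    then show ?thesis using x by (simp add: mod_comm[OF Q.mods x])
  qed
  with sh that show thesis by blast
qed

text \<open>Only one of the two homotopies of this equivalence is recorded, as the situation is symmetric.\<close>

lemma comparison:
  assumes "aug_res R Q d" "aug_res R Q' d'" and eq: "Q 0 = Q' 0"
  obtains \<phi> \<psi> s where "\<And>i. \<phi> i \<in> mod_hom R (Q i) (Q' i)" "\<And>i. \<psi> i \<in> mod_hom R (Q' i) (Q i)"
    "\<And>i. s i \<in> mod_hom R (Q i) (Q (Suc i))"
    "\<And>i x. x \<in> carrier (Q (Suc i)) \<Longrightarrow> d' i (\<phi> (Suc i) x) = \<phi> i (d i x)"
    "\<And>i x. x \<in> carrier (Q' (Suc i)) \<Longrightarrow> d i (\<psi> (Suc i) x) = \<psi> i (d' i x)"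
    "\<And>i x. x \<in> carrier (Q (Suc i)) \<Longrightarrow> \<psi> (Suc i) (\<phi> (Suc i) x) =
       x \<oplus>\<^bsub>Q (Suc i)\<^esub> (d (Suc i) (s (Suc i) x) \<oplus>\<^bsub>Q (Suc i)\<^esub> s i (d i x))"
proof -
  interpret Q: aug_res R Q d by fact
  interpret Q': aug_res R Q' d' by fact
  have id: "(\<lambda>x\<in>carrier (Q 0). x) \<in> mod_hom R (Q 0) (Q' 0)" "(\<lambda>x\<in>carrier (Q 0). x) \<in> mod_hom R (Q' 0) (Q 0)"
    using mod_hom_id[OF Q.mods[of 0]] by (simp_all add: eq)
  obtain \<phi> where \<phi>: "\<phi> 0 = (\<lambda>x\<in>carrier (Q 0). x)" "\<And>i. \<phi> i \<in> mod_hom R (Q i) (Q' i)"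
    "\<And>i x. x \<in> carrier (Q (Suc i)) \<Longrightarrow> d' i (\<phi> (Suc i) x) = \<phi> i (d i x)"
    using comparison_map[OF assms(1,2) id(1)] by blast
  obtain \<psi> where \<psi>: "\<psi> 0 = (\<lambda>x\<in>carrier (Q 0). x)" "\<And>i. \<psi> i \<in> mod_hom R (Q' i) (Q i)"
    "\<And>i x. x \<in> carrier (Q' (Suc i)) \<Longrightarrow> d i (\<psi> (Suc i) x) = \<psi> i (d' i x)"
    using comparison_map[OF assms(2,1) id(2)] by blast
  define T where "T i = (\<lambda>x\<in>carrier (Q i). \<psi> i (\<phi> i x))" for i
  note [simp] = hom_simps(1)[OF \<phi>(2) Q.mods Q'.mods] Q.dsimps(1)
  obtain s where "\<And>i. s i \<in> mod_hom R (Q i) (Q (Suc i))" 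
    "\<And>i x. x \<in> carrier (Q (Suc i)) \<Longrightarrow>
       T (Suc i) x = x \<oplus>\<^bsub>Q (Suc i)\<^esub> (d (Suc i) (s (Suc i) x) \<oplus>\<^bsub>Q (Suc i)\<^esub> s i (d i x))"
  proof (rule comparison_homotopy[OF assms(1), of T])
    show "T i \<in> mod_hom R (Q i) (Q i)" for i
      unfolding T_def by (rule mod_hom_compose[OF \<phi>(2) \<psi>(2) Q.mods Q'.mods Q.mods])
  qed (auto simp: T_def \<phi>(1,3) \<psi>(1,3) eq[symmetric])
  then show thesis by (intro that[OF \<phi>(2) \<psi>(2) _ \<phi>(3) \<psi>(3)]) (auto simp: T_def)
qed

lemma ext_along_resolution_independent:
  fixes X :: "('u, 'b) module"
  assumes "aug_res R Q d" "aug_res R Q' d'" and eq: "Q 0 = Q' 0" and X: "left_module R X"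
    and ext: "ext_along R (Q' (Suc i)) (Q' i) (d' i) X"
  shows "ext_along R (Q (Suc i)) (Q i) (d i) X"
  unfolding ext_along_def
proof (intro ballI impI)
  interpret Q: aug_res R Q d by fact
  interpret Q': aug_res R Q' d' by fact
  obtain \<phi> \<psi> s where \<phi>: "\<And>i. \<phi> i \<in> mod_hom R (Q i) (Q' i)" and \<psi>: "\<And>i. \<psi> i \<in> mod_hom R (Q' i) (Q i)"
    and s: "\<And>i. s i \<in> mod_hom R (Q i) (Q (Suc i))"
    and \<phi>d: "\<And>i x. x \<in> carrier (Q (Suc i)) \<Longrightarrow> d' i (\<phi> (Suc i) x) = \<phi> i (d i x)"
    and \<psi>d: "\<And>i x. x \<in> carrier (Q' (Suc i)) \<Longrightarrow> d i (\<psi> (Suc i) x) = \<psi> i (d' i x)"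
    and hty: "\<And>i x. x \<in> carrier (Q (Suc i)) \<Longrightarrow> \<psi> (Suc i) (\<phi> (Suc i) x) =
       x \<oplus>\<^bsub>Q (Suc i)\<^esub> (d (Suc i) (s (Suc i) x) \<oplus>\<^bsub>Q (Suc i)\<^esub> s i (d i x))"
    by (rule comparison[OF assms(1-3)]) (rule that; assumption)
  fix h assume h: "h \<in> mod_hom R (Q (Suc i)) X"
    and hk: "\<forall>z\<in>carrier (Q (Suc i)). d i z = \<zero>\<^bsub>Q i\<^esub> \<longrightarrow> h z = \<zero>\<^bsub>X\<^esub>"
  note [simp] = hom_simps[OF \<phi> Q.mods Q'.mods] hom_simps[OF \<psi> Q'.mods Q.mods]
    hom_simps[OF s Q.mods Q.mods] Q.dsimps Q'.dsimps hom_simps[OF h Q.mods X] mod_simps[OF X]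
    mod_simps[OF Q.mods] \<phi>d \<psi>d
  have "(\<lambda>x\<in>carrier (Q' (Suc i)). h (\<psi> (Suc i) x)) \<in> mod_hom R (Q' (Suc i)) X"
    by (rule mod_hom_compose[OF \<psi> h Q'.mods Q.mods X])
  from ext_alongD[OF ext this] hk
  obtain k where k: "k \<in> mod_hom R (Q' i) X"
    "\<And>z. z \<in> carrier (Q' (Suc i)) \<Longrightarrow> k (d' i z) = h (\<psi> (Suc i) z)"
    by auto
  note [simp] = hom_simps[OF k(1) Q'.mods X]
  \<comment> \<open>At d z the map k \<phi> takes the value h (\<psi> \<phi> z), which by the
    homotopy is h z + h (d s z) + h (s d z). The second term vanishes because h kills the kernel of
    d, and subtracting h s removes the third.\<close>
  let ?k = "\<lambda>x\<in>carrier (Q i). (\<lambda>x\<in>carrier (Q i). k (\<phi> i x)) x \<ominus>\<^bsub>X\<^esub> (\<lambda>x\<in>carrier (Q i). h (s i x)) x"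
  have "?k \<in> mod_hom R (Q i) X"
    by (intro mod_hom_diff mod_hom_compose[OF \<phi> k(1)] mod_hom_compose[OF s h] Q.mods Q'.mods X)
  moreover have "?k (d i z) = h z" if z: "z \<in> carrier (Q (Suc i))" for z
  proof -
    have "k (\<phi> i (d i z)) = h (\<psi> (Suc i) (\<phi> (Suc i) z))"
      using k(2)[of "\<phi> (Suc i) z"] z by simp
    also have "\<dots> = h z \<oplus>\<^bsub>X\<^esub> (h (d (Suc i) (s (Suc i) z)) \<oplus>\<^bsub>X\<^esub> h (s i (d i z)))"
      using z by (simp add: hty)
    also have "h (d (Suc i) (s (Suc i) z)) = \<zero>\<^bsub>X\<^esub>"
      using hk z Q.dd by simp
    finally show ?thesis using z by simp
  qed
  ultimately show "\<exists>k\<in>mod_hom R (Q i) X. \<forall>z\<in>carrier (Q (Suc i)). k (d i z) = h z" by blast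
qed

section \<open>Ext\<close>

text \<open>Commutativity of G makes the image of f normal in the kernel of g; the factor group is
  then trivial as soon as the kernel is contained in the image.\<close>

lemma trivial_homology_iff:
  assumes F: "group F" and G: "comm_group G" and H: "group H" and f: "f \<in> hom F G" and g: "g \<in> hom G H"
    and gf: "\<And>x. x \<in> carrier F \<Longrightarrow> g (f x) = \<one>\<^bsub>H\<^esub>"
  shows "trivial_group (homology_at F G H f g) \<longleftrightarrow>
    (\<forall>x\<in>carrier G. g x = \<one>\<^bsub>H\<^esub> \<longrightarrow> x \<in> f ` carrier F)"
proof -
  interpret G: comm_group G by fact
  interpret f: group_hom F G f using F f by (simp add: group_hom_def group_hom_axioms_def G.group_axioms)
  interpret g: group_hom G H g using H g by (simp add: group_hom_def group_hom_axioms_def G.group_axioms)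
  define K where "K = G\<lparr>carrier := kernel G H g\<rparr>"
  define N where "N = f ` carrier F"
  have K: "comm_group K"
    unfolding K_def
    by (rule group.group_comm_groupI[OF G.subgroup_imp_group[OF g.subgroup_kernel]])
      (auto simp: kernel_def G.m_comm)
  interpret K: comm_group K by fact
  have NK: "N \<subseteq> carrier K"
    using gf by (auto simp: N_def K_def kernel_def)
  have "subgroup N K"
    unfolding K_def using f.img_is_subgroup g.subgroup_kernel NK
    by (intro G.subgroup_incl) (auto simp: N_def K_def)
  then have N: "N \<lhd> K" "subgroup N K" by (auto simp: K.normal_iff_subgroup)
  have "trivial_group (K Mod N) \<longleftrightarrow> carrier (K Mod N) = {N}"
    using normal.factorgroup_is_group[OF N(1)] by (simp add: trivial_group_def)
  also have "\<dots> \<longleftrightarrow> carrier K \<subseteq> N"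
  proof
    assume "carrier (K Mod N) = {N}"
    then have "N #>\<^bsub>K\<^esub> x = N" if "x \<in> carrier K" for x
      using that by (auto simp: carrier_FactGroup)
    then show "carrier K \<subseteq> N" using K.rcos_self[OF _ N(2)] by blast
  next
    assume "carrier K \<subseteq> N"
    then have "N #>\<^bsub>K\<^esub> x = N" if "x \<in> carrier K" for x
      using that K.coset_join2[OF that N(2)] by auto
    then show "carrier (K Mod N) = {N}" by (auto simp: carrier_FactGroup)
  qed
  finally show ?thesis unfolding homology_at_def K_def[symmetric] N_def
    by (auto simp: K_def kernel_def)
qed

lemma comm_group_hom_group:
  assumes A: "left_module R A" and B: "left_module R B"
  shows "comm_group (hom_group R A B)"
proof -
  interpret B: left_module R B by fact
  note c = hom_simps(1)[OF _ A B]
  show ?thesis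
  proof (rule comm_groupI)
    show "\<one>\<^bsub>hom_group R A B\<^esub> \<in> carrier (hom_group R A B)"
      using mod_hom_zero[OF A B] by (simp add: hom_group_def)
    fix f assume f: "f \<in> carrier (hom_group R A B)"
    then have fh: "f \<in> mod_hom R A B" by (simp add: hom_group_def)
    show "\<one>\<^bsub>hom_group R A B\<^esub> \<otimes>\<^bsub>hom_group R A B\<^esub> f = f"
      using c[OF fh] hom_simps(6)[OF fh A B]
      by (simp add: hom_group_def mod_simps[OF B] cong: restrict_cong)
    show "\<exists>g\<in>carrier (hom_group R A B). g \<otimes>\<^bsub>hom_group R A B\<^esub> f = \<one>\<^bsub>hom_group R A B\<^esub>"
    proof (rule bexI)
      let ?g = "\<lambda>x\<in>carrier A. (\<lambda>x\<in>carrier A. \<zero>\<^bsub>B\<^esub>) x \<ominus>\<^bsub>B\<^esub> f x"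
      show "?g \<in> carrier (hom_group R A B)"
        using mod_hom_diff[OF mod_hom_zero[OF A B] fh A B] by (simp add: hom_group_def)
      show "?g \<otimes>\<^bsub>hom_group R A B\<^esub> f = \<one>\<^bsub>hom_group R A B\<^esub>"
        using c[OF fh] by (auto simp: hom_group_def mod_simps[OF B] intro!: restrict_ext)
    qed
  qed (auto simp: hom_group_def mod_hom_add[OF _ _ A B] B.a_ac c intro!: restrict_ext)
qed

lemma chosen_projective_resolution:
  assumes "projective_resolution R A P d e"
  obtains P' d' e' where "chosen_projective_resolution R A = (P', d')"
    "projective_resolution R A P' d' e'"
proof -
  define T where "T = (\<lambda>(P, d). \<exists>e. projective_resolution R A P d e)"
  have "T (P, d)" using assms by (auto simp: T_def)
  then have T: "T (chosen_projective_resolution R A)"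
    unfolding chosen_projective_resolution_def T_def[symmetric] by (rule someI)
  obtain P' d' where c: "chosen_projective_resolution R A = (P', d')" by fastforce
  with T that show thesis by (auto simp: T_def)
qed

text \<open>The resolution chosen inside \<open>Ext\<close> is exchanged for \<open>Q\<close> by
  independence. As \<open>Q 0 = A\<close>, the projective in degree \<open>Suc i\<close> is
  \<open>Q (Suc (Suc i))\<close>, and exactness turns the cocycles there into the maps vanishing on
  the kernel of \<open>d (Suc i)\<close>.\<close>

lemma Ext_trivial_iff_ext_along:
  fixes A :: "('u, 'u) module" and B :: "('u, 'b) module"
  assumes A: "left_module R A" and B: "left_module R B"
    and "aug_res R Q d" "Q 0 = A"
  shows "trivial_group (Ext R (Suc i) A B) \<longleftrightarrow>
    ext_along R (Q (Suc (Suc i))) (Q (Suc i)) (d (Suc i)) B"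
proof -
  interpret Q: aug_res R Q d by fact
  have "projective_resolution R A (\<lambda>i. Q (Suc i)) (\<lambda>i. d (Suc i)) (d 0)"
    using Q.aug assms(4) by (auto simp: augmented_resolution_def projective_resolution_def)
  then obtain P \<delta> e where P: "chosen_projective_resolution R A = (P, \<delta>)"
    "projective_resolution R A P \<delta> e"
    by (rule chosen_projective_resolution)
  interpret P: aug_res R "case_nat A P" "case_nat e \<delta>"
    by unfold_locales (rule augmented_resolution_of_projective[OF P(2) A])
  have mP: "left_module R (P j)" and \<delta>: "\<delta> j \<in> mod_hom R (P (Suc j)) (P j)" for j
    using P.mods[of "Suc j"] P.homs[of "Suc j"] by auto
  let ?H = "\<lambda>j. hom_group R (P j) B"
  let ?D = "\<lambda>j h. compose (carrier (P (Suc j))) h (\<delta> j)"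
  have D: "?D j \<in> hom (?H j) (?H (Suc j))" for j
  proof (rule homI)
    fix f g assume fg: "f \<in> carrier (?H j)" "g \<in> carrier (?H j)"
    show "?D j f \<in> carrier (?H (Suc j))"
      using mod_hom_compose[OF \<delta> _ mP mP B, of f j] fg by (simp add: hom_group_def compose_def)
    show "?D j (f \<otimes>\<^bsub>?H j\<^esub> g) = ?D j f \<otimes>\<^bsub>?H (Suc j)\<^esub> ?D j g"
      using hom_simps(1)[OF \<delta> mP mP, of _ j]
      by (auto simp: hom_group_def compose_def fun_eq_iff)
  qed
  have "trivial_group (Ext R (Suc i) A B) \<longleftrightarrow>
    (\<forall>x\<in>carrier (?H (Suc i)). ?D (Suc i) x = \<one>\<^bsub>?H (Suc (Suc i))\<^esub> \<longrightarrow> x \<in> ?D i ` carrier (?H i))"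
    unfolding Ext_def P(1) Let_def prod.case nat.case
  proof (rule trivial_homology_iff)
    fix x assume x: "x \<in> carrier (?H i)"
    then have "x \<in> mod_hom R (P i) B" by (simp add: hom_group_def)
    from hom_simps(4)[OF this mP B] show "?D (Suc i) (?D i x) = \<one>\<^bsub>?H (Suc (Suc i))\<^esub>"
      using P.dd[of _ "Suc i"] hom_simps(1)[OF \<delta> mP mP, of _ "Suc i"]
      by (auto simp: hom_group_def compose_def intro!: restrict_ext)
  qed (auto intro: D comm_group_hom_group[OF mP B] comm_group.axioms)
  also have "\<dots> \<longleftrightarrow> ext_along R (P (Suc i)) (P i) (\<delta> i) B"
  proof -
    have 1: "?D (Suc i) x = \<one>\<^bsub>?H (Suc (Suc i))\<^esub> \<longleftrightarrow>
        (\<forall>z\<in>carrier (P (Suc i)). \<delta> i z = \<zero>\<^bsub>P i\<^esub> \<longrightarrow> x z = \<zero>\<^bsub>B\<^esub>)"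
      if x: "x \<in> mod_hom R (P (Suc i)) B" for x
    proof -
      have "?D (Suc i) x = \<one>\<^bsub>?H (Suc (Suc i))\<^esub> \<longleftrightarrow>
          (\<forall>z\<in>carrier (P (Suc (Suc i))). x (\<delta> (Suc i) z) = \<zero>\<^bsub>B\<^esub>)"
        by (auto simp: hom_group_def compose_def fun_eq_iff)
      also have "\<dots> \<longleftrightarrow> (\<forall>z\<in>carrier (P (Suc i)). \<delta> i z = \<zero>\<^bsub>P i\<^esub> \<longrightarrow> x z = \<zero>\<^bsub>B\<^esub>)"
        using P.exact[of _ "Suc i"] hom_simps(1)[OF \<delta> mP mP, of _ "Suc i"] by auto
      finally show ?thesis .
    qed
    have 2: "x \<in> ?D i ` carrier (?H i) \<longleftrightarrow> (\<exists>k\<in>mod_hom R (P i) B. \<forall>z\<in>carrier (P (Suc i)). k (\<delta> i z) = x z)"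
      if x: "x \<in> mod_hom R (P (Suc i)) B" for x
    proof -
      have "x = ?D i k \<longleftrightarrow> (\<forall>z\<in>carrier (P (Suc i)). k (\<delta> i z) = x z)" for k
      proof
        have "x \<in> extensional (carrier (P (Suc i)))"
          using x by (simp add: mod_hom_def PiE_def)
        then show "x = ?D i k" if "\<forall>z\<in>carrier (P (Suc i)). k (\<delta> i z) = x z"
          using that by (auto simp: compose_def intro: extensionalityI)
      qed (simp add: compose_def)
      then show ?thesis by (auto simp: hom_group_def)
    qed
    show ?thesis unfolding ext_along_def using 1 2 by (simp add: hom_group_def)
  qed
  also have "\<dots> \<longleftrightarrow> ext_along R (Q (Suc (Suc i))) (Q (Suc i)) (d (Suc i)) B"
  proof
    have eq: "case_nat A P 0 = Q 0" using assms(4) by simp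
    show "ext_along R (Q (Suc (Suc i))) (Q (Suc i)) (d (Suc i)) B" if "ext_along R (P (Suc i)) (P i) (\<delta> i) B"
      by (rule ext_along_resolution_independent[OF Q.aug_res_axioms P.aug_res_axioms eq[symmetric] B])
        (simp add: that)
    show "ext_along R (P (Suc i)) (P i) (\<delta> i) B" if "ext_along R (Q (Suc (Suc i))) (Q (Suc i)) (d (Suc i)) B"
      using ext_along_resolution_independent[OF P.aug_res_axioms Q.aug_res_axioms eq B that] by simp
  qed
  finally show ?thesis .
qed

section \<open>Tor\<close>

lemma op_ring_simps [simp]:
  "carrier (op_ring S) = carrier S" "\<one>\<^bsub>op_ring S\<^esub> = \<one>\<^bsub>S\<^esub>" "\<zero>\<^bsub>op_ring S\<^esub> = \<zero>\<^bsub>S\<^esub>"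
  "x \<oplus>\<^bsub>op_ring S\<^esub> y = x \<oplus>\<^bsub>S\<^esub> y" "x \<otimes>\<^bsub>op_ring S\<^esub> y = y \<otimes>\<^bsub>S\<^esub> x"
  by (simp_all add: op_ring_def)

lemma keys_Times_diff:
  "\<lbrakk>Poly_Mapping.keys u \<subseteq> A; Poly_Mapping.keys v \<subseteq> A\<rbrakk> \<Longrightarrow> Poly_Mapping.keys (u - v) \<subseteq> A"
  "\<lbrakk>Poly_Mapping.keys u \<subseteq> A; Poly_Mapping.keys v \<subseteq> A\<rbrakk> \<Longrightarrow> Poly_Mapping.keys (u + v) \<subseteq> A"
  for u v :: "'b \<Rightarrow>\<^sub>0 int"
  using keys_diff[of u v] keys_add[of u v] by auto

text \<open>The map \<open>h \<otimes> N\<close> before passing to the quotient, on formal sums of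
  pairs. Any function h is allowed; relations are respected once it is a homomorphism.\<close>

definition push :: "('p \<Rightarrow> 'q) \<Rightarrow> ('p \<times> 'n \<Rightarrow>\<^sub>0 int) \<Rightarrow> 'q \<times> 'n \<Rightarrow>\<^sub>0 int" where
  "push h = frag_extend (\<lambda>(p, x). frag_of (h p, x))"

lemma push_simps [simp]:
  "push h (frag_of (p, x)) = frag_of (h p, x)" "push h 0 = 0" "push h (- u) = - push h u"
  "push h (u - v) = push h u - push h v" "push h (u + v) = push h u + push h v"
  by (simp_all add: push_def frag_extend_diff frag_extend_add frag_extend_minus)

lemma push_push: "push g (push h u) = push (\<lambda>p. g (h p)) u"
  using subset_UNIV[of "Poly_Mapping.keys u"] by (induction u rule: frag_induction) auto

lemma push_id: "push (\<lambda>p. p) u = u"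
  using subset_UNIV[of "Poly_Mapping.keys u"] by (induction u rule: frag_induction) auto

lemma push_cong:
  assumes "Poly_Mapping.keys u \<subseteq> A \<times> B" "\<And>p. p \<in> A \<Longrightarrow> h p = g p"
  shows "push h u = push g u"
  using assms(1) by (induction u rule: frag_induction) (auto simp: assms(2))

lemma keys_push:
  assumes "Poly_Mapping.keys u \<subseteq> A \<times> B" "\<And>p. p \<in> A \<Longrightarrow> h p \<in> A'"
  shows "Poly_Mapping.keys (push h u) \<subseteq> A' \<times> B"
  using assms(1)
proof (induction u rule: frag_induction)
  case (diff a b)
  then show ?case unfolding push_simps by (rule keys_Times_diff)
qed (auto simp: assms(2))

locale tensor_factor =
  fixes S :: "'s ring" and P :: "('s, 'p) module" and N :: "('s, 'n) module"
  assumes P: "left_module (op_ring S) P" and N: "left_module S N"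
begin

abbreviation "F \<equiv> free_Abelian_group (carrier P \<times> carrier N)"
abbreviation "K \<equiv> tensor_subgroup S P N"

lemma relations_subset: "tensor_relations S P N \<subseteq> carrier F"
proof -
  note c = mod_simps(1,5)[OF P] mod_simps(1,5)[OF N]
  have "Poly_Mapping.keys u \<subseteq> carrier P \<times> carrier N" if "u \<in> tensor_relations S P N" for u
    using that unfolding tensor_relations_def
    by (elim UnE CollectE exE conjE; hypsubst) (intro keys_Times_diff; simp add: c)+
  then show ?thesis by auto
qed

lemma K: "subgroup K F"
  unfolding tensor_subgroup_def
  by (rule group.generate_is_subgroup[OF group_free_Abelian_group relations_subset])

lemma K_keys: "u \<in> K \<Longrightarrow> Poly_Mapping.keys u \<subseteq> carrier P \<times> carrier N"
  using subsetD[OF subgroup.subset[OF K]] by simp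

lemma K_zero: "0 \<in> K"
  using subgroup.one_closed[OF K] by simp

lemma K_add: "\<lbrakk>u \<in> K; v \<in> K\<rbrakk> \<Longrightarrow> u + v \<in> K"
  using subgroup.m_closed[OF K] by simp

lemma K_uminus: "u \<in> K \<Longrightarrow> - u \<in> K"
  using subgroup.m_inv_closed[OF K, of u] K_keys by simp

lemma K_diff: "\<lbrakk>u \<in> K; v \<in> K\<rbrakk> \<Longrightarrow> u - v \<in> K"
  using K_add[of u "- v"] K_uminus by simp

lemma K_rel: "u \<in> tensor_relations S P N \<Longrightarrow> u \<in> K"
  unfolding tensor_subgroup_def by (rule generate.incl)

lemma K_add_left: "\<lbrakk>p \<in> carrier P; q \<in> carrier P; x \<in> carrier N\<rbrakk> \<Longrightarrow>
    frag_of (p \<oplus>\<^bsub>P\<^esub> q, x) - frag_of (p, x) - frag_of (q, x) \<in> K"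
  by (rule K_rel) (unfold tensor_relations_def, blast)

lemma K_add_right: "\<lbrakk>p \<in> carrier P; x \<in> carrier N; y \<in> carrier N\<rbrakk> \<Longrightarrow>
    frag_of (p, x \<oplus>\<^bsub>N\<^esub> y) - frag_of (p, x) - frag_of (p, y) \<in> K"
  by (rule K_rel) (unfold tensor_relations_def, blast)

lemma K_smult: "\<lbrakk>s \<in> carrier S; p \<in> carrier P; x \<in> carrier N\<rbrakk> \<Longrightarrow>
    frag_of (s \<odot>\<^bsub>P\<^esub> p, x) - frag_of (p, s \<odot>\<^bsub>N\<^esub> x) \<in> K"
  by (rule K_rel) (unfold tensor_relations_def, blast)

lemma K_induct [consumes 1, case_names zero add_left add_right smult plus minus]:
  assumes "u \<in> K" and "Q 0"
    and "\<And>p q x. \<lbrakk>p \<in> carrier P; q \<in> carrier P; x \<in> carrier N\<rbrakk> \<Longrightarrow>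
      Q (frag_of (p \<oplus>\<^bsub>P\<^esub> q, x) - frag_of (p, x) - frag_of (q, x))"
    and "\<And>p x y. \<lbrakk>p \<in> carrier P; x \<in> carrier N; y \<in> carrier N\<rbrakk> \<Longrightarrow>
      Q (frag_of (p, x \<oplus>\<^bsub>N\<^esub> y) - frag_of (p, x) - frag_of (p, y))"
    and "\<And>s p x. \<lbrakk>s \<in> carrier S; p \<in> carrier P; x \<in> carrier N\<rbrakk> \<Longrightarrow>
      Q (frag_of (s \<odot>\<^bsub>P\<^esub> p, x) - frag_of (p, s \<odot>\<^bsub>N\<^esub> x))"
    and plus: "\<And>u v. \<lbrakk>u \<in> K; v \<in> K; Q u; Q v\<rbrakk> \<Longrightarrow> Q (u + v)"
    and minus: "\<And>u. \<lbrakk>u \<in> K; Q u\<rbrakk> \<Longrightarrow> Q (- u)"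
  shows "Q u"
proof -
  have rel: "Q v" if "v \<in> tensor_relations S P N" for v
    using that assms(3-5) unfolding tensor_relations_def by blast
  from assms(1) show ?thesis
    unfolding tensor_subgroup_def
  proof (induction u rule: generate.induct)
    case one
    then show ?case using assms(2) by simp
  next
    case (incl v)
    then show ?case by (rule rel)
  next
    case (inv v)
    then have "v \<in> K" by (rule K_rel)
    then show ?case using inv_free_Abelian_group[OF K_keys] minus rel[OF inv] by metis
  next
    case (eng v w)
    then show ?case using plus by (simp add: tensor_subgroup_def)
  qed
qed

text \<open>\<open>push\<close> is additive in its function only modulo the tensor relations. This
  is the form in which a chain homotopy acts on representatives.\<close>

lemma K_additive:
  assumes u: "Poly_Mapping.keys u \<subseteq> A \<times> carrier N"
    and "\<And>p. p \<in> A \<Longrightarrow> h p \<in> carrier P" "\<And>p. p \<in> A \<Longrightarrow> k p \<in> carrier P"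
  shows "push (\<lambda>p. h p \<oplus>\<^bsub>P\<^esub> k p) u - push h u - push k u \<in> K"
  using u
proof (induction u rule: frag_induction)
  case zero
  then show ?case by (simp add: K_zero)
next
  case (one a)
  then show ?case using assms(2,3) K_add_left by (cases a) auto
next
  case (diff u v)
  have "push (\<lambda>p. h p \<oplus>\<^bsub>P\<^esub> k p) (u - v) - push h (u - v) - push k (u - v) =
    (push (\<lambda>p. h p \<oplus>\<^bsub>P\<^esub> k p) u - push h u - push k u)
    - (push (\<lambda>p. h p \<oplus>\<^bsub>P\<^esub> k p) v - push h v - push k v)" by simp
  with K_diff[OF diff] show ?case by metis
qed

end

lemma push_tensor_subgroup:
  assumes "tensor_factor S P N" "tensor_factor S Q N" and h: "h \<in> mod_hom (op_ring S) P Q"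
    and u: "u \<in> tensor_subgroup S P N"
  shows "push h u \<in> tensor_subgroup S Q N"
proof -
  interpret P: tensor_factor S P N by fact
  interpret Q: tensor_factor S Q N by fact
  note [simp] = hom_simps[OF h P.P Q.P] mod_simps[OF P.N]
  from u show ?thesis
  proof (induction rule: P.K_induct)
    case (add_left p q x)
    then show ?case using Q.K_add_left[of "h p" "h q" x] by simp
  next
    case (add_right p x y)
    then show ?case using Q.K_add_right[of "h p" x y] by simp
  next
    case (smult s p x)
    then show ?case using Q.K_smult[of s "h p" x] hom_simps(3)[OF h P.P Q.P] by simp
  qed (auto intro: Q.K_zero Q.K_add Q.K_uminus)
qed

text \<open>Exactness at \<open>Q (i + 1) \<otimes> N\<close> of the complex \<open>Q \<otimes> N\<close>, on representatives in the free abelian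
  group.\<close>

definition tor_exact ::
  "'s ring \<Rightarrow> (nat \<Rightarrow> ('s, 'p) module) \<Rightarrow> (nat \<Rightarrow> 'p \<Rightarrow> 'p) \<Rightarrow> ('s, 'n) module \<Rightarrow> nat \<Rightarrow> bool"
  where "tor_exact S Q d N i \<longleftrightarrow>
    (\<forall>u. Poly_Mapping.keys u \<subseteq> carrier (Q (Suc i)) \<times> carrier N \<longrightarrow>
       push (d i) u \<in> tensor_subgroup S (Q i) N \<longrightarrow>
       (\<exists>v. Poly_Mapping.keys v \<subseteq> carrier (Q (Suc (Suc i))) \<times> carrier N \<and>
          u - push (d (Suc i)) v \<in> tensor_subgroup S (Q (Suc i)) N))"

lemma tor_exact_resolution_independent:
  fixes N :: "('u, 'n) module"
  assumes "aug_res (op_ring S) Q d" "aug_res (op_ring S) Q' d'" and eq: "Q 0 = Q' 0"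
    and N: "left_module S N" and ex: "tor_exact S Q' d' N i"
  shows "tor_exact S Q d N i"
  unfolding tor_exact_def
proof (intro allI impI)
  interpret Q: aug_res "op_ring S" Q d by fact
  interpret Q': aug_res "op_ring S" Q' d' by fact
  interpret TQ: tensor_factor S "Q j" N for j by (rule tensor_factor.intro[OF Q.mods N])
  interpret TQ': tensor_factor S "Q' j" N for j by (rule tensor_factor.intro[OF Q'.mods N])
  obtain \<phi> \<psi> s where \<phi>: "\<And>i. \<phi> i \<in> mod_hom (op_ring S) (Q i) (Q' i)"
    and \<psi>: "\<And>i. \<psi> i \<in> mod_hom (op_ring S) (Q' i) (Q i)"
    and s: "\<And>i. s i \<in> mod_hom (op_ring S) (Q i) (Q (Suc i))"
    and \<phi>d: "\<And>i x. x \<in> carrier (Q (Suc i)) \<Longrightarrow> d' i (\<phi> (Suc i) x) = \<phi> i (d i x)"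
    and \<psi>d: "\<And>i x. x \<in> carrier (Q' (Suc i)) \<Longrightarrow> d i (\<psi> (Suc i) x) = \<psi> i (d' i x)"
    and hty: "\<And>i x. x \<in> carrier (Q (Suc i)) \<Longrightarrow> \<psi> (Suc i) (\<phi> (Suc i) x) =
       x \<oplus>\<^bsub>Q (Suc i)\<^esub> (d (Suc i) (s (Suc i) x) \<oplus>\<^bsub>Q (Suc i)\<^esub> s i (d i x))"
    by (rule comparison[OF assms(1-3)]) (rule that; assumption)
  note c\<phi> = hom_simps(1)[OF \<phi> Q.mods Q'.mods] and c\<psi> = hom_simps(1)[OF \<psi> Q'.mods Q.mods]
    and cs = hom_simps(1)[OF s Q.mods Q.mods]
  note cs' = mod_simps(1)[OF Q.mods]
  fix u assume u: "Poly_Mapping.keys u \<subseteq> carrier (Q (Suc i)) \<times> carrier N"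
    and du: "push (d i) u \<in> tensor_subgroup S (Q i) N"
  have "push (d' i) (push (\<phi> (Suc i)) u) = push (\<phi> i) (push (d i) u)"
    unfolding push_push by (rule push_cong[OF u]) (rule \<phi>d)
  also have "\<dots> \<in> tensor_subgroup S (Q' i) N"
    by (rule push_tensor_subgroup[OF TQ.tensor_factor_axioms TQ'.tensor_factor_axioms \<phi> du])
  finally have d\<phi>: "push (d' i) (push (\<phi> (Suc i)) u) \<in> tensor_subgroup S (Q' i) N" .
  have "Poly_Mapping.keys (push (\<phi> (Suc i)) u) \<subseteq> carrier (Q' (Suc i)) \<times> carrier N"
    by (rule keys_push[OF u c\<phi>])
  from ex[unfolded tor_exact_def, rule_format, OF this d\<phi>]
  obtain v where v: "Poly_Mapping.keys v \<subseteq> carrier (Q' (Suc (Suc i))) \<times> carrier N"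
    and uv: "push (\<phi> (Suc i)) u - push (d' (Suc i)) v \<in> tensor_subgroup S (Q' (Suc i)) N"
    by (elim exE conjE)
  have "push (\<psi> (Suc i)) (push (d' (Suc i)) v) = push (d (Suc i)) (push (\<psi> (Suc (Suc i))) v)"
    unfolding push_push by (rule push_cong[OF v]) (simp add: \<psi>d)
  with push_tensor_subgroup[OF TQ'.tensor_factor_axioms TQ.tensor_factor_axioms \<psi> uv]
  have 1: "push (\<psi> (Suc i)) (push (\<phi> (Suc i)) u) - push (d (Suc i)) (push (\<psi> (Suc (Suc i))) v)
      \<in> tensor_subgroup S (Q (Suc i)) N"
    by simp
  let ?a = "\<lambda>x. d (Suc i) (s (Suc i) x)" and ?b = "\<lambda>x. s i (d i x)"
  have "push (\<psi> (Suc i)) (push (\<phi> (Suc i)) u) =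
      push (\<lambda>x. x \<oplus>\<^bsub>Q (Suc i)\<^esub> (?a x \<oplus>\<^bsub>Q (Suc i)\<^esub> ?b x)) u"
    unfolding push_push by (rule push_cong[OF u]) (rule hty)
  with TQ.K_additive[OF u, of "\<lambda>x. x" "Suc i" "\<lambda>x. ?a x \<oplus>\<^bsub>Q (Suc i)\<^esub> ?b x"] cs Q.dsimps(1) cs'
  have 2: "push (\<psi> (Suc i)) (push (\<phi> (Suc i)) u) - push (\<lambda>x. x) u
      - push (\<lambda>x. ?a x \<oplus>\<^bsub>Q (Suc i)\<^esub> ?b x) u \<in> tensor_subgroup S (Q (Suc i)) N"
    by simp
  have 3: "push (\<lambda>x. ?a x \<oplus>\<^bsub>Q (Suc i)\<^esub> ?b x) u - push ?a u - push ?b u \<in> tensor_subgroup S (Q (Suc i)) N"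
    by (intro TQ.K_additive[OF u]) (auto intro: cs Q.dsimps(1))
  have 4: "push ?b u \<in> tensor_subgroup S (Q (Suc i)) N"
    using push_tensor_subgroup[OF TQ.tensor_factor_axioms TQ.tensor_factor_axioms s du]
    by (simp add: push_push)
  \<comment> \<open>Modulo relations the homotopy reads u = \<psi> \<phi> u - d s u - s d u. Here
    \<psi> \<phi> u is \<psi> d' v = d \<psi> v, and s d u is a relation because d u is one. What
    remains is d applied to this witness.\<close>
  let ?v = "push (\<psi> (Suc (Suc i))) v - push (s (Suc i)) u"
  have "u - push (d (Suc i)) ?v =
    (push (\<psi> (Suc i)) (push (\<phi> (Suc i)) u) - push (d (Suc i)) (push (\<psi> (Suc (Suc i))) v))
    - (push (\<psi> (Suc i)) (push (\<phi> (Suc i)) u) - push (\<lambda>x. x) u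
      - push (\<lambda>x. ?a x \<oplus>\<^bsub>Q (Suc i)\<^esub> ?b x) u)
    - (push (\<lambda>x. ?a x \<oplus>\<^bsub>Q (Suc i)\<^esub> ?b x) u - push ?a u - push ?b u) - push ?b u"
    unfolding push_id by (simp add: push_push[of "d (Suc i)" "s (Suc i)"])
  also have "\<dots> \<in> tensor_subgroup S (Q (Suc i)) N"
    by (intro TQ.K_diff 1 2 3 4)
  finally have "u - push (d (Suc i)) ?v \<in> tensor_subgroup S (Q (Suc i)) N" .
  moreover have "Poly_Mapping.keys ?v \<subseteq> carrier (Q (Suc (Suc i))) \<times> carrier N"
    by (intro keys_Times_diff keys_push[OF v c\<psi>] keys_push[OF u cs])
  ultimately show "\<exists>v. Poly_Mapping.keys v \<subseteq> carrier (Q (Suc (Suc i))) \<times> carrier N \<and>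
      u - push (d (Suc i)) v \<in> tensor_subgroup S (Q (Suc i)) N" by blast
qed

context tensor_factor
begin

lemma comm_group_tensor: "comm_group (tensor S P N)"
proof -
  interpret F: comm_group F by (rule abelian_free_Abelian_group)
  have n: "K \<lhd> F" using K by (rule F.subgroup_imp_normal)
  interpret n: normal K F by (rule n)
  show ?thesis
    unfolding tensor_def
  proof (rule group.group_comm_groupI[OF n.factorgroup_is_group])
    fix X Y assume "X \<in> carrier (F Mod K)" "Y \<in> carrier (F Mod K)"
    then show "X \<otimes>\<^bsub>F Mod K\<^esub> Y = Y \<otimes>\<^bsub>F Mod K\<^esub> X"
      unfolding carrier_FactGroup by (auto simp: n.rcos_sum add.commute)
  qed
qed

lemma tensor_carrier: "carrier (tensor S P N) = (\<lambda>u. K #>\<^bsub>F\<^esub> u) ` carrier F"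
  and tensor_one: "\<one>\<^bsub>tensor S P N\<^esub> = K"
  by (simp_all add: tensor_def carrier_FactGroup)

lemma tensor_mult:
  assumes "u \<in> carrier F" "v \<in> carrier F"
  shows "(K #>\<^bsub>F\<^esub> u) \<otimes>\<^bsub>tensor S P N\<^esub> (K #>\<^bsub>F\<^esub> v) = K #>\<^bsub>F\<^esub> (u + v)"
proof -
  interpret F: comm_group F by (rule abelian_free_Abelian_group)
  interpret n: normal K F using K by (rule F.subgroup_imp_normal)
  show ?thesis using n.rcos_sum[OF assms] by (simp add: tensor_def)
qed

lemma coset_iff: "v \<in> K #>\<^bsub>F\<^esub> u \<longleftrightarrow> v - u \<in> K"
  by (auto simp: r_coset_def) (metis diff_add_cancel)

lemma coset_eq_iff:
  assumes "u \<in> carrier F" "v \<in> carrier F"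
  shows "K #>\<^bsub>F\<^esub> u = K #>\<^bsub>F\<^esub> v \<longleftrightarrow> u - v \<in> K"
proof
  assume "K #>\<^bsub>F\<^esub> u = K #>\<^bsub>F\<^esub> v"
  moreover have "u \<in> K #>\<^bsub>F\<^esub> u" by (simp add: coset_iff K_zero)
  ultimately show "u - v \<in> K" by (simp add: coset_iff)
next
  assume "u - v \<in> K"
  then have "w - u \<in> K \<longleftrightarrow> w - v \<in> K" for w
    using K_add[of "w - u" "u - v"] K_diff[of "w - v" "u - v"] by auto
  then show "K #>\<^bsub>F\<^esub> u = K #>\<^bsub>F\<^esub> v" by (auto simp: coset_iff)
qed

lemma coset_one_iff:
  assumes "u \<in> carrier F"
  shows "K #>\<^bsub>F\<^esub> u = K \<longleftrightarrow> u \<in> K"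
proof -
  have "K #>\<^bsub>F\<^esub> 0 = K" by (auto simp: coset_iff)
  then show ?thesis using coset_eq_iff[OF assms, of 0] by simp
qed

end

text \<open>Congruent representatives are pushed to congruent ones, so the union that defines
  \<open>tensor_map\<close> runs over equal cosets.\<close>

lemma tensor_map_coset:
  assumes "tensor_factor S P N" "tensor_factor S Q N" and h: "h \<in> mod_hom (op_ring S) P Q"
    and u: "Poly_Mapping.keys u \<subseteq> carrier P \<times> carrier N"
  shows "tensor_map S Q N h (tensor_subgroup S P N #>\<^bsub>free_Abelian_group (carrier P \<times> carrier N)\<^esub> u) =
    tensor_subgroup S Q N #>\<^bsub>free_Abelian_group (carrier Q \<times> carrier N)\<^esub> push h u"
proof -
  interpret P: tensor_factor S P N by fact
  interpret Q: tensor_factor S Q N by fact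
  have kp: "Poly_Mapping.keys (push h v) \<subseteq> carrier Q \<times> carrier N"
    if "Poly_Mapping.keys v \<subseteq> carrier P \<times> carrier N" for v
    by (rule keys_push[OF that hom_simps(1)[OF h P.P Q.P]])
  have *: "Q.K #>\<^bsub>Q.F\<^esub> push h v = Q.K #>\<^bsub>Q.F\<^esub> push h u" if v: "v - u \<in> P.K" for v
  proof -
    have kv: "Poly_Mapping.keys v \<subseteq> carrier P \<times> carrier N"
      using keys_Times_diff(2)[OF P.K_keys[OF v] u] by simp
    have "push h v - push h u \<in> Q.K"
      using push_tensor_subgroup[OF assms(1-3) v] by simp
    then show ?thesis
      using kp[OF kv] kp[OF u] by (subst Q.coset_eq_iff) auto
  qed
  have "u \<in> P.K #>\<^bsub>P.F\<^esub> u" by (simp add: P.coset_iff P.K_zero)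
  moreover have "Q.K #>\<^bsub>Q.F\<^esub> push h v = Q.K #>\<^bsub>Q.F\<^esub> push h u" if "v \<in> P.K #>\<^bsub>P.F\<^esub> u" for v
    using * that by (simp add: P.coset_iff)
  ultimately have "(\<Union>v\<in>P.K #>\<^bsub>P.F\<^esub> u. Q.K #>\<^bsub>Q.F\<^esub> push h v) = Q.K #>\<^bsub>Q.F\<^esub> push h u"
    by blast
  then show ?thesis
    unfolding tensor_map_def push_def[symmetric] .
qed

text \<open>As for Ext, the chosen resolution is exchanged for \<open>Q\<close>. Since
  \<open>Q 0 = A\<close>, degree \<open>Suc i\<close> of Tor sits at \<open>Q (Suc (Suc i))\<close>,
  which \<open>tor_exact\<close> addresses by the index \<open>Suc i\<close>.\<close>

lemma Tor_trivial_iff_tor_exact: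
  fixes A :: "('u, 'u) module" and N :: "('u, 'n) module"
  assumes A: "left_module (op_ring S) A" and N: "left_module S N"
    and "aug_res (op_ring S) Q d" "Q 0 = A"
  shows "trivial_group (Tor S (Suc i) A N) \<longleftrightarrow> tor_exact S Q d N (Suc i)"
proof -
  interpret Q: aug_res "op_ring S" Q d by fact
  have "projective_resolution (op_ring S) A (\<lambda>i. Q (Suc i)) (\<lambda>i. d (Suc i)) (d 0)"
    using Q.aug assms(4) by (auto simp: augmented_resolution_def projective_resolution_def)
  then obtain P \<delta> e where P: "chosen_projective_resolution (op_ring S) A = (P, \<delta>)"
    "projective_resolution (op_ring S) A P \<delta> e"
    by (rule chosen_projective_resolution)
  interpret P: aug_res "op_ring S" "case_nat A P" "case_nat e \<delta>"
    by unfold_locales (rule augmented_resolution_of_projective[OF P(2) A])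
  have mP: "left_module (op_ring S) (P j)" and \<delta>: "\<delta> j \<in> mod_hom (op_ring S) (P (Suc j)) (P j)" for j
    using P.mods[of "Suc j"] P.homs[of "Suc j"] by auto
  interpret T: tensor_factor S "P j" N for j by (rule tensor_factor.intro[OF mP N])
  note tm = tensor_map_coset[OF T.tensor_factor_axioms T.tensor_factor_axioms \<delta>]
  have kp: "Poly_Mapping.keys (push (\<delta> j) v) \<subseteq> carrier (P j) \<times> carrier N"
    if "Poly_Mapping.keys v \<subseteq> carrier (P (Suc j)) \<times> carrier N" for v j
    by (rule keys_push[OF that hom_simps(1)[OF \<delta> mP mP]])
  let ?T = "\<lambda>j. tensor S (P j) N" and ?t = "\<lambda>j. tensor_map S (P j) N (\<delta> j)"
  have t: "?t j \<in> hom (?T (Suc j)) (?T j)" for j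
  proof (rule homI)
    fix X assume "X \<in> carrier (?T (Suc j))"
    then obtain u where u: "Poly_Mapping.keys u \<subseteq> carrier (P (Suc j)) \<times> carrier N"
      "X = T.K (Suc j) #>\<^bsub>T.F (Suc j)\<^esub> u" by (auto simp: T.tensor_carrier)
    show "?t j X \<in> carrier (?T j)"
      using kp[OF u(1)] unfolding u(2) tm[OF u(1)] T.tensor_carrier by auto
    fix Y assume "Y \<in> carrier (?T (Suc j))"
    then obtain v where v: "Poly_Mapping.keys v \<subseteq> carrier (P (Suc j)) \<times> carrier N"
      "Y = T.K (Suc j) #>\<^bsub>T.F (Suc j)\<^esub> v" by (auto simp: T.tensor_carrier)
    show "?t j (X \<otimes>\<^bsub>?T (Suc j)\<^esub> Y) = ?t j X \<otimes>\<^bsub>?T j\<^esub> ?t j Y"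
      using u v kp[OF u(1)] kp[OF v(1)] keys_Times_diff(2)[OF u(1) v(1)]
      by (simp add: T.tensor_mult tm)
  qed
  have "trivial_group (Tor S (Suc i) A N) \<longleftrightarrow>
    (\<forall>X\<in>carrier (?T (Suc i)). ?t i X = \<one>\<^bsub>?T i\<^esub> \<longrightarrow> X \<in> ?t (Suc i) ` carrier (?T (Suc (Suc i))))"
    unfolding Tor_def P(1) Let_def prod.case nat.case
  proof (rule trivial_homology_iff)
    fix X assume "X \<in> carrier (?T (Suc (Suc i)))"
    then obtain u where u: "Poly_Mapping.keys u \<subseteq> carrier (P (Suc (Suc i))) \<times> carrier N"
      "X = T.K (Suc (Suc i)) #>\<^bsub>T.F (Suc (Suc i))\<^esub> u" by (auto simp: T.tensor_carrier)
    have "push (\<delta> i) (push (\<delta> (Suc i)) u) = push (\<lambda>p. \<zero>\<^bsub>P i\<^esub>) u"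
      unfolding push_push using P.dd[of _ "Suc i"] by (intro push_cong[OF u(1)]) simp
    also have "\<dots> \<in> T.K i"
    proof -
      have z: "\<zero>\<^bsub>P i\<^esub> \<in> carrier (P i)" by (rule mod_simps(2)[OF mP])
      \<comment> \<open>Additivity applied to 0 + 0 = 0 shows that pushing along the zero map
        produces only relations.\<close>
      have "push (\<lambda>p. \<zero>\<^bsub>P i\<^esub> \<oplus>\<^bsub>P i\<^esub> \<zero>\<^bsub>P i\<^esub>) u - push (\<lambda>p. \<zero>\<^bsub>P i\<^esub>) u - push (\<lambda>p. \<zero>\<^bsub>P i\<^esub>) u \<in> T.K i"
        using z by (intro T.K_additive[OF u(1)]) auto
      then have "- push (\<lambda>p. \<zero>\<^bsub>P i\<^esub>) u \<in> T.K i" using z by (simp add: mod_simps(7)[OF mP])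
      from T.K_uminus[OF this] show ?thesis by simp
    qed
    finally have "push (\<delta> i) (push (\<delta> (Suc i)) u) \<in> T.K i" .
    then show "?t i (?t (Suc i) X) = \<one>\<^bsub>?T i\<^esub>"
      unfolding u(2) tm[OF u(1)] tm[OF kp[OF u(1)]] T.tensor_one
      using kp[OF kp[OF u(1)]] by (subst T.coset_one_iff) auto
  qed (auto intro: t T.comm_group_tensor comm_group.axioms)
  also have "\<dots> \<longleftrightarrow> tor_exact S (case_nat A P) (case_nat e \<delta>) N (Suc i)"
  proof -
    have 1: "?t i (T.K (Suc i) #>\<^bsub>T.F (Suc i)\<^esub> u) = \<one>\<^bsub>?T i\<^esub> \<longleftrightarrow> push (\<delta> i) u \<in> T.K i"
      if u: "Poly_Mapping.keys u \<subseteq> carrier (P (Suc i)) \<times> carrier N" for u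
      unfolding tm[OF u] T.tensor_one using kp[OF u] by (subst T.coset_one_iff) auto
    have 2: "(T.K (Suc i) #>\<^bsub>T.F (Suc i)\<^esub> u) \<in> ?t (Suc i) ` carrier (?T (Suc (Suc i))) \<longleftrightarrow>
      (\<exists>v. Poly_Mapping.keys v \<subseteq> carrier (P (Suc (Suc i))) \<times> carrier N \<and> u - push (\<delta> (Suc i)) v \<in> T.K (Suc i))"
      if u: "Poly_Mapping.keys u \<subseteq> carrier (P (Suc i)) \<times> carrier N" for u
    proof -
      have eqv: "(T.K (Suc i) #>\<^bsub>T.F (Suc i)\<^esub> u) = ?t (Suc i) (T.K (Suc (Suc i)) #>\<^bsub>T.F (Suc (Suc i))\<^esub> v) \<longleftrightarrow>
          u - push (\<delta> (Suc i)) v \<in> T.K (Suc i)"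
        if v: "Poly_Mapping.keys v \<subseteq> carrier (P (Suc (Suc i))) \<times> carrier N" for v
        unfolding tm[OF v] using kp[OF v] u by (subst T.coset_eq_iff) auto
      show ?thesis
        unfolding T.tensor_carrier image_image image_iff Bex_def carrier_free_Abelian_group_iff
        by (rule iff_exI, rule conj_cong[OF refl], rule eqv)
    qed
    show ?thesis
      unfolding tor_exact_def T.tensor_carrier[of "Suc i"] nat.case Set.ball_simps(9)
      unfolding Ball_def carrier_free_Abelian_group_iff
      by (rule iff_allI, rule imp_cong[OF refl], rule imp_cong[OF 1], assumption, rule 2)
  qed
  also have "\<dots> \<longleftrightarrow> tor_exact S Q d N (Suc i)"
  proof
    have eq: "case_nat A P 0 = Q 0" using assms(4) by simp
    show "tor_exact S Q d N (Suc i)" if "tor_exact S (case_nat A P) (case_nat e \<delta>) N (Suc i)"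
      by (rule tor_exact_resolution_independent[OF Q.aug_res_axioms P.aug_res_axioms eq[symmetric] N that])
    show "tor_exact S (case_nat A P) (case_nat e \<delta>) N (Suc i)" if "tor_exact S Q d N (Suc i)"
      by (rule tor_exact_resolution_independent[OF P.aug_res_axioms Q.aug_res_axioms eq N that])
  qed
  finally show ?thesis .
qed

section \<open>Dual bases\<close>

definition regular_module :: "'r ring \<Rightarrow> ('r, 'r) module" where
  "regular_module T = \<lparr>carrier = carrier T, monoid.mult = undefined, one = undefined,
     ring.zero = \<zero>\<^bsub>T\<^esub>, add = add T, smult = monoid.mult T\<rparr>"

lemma regular_module_simps [simp]:
  "carrier (regular_module T) = carrier T" "\<zero>\<^bsub>regular_module T\<^esub> = \<zero>\<^bsub>T\<^esub>"
  "x \<oplus>\<^bsub>regular_module T\<^esub> y = x \<oplus>\<^bsub>T\<^esub> y" "r \<odot>\<^bsub>regular_module T\<^esub> x = r \<otimes>\<^bsub>T\<^esub> x"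
  by (simp_all add: regular_module_def)

lemma left_module_regular:
  assumes "ring T"
  shows "left_module T (regular_module T)"
proof -
  interpret T: ring T by fact
  show ?thesis
    by (rule left_module_intro)
      (auto simp: assms T.a_ac T.l_distr T.r_distr T.m_assoc intro: bexI[of _ "\<ominus>\<^bsub>T\<^esub> x" for x] T.l_neg)
qed

text \<open>The surjection onto P from the free module on a finite generating set splits; the
  coordinates of the splitting are the functionals f.\<close>

lemma fg_projective_dual_basis:
  fixes P :: "('u, 'u) module"
  assumes inf: "infinite (UNIV :: 'u set)" and proj: "projective_module T P"
    and fg: "finitely_generated T P"
  obtains A f where "finite A" "A \<subseteq> carrier P"
    "\<And>a. a \<in> A \<Longrightarrow> f a \<in> mod_hom T P (regular_module T)"
    "\<And>p. p \<in> carrier P \<Longrightarrow> (\<Oplus>\<^bsub>P\<^esub>a\<in>A. f a p \<odot>\<^bsub>P\<^esub> a) = p"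
proof -
  have P: "left_module T P" using proj by (simp add: projective_module_def)
  interpret P: left_module T P by (rule P)
  have rT: "left_module T (regular_module T)" by (rule left_module_regular[OF P.ring_axioms])
  from fg obtain A where A: "finite A" "A \<subseteq> carrier P"
    "\<forall>N. submodule N T P \<and> A \<subseteq> N \<longrightarrow> N = carrier P"
    unfolding finitely_generated_def by (elim exE conjE)
  have Ac: "a \<in> carrier P" if "a \<in> A" for a using that A(2) by auto
  define D where "D = direct_sum_copies (regular_module T) A"
  have D: "left_module T D"
    unfolding D_def by (rule left_module_direct_sum_copies[OF rT])
  have Dc: "carrier D = A \<rightarrow>\<^sub>E carrier T"
    using A(1) by (auto simp: D_def direct_sum_copies_simps[OF rT])
  note Ds = direct_sum_copies_simps(2-4)[OF rT, of A, folded D_def]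
  define \<sigma> where "\<sigma> = (\<lambda>y\<in>carrier D. \<Oplus>\<^bsub>P\<^esub>a\<in>A. (\<lambda>y\<in>carrier D. y a \<odot>\<^bsub>P\<^esub> a) y)"
  have comp: "(\<lambda>y\<in>carrier D. y a \<odot>\<^bsub>P\<^esub> a) \<in> mod_hom T D P" if "a \<in> A" for a
    using that by (intro mod_homI D)
      (auto simp: Dc Ds PiE_iff Ac P.smult_closed P.smult_l_distr P.smult_assoc)
  have \<sigma>: "\<sigma> \<in> mod_hom T D P"
    unfolding \<sigma>_def by (rule mod_hom_finsum[OF A(1) comp D P])
  have \<sigma>_eq: "\<sigma> y = (\<Oplus>\<^bsub>P\<^esub>a\<in>A. y a \<odot>\<^bsub>P\<^esub> a)" if "y \<in> carrier D" for y
    using that by (simp add: \<sigma>_def)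
  have "a \<in> \<sigma> ` carrier D" if a: "a \<in> A" for a
  proof -
    let ?y = "\<lambda>b\<in>A. if a = b then \<one>\<^bsub>T\<^esub> else \<zero>\<^bsub>T\<^esub>"
    have y: "?y \<in> carrier D" by (auto simp: Dc)
    have "\<sigma> ?y = (\<Oplus>\<^bsub>P\<^esub>b\<in>A. if a = b then b else \<zero>\<^bsub>P\<^esub>)"
      unfolding \<sigma>_eq[OF y]
      by (rule P.finsum_cong') (auto simp: Ac P.smult_one mod_simps(16)[OF P])
    also have "\<dots> = a"
      using P.add.finprod_singleton[OF a A(1), of "\<lambda>b. b"] Ac by auto
    finally show ?thesis using y by (metis imageI)
  qed
  then have "A \<subseteq> \<sigma> ` carrier D" by blast
  with A(3) submodule_image[OF \<sigma> D P] have surj: "\<sigma> ` carrier D = carrier P" by blast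
  \<comment> \<open>\<open>projective_module\<close> quantifies over modules inside
    \<open>'u\<close>, so the free module is first moved there, an element being coded by its tuple
    of coordinates.\<close>
  obtain enc :: "'u list \<Rightarrow> 'u" where enc: "inj enc" using infinite_list_encoding[OF inf] .
  obtain xs where xs: "set xs = A" using finite_list[OF A(1)] by auto
  have "inj_on (\<lambda>y. enc (map y xs)) (carrier D)"
  proof (rule inj_onI)
    fix x y assume "x \<in> carrier D" "y \<in> carrier D" "enc (map x xs) = enc (map y xs)"
    then show "x = y" unfolding Dc by (intro PiE_ext) (auto simp: inj_eq[OF enc] xs)
  qed
  from transport_module[OF D this] obtain F :: "('u, 'u) module" and t
    where F: "left_module T F" "t \<in> mod_hom T D F" "bij_betw t (carrier D) (carrier F)" .
  obtain t' where t': "t' \<in> mod_hom T F D" "bij_betw t' (carrier F) (carrier D)"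
    using mod_hom_inv[OF F(2,3) D F(1)] by metis
  let ?\<sigma> = "\<lambda>x\<in>carrier F. \<sigma> (t' x)"
  have "?\<sigma> ` carrier F = carrier P"
    using t'(2) surj by (simp add: image_image[symmetric, of \<sigma> t'] bij_betw_def)
  moreover have "?\<sigma> \<in> mod_hom T F P" by (rule mod_hom_compose[OF t'(1) \<sigma> F(1) D P])
  ultimately obtain k where k: "k \<in> mod_hom T P F" "\<And>p. p \<in> carrier P \<Longrightarrow> ?\<sigma> (k p) = p"
    using projective_lift[OF proj F(1) P _ mod_hom_id[OF P], of ?\<sigma>] by auto
  define k' where "k' = (\<lambda>p\<in>carrier P. t' (k p))"
  have k': "k' \<in> mod_hom T P D"
    unfolding k'_def by (rule mod_hom_compose[OF k(1) t'(1) P F(1) D])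
  note [simp] = hom_simps[OF k' P D]
  have k'c: "k' p \<in> A \<rightarrow>\<^sub>E carrier T" if "p \<in> carrier P" for p
    using hom_simps(1)[OF k' P D that] by (simp add: Dc)
  show thesis
  proof (rule that[OF A(1,2), of "\<lambda>a. \<lambda>p\<in>carrier P. k' p a"])
    show "(\<lambda>p\<in>carrier P. k' p a) \<in> mod_hom T P (regular_module T)" if "a \<in> A" for a
      using that by (intro mod_homI P) (auto simp: Ds PiE_mem[OF k'c])
    fix p assume p: "p \<in> carrier P"
    have "\<sigma> (k' p) = p"
      using k(2)[OF p] p hom_simps(1)[OF k(1) P F(1) p] by (simp add: k'_def)
    then show "(\<Oplus>\<^bsub>P\<^esub>a\<in>A. (\<lambda>p\<in>carrier P. k' p a) p \<odot>\<^bsub>P\<^esub> a) = p"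
      using \<sigma>_eq p by simp
  qed
qed

section \<open>The dual complex of a semidualizing bimodule\<close>

lemma left_mod_simps [simp]:
  "carrier (left_mod C) = carrier C" "\<zero>\<^bsub>left_mod C\<^esub> = \<zero>\<^bsub>C\<^esub>"
  "x \<oplus>\<^bsub>left_mod C\<^esub> y = x \<oplus>\<^bsub>C\<^esub> y" "r \<odot>\<^bsub>left_mod C\<^esub> x = r \<odot>\<^bsub>C\<^esub> x"
  by (simp_all add: left_mod_def module.truncate_def)

lemma right_mod_simps [simp]:
  "carrier (right_mod C) = carrier C" "\<zero>\<^bsub>right_mod C\<^esub> = \<zero>\<^bsub>C\<^esub>"
  "x \<oplus>\<^bsub>right_mod C\<^esub> y = x \<oplus>\<^bsub>C\<^esub> y" "s \<odot>\<^bsub>right_mod C\<^esub> x = rsmult C x s"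
  by (simp_all add: right_mod_def)

text \<open>The resolved module is an image of the first projective, hence also finitely generated.
  So all degrees of the augmented resolution are, including degree 0.\<close>

lemma fg_augmented_resolution:
  assumes "has_fg_projective_resolution R A" "left_module R A"
  obtains Q d where "aug_res R Q d" "Q 0 = A" "\<And>i. finitely_generated R (Q i)"
proof -
  obtain P \<delta> e where P: "projective_resolution R A P \<delta> e" "\<And>i. finitely_generated R (P i)"
    using assms(1) unfolding has_fg_projective_resolution_def by blast
  interpret P: aug_res R "case_nat A P" "case_nat e \<delta>"
    by unfold_locales (rule augmented_resolution_of_projective[OF P(1) assms(2)])
  have "finitely_generated R A"
    using finitely_generated_image[OF P(2)[of 0], of e A] P.homs[of 0] P.surj0 P.mods[of 1] assms(2)
    by simp
  then have "finitely_generated R (case_nat A P i)" for i using P(2) by (cases i) auto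
  with that P.aug_res_axioms show thesis by simp
qed

section \<open>The duals Hom_S(P, C) as left R-modules\<close>

locale semidualizing_bimodule =
  fixes R S :: "'u ring" and C :: "('u, 'u, 'u) bimodule"
  assumes inf: "infinite (UNIV :: 'u set)" and semi: "semidualizing R S C"
begin

abbreviation "T \<equiv> op_ring S"
abbreviation "CR \<equiv> left_mod C"
abbreviation "CS \<equiv> right_mod C"

lemma bimodule: "is_bimodule R S C" using semi by (simp add: semidualizing_def)

lemma CR: "left_module R CR" and CS: "left_module T CS" and ring_R: "ring R" and ring_S: "ring S"
  using bimodule by (auto simp: is_bimodule_def)

lemma rsmult_smult: "\<lbrakk>r \<in> carrier R; s \<in> carrier S; c \<in> carrier C\<rbrakk> \<Longrightarrow>
    rsmult C (r \<odot>\<^bsub>C\<^esub> c) s = r \<odot>\<^bsub>C\<^esub> rsmult C c s"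
  using bimodule by (auto simp: is_bimodule_def)

lemmas C_simps = mod_simps[OF CR, simplified] mod_simps[OF CS, simplified]

lemma R_homothety:
  assumes "h \<in> mod_hom T CS CS"
  shows "\<exists>r\<in>carrier R. \<forall>c\<in>carrier C. h c = r \<odot>\<^bsub>C\<^esub> c"
proof -
  have "(\<lambda>r. \<lambda>c\<in>carrier C. r \<odot>\<^bsub>C\<^esub> c) ` carrier R = mod_hom T CS CS"
    using semi by (auto simp: semidualizing_def iso_def bij_betw_def hom_group_def)
  then obtain r where "r \<in> carrier R" "h = (\<lambda>c\<in>carrier C. r \<odot>\<^bsub>C\<^esub> c)" using assms by blast
  then show ?thesis by auto
qed

lemma R_homothety_inj:
  assumes "r \<in> carrier R" "r' \<in> carrier R" "\<And>c. c \<in> carrier C \<Longrightarrow> r \<odot>\<^bsub>C\<^esub> c = r' \<odot>\<^bsub>C\<^esub> c"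
  shows "r = r'"
proof -
  have "inj_on (\<lambda>r. \<lambda>c\<in>carrier C. r \<odot>\<^bsub>C\<^esub> c) (carrier R)"
    using semi by (simp add: semidualizing_def iso_def bij_betw_def)
  from inj_onD[OF this _ assms(1,2)] assms(3) show ?thesis by (simp cong: restrict_cong)
qed

lemma S_homothety:
  assumes "h \<in> mod_hom R CR CR"
  shows "\<exists>s\<in>carrier S. \<forall>c\<in>carrier C. h c = rsmult C c s"
proof -
  have "(\<lambda>s. \<lambda>c\<in>carrier C. rsmult C c s) ` carrier S = mod_hom R CR CR"
    using semi by (auto simp: semidualizing_def iso_def bij_betw_def hom_group_def)
  then obtain s where "s \<in> carrier S" "h = (\<lambda>c\<in>carrier C. rsmult C c s)" using assms by blast
  then show ?thesis by auto
qed

lemma S_homothety_zero: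
  assumes "s \<in> carrier S" "\<And>c. c \<in> carrier C \<Longrightarrow> rsmult C c s = \<zero>\<^bsub>C\<^esub>"
  shows "s = \<zero>\<^bsub>S\<^esub>"
proof -
  interpret S: ring S by (rule ring_S)
  have "inj_on (\<lambda>s. \<lambda>c\<in>carrier C. rsmult C c s) (carrier S)"
    using semi by (simp add: semidualizing_def iso_def bij_betw_def)
  from inj_onD[OF this _ assms(1) S.zero_closed] assms(2) show ?thesis
    using C_simps by (simp cong: restrict_cong)
qed

definition dual :: "('u, 'p) module \<Rightarrow> ('u, 'p \<Rightarrow> 'u) module" where
  "dual P = \<lparr>carrier = mod_hom T P CS, monoid.mult = undefined, one = undefined,
     ring.zero = (\<lambda>p\<in>carrier P. \<zero>\<^bsub>C\<^esub>), add = (\<lambda>g h. \<lambda>p\<in>carrier P. g p \<oplus>\<^bsub>C\<^esub> h p),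
     smult = (\<lambda>r g. \<lambda>p\<in>carrier P. r \<odot>\<^bsub>C\<^esub> g p)\<rparr>"

lemma dual_simps:
  "carrier (dual P) = mod_hom T P CS" "\<zero>\<^bsub>dual P\<^esub> = (\<lambda>p\<in>carrier P. \<zero>\<^bsub>C\<^esub>)"
  "g \<oplus>\<^bsub>dual P\<^esub> h = (\<lambda>p\<in>carrier P. g p \<oplus>\<^bsub>C\<^esub> h p)"
  "r \<odot>\<^bsub>dual P\<^esub> g = (\<lambda>p\<in>carrier P. r \<odot>\<^bsub>C\<^esub> g p)"
  by (simp_all add: dual_def)

lemma left_module_dual:
  assumes P: "left_module T P"
  shows "left_module R (dual P)"
proof -
  interpret CR: left_module R CR by (rule CR)
  interpret CS: left_module T CS by (rule CS)
  note c = hom_simps(1)[OF _ P CS, simplified]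
  note [simp] = mod_simps[OF P] C_simps
  show ?thesis
  proof (rule left_module_intro)
    show "\<zero>\<^bsub>dual P\<^esub> \<in> carrier (dual P)"
      using mod_hom_zero[OF P CS] by (simp add: dual_simps)
    fix g assume g: "g \<in> carrier (dual P)"
    then have gh: "g \<in> mod_hom T P CS" by (simp add: dual_simps)
    note [simp] = hom_simps[OF gh P CS, simplified]
    show "\<zero>\<^bsub>dual P\<^esub> \<oplus>\<^bsub>dual P\<^esub> g = g" "\<one>\<^bsub>R\<^esub> \<odot>\<^bsub>dual P\<^esub> g = g"
      using hom_simps(6)[OF gh P CS] by (simp_all add: dual_simps cong: restrict_cong)
    show "\<exists>h\<in>carrier (dual P). h \<oplus>\<^bsub>dual P\<^esub> g = \<zero>\<^bsub>dual P\<^esub>"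
    proof (rule bexI)
      let ?h = "\<lambda>x\<in>carrier P. (\<lambda>x\<in>carrier P. \<zero>\<^bsub>CS\<^esub>) x \<ominus>\<^bsub>CS\<^esub> g x"
      show "?h \<in> carrier (dual P)"
        unfolding dual_simps by (rule mod_hom_diff[OF mod_hom_zero[OF P CS] gh P CS])
      show "?h \<oplus>\<^bsub>dual P\<^esub> g = \<zero>\<^bsub>dual P\<^esub>"
        using mod_simps(11)[OF CS, simplified] by (simp add: dual_simps cong: restrict_cong)
    qed
    fix r assume r: "r \<in> carrier R"
    show "r \<odot>\<^bsub>dual P\<^esub> g \<in> carrier (dual P)"
      unfolding dual_simps using r CR.smult_r_distr
      by (intro mod_homI P) (auto simp: rsmult_smult)
  next
    fix g h assume "g \<in> carrier (dual P)" "h \<in> carrier (dual P)"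
    then show "g \<oplus>\<^bsub>dual P\<^esub> h \<in> carrier (dual P)"
      using mod_hom_add[OF _ _ P CS] by (simp add: dual_simps)
  qed (use CR.smult_l_distr CR.smult_r_distr CR.smult_assoc CR.a_assoc CR.a_comm in
      \<open>auto simp: dual_simps c CR.ring_axioms intro!: restrict_ext\<close>)
qed

lemma eval_hom:
  assumes "left_module T P" "p \<in> carrier P"
  shows "(\<lambda>g\<in>carrier (dual P). g p) \<in> mod_hom R (dual P) CR"
  using assms by (intro mod_homI left_module_dual) (auto simp: dual_simps hom_simps(1)[OF _ _ CS, simplified])

definition dual_map :: "('u, 'p) module \<Rightarrow> ('u, 'q) module \<Rightarrow> ('p \<Rightarrow> 'q) \<Rightarrow> ('q \<Rightarrow> 'u) \<Rightarrow> 'p \<Rightarrow> 'u" where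
  "dual_map P Q h = (\<lambda>g\<in>carrier (dual Q). \<lambda>p\<in>carrier P. g (h p))"

lemma dual_map_hom:
  assumes P: "left_module T P" and Q: "left_module T Q" and h: "h \<in> mod_hom T P Q"
  shows "dual_map P Q h \<in> mod_hom R (dual Q) (dual P)"
  unfolding dual_map_def
  using hom_simps(1)[OF h P Q]
  by (intro mod_homI left_module_dual Q)
    (auto simp: dual_simps mod_hom_compose[OF h _ P Q CS] intro!: restrict_ext)

end

text \<open>Dual bases: \<open>emb a c\<close> is the functional \<open>p \<mapsto> c f\<^sub>a(p)\<close>, and \<open>g = \<Sum>\<^sub>a emb a (g a)\<close>.\<close>

locale dual_basis = semidualizing_bimodule +
  fixes P :: "('a, 'p) module" and A f
  assumes P: "left_module T P" and fin: "finite A" and sub: "A \<subseteq> carrier P"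
    and f: "\<And>a. a \<in> A \<Longrightarrow> f a \<in> mod_hom T P (regular_module T)"
    and basis: "\<And>p. p \<in> carrier P \<Longrightarrow> (\<Oplus>\<^bsub>P\<^esub>a\<in>A. f a p \<odot>\<^bsub>P\<^esub> a) = p"
begin

lemma Ac: "a \<in> A \<Longrightarrow> a \<in> carrier P" using sub by auto

lemma ring_T: "ring T" using CS by (rule mod_ring)

lemmas f_simps = hom_simps[OF f P left_module_regular[OF ring_T], simplified]

definition emb :: "'p \<Rightarrow> 'a \<Rightarrow> 'p \<Rightarrow> 'a" where
  "emb a = (\<lambda>c\<in>carrier C. \<lambda>p\<in>carrier P. rsmult C c (f a p))"

lemma emb_hom: "a \<in> A \<Longrightarrow> emb a \<in> mod_hom R CR (dual P)"
proof -
  assume a: "a \<in> A"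
  interpret CS: left_module T CS by (rule CS)
  note [simp] = C_simps f_simps[OF a] mod_simps[OF P]
  have 1: "(\<lambda>p\<in>carrier P. rsmult C c (f a p)) \<in> mod_hom T P CS" if "c \<in> carrier C" for c
    using that CS.smult_l_distr CS.smult_assoc by (intro mod_homI P) auto
  have "restrict (\<lambda>c. \<lambda>p\<in>carrier P. rsmult C c (f a p)) (carrier CR) \<in> mod_hom R CR (dual P)"
    by (rule mod_homI[OF _ _ _ CR])
      (use 1 CS.smult_r_distr in \<open>auto simp: dual_simps rsmult_smult intro!: restrict_ext\<close>)
  then show ?thesis by (simp add: emb_def)
qed

lemma expand:
  assumes h: "h \<in> mod_hom R (dual P) X" and X: "left_module R X" and g: "g \<in> carrier (dual P)"
  shows "h g = (\<Oplus>\<^bsub>X\<^esub>a\<in>A. h (emb a (g a)))"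
proof -
  interpret CR: left_module R CR by (rule CR)
  interpret CS: left_module T CS by (rule CS)
  note D = left_module_dual[OF P]
  interpret D: left_module R "dual P" by (rule D)
  have gh: "g \<in> mod_hom T P CS" using g by (simp add: dual_simps)
  note [simp] = hom_simps[OF gh P CS, simplified] f_simps
  have e: "emb a (g a) \<in> carrier (dual P)" if "a \<in> A" for a
    using that hom_simps(1)[OF emb_hom[OF that] CR D] Ac by simp
  \<comment> \<open>\<open>left_mod C\<close> and \<open>right_mod C\<close> share their addition,
    so sums formed in either are the same.\<close>
  have ed: "finsum CR = finsum CS"
    by (simp add: finsum_def left_mod_def right_mod_def module.truncate_def fun_eq_iff
        finprod_def foldD_def foldSetD_def)
  have "(\<Oplus>\<^bsub>dual P\<^esub>a\<in>A. emb a (g a)) = g"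
  proof (rule mod_hom_eqI[OF _ gh])
    have s: "(\<Oplus>\<^bsub>dual P\<^esub>a\<in>A. emb a (g a)) \<in> carrier (dual P)" using e by (intro D.finsum_closed) auto
    then show "(\<Oplus>\<^bsub>dual P\<^esub>a\<in>A. emb a (g a)) \<in> mod_hom T P CS" by (simp add: dual_simps)
    fix p assume p: "p \<in> carrier P"
    have "(\<Oplus>\<^bsub>dual P\<^esub>a\<in>A. emb a (g a)) p = (\<Oplus>\<^bsub>CR\<^esub>a\<in>A. (\<lambda>g\<in>carrier (dual P). g p) (emb a (g a)))"
      using hom_finsum[OF eval_hom[OF P p] D CR fin, of "\<lambda>a. emb a (g a)"] e s by simp
    also have "\<dots> = (\<Oplus>\<^bsub>CR\<^esub>a\<in>A. g (f a p \<odot>\<^bsub>P\<^esub> a))"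
      by (rule CR.finsum_cong') (use e p in \<open>auto simp: emb_def Ac mod_simps[OF P] C_simps\<close>)
    also have "\<dots> = g (\<Oplus>\<^bsub>P\<^esub>a\<in>A. f a p \<odot>\<^bsub>P\<^esub> a)"
      unfolding ed by (rule hom_finsum[OF gh P CS fin, symmetric]) (simp add: p Ac mod_simps[OF P])
    finally show "(\<Oplus>\<^bsub>dual P\<^esub>a\<in>A. emb a (g a)) p = g p" using basis[OF p] by simp
  qed
  then have "h g = h (\<Oplus>\<^bsub>dual P\<^esub>a\<in>A. emb a (g a))" by simp
  also have "\<dots> = (\<Oplus>\<^bsub>X\<^esub>a\<in>A. h (emb a (g a)))"
    by (rule hom_finsum[OF h D X fin e])
  finally show ?thesis .
qed

text \<open>The dual of P is a summand of a finite power of C, through the maps \<open>emb a\<close>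
  and the evaluations at the basis elements. So each component of \<phi> on C is lifted by itself,
  and the lifts are added after evaluation.\<close>

lemma dual_lifts:
  assumes U: "left_module R U" and X: "left_module R X" and \<pi>: "\<pi> \<in> mod_hom R U X" and l: "lifts R CR U X \<pi>"
  shows "lifts R (dual P) U X \<pi>"
  unfolding lifts_def
proof
  note D = left_module_dual[OF P]
  fix \<phi> assume \<phi>: "\<phi> \<in> mod_hom R (dual P) X"
  have "\<exists>\<kappa>\<in>mod_hom R CR U. \<forall>c\<in>carrier C. \<pi> (\<kappa> c) = \<phi> (emb a c)" if a: "a \<in> A" for a
    using l mod_hom_compose[OF emb_hom[OF a] \<phi> CR D X] unfolding lifts_def by fastforce
  then obtain \<kappa> where \<kappa>: "\<And>a. a \<in> A \<Longrightarrow> \<kappa> a \<in> mod_hom R CR U"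
    "\<And>a c. \<lbrakk>a \<in> A; c \<in> carrier C\<rbrakk> \<Longrightarrow> \<pi> (\<kappa> a c) = \<phi> (emb a c)" by metis
  let ?k = "\<lambda>a. \<lambda>g\<in>carrier (dual P). \<kappa> a ((\<lambda>g\<in>carrier (dual P). g a) g)"
  have k: "?k a \<in> mod_hom R (dual P) U" if "a \<in> A" for a
    by (rule mod_hom_compose[OF eval_hom[OF P Ac[OF that]] \<kappa>(1)[OF that] D CR U])
  let ?\<psi> = "\<lambda>g\<in>carrier (dual P). \<Oplus>\<^bsub>U\<^esub>a\<in>A. ?k a g"
  have "?\<psi> \<in> mod_hom R (dual P) U" by (rule mod_hom_finsum[OF fin k D U])
  moreover have "\<pi> (?\<psi> g) = \<phi> g" if g: "g \<in> carrier (dual P)" for g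
  proof -
    interpret X: left_module R X by (rule X)
    interpret D: left_module R "dual P" by (rule D)
    have gc: "g a \<in> carrier C" if "a \<in> A" for a
      using g hom_simps(1)[OF _ P CS _] Ac[OF that] by (auto simp: dual_simps)
    have "\<pi> (?\<psi> g) = (\<Oplus>\<^bsub>X\<^esub>a\<in>A. \<pi> (?k a g))"
      using hom_finsum[OF \<pi> U X fin, of "\<lambda>a. ?k a g"] g hom_simps(1)[OF k D U g] by simp
    also have "\<dots> = (\<Oplus>\<^bsub>X\<^esub>a\<in>A. \<phi> (emb a (g a)))"
    proof (rule X.finsum_cong')
      show "(\<lambda>a. \<phi> (emb a (g a))) \<in> A \<rightarrow> carrier X"
        using hom_simps(1)[OF \<phi> D X] hom_simps(1)[OF emb_hom CR D] gc by auto
    qed (use g gc \<kappa>(2) in auto)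
    also have "\<dots> = \<phi> g" by (rule expand[OF \<phi> X g, symmetric])
    finally show ?thesis .
  qed
  ultimately show "\<exists>\<psi>\<in>mod_hom R (dual P) U. \<forall>z\<in>carrier (dual P). \<pi> (\<psi> z) = \<phi> z" by blast
qed

text \<open>This is surjectivity of P into its double dual. Each composite of h with
  \<open>emb a\<close> is an R-endomorphism of C, hence right multiplication by some s_a, and h is
  evaluation at the sum of the elements a s_a.\<close>

lemma dual_reflexive:
  assumes h: "h \<in> mod_hom R (dual P) CR"
  shows "\<exists>p\<in>carrier P. \<forall>g\<in>carrier (dual P). h g = g p"
proof -
  interpret P: left_module T P by (rule P)
  interpret CR: left_module R CR by (rule CR)
  note D = left_module_dual[OF P]
  have "\<exists>s\<in>carrier S. \<forall>c\<in>carrier C. h (emb a c) = rsmult C c s" if a: "a \<in> A" for a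
    using S_homothety[OF mod_hom_compose[OF emb_hom[OF a] h CR D CR]] by auto
  then obtain s where s: "\<And>a. a \<in> A \<Longrightarrow> s a \<in> carrier S"
    "\<And>a c. \<lbrakk>a \<in> A; c \<in> carrier C\<rbrakk> \<Longrightarrow> h (emb a c) = rsmult C c (s a)" by metis
  have sa: "s a \<odot>\<^bsub>P\<^esub> a \<in> carrier P" if "a \<in> A" for a
    using that s(1) Ac P.smult_closed by simp
  have ed: "finsum CR = finsum CS"
    by (simp add: finsum_def left_mod_def right_mod_def module.truncate_def fun_eq_iff
        finprod_def foldD_def foldSetD_def)
  have "h g = g (\<Oplus>\<^bsub>P\<^esub>a\<in>A. s a \<odot>\<^bsub>P\<^esub> a)" if g: "g \<in> carrier (dual P)" for g
  proof -
    have gh: "g \<in> mod_hom T P CS" using g by (simp add: dual_simps)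
    note [simp] = hom_simps[OF gh P CS, simplified]
    have "h g = (\<Oplus>\<^bsub>CR\<^esub>a\<in>A. h (emb a (g a)))" by (rule expand[OF h CR g])
    also have "\<dots> = (\<Oplus>\<^bsub>CR\<^esub>a\<in>A. g (s a \<odot>\<^bsub>P\<^esub> a))"
      by (rule CR.finsum_cong') (use s sa Ac in \<open>auto simp: C_simps\<close>)
    also have "\<dots> = g (\<Oplus>\<^bsub>P\<^esub>a\<in>A. s a \<odot>\<^bsub>P\<^esub> a)"
      unfolding ed by (rule hom_finsum[OF gh P CS fin sa, symmetric])
    finally show ?thesis .
  qed
  moreover have "(\<Oplus>\<^bsub>P\<^esub>a\<in>A. s a \<odot>\<^bsub>P\<^esub> a) \<in> carrier P" using sa by (intro P.finsum_closed) auto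
  ultimately show ?thesis by blast
qed

text \<open>This is injectivity of P into its double dual. If every functional vanishes at q, each
  coordinate f_a(q) annihilates C and is therefore zero, the homothety map of S being
  injective.\<close>

lemma dual_torsionless:
  assumes q: "q \<in> carrier P" and z: "\<And>g. g \<in> carrier (dual P) \<Longrightarrow> g q = \<zero>\<^bsub>C\<^esub>"
  shows "q = \<zero>\<^bsub>P\<^esub>"
proof -
  interpret P: left_module T P by (rule P)
  note D = left_module_dual[OF P]
  have "f a q = \<zero>\<^bsub>S\<^esub>" if a: "a \<in> A" for a
  proof (rule S_homothety_zero)
    show "f a q \<in> carrier S" using f_simps(1)[OF a q] by simp
    fix c assume c: "c \<in> carrier C"
    have "emb a c q = \<zero>\<^bsub>C\<^esub>" using hom_simps(1)[OF emb_hom[OF a] CR D] c by (intro z) simp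
    then show "rsmult C c (f a q) = \<zero>\<^bsub>C\<^esub>" using c q by (simp add: emb_def)
  qed
  then have "(\<Oplus>\<^bsub>P\<^esub>a\<in>A. f a q \<odot>\<^bsub>P\<^esub> a) = (\<Oplus>\<^bsub>P\<^esub>a\<in>A. \<zero>\<^bsub>P\<^esub>)"
    using mod_simps(16)[OF P, simplified] Ac by (intro P.finsum_cong') auto
  then show ?thesis using basis[OF q] by simp
qed

text \<open>Elements of the dual are sums of values \<open>emb a c\<close>, so the elements
  \<open>emb a b\<close>, for b in a finite detecting set of C, detect every map from the dual to
  C.\<close>

lemma dual_hom_separating:
  assumes "finitely_generated R CR"
  shows "hom_separating R (dual P) CR"
proof -
  interpret CR: left_module R CR by (rule CR)
  note D = left_module_dual[OF P]
  obtain B where B: "finite B" "B \<subseteq> carrier CR"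
    "\<forall>h\<in>mod_hom R CR CR. (\<forall>b\<in>B. h b = \<zero>\<^bsub>CR\<^esub>) \<longrightarrow> (\<forall>z\<in>carrier CR. h z = \<zero>\<^bsub>CR\<^esub>)"
    using finitely_generated_hom_separating[OF assms CR CR] unfolding hom_separating_def
    by (elim exE conjE)
  let ?G = "(\<lambda>(a, b). emb a b) ` (A \<times> B)"
  have G: "?G \<subseteq> carrier (dual P)"
    using B(2) hom_simps(1)[OF emb_hom CR D] by auto
  have z: "h g = \<zero>\<^bsub>CR\<^esub>"
    if h: "h \<in> mod_hom R (dual P) CR" and hz: "\<forall>x\<in>?G. h x = \<zero>\<^bsub>CR\<^esub>" and g: "g \<in> carrier (dual P)" for h g
  proof -
    have "h (emb a c) = \<zero>\<^bsub>CR\<^esub>" if a: "a \<in> A" and c: "c \<in> carrier C" for a c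
    proof -
      have "(\<lambda>c\<in>carrier CR. h (emb a c)) c = \<zero>\<^bsub>CR\<^esub>"
        by (rule B(3)[rule_format, OF mod_hom_compose[OF emb_hom[OF a] h CR D CR]])
          (use hz a c B(2) in \<open>auto simp: subset_iff\<close>)
      then show ?thesis using c by simp
    qed
    moreover have "g a \<in> carrier C" if "a \<in> A" for a
      using g hom_simps(1)[OF _ P CS _] Ac[OF that] by (auto simp: dual_simps)
    ultimately have "(\<Oplus>\<^bsub>CR\<^esub>a\<in>A. h (emb a (g a))) = (\<Oplus>\<^bsub>CR\<^esub>a\<in>A. \<zero>\<^bsub>CR\<^esub>)"
      by (intro CR.finsum_cong') (auto simp: C_simps)
    then show ?thesis unfolding expand[OF h CR g] using CR.finsum_zero by simp
  qed
  have finG: "finite ?G" using fin B(1) by auto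
  show ?thesis
    unfolding hom_separating_def by (rule exI[of _ ?G], intro conjI finG G ballI impI) (rule z)
qed

end

lemma ball_one_to_iff: "(\<forall>i\<in>{1..n}. P i) \<longleftrightarrow> (\<forall>i<n. P (Suc i))"
proof (intro iffI allI ballI impI)
  fix i assume "\<forall>i<n. P (Suc i)" "i \<in> {1..n}"
  then show "P i" by (cases i) auto
qed auto

section \<open>The complex of duals: exactness, lifting, reflexivity\<close>

locale dual_complex = semidualizing_bimodule +
  fixes Q :: "nat \<Rightarrow> ('a, 'a) module" and d :: "nat \<Rightarrow> 'a \<Rightarrow> 'a"
    and B :: "nat \<Rightarrow> ('a, 'a) module" and dB :: "nat \<Rightarrow> 'a \<Rightarrow> 'a"
  assumes Q: "aug_res (op_ring S) Q d" and Q0: "Q 0 = right_mod C"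
    and Qfg: "\<And>i. finitely_generated (op_ring S) (Q i)"
    and B: "aug_res R B dB" and B0: "B 0 = left_mod C" and Bfg: "\<And>i. finitely_generated R (B i)"
begin

sublocale Q: aug_res "op_ring S" Q d by (rule Q)
sublocale B: aug_res R B dB by (rule B)

abbreviation "E i \<equiv> dual (Q i)"
abbreviation "\<delta> i \<equiv> dual_map (Q (Suc i)) (Q i) (d i)"

lemma E: "left_module R (E i)" by (rule left_module_dual[OF Q.mods])

lemma \<delta>: "\<delta> i \<in> mod_hom R (E i) (E (Suc i))"
  by (rule dual_map_hom[OF Q.mods Q.mods Q.homs])

lemma E_iff: "g \<in> carrier (E i) \<longleftrightarrow> g \<in> mod_hom T (Q i) CS"
  by (simp add: dual_simps)

lemma \<delta>_apply: "\<lbrakk>g \<in> carrier (E i); p \<in> carrier (Q (Suc i))\<rbrakk> \<Longrightarrow> \<delta> i g p = g (d i p)"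
  by (simp add: dual_map_def)

lemma E_eqI: "\<lbrakk>g \<in> carrier (E i); h \<in> carrier (E i); \<And>p. p \<in> carrier (Q i) \<Longrightarrow> g p = h p\<rbrakk> \<Longrightarrow> g = h"
  unfolding E_iff by (rule mod_hom_eqI)

lemmas \<delta>_simps = hom_simps[OF \<delta> E E]

text \<open>Dual bases exist in positive degrees only, as \<open>Q 0 = C\<close> need not be
  projective. Hence the case distinctions in the lemmas below, where \<open>E 0\<close> is handled
  through its identification with R.\<close>

lemma basis:
  obtains A f where "dual_basis R S C (Q (Suc i)) A f"
proof -
  obtain A f where "finite A" "A \<subseteq> carrier (Q (Suc i))"
    "\<And>a. a \<in> A \<Longrightarrow> f a \<in> mod_hom T (Q (Suc i)) (regular_module T)"
    "\<And>p. p \<in> carrier (Q (Suc i)) \<Longrightarrow> (\<Oplus>\<^bsub>Q (Suc i)\<^esub>a\<in>A. f a p \<odot>\<^bsub>Q (Suc i)\<^esub> a) = p"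
    by (rule fg_projective_dual_basis[OF inf Q.proj Qfg]) (rule that; assumption)
  then have "dual_basis R S C (Q (Suc i)) A f"
    by (intro dual_basis.intro dual_basis_axioms.intro semidualizing_bimodule_axioms Q.mods)
  then show thesis by (rule that)
qed

text \<open>The image of 1 under the homothety isomorphism from R to \<open>E 0\<close>.\<close>

definition idC :: "'a \<Rightarrow> 'a" where "idC = (\<lambda>c\<in>carrier C. c)"

lemma idC: "idC \<in> carrier (E 0)"
  using mod_hom_id[OF CS] by (simp add: idC_def dual_simps Q0)

lemma E0_scalar:
  assumes "g \<in> carrier (E 0)"
  shows "\<exists>r\<in>carrier R. g = r \<odot>\<^bsub>E 0\<^esub> idC"
proof -
  obtain r where r: "r \<in> carrier R" "\<And>c. c \<in> carrier C \<Longrightarrow> g c = r \<odot>\<^bsub>C\<^esub> c"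
    using R_homothety[of g] assms by (auto simp: dual_simps Q0)
  have "g = r \<odot>\<^bsub>E 0\<^esub> idC"
    by (rule E_eqI[OF assms mod_simps(5)[OF E r(1) idC]]) (auto simp: r(2) Q0 dual_simps(4) idC_def)
  with r(1) show ?thesis by blast
qed

text \<open>For i = 0 the map \<open>d 0\<close> is onto, and every map that kills its kernel
  factors. For i = j + 1 it is the vanishing of the Ext group of C with itself over S in degree j +
  1.\<close>

lemma dual_exact_ext: "ext_along T (Q (Suc i)) (Q i) (d i) CS"
proof (cases i)
  case 0
  then show ?thesis
    using ext_along_surj[OF Q.homs[of 0] Q.surj0 Q.mods Q.mods CS] by simp
next
  case (Suc j)
  have "trivial_group (Ext T (Suc j) CS CS)"
    using semi by (simp add: semidualizing_def)
  then show ?thesis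
    unfolding Ext_trivial_iff_ext_along[OF CS CS Q Q0] Suc .
qed

lemma E_exact:
  assumes z: "z \<in> carrier (E (Suc i))"
  shows "\<delta> (Suc i) z = \<zero>\<^bsub>E (Suc (Suc i))\<^esub> \<longleftrightarrow> z \<in> \<delta> i ` carrier (E i)"
proof
  have zh: "z \<in> mod_hom T (Q (Suc i)) CS" using z by (simp add: E_iff)
  assume a: "\<delta> (Suc i) z = \<zero>\<^bsub>E (Suc (Suc i))\<^esub>"
  have z0: "z p = \<zero>\<^bsub>CS\<^esub>" if p: "p \<in> carrier (Q (Suc i))" "d i p = \<zero>\<^bsub>Q i\<^esub>" for p
  proof -
    obtain q where q: "q \<in> carrier (Q (Suc (Suc i)))" "p = d (Suc i) q"
      using Q.exact p by blast
    have "z p = \<delta> (Suc i) z q" using \<delta>_apply[OF z q(1)] q(2) by simp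
    then show ?thesis unfolding a using q(1) by (simp add: dual_simps(2))
  qed
  have "\<exists>k\<in>mod_hom T (Q i) CS. \<forall>p\<in>carrier (Q (Suc i)). k (d i p) = z p"
    using dual_exact_ext[of i] zh z0 unfolding ext_along_def by blast
  then obtain k where k: "k \<in> mod_hom T (Q i) CS" "\<And>p. p \<in> carrier (Q (Suc i)) \<Longrightarrow> k (d i p) = z p"
    by blast
  have kE: "k \<in> carrier (E i)" using k(1) by (simp add: E_iff)
  have "z = \<delta> i k"
    by (rule E_eqI[OF z \<delta>_simps(1)[OF kE]]) (simp add: \<delta>_apply[OF kE] k(2))
  then show "z \<in> \<delta> i ` carrier (E i)" using kE by blast
next
  assume "z \<in> \<delta> i ` carrier (E i)"
  then obtain g where g: "g \<in> carrier (E i)" "z = \<delta> i g" by blast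
  have gh: "g \<in> mod_hom T (Q i) CS" using g(1) by (simp add: E_iff)
  show "\<delta> (Suc i) z = \<zero>\<^bsub>E (Suc (Suc i))\<^esub>"
    by (rule E_eqI[OF \<delta>_simps(1)[OF z] mod_simps(2)[OF E]])
      (use g z Q.dd Q.dsimps(1) hom_simps(4)[OF gh Q.mods CS] in
        \<open>auto simp: \<delta>_apply dual_simps(2)\<close>)
qed

lemma \<delta>0_inj: "inj_on (\<delta> 0) (carrier (E 0))"
proof (rule inj_onI)
  fix g h assume g: "g \<in> carrier (E 0)" and h: "h \<in> carrier (E 0)" and eq: "\<delta> 0 g = \<delta> 0 h"
  show "g = h"
  proof (rule E_eqI[OF g h])
    fix p assume "p \<in> carrier (Q 0)"
    then obtain q where "q \<in> carrier (Q (Suc 0))" "p = d 0 q" using Q.surj0 by blast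
    then show "g p = h p" using \<delta>_apply[OF g, of q] \<delta>_apply[OF h, of q] eq by simp
  qed
qed

text \<open>\<open>E 0\<close> is free on \<open>idC\<close>: surjectivity of the homothety map of R
  gives each g a coordinate s g, and injectivity makes the coordinate unique, hence additive and
  R-linear in g.\<close>

lemma E0_hom:
  assumes U: "left_module R U" and u: "u \<in> carrier U"
  shows "\<exists>\<psi>\<in>mod_hom R (E 0) U. \<psi> idC = u"
proof -
  interpret U: left_module R U by (rule U)
  interpret CR: left_module R CR by (rule CR)
  have R0: "\<zero>\<^bsub>R\<^esub> \<in> carrier R" by (rule ring.ring_simprules(2)[OF ring_R])
  have "\<forall>g\<in>carrier (E 0). \<exists>r. r \<in> carrier R \<and> g = r \<odot>\<^bsub>E 0\<^esub> idC" using E0_scalar by blast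
  then obtain s where s: "\<And>g. g \<in> carrier (E 0) \<Longrightarrow> s g \<in> carrier R"
    "\<And>g. g \<in> carrier (E 0) \<Longrightarrow> g = s g \<odot>\<^bsub>E 0\<^esub> idC" by metis
  have sc: "g c = s g \<odot>\<^bsub>C\<^esub> c" if "g \<in> carrier (E 0)" "c \<in> carrier C" for g c
    using fun_cong[OF s(2)[OF that(1)], of c] that(2) by (simp add: dual_simps(4) Q0 idC_def)
  have E0: "g \<oplus>\<^bsub>E 0\<^esub> h \<in> carrier (E 0)" "r \<odot>\<^bsub>E 0\<^esub> g \<in> carrier (E 0)"
    if "g \<in> carrier (E 0)" "h \<in> carrier (E 0)" "r \<in> carrier R" for g h r
    using that mod_simps(1,5)[OF E] by blast+
  have sadd: "s (g \<oplus>\<^bsub>E 0\<^esub> h) = s g \<oplus>\<^bsub>R\<^esub> s h" if gh: "g \<in> carrier (E 0)" "h \<in> carrier (E 0)" for g h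
  proof (rule R_homothety_inj)
    fix c assume c: "c \<in> carrier C"
    have "s (g \<oplus>\<^bsub>E 0\<^esub> h) \<odot>\<^bsub>C\<^esub> c = (g \<oplus>\<^bsub>E 0\<^esub> h) c"
      by (rule sc[OF E0(1)[OF gh R0] c, symmetric])
    also have "\<dots> = s g \<odot>\<^bsub>C\<^esub> c \<oplus>\<^bsub>C\<^esub> s h \<odot>\<^bsub>C\<^esub> c"
      using c gh sc by (simp add: dual_simps(3) Q0)
    finally show "s (g \<oplus>\<^bsub>E 0\<^esub> h) \<odot>\<^bsub>C\<^esub> c = (s g \<oplus>\<^bsub>R\<^esub> s h) \<odot>\<^bsub>C\<^esub> c"
      using CR.smult_l_distr[OF s(1)[OF gh(1)] s(1)[OF gh(2)], of c] c by simp
  qed (use s(1) gh E0(1)[OF gh R0] in auto)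
  have smul: "s (r \<odot>\<^bsub>E 0\<^esub> g) = r \<otimes>\<^bsub>R\<^esub> s g" if rg: "r \<in> carrier R" "g \<in> carrier (E 0)" for r g
  proof (rule R_homothety_inj)
    fix c assume c: "c \<in> carrier C"
    have "s (r \<odot>\<^bsub>E 0\<^esub> g) \<odot>\<^bsub>C\<^esub> c = (r \<odot>\<^bsub>E 0\<^esub> g) c"
      by (rule sc[OF E0(2)[OF rg(2,2,1)] c, symmetric])
    also have "\<dots> = r \<odot>\<^bsub>C\<^esub> (s g \<odot>\<^bsub>C\<^esub> c)"
      using c rg sc by (simp add: dual_simps(4) Q0)
    finally show "s (r \<odot>\<^bsub>E 0\<^esub> g) \<odot>\<^bsub>C\<^esub> c = (r \<otimes>\<^bsub>R\<^esub> s g) \<odot>\<^bsub>C\<^esub> c"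
      using CR.smult_assoc[OF rg(1) s(1)[OF rg(2)], of c] c by simp
  qed (use s(1) rg E0(2)[OF rg(2,2,1)] in auto)
  have "(\<lambda>g\<in>carrier (E 0). s g \<odot>\<^bsub>U\<^esub> u) \<in> mod_hom R (E 0) U"
    by (intro mod_homI E)
      (use s(1) u in \<open>auto simp: sadd smul U.smult_closed U.smult_l_distr U.smult_assoc\<close>)
  moreover have "s idC = \<one>\<^bsub>R\<^esub>"
  proof (rule R_homothety_inj[OF s(1)[OF idC]])
    show "\<one>\<^bsub>R\<^esub> \<in> carrier R" by (rule ring.ring_simprules(6)[OF ring_R])
    show "s idC \<odot>\<^bsub>C\<^esub> c = \<one>\<^bsub>R\<^esub> \<odot>\<^bsub>C\<^esub> c" if "c \<in> carrier C" for c
      using sc[OF idC that] CR.smult_one that by (simp add: idC_def)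
  qed
  then have "(\<lambda>g\<in>carrier (E 0). s g \<odot>\<^bsub>U\<^esub> u) idC = u" using idC u by (simp add: U.smult_one)
  ultimately show ?thesis by (rule bexI[of "\<lambda>\<psi>. \<psi> idC = u", rotated])
qed

text \<open>In positive degrees \<open>E i\<close> is a summand of a power of C and inherits lifting
  from C. \<open>E 0\<close> is free on one generator, so there the surjectivity of \<pi> provides
  the lift.\<close>

lemma E_lifts:
  assumes U: "left_module R U" and X: "left_module R X" and \<pi>: "\<pi> \<in> mod_hom R U X"
    and surj: "\<pi> ` carrier U = carrier X" and l: "lifts R CR U X \<pi>"
  shows "lifts R (E i) U X \<pi>"
proof (cases i)
  case (Suc j)
  obtain A f where "dual_basis R S C (Q (Suc j)) A f" by (rule basis)
  then interpret dual_basis R S C "Q (Suc j)" A f .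
  show ?thesis unfolding Suc by (rule dual_lifts[OF U X \<pi> l])
next
  case 0
  show ?thesis
    unfolding 0 lifts_def
  proof
    fix \<phi> assume \<phi>: "\<phi> \<in> mod_hom R (E 0) X"
    have "\<phi> idC \<in> \<pi> ` carrier U" unfolding surj by (rule hom_simps(1)[OF \<phi> E X idC])
    then obtain u where u: "u \<in> carrier U" "\<pi> u = \<phi> idC" by auto
    obtain \<psi> where \<psi>: "\<psi> \<in> mod_hom R (E 0) U" "\<psi> idC = u" using E0_hom[OF U u(1)] by (elim bexE)
    have "\<pi> (\<psi> g) = \<phi> g" if g: "g \<in> carrier (E 0)" for g
    proof -
      obtain r where r: "r \<in> carrier R" "g = r \<odot>\<^bsub>E 0\<^esub> idC" using E0_scalar[OF g] by (elim bexE)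
      show ?thesis
        unfolding r(2) hom_simps(3)[OF \<psi>(1) E U r(1) idC] hom_simps(3)[OF \<phi> E X r(1) idC]
        using hom_simps(3)[OF \<pi> U X r(1) u(1)] \<psi>(2) u(2) by simp
    qed
    with \<psi>(1) show "\<exists>\<psi>\<in>mod_hom R (E 0) U. \<forall>z\<in>carrier (E 0). \<pi> (\<psi> z) = \<phi> z" by blast
  qed
qed

lemma E_reflexive:
  assumes h: "h \<in> mod_hom R (E i) CR"
  shows "\<exists>p\<in>carrier (Q i). \<forall>g\<in>carrier (E i). h g = g p"
proof (cases i)
  case (Suc j)
  obtain A f where "dual_basis R S C (Q (Suc j)) A f" by (rule basis)
  then interpret dual_basis R S C "Q (Suc j)" A f .
  show ?thesis using dual_reflexive h unfolding Suc by blast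
next
  case 0
  have hh: "h \<in> mod_hom R (E 0) CR" using h 0 by simp
  have c: "h idC \<in> carrier C" using hom_simps(1)[OF hh E CR idC] by simp
  have "h g = g (h idC)" if g: "g \<in> carrier (E 0)" for g
  proof -
    obtain r where r: "r \<in> carrier R" "g = r \<odot>\<^bsub>E 0\<^esub> idC" using E0_scalar[OF g] by blast
    have "h g = r \<odot>\<^bsub>C\<^esub> h idC" unfolding r(2) using hom_simps(3)[OF hh E CR r(1) idC] by simp
    then show ?thesis unfolding r(2) using c by (simp add: dual_simps(4) Q0 idC_def)
  qed
  then show ?thesis unfolding 0 using c by (intro bexI[of _ "h idC"]) (auto simp: Q0)
qed

lemma E_torsionless:
  assumes "q \<in> carrier (Q i)" "\<And>g. g \<in> carrier (E i) \<Longrightarrow> g q = \<zero>\<^bsub>C\<^esub>"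
  shows "q = \<zero>\<^bsub>Q i\<^esub>"
proof (cases i)
  case (Suc j)
  obtain A f where "dual_basis R S C (Q (Suc j)) A f" by (rule basis)
  then interpret dual_basis R S C "Q (Suc j)" A f .
  show ?thesis using dual_torsionless[of q] assms unfolding Suc by blast
next
  case 0
  then show ?thesis using assms(1) assms(2)[of idC] idC by (simp add: Q0 idC_def)
qed

text \<open>By reflexivity Hom(E, C) is again Q, which is exact. The map h is evaluation at some p.
  In positive degree h kills the image of the previous differential, so every functional vanishes at
  d p; hence d p = 0 and p = d q. In degree 0 such a q exists because \<open>d 0\<close> is onto.
  Evaluation at q is the extension.\<close>

lemma E_ext_along_C: "ext_along R (E i) (E (Suc i)) (\<delta> i) CR"
  unfolding ext_along_def
proof (intro ballI impI)
  fix h assume h: "h \<in> mod_hom R (E i) CR" and hk: "\<forall>z\<in>carrier (E i). \<delta> i z = \<zero>\<^bsub>E (Suc i)\<^esub> \<longrightarrow> h z = \<zero>\<^bsub>CR\<^esub>"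
  obtain p where p: "p \<in> carrier (Q i)" "\<And>g. g \<in> carrier (E i) \<Longrightarrow> h g = g p"
    using E_reflexive[OF h] by blast
  have "p \<in> d i ` carrier (Q (Suc i))"
  proof (cases i)
    case 0
    then show ?thesis using p(1) Q.surj0 by simp
  next
    case (Suc j)
    have pj: "p \<in> carrier (Q (Suc j))" using p(1) Suc by simp
    have "d j p = \<zero>\<^bsub>Q j\<^esub>"
    proof (rule E_torsionless[OF Q.dsimps(1)[OF pj]])
      fix g assume g: "g \<in> carrier (E j)"
      have dg: "\<delta> j g \<in> carrier (E (Suc j))" by (rule \<delta>_simps(1)[OF g])
      have "\<delta> (Suc j) (\<delta> j g) = \<zero>\<^bsub>E (Suc (Suc j))\<^esub>" using E_exact[OF dg] g by blast
      then have "h (\<delta> j g) = \<zero>\<^bsub>CR\<^esub>" using hk dg Suc by blast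
      then show "g (d j p) = \<zero>\<^bsub>C\<^esub>" using p(2)[of "\<delta> j g"] dg Suc \<delta>_apply[OF g pj] by simp
    qed
    then show ?thesis using Q.exact[OF pj] Suc by blast
  qed
  then obtain q where q: "q \<in> carrier (Q (Suc i))" "p = d i q" by blast
  show "\<exists>k\<in>mod_hom R (E (Suc i)) CR. \<forall>z\<in>carrier (E i). k (\<delta> i z) = h z"
    by (rule bexI[OF _ eval_hom[OF Q.mods q(1)]])
      (use q p(2) \<delta>_simps(1) in \<open>auto simp: \<delta>_apply\<close>)
qed

lemma CR_fg: "finitely_generated R CR" using Bfg[of 0] by (simp add: B0)

lemma E_hom_separating: "hom_separating R (E i) CR"
proof (cases i)
  case (Suc j)
  obtain A f where "dual_basis R S C (Q (Suc j)) A f" by (rule basis)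
  then interpret dual_basis R S C "Q (Suc j)" A f .
  show ?thesis unfolding Suc by (rule dual_hom_separating[OF CR_fg])
next
  case 0
  have z: "h g = \<zero>\<^bsub>CR\<^esub>" if h: "h \<in> mod_hom R (E 0) CR" and hz: "\<forall>a\<in>{idC}. h a = \<zero>\<^bsub>CR\<^esub>" and g: "g \<in> carrier (E 0)" for h g
  proof -
    obtain r where r: "r \<in> carrier R" "g = r \<odot>\<^bsub>E 0\<^esub> idC" using E0_scalar[OF g] by blast
    show ?thesis
      unfolding r(2) hom_simps(3)[OF h E CR r(1) idC] using hz mod_simps(15)[OF CR r(1)] by simp
  qed
  have i0: "{idC} \<subseteq> carrier (E 0)" using idC by simp
  show ?thesis
    unfolding 0 hom_separating_def
    by (rule exI[of _ "{idC}"], intro conjI finite.intros i0 ballI impI) (rule z)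
qed

text \<open>Elements of \<open>E i\<close> are homomorphisms out of a finitely generated module,
  coded by their values on generators. Through this coding, injective modules, which are tested
  inside \<open>'u\<close>, extend maps along the differentials of E.\<close>

lemma E_encoding:
  obtains \<iota> :: "('a \<Rightarrow> 'a) \<Rightarrow> 'a" where "inj_on \<iota> (carrier (E i))"
proof -
  obtain enc :: "'a list \<Rightarrow> 'a" where enc: "inj enc" using infinite_list_encoding[OF inf] .
  obtain A where A: "finite A" "A \<subseteq> carrier (Q i)"
    "\<forall>g\<in>mod_hom T (Q i) CS. \<forall>h\<in>mod_hom T (Q i) CS. (\<forall>a\<in>A. g a = h a) \<longrightarrow> g = h"
    using hom_separatingE[OF finitely_generated_hom_separating[OF Qfg Q.mods CS] Q.mods CS] .
  obtain xs where xs: "set xs = A" using finite_list[OF A(1)] by auto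
  have "inj_on (\<lambda>h. enc (map h xs)) (carrier (E i))"
    by (rule inj_onI, rule A(3)[rule_format]) (use xs in \<open>auto simp: E_iff inj_eq[OF enc]\<close>)
  then show thesis by (rule that)
qed

lemma B_ext_along_C: "ext_along R (B (Suc (Suc i))) (B (Suc i)) (dB (Suc i)) CR"
proof -
  have "trivial_group (Ext R (Suc i) CR CR)"
    using semi by (simp add: semidualizing_def)
  then show ?thesis unfolding Ext_trivial_iff_ext_along[OF CR CR B B0] .
qed

text \<open>Degrees start at \<open>E 0\<close>, the copy of R. The i-th condition expresses that
  Tor of C and the cotranspose of X vanishes in degree i + 1; \<open>cotorsionfree_iff_ctf\<close>
  makes the link.\<close>

definition ctf :: "nat \<Rightarrow> ('a, 'b) module \<Rightarrow> bool" where
  "ctf k X \<longleftrightarrow> (\<forall>i<k. ext_along R (E i) (E (Suc i)) (\<delta> i) X)"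

text \<open>The i-th condition is the vanishing of Ext of C and X in degree i + 1. The list starts
  at \<open>dB 1\<close> because \<open>dB 0\<close> is the augmentation onto C.\<close>

definition csph :: "nat \<Rightarrow> ('a, 'b) module \<Rightarrow> bool" where
  "csph n X \<longleftrightarrow> (\<forall>i<n. ext_along R (B (Suc (Suc i))) (B (Suc i)) (dB (Suc i)) X)"

lemma cospherical_iff_csph:
  assumes X: "left_module R X"
  shows "cospherical R C n X \<longleftrightarrow> csph n X"
proof -
  have "cospherical R C n X \<longleftrightarrow> (\<forall>i<n. trivial_group (Ext R (Suc i) CR X))"
    unfolding cospherical_def
    by (rule ball_one_to_iff)
  then show ?thesis
    unfolding csph_def Ext_trivial_iff_ext_along[OF CR X B B0] .
qed

text \<open>The middle terms \<open>W \<oplus> I\<close> of the dimension shift, with \<open>W\<close> in \<open>Add C\<close> and \<open>I\<close> injective, are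
  acyclic for both complexes.\<close>

lemma acyclic:
  assumes W: "in_Add R CR W" and I: "injective_module R I" and U: "is_prod R U W I p q"
  shows "ext_along R (E i) (E (Suc i)) (\<delta> i) U"
    and "ext_along R (B (Suc (Suc i))) (B (Suc i)) (dB (Suc i)) U"
proof -
  have LW: "left_module R W" using W unfolding in_Add_def by (rule conjunct1)
  have LI: "left_module R I" using I unfolding injective_module_def by (rule conjunct1)
  obtain \<iota> :: "('a \<Rightarrow> 'a) \<Rightarrow> 'a" where \<iota>: "inj_on \<iota> (carrier (E (Suc i)))" by (rule E_encoding)
  show "ext_along R (E i) (E (Suc i)) (\<delta> i) U"
    by (rule ext_along_prod[OF U LW LI E E \<delta>
          ext_along_in_Add[OF W CR E E \<delta> E_ext_along_C E_hom_separating]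
          ext_along_injective[OF I E E \<delta> \<iota>]])
  show "ext_along R (B (Suc (Suc i))) (B (Suc i)) (dB (Suc i)) U"
    by (rule ext_along_prod[OF U LW LI B.mods B.mods B.homs
          ext_along_in_Add[OF W CR B.mods B.mods B.homs B_ext_along_C
            finitely_generated_hom_separating[OF Bfg B.mods CR]]
          ext_along_injective[OF I B.mods B.mods B.homs inj_on_id]])
qed

end

section \<open>The dimension shift\<close>

locale shift = dual_complex +
  fixes X X' U :: "('a, 'a) module" and W I :: "('a, 'a) module" and i \<pi> p q
  assumes ses: "short_exact R X U X' i \<pi>" and X: "left_module R X" and X': "left_module R X'"
    and W: "in_Add R (left_mod C) W" and I: "injective_module R I" and U: "is_prod R U W I p q"
begin

lemma LU: "left_module R U" and \<pi>: "\<pi> \<in> mod_hom R U X'" and surj: "\<pi> ` carrier U = carrier X'"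
  using U ses by (auto simp: is_prod_def short_exact_def)

lemmas acyclic_U = acyclic[OF W I U]

lemma hs_E: "hom_shift R X U X' i \<pi> (E j) (E (Suc j)) (E (Suc (Suc j))) (\<delta> j) (\<delta> (Suc j))"
  by (intro hom_shift.intro ses X LU X' E \<delta> E_exact)

lemma hs_B: "hom_shift R X U X' i \<pi> (B (Suc (Suc j))) (B (Suc j)) (B j) (dB (Suc j)) (dB j)"
  by (intro hom_shift.intro ses X LU X' B.mods B.homs B.exact)

lemma lifts_B: "lifts R (B (Suc j)) U X' \<pi>"
  by (rule projective_lifts[OF B.proj LU X' \<pi> surj])

context
  assumes l: "lifts R CR U X' \<pi>"
begin

lemmas lifts_E = E_lifts[OF LU X' \<pi> surj l]

text \<open>Exactness for X in degree j comes from exactness for X' in degree j + 1.\<close>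

lemma ctf_kernel: "ctf (Suc k) X' \<Longrightarrow> ctf k X"
  unfolding ctf_def
  using hom_shift.ext_along_kernel[OF hs_E lifts_E acyclic_U(1)] by auto

text \<open>Degree j + 1 for X' comes from degree j for X. In degree 0 the complex E begins with an
  injection, so a map from \<open>E 0\<close> to X' is lifted to U, extended there and projected
  back.\<close>

lemma ctf_cokernel: assumes "ctf k X" shows "ctf (Suc k) X'"
  unfolding ctf_def
proof (intro allI impI)
  fix j assume j: "j < Suc k"
  show "ext_along R (E j) (E (Suc j)) (\<delta> j) X'"
  proof (cases j)
    case 0
    show ?thesis
      unfolding 0 by (rule ext_along_of_inj[OF \<pi> lifts_E acyclic_U(1) \<delta>0_inj \<delta> LU X' E E])
  next
    case (Suc m)
    then have "ext_along R (E m) (E (Suc m)) (\<delta> m) X" using assms j by (simp add: ctf_def)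
    then show ?thesis
      unfolding Suc by (rule hom_shift.ext_along_cokernel[OF hs_E lifts_E acyclic_U(1)])
  qed
qed

text \<open>Each degree for X comes from the preceding one for X'. The new lowest degree, the first
  Ext of C and X, vanishes because maps from \<open>B 0 = C\<close> to X' lift to U.\<close>

lemma csph_kernel: assumes "csph n X'" shows "csph (Suc n) X"
  unfolding csph_def
proof (intro allI impI)
  fix j assume j: "j < Suc n"
  show "ext_along R (B (Suc (Suc j))) (B (Suc j)) (dB (Suc j)) X"
  proof (cases j)
    case 0
    have "lifts R (B 0) U X' \<pi>" using l by (simp add: B0)
    moreover have "ext_along R (B (Suc 0)) (B 0) (dB 0) X'"
      by (rule ext_along_surj[OF B.homs B.surj0 B.mods B.mods X'])
    ultimately show ?thesis
      unfolding 0 by (rule hom_shift.ext_along_kernel[OF hs_B _ acyclic_U(2)])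
  next
    case (Suc m)
    then have "ext_along R (B (Suc (Suc m))) (B (Suc m)) (dB (Suc m)) X'"
      using assms j by (simp add: csph_def)
    then show ?thesis
      unfolding Suc by (rule hom_shift.ext_along_kernel[OF hs_B lifts_B acyclic_U(2)])
  qed
qed

end

text \<open>The same link read backwards: once the first Ext of C and X vanishes, maps from C to X'
  lift to U, which is what the shift along E requires.\<close>

lemma lifts_of_csph:
  assumes "csph (Suc n) X"
  shows "lifts R CR U X' \<pi>"
proof -
  have "ext_along R (B (Suc (Suc 0))) (B (Suc 0)) (dB (Suc 0)) X"
    using assms by (simp add: csph_def)
  then have "lifts R (B 0) U X' \<pi>"
    by (rule hom_shift.lifts_of_ext_along[OF hs_B lifts_B
          ext_along_surj[OF B.homs B.surj0 B.mods B.mods LU] _ B.surj0])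
  then show ?thesis by (simp add: B0)
qed

lemma csph_cokernel: "csph (Suc n) X \<Longrightarrow> csph n X'"
  unfolding csph_def
  using hom_shift.ext_along_cokernel[OF hs_B lifts_B acyclic_U(2)] by auto

end

section \<open>The cotranspose\<close>

lemma frag_induct_keys [consumes 1, case_names zero one diff]:
  assumes "Poly_Mapping.keys u \<subseteq> A" "P 0" "\<And>x. x \<in> A \<Longrightarrow> P (frag_of x)"
    and "\<And>u v. \<lbrakk>Poly_Mapping.keys u \<subseteq> A; Poly_Mapping.keys v \<subseteq> A; P u; P v\<rbrakk> \<Longrightarrow> P (u - v)"
  shows "P u"
  by (rule free_Abelian_group_induct[OF assms(1,2) assms(4,3)])

context tensor_factor
begin

lemma K_sum: "(\<And>a. a \<in> A \<Longrightarrow> t a \<in> K) \<Longrightarrow> sum t A \<in> K"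
  by (induction A rule: infinite_finite_induct) (auto intro: K_zero K_add)

lemma K_frag_zero: "p \<in> carrier P \<Longrightarrow> frag_of (p, \<zero>\<^bsub>N\<^esub>) \<in> K"
  using K_uminus[OF K_add_right[of p "\<zero>\<^bsub>N\<^esub>" "\<zero>\<^bsub>N\<^esub>"]] mod_simps(2,7)[OF N] by simp

lemma K_finsum:
  assumes "finite A" "\<And>a. a \<in> A \<Longrightarrow> t a \<in> carrier P" "x \<in> carrier N"
  shows "frag_of (\<Oplus>\<^bsub>P\<^esub>a\<in>A. t a, x) - (\<Sum>a\<in>A. frag_of (t a, x)) \<in> K"
  using assms(1,2)
proof (induction A)
  case empty
  interpret P: left_module "op_ring S" P by (rule P)
  show ?case using K_uminus[OF K_add_left[of "\<zero>\<^bsub>P\<^esub>" "\<zero>\<^bsub>P\<^esub>" x]] assms(3) by simp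
next
  case (insert a A)
  interpret P: left_module "op_ring S" P by (rule P)
  have c: "(\<Oplus>\<^bsub>P\<^esub>a\<in>A. t a) \<in> carrier P" using insert by (intro P.finsum_closed) auto
  have "(\<Oplus>\<^bsub>P\<^esub>a\<in>insert a A. t a) = t a \<oplus>\<^bsub>P\<^esub> (\<Oplus>\<^bsub>P\<^esub>a\<in>A. t a)"
    using insert by (intro P.finsum_insert) auto
  then have "frag_of (\<Oplus>\<^bsub>P\<^esub>a\<in>insert a A. t a, x) - (\<Sum>a\<in>insert a A. frag_of (t a, x)) =
    (frag_of (t a \<oplus>\<^bsub>P\<^esub> (\<Oplus>\<^bsub>P\<^esub>a\<in>A. t a), x) - frag_of (t a, x) - frag_of (\<Oplus>\<^bsub>P\<^esub>a\<in>A. t a, x))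
    + (frag_of (\<Oplus>\<^bsub>P\<^esub>a\<in>A. t a, x) - (\<Sum>a\<in>A. frag_of (t a, x)))"
    using insert by simp
  then show ?case
    using K_add[OF K_add_left[of "t a" "\<Oplus>\<^bsub>P\<^esub>a\<in>A. t a" x] insert.IH] insert.prems c assms(3) by simp
qed

end

context semidualizing_bimodule
begin

lemma star_mod_simps [simp]:
  "carrier (star_mod R C X) = mod_hom R CR X"
  "\<zero>\<^bsub>star_mod R C X\<^esub> = (\<lambda>c\<in>carrier C. \<zero>\<^bsub>X\<^esub>)"
  "g \<oplus>\<^bsub>star_mod R C X\<^esub> h = (\<lambda>c\<in>carrier C. g c \<oplus>\<^bsub>X\<^esub> h c)"
  "s \<odot>\<^bsub>star_mod R C X\<^esub> h = (\<lambda>c\<in>carrier C. h (rsmult C c s))"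
  by (simp_all add: star_mod_def Let_def hom_group_def)

lemma left_module_star:
  assumes X: "left_module R X"
  shows "left_module S (star_mod R C X)"
proof -
  interpret X: left_module R X by (rule X)
  interpret CR: left_module R CR by (rule CR)
  interpret CS: left_module T CS by (rule CS)
  note c = hom_simps(1)[OF _ CR X, simplified]
  note [simp] = C_simps mod_simps[OF X]
  show ?thesis
  proof (rule left_module_intro)
    show "ring S" by (rule ring_S)
    show "\<zero>\<^bsub>star_mod R C X\<^esub> \<in> carrier (star_mod R C X)"
      using mod_hom_zero[OF CR X] by simp
    fix g assume "g \<in> carrier (star_mod R C X)"
    then have gh: "g \<in> mod_hom R CR X" by simp
    note [simp] = hom_simps[OF gh CR X, simplified]
    have gr: "(\<lambda>c\<in>carrier C. g c) = g" using hom_simps(6)[OF gh CR X] by simp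
    show "\<zero>\<^bsub>star_mod R C X\<^esub> \<oplus>\<^bsub>star_mod R C X\<^esub> g = g" "\<one>\<^bsub>S\<^esub> \<odot>\<^bsub>star_mod R C X\<^esub> g = g"
      using CS.smult_one by (simp_all add: gr cong: restrict_cong)
    show "\<exists>h\<in>carrier (star_mod R C X). h \<oplus>\<^bsub>star_mod R C X\<^esub> g = \<zero>\<^bsub>star_mod R C X\<^esub>"
    proof (rule bexI)
      let ?h = "\<lambda>x\<in>carrier CR. (\<lambda>x\<in>carrier CR. \<zero>\<^bsub>X\<^esub>) x \<ominus>\<^bsub>X\<^esub> g x"
      show "?h \<in> carrier (star_mod R C X)"
        unfolding star_mod_simps by (rule mod_hom_diff[OF mod_hom_zero[OF CR X] gh CR X])
      show "?h \<oplus>\<^bsub>star_mod R C X\<^esub> g = \<zero>\<^bsub>star_mod R C X\<^esub>"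
        by (simp cong: restrict_cong)
    qed
    fix s assume s: "s \<in> carrier S"
    have "restrict (\<lambda>c. g (rsmult C c s)) (carrier CR) \<in> mod_hom R CR X"
      using s CS.smult_r_distr by (intro mod_homI CR) (auto simp: rsmult_smult)
    then show "s \<odot>\<^bsub>star_mod R C X\<^esub> g \<in> carrier (star_mod R C X)" by simp
  next
    fix g h assume "g \<in> carrier (star_mod R C X)" "h \<in> carrier (star_mod R C X)"
    then show "g \<oplus>\<^bsub>star_mod R C X\<^esub> h \<in> carrier (star_mod R C X)"
      using mod_hom_add[OF _ _ CR X] by simp
  next
    fix r s g assume rs: "r \<in> carrier S" "s \<in> carrier S" and g: "g \<in> carrier (star_mod R C X)"
    then have gh: "g \<in> mod_hom R CR X" by simp
    note [simp] = hom_simps[OF gh CR X, simplified]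
    show "(r \<oplus>\<^bsub>S\<^esub> s) \<odot>\<^bsub>star_mod R C X\<^esub> g = r \<odot>\<^bsub>star_mod R C X\<^esub> g \<oplus>\<^bsub>star_mod R C X\<^esub> s \<odot>\<^bsub>star_mod R C X\<^esub> g"
      using rs CS.smult_l_distr[of r s] by (simp cong: restrict_cong)
    \<comment> \<open>C is a left module over the opposite ring, where the two factors are swapped;
      hence the instance with s before r.\<close>
    show "(r \<otimes>\<^bsub>S\<^esub> s) \<odot>\<^bsub>star_mod R C X\<^esub> g = r \<odot>\<^bsub>star_mod R C X\<^esub> (s \<odot>\<^bsub>star_mod R C X\<^esub> g)"
      using rs CS.smult_assoc[of s r] by (simp cong: restrict_cong)
  qed (auto simp: c X.a_ac intro!: restrict_ext)
qed

end

section \<open>Tensoring with the cokernel of Hom(C, J0) into Hom(C, J1)\<close>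

locale cotranspose_setup = dual_complex +
  fixes J0 J1 :: "('a, 'a) module" and \<eta>
  assumes J0: "left_module R J0" and J1: "left_module R J1" and \<eta>: "\<eta> \<in> mod_hom R J0 J1"
begin

abbreviation "N0 \<equiv> star_map C \<eta> ` mod_hom R CR J0"
abbreviation "N \<equiv> quotient_module (star_mod R C J1) N0"

definition cls :: "('a \<Rightarrow> 'a) \<Rightarrow> ('a \<Rightarrow> 'a) set" where
  "cls = (\<lambda>h\<in>carrier (star_mod R C J1). N0 +>\<^bsub>star_mod R C J1\<^esub> h)"

lemmas simps = mod_simps[OF J0] mod_simps[OF J1] hom_simps[OF \<eta> J0 J1] C_simps

lemma N0_iff: "h \<in> N0 \<longleftrightarrow> (\<exists>w\<in>mod_hom R CR J0. h = (\<lambda>c\<in>carrier C. \<eta> (w c)))"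
  by (auto simp: star_map_def compose_def)

lemma N0: "submodule N0 S (star_mod R C J1)"
proof -
  note L = left_module_star[OF J0]
  note c = hom_simps(1)[OF _ CR J0, simplified]
  have "star_map C \<eta> = (\<lambda>h. \<lambda>c\<in>carrier C. \<eta> (h c))"
    by (simp add: star_map_def compose_def fun_eq_iff)
  moreover have "restrict (\<lambda>h. \<lambda>c\<in>carrier C. \<eta> (h c)) (carrier (star_mod R C J0))
      \<in> mod_hom S (star_mod R C J0) (star_mod R C J1)"
    using mod_hom_compose[OF _ \<eta> CR J0 J1]
    by (intro mod_homI L) (auto simp: simps c intro!: restrict_ext)
  ultimately show ?thesis
    using submodule_image[OF _ L left_module_star[OF J1], of "restrict (\<lambda>h. \<lambda>c\<in>carrier C. \<eta> (h c)) (carrier (star_mod R C J0))"]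
    by simp
qed

lemma N: "left_module S N" and cls_hom: "cls \<in> mod_hom S (star_mod R C J1) N"
  and cls_surj: "cls ` mod_hom R CR J1 = carrier N"
  and cls_zero: "h \<in> mod_hom R CR J1 \<Longrightarrow> cls h = \<zero>\<^bsub>N\<^esub> \<longleftrightarrow> h \<in> N0"
  using quotient_module_props[OF left_module_star[OF J1] N0] by (simp_all add: cls_def)

lemma cls_simps:
  shows "h \<in> mod_hom R CR J1 \<Longrightarrow> cls h \<in> carrier N"
    and "\<lbrakk>h \<in> mod_hom R CR J1; k \<in> mod_hom R CR J1\<rbrakk> \<Longrightarrow> cls (h \<oplus>\<^bsub>star_mod R C J1\<^esub> k) = cls h \<oplus>\<^bsub>N\<^esub> cls k"
    and "\<lbrakk>s \<in> carrier S; h \<in> mod_hom R CR J1\<rbrakk> \<Longrightarrow> cls (s \<odot>\<^bsub>star_mod R C J1\<^esub> h) = s \<odot>\<^bsub>N\<^esub> cls h"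
  using hom_simps(1-3)[OF cls_hom left_module_star[OF J1] N] unfolding star_mod_simps(1) by blast+

text \<open>A mere choice of representatives, neither additive nor S-linear in X. The errors factor
  through \<eta>, which is why the pairing below is well defined only up to
  \<open>in_L\<close>.\<close>

definition rep :: "('a \<Rightarrow> 'a) set \<Rightarrow> 'a \<Rightarrow> 'a" where
  "rep X = (SOME h. h \<in> mod_hom R CR J1 \<and> cls h = X)"

lemma rep:
  assumes "X \<in> carrier N"
  shows "rep X \<in> mod_hom R CR J1" and "cls (rep X) = X"
proof -
  have "X \<in> cls ` mod_hom R CR J1" unfolding cls_surj by (rule assms)
  then have "\<exists>h. h \<in> mod_hom R CR J1 \<and> cls h = X" by auto
  then have "rep X \<in> mod_hom R CR J1 \<and> cls (rep X) = X" unfolding rep_def by (rule someI_ex)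
  then show "rep X \<in> mod_hom R CR J1" and "cls (rep X) = X" by auto
qed

lemma rep_simps:
  assumes "X \<in> carrier N"
  shows "c \<in> carrier C \<Longrightarrow> rep X c \<in> carrier J1"
    and "\<lbrakk>c \<in> carrier C; c' \<in> carrier C\<rbrakk> \<Longrightarrow> rep X (c \<oplus>\<^bsub>C\<^esub> c') = rep X c \<oplus>\<^bsub>J1\<^esub> rep X c'"
  using hom_simps[OF rep(1)[OF assms] CR J1] by simp_all

lemma cls_eqD:
  assumes h: "h \<in> mod_hom R CR J1" and k: "k \<in> mod_hom R CR J1" and eq: "cls h = cls k"
  obtains w where "w \<in> mod_hom R CR J0" "\<And>c. c \<in> carrier C \<Longrightarrow> h c = k c \<oplus>\<^bsub>J1\<^esub> \<eta> (w c)"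
proof -
  interpret J1: left_module R J1 by (rule J1)
  note c = hom_simps(1)[OF h CR J1, simplified] hom_simps(1)[OF k CR J1, simplified]
  define t where "t = (\<lambda>c\<in>carrier CR. h c \<ominus>\<^bsub>J1\<^esub> k c)"
  have t: "t \<in> mod_hom R CR J1" unfolding t_def by (rule mod_hom_diff[OF h k CR J1])
  have "h = k \<oplus>\<^bsub>star_mod R C J1\<^esub> t"
  proof (rule mod_hom_eqI[OF h])
    show "k \<oplus>\<^bsub>star_mod R C J1\<^esub> t \<in> mod_hom R CR J1" using mod_hom_add[OF k t CR J1] by simp
    fix x assume "x \<in> carrier CR"
    then show "h x = (k \<oplus>\<^bsub>star_mod R C J1\<^esub> t) x"
      using mod_simps(11)[OF J1, of "h x" "k x"] c by (simp add: t_def mod_comm[OF J1, of "k x"] simps)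
  qed
  then have "cls h = cls k \<oplus>\<^bsub>N\<^esub> cls t" using cls_simps(2)[OF k t] by simp
  then have "cls t = \<zero>\<^bsub>N\<^esub>"
    using mod_simps(13)[OF N cls_simps(1)[OF k] cls_simps(1)[OF t]]
      mod_simps(9)[OF N cls_simps(1)[OF k]] eq by simp
  then have "t \<in> N0" using cls_zero[OF t] by simp
  then obtain w where w: "w \<in> mod_hom R CR J0" "t = (\<lambda>c\<in>carrier C. \<eta> (w c))"
    unfolding N0_iff by (elim bexE)
  have "h c = k c \<oplus>\<^bsub>J1\<^esub> \<eta> (w c)" if "c \<in> carrier C" for c
  proof -
    have "\<eta> (w c) = h c \<ominus>\<^bsub>J1\<^esub> k c" using fun_cong[OF w(2), of c] that by (simp add: t_def)
    then show ?thesis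
      using mod_simps(11)[OF J1, of "h c" "k c"] c that by (simp add: mod_comm[OF J1, of "k c"] simps)
  qed
  from that[OF w(1) this] show thesis .
qed

text \<open>For finitely generated projective \<open>P\<close>, \<open>P \<otimes> X\<^sub>*\<close> is \<open>Hom\<^sub>R(Hom\<^sub>S(P, C), X)\<close>. A pairing
  is this comparison map on representatives, well defined up to \<open>in_L\<close>.\<close>

definition is_pairing :: "('a, 'a) module \<Rightarrow> (('a \<times> ('a \<Rightarrow> 'a) set \<Rightarrow>\<^sub>0 int) \<Rightarrow> ('a \<Rightarrow> 'a) \<Rightarrow> 'a) \<Rightarrow> bool" where
  "is_pairing P \<beta> \<longleftrightarrow>
    (\<forall>u. Poly_Mapping.keys u \<subseteq> carrier P \<times> carrier N \<longrightarrow> \<beta> u \<in> mod_hom R (dual P) J1) \<and>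
    (\<forall>u v. Poly_Mapping.keys u \<subseteq> carrier P \<times> carrier N \<longrightarrow> Poly_Mapping.keys v \<subseteq> carrier P \<times> carrier N \<longrightarrow>
       (\<forall>g\<in>carrier (dual P). \<beta> (u - v) g = \<beta> u g \<ominus>\<^bsub>J1\<^esub> \<beta> v g)) \<and>
    (\<forall>p\<in>carrier P. \<forall>X\<in>carrier N. \<forall>g\<in>carrier (dual P). \<beta> (frag_of (p, X)) g = rep X (g p))"

text \<open>The homomorphisms to be divided out: for finitely generated projective P, right
  exactness of the tensor product presents \<open>P \<otimes> N\<close> as Hom(dual P, J1) modulo
  these.\<close>

definition in_L :: "('a, 'a) module \<Rightarrow> (('a \<Rightarrow> 'a) \<Rightarrow> 'a) \<Rightarrow> bool" where
  "in_L P h \<longleftrightarrow> (\<exists>\<omega>\<in>mod_hom R (dual P) J0. \<forall>g\<in>carrier (dual P). h g = \<eta> (\<omega> g))"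

lemma dual_apply: "\<lbrakk>left_module T P; g \<in> carrier (dual P); p \<in> carrier P\<rbrakk> \<Longrightarrow> g p \<in> carrier C"
  using hom_simps(1)[OF _ _ CS, of g P p] by (simp add: dual_simps)

text \<open>The group of formal sums is free on the pairs, so it suffices to send (p, X) to
  evaluation at p followed by the representative of X.\<close>

lemma pairing_exists:
  assumes P: "left_module T P"
  obtains \<beta> where "is_pairing P \<beta>"
proof -
  let ?F = "free_Abelian_group (carrier P \<times> carrier N)"
  note D = left_module_dual[OF P]
  interpret H: comm_group "hom_group R (dual P) J1" by (rule comm_group_hom_group[OF D J1])
  define b where "b = (\<lambda>(p, X). \<lambda>g\<in>carrier (dual P). rep X ((\<lambda>g\<in>carrier (dual P). g p) g))"
  have "b z \<in> mod_hom R (dual P) J1" if "z \<in> carrier P \<times> carrier N" for z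
    using that mod_hom_compose[OF eval_hom[OF P] rep(1) D CR J1] by (auto simp: b_def)
  then have "b ` (carrier P \<times> carrier N) \<subseteq> carrier (hom_group R (dual P) J1)"
    by (auto simp: hom_group_def)
  then obtain \<beta> where \<beta>: "\<beta> \<in> hom ?F (hom_group R (dual P) J1)"
    "\<And>z. z \<in> carrier P \<times> carrier N \<Longrightarrow> \<beta> (frag_of z) = b z"
    using H.free_Abelian_group_universal by metis
  have c: "\<beta> u \<in> mod_hom R (dual P) J1" if "Poly_Mapping.keys u \<subseteq> carrier P \<times> carrier N" for u
    using hom_in_carrier[OF \<beta>(1), of u] that by (simp add: hom_group_def)
  have "\<beta> (u - v) g = \<beta> u g \<ominus>\<^bsub>J1\<^esub> \<beta> v g"
    if u: "Poly_Mapping.keys u \<subseteq> carrier P \<times> carrier N" and v: "Poly_Mapping.keys v \<subseteq> carrier P \<times> carrier N"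
      and g: "g \<in> carrier (dual P)" for u v g
  proof -
    note uv = keys_Times_diff(1)[OF u v]
    have "\<beta> u = \<beta> (u - v) \<otimes>\<^bsub>hom_group R (dual P) J1\<^esub> \<beta> v"
      using hom_mult[OF \<beta>(1), of "u - v" v] uv v by simp
    then have "\<beta> u g = \<beta> (u - v) g \<oplus>\<^bsub>J1\<^esub> \<beta> v g" using g by (simp add: hom_group_def)
    then show ?thesis
      using mod_simps(12)[OF J1 hom_simps(1)[OF c[OF uv] D J1 g] hom_simps(1)[OF c[OF v] D J1 g]] by simp
  qed
  with c \<beta>(2) have "is_pairing P \<beta>" unfolding is_pairing_def by (auto simp: b_def)
  then show thesis by (rule that)
qed

lemma L_zero:
  assumes "left_module T P" "\<And>g. g \<in> carrier (dual P) \<Longrightarrow> m g = \<zero>\<^bsub>J1\<^esub>"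
  shows "in_L P m"
  unfolding in_L_def
  by (rule bexI[OF _ mod_hom_zero[OF left_module_dual[OF assms(1)] J0]]) (simp add: assms(2) simps)

lemma L_diff:
  assumes P: "left_module T P" and "in_L P h" "in_L P k"
    and m: "\<And>g. g \<in> carrier (dual P) \<Longrightarrow> m g = h g \<ominus>\<^bsub>J1\<^esub> k g"
  shows "in_L P m"
proof -
  note D = left_module_dual[OF P]
  obtain w v where w: "w \<in> mod_hom R (dual P) J0" "\<forall>g\<in>carrier (dual P). h g = \<eta> (w g)"
    and v: "v \<in> mod_hom R (dual P) J0" "\<forall>g\<in>carrier (dual P). k g = \<eta> (v g)"
    using assms(2,3) unfolding in_L_def by blast
  show ?thesis
    unfolding in_L_def
    by (rule bexI[OF _ mod_hom_diff[OF w(1) v(1) D J0]])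
      (use m w(2) v(2) hom_simps(1)[OF w(1) D J0] hom_simps(1)[OF v(1) D J0] in \<open>simp add: simps\<close>)
qed

lemma L_eval:
  assumes P: "left_module T P" and p: "p \<in> carrier P" and w: "w \<in> mod_hom R CR J0"
    and m: "\<And>g. g \<in> carrier (dual P) \<Longrightarrow> m g = \<eta> (w (g p))"
  shows "in_L P m"
  unfolding in_L_def
  by (rule bexI[OF _ mod_hom_compose[OF eval_hom[OF P p] w left_module_dual[OF P] CR J0]]) (simp add: m)

context
  fixes P \<beta>
  assumes P: "left_module T P" and \<beta>: "is_pairing P \<beta>"
begin

interpretation TP: tensor_factor S P N by (rule tensor_factor.intro[OF P N])

lemma pairing_hom: "Poly_Mapping.keys u \<subseteq> carrier P \<times> carrier N \<Longrightarrow> \<beta> u \<in> mod_hom R (dual P) J1"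
  by (rule conjunct1[OF \<beta>[unfolded is_pairing_def], rule_format])

lemma pairing_diff: "\<lbrakk>Poly_Mapping.keys u \<subseteq> carrier P \<times> carrier N; Poly_Mapping.keys v \<subseteq> carrier P \<times> carrier N;
    g \<in> carrier (dual P)\<rbrakk> \<Longrightarrow> \<beta> (u - v) g = \<beta> u g \<ominus>\<^bsub>J1\<^esub> \<beta> v g"
  by (rule conjunct1[OF conjunct2[OF \<beta>[unfolded is_pairing_def]], rule_format])

lemma pairing_frag: "\<lbrakk>p \<in> carrier P; X \<in> carrier N; g \<in> carrier (dual P)\<rbrakk> \<Longrightarrow> \<beta> (frag_of (p, X)) g = rep X (g p)"
  by (rule conjunct2[OF conjunct2[OF \<beta>[unfolded is_pairing_def]], rule_format])

lemma pairing_closed: "\<lbrakk>Poly_Mapping.keys u \<subseteq> carrier P \<times> carrier N; g \<in> carrier (dual P)\<rbrakk> \<Longrightarrow> \<beta> u g \<in> carrier J1"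
  by (rule hom_simps(1)[OF pairing_hom left_module_dual[OF P] J1])

lemma pairing_zero: "g \<in> carrier (dual P) \<Longrightarrow> \<beta> 0 g = \<zero>\<^bsub>J1\<^esub>"
  using pairing_diff[of 0 0 g] pairing_closed[of 0 g] by (simp add: simps)

lemma pairing_add:
  assumes u: "Poly_Mapping.keys u \<subseteq> carrier P \<times> carrier N" and v: "Poly_Mapping.keys v \<subseteq> carrier P \<times> carrier N"
    and g: "g \<in> carrier (dual P)"
  shows "\<beta> (u + v) g = \<beta> u g \<oplus>\<^bsub>J1\<^esub> \<beta> v g"
  using pairing_diff[OF keys_Times_diff(2)[OF u v] v g]
    mod_simps(11)[OF J1 pairing_closed[OF keys_Times_diff(2)[OF u v] g] pairing_closed[OF v g]] by simp

text \<open>Additivity in the first variable holds exactly, each \<open>rep X\<close> being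
  additive. Additivity in the second variable and balancing hold up to a map through \<eta>, since
  there different representatives of the same class are compared.\<close>

lemma pairing_relations:
  assumes "u \<in> tensor_subgroup S P N"
  shows "in_L P (\<beta> u)"
  using assms
proof (induction rule: TP.K_induct)
  case zero
  show ?case by (rule L_zero[OF P pairing_zero])
next
  case (plus u v)
  \<comment> \<open>\<open>L_diff\<close> handles differences, so u + v is read as u - (0 -
    v).\<close>
  show ?case
  proof (rule L_diff[OF P plus(3) L_diff[OF P L_zero[OF P] plus(4)]])
    fix g assume g: "g \<in> carrier (dual P)"
    show "\<beta> (u + v) g = \<beta> u g \<ominus>\<^bsub>J1\<^esub> (\<zero>\<^bsub>J1\<^esub> \<ominus>\<^bsub>J1\<^esub> \<beta> v g)"
    proof -
      have "\<beta> (u - (0 - v)) g = \<beta> u g \<ominus>\<^bsub>J1\<^esub> \<beta> (0 - v) g"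
        using TP.K_keys plus(1,2) by (intro pairing_diff g) auto
      also have "\<beta> (0 - v) g = \<zero>\<^bsub>J1\<^esub> \<ominus>\<^bsub>J1\<^esub> \<beta> v g"
        using pairing_diff[OF _ TP.K_keys[OF plus(2)] g, of 0] pairing_zero[OF g] by simp
      finally show ?thesis by simp
    qed
  qed auto
next
  case (minus u)
  show ?case
    by (rule L_diff[OF P L_zero[OF P pairing_zero] minus(2)])
      (use pairing_diff[OF _ TP.K_keys[OF minus(1)], of 0] in auto)
next
  case (add_left p q X)
  show ?case
  proof (rule L_zero[OF P])
    fix g assume g: "g \<in> carrier (dual P)"
    then have gh: "g \<in> mod_hom T P CS" by (simp add: dual_simps)
    have gp: "g p \<in> carrier C" "g q \<in> carrier C" using dual_apply[OF P g] add_left by auto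
    have k: "Poly_Mapping.keys (frag_of (p', X)) \<subseteq> carrier P \<times> carrier N" if "p' \<in> carrier P" for p'
      using that add_left by simp
    have "g (p \<oplus>\<^bsub>P\<^esub> q) = g p \<oplus>\<^bsub>C\<^esub> g q" using hom_simps(2)[OF gh P CS] add_left by simp
    then show "\<beta> (frag_of (p \<oplus>\<^bsub>P\<^esub> q, X) - frag_of (p, X) - frag_of (q, X)) g = \<zero>\<^bsub>J1\<^esub>"
      using add_left g gp k rep_simps[OF add_left(3)] mod_simps(1)[OF P]
      by (simp add: pairing_diff keys_Times_diff pairing_frag simps)
  qed
next
  case (add_right p X Y)
  have XY: "X \<oplus>\<^bsub>N\<^esub> Y \<in> carrier N" using mod_simps(1)[OF N] add_right by simp
  have sum: "rep X \<oplus>\<^bsub>star_mod R C J1\<^esub> rep Y \<in> mod_hom R CR J1"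
    using mod_simps(1)[OF left_module_star[OF J1], of "rep X" "rep Y"] rep(1) add_right
    unfolding star_mod_simps(1) by blast
  have eq: "cls (rep (X \<oplus>\<^bsub>N\<^esub> Y)) = cls (rep X \<oplus>\<^bsub>star_mod R C J1\<^esub> rep Y)"
    using rep(2)[OF XY] rep add_right by (subst cls_simps(2)) auto
  obtain w where w: "w \<in> mod_hom R CR J0"
    "\<And>c. c \<in> carrier C \<Longrightarrow> rep (X \<oplus>\<^bsub>N\<^esub> Y) c = (rep X \<oplus>\<^bsub>star_mod R C J1\<^esub> rep Y) c \<oplus>\<^bsub>J1\<^esub> \<eta> (w c)"
    by (rule cls_eqD[OF rep(1)[OF XY] sum eq]) (rule that; assumption)
  show ?case
  proof (rule L_eval[OF P add_right(1) w(1)])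
    fix g assume g: "g \<in> carrier (dual P)"
    have gp: "g p \<in> carrier C" using dual_apply[OF P g] add_right by auto
    have wc: "w (g p) \<in> carrier J0" using hom_simps(1)[OF w(1) CR J0] gp by simp
    have k: "Poly_Mapping.keys (frag_of (p, X')) \<subseteq> carrier P \<times> carrier N" if "X' \<in> carrier N" for X'
      using that add_right by simp
    have "rep (X \<oplus>\<^bsub>N\<^esub> Y) (g p) = rep X (g p) \<oplus>\<^bsub>J1\<^esub> (rep Y (g p) \<oplus>\<^bsub>J1\<^esub> \<eta> (w (g p)))"
      using w(2)[OF gp] gp rep_simps(1) add_right wc by (simp add: mod_assoc[OF J1] simps)
    then have "\<beta> (frag_of (p, X \<oplus>\<^bsub>N\<^esub> Y) - frag_of (p, X) - frag_of (p, Y)) g =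
        (rep X (g p) \<oplus>\<^bsub>J1\<^esub> (rep Y (g p) \<oplus>\<^bsub>J1\<^esub> \<eta> (w (g p)))) \<ominus>\<^bsub>J1\<^esub> rep X (g p) \<ominus>\<^bsub>J1\<^esub> rep Y (g p)"
      using add_right g k XY by (simp add: pairing_diff keys_Times_diff pairing_frag)
    then show "\<beta> (frag_of (p, X \<oplus>\<^bsub>N\<^esub> Y) - frag_of (p, X) - frag_of (p, Y)) g = \<eta> (w (g p))"
      using add_right gp wc rep_simps(1) by (simp add: simps)
  qed
next
  case (smult s p X)
  have sX: "s \<odot>\<^bsub>N\<^esub> X \<in> carrier N" using mod_simps(5)[OF N] smult by simp
  have sr: "s \<odot>\<^bsub>star_mod R C J1\<^esub> rep X \<in> mod_hom R CR J1"
    using mod_simps(5)[OF left_module_star[OF J1], of s "rep X"] rep(1) smult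
    unfolding star_mod_simps(1) by blast
  have eq: "cls (s \<odot>\<^bsub>star_mod R C J1\<^esub> rep X) = cls (rep (s \<odot>\<^bsub>N\<^esub> X))"
    using rep(2)[OF sX] rep smult by (subst cls_simps(3)) auto
  obtain w where w: "w \<in> mod_hom R CR J0"
    "\<And>c. c \<in> carrier C \<Longrightarrow> (s \<odot>\<^bsub>star_mod R C J1\<^esub> rep X) c = rep (s \<odot>\<^bsub>N\<^esub> X) c \<oplus>\<^bsub>J1\<^esub> \<eta> (w c)"
    by (rule cls_eqD[OF sr rep(1)[OF sX] eq]) (rule that; assumption)
  show ?case
  proof (rule L_eval[OF P smult(2) w(1)])
    fix g assume g: "g \<in> carrier (dual P)"
    then have gh: "g \<in> mod_hom T P CS" by (simp add: dual_simps)
    have gp: "g p \<in> carrier C" using dual_apply[OF P g] smult by auto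
    have wc: "w (g p) \<in> carrier J0" using hom_simps(1)[OF w(1) CR J0] gp by simp
    have "g (s \<odot>\<^bsub>P\<^esub> p) = rsmult C (g p) s" using hom_simps(3)[OF gh P CS] smult by simp
    then have "\<beta> (frag_of (s \<odot>\<^bsub>P\<^esub> p, X) - frag_of (p, s \<odot>\<^bsub>N\<^esub> X)) g =
        rep X (rsmult C (g p) s) \<ominus>\<^bsub>J1\<^esub> rep (s \<odot>\<^bsub>N\<^esub> X) (g p)"
      using smult g sX mod_simps(5)[OF P] by (simp add: pairing_diff pairing_frag)
    also have "rep X (rsmult C (g p) s) = rep (s \<odot>\<^bsub>N\<^esub> X) (g p) \<oplus>\<^bsub>J1\<^esub> \<eta> (w (g p))"
      using w(2)[OF gp] gp by simp
    finally show "\<beta> (frag_of (s \<odot>\<^bsub>P\<^esub> p, X) - frag_of (p, s \<odot>\<^bsub>N\<^esub> X)) g = \<eta> (w (g p))"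
      using rep_simps(1)[OF sX gp] wc by (simp add: simps)
  qed
qed

lemma pairing_sum:
  assumes "finite A" "\<And>a. a \<in> A \<Longrightarrow> a \<in> carrier P" "\<And>a. a \<in> A \<Longrightarrow> Y a \<in> carrier N" and g: "g \<in> carrier (dual P)"
  shows "Poly_Mapping.keys (\<Sum>a\<in>A. frag_of (a, Y a)) \<subseteq> carrier P \<times> carrier N"
    and "\<beta> (\<Sum>a\<in>A. frag_of (a, Y a)) g = (\<Oplus>\<^bsub>J1\<^esub>a\<in>A. rep (Y a) (g a))"
proof -
  interpret J1: left_module R J1 by (rule J1)
  have "Poly_Mapping.keys (\<Sum>a\<in>A. frag_of (a, Y a)) \<subseteq> carrier P \<times> carrier N \<and>
    \<beta> (\<Sum>a\<in>A. frag_of (a, Y a)) g = (\<Oplus>\<^bsub>J1\<^esub>a\<in>A. rep (Y a) (g a))"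
    using assms(1-3)
  proof (induction A)
    case empty
    then show ?case using pairing_zero[OF g] by simp
  next
    case (insert a A)
    then have IH: "Poly_Mapping.keys (\<Sum>a\<in>A. frag_of (a, Y a)) \<subseteq> carrier P \<times> carrier N"
      "\<beta> (\<Sum>a\<in>A. frag_of (a, Y a)) g = (\<Oplus>\<^bsub>J1\<^esub>a\<in>A. rep (Y a) (g a))" by auto
    have k: "Poly_Mapping.keys (frag_of (a, Y a)) \<subseteq> carrier P \<times> carrier N" using insert by simp
    have rc: "rep (Y b) (g b) \<in> carrier J1" if "b \<in> insert a A" for b
      using that insert.prems by (intro rep_simps(1) dual_apply[OF P g])
    show ?case
      using insert keys_Times_diff(2)[OF k IH(1)] pairing_add[OF k IH(1) g] IH(2) pairing_frag[OF _ _ g] rc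
      by (simp add: J1.finsum_insert Pi_def)
  qed
  then show "Poly_Mapping.keys (\<Sum>a\<in>A. frag_of (a, Y a)) \<subseteq> carrier P \<times> carrier N"
    and "\<beta> (\<Sum>a\<in>A. frag_of (a, Y a)) g = (\<Oplus>\<^bsub>J1\<^esub>a\<in>A. rep (Y a) (g a))" by auto
qed

end

text \<open>This carries the differential of \<open>Q \<otimes> N\<close> over to composition with
  the differential of the dual complex. Both sides respect differences in u and agree on
  generators.\<close>

lemma pairing_natural:
  assumes P: "left_module T P" and P': "left_module T P'" and \<beta>: "is_pairing P \<beta>" and \<beta>': "is_pairing P' \<beta>'"
    and h: "h \<in> mod_hom T P P'" and u: "Poly_Mapping.keys u \<subseteq> carrier P \<times> carrier N"
    and g: "g \<in> carrier (dual P')"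
  shows "\<beta>' (push h u) g = \<beta> u (dual_map P P' h g)"
proof -
  have dg: "dual_map P P' h g \<in> carrier (dual P)"
    by (rule hom_simps(1)[OF dual_map_hom[OF P P' h] left_module_dual[OF P'] left_module_dual[OF P] g])
  have hc: "h p \<in> carrier P'" if "p \<in> carrier P" for p by (rule hom_simps(1)[OF h P P' that])
  from u show ?thesis
  proof (induction u rule: frag_induct_keys)
    case zero
    then show ?case by (simp add: pairing_zero[OF P \<beta> dg] pairing_zero[OF P' \<beta>' g])
  next
    case (one x)
    then show ?case
      using g hc by (auto simp: pairing_frag[OF P \<beta> _ _ dg] pairing_frag[OF P' \<beta>' _ _ g]) (simp add: dual_map_def)
  next
    case (diff u v)
    have "\<beta>' (push h u - push h v) g = \<beta>' (push h u) g \<ominus>\<^bsub>J1\<^esub> \<beta>' (push h v) g"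
      by (rule pairing_diff[OF P' \<beta>' keys_push[OF diff(1) hc] keys_push[OF diff(2) hc] g])
    then show ?case by (simp add: pairing_diff[OF P \<beta> diff(1,2) dg] diff(3,4))
  qed
qed

end

section \<open>The inverse of the pairing from a dual basis\<close>

locale cotranspose_basis = cotranspose_setup +
  fixes P :: "('a, 'a) module" and A f \<beta>
  assumes basis: "dual_basis R S C P A f" and \<beta>: "is_pairing P \<beta>"
begin

sublocale DB: dual_basis R S C P A f by (rule basis)
sublocale TP: tensor_factor S P N by (rule tensor_factor.intro[OF DB.P N])

lemmas D = left_module_dual[OF DB.P]

text \<open>Inverse to the pairing: h is cut into its components on the copies of C embedded by
  \<open>emb a\<close>, and the class of the component at a is tensored with the basis element a.
  Sums are respected only modulo the tensor relations.\<close>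

definition \<gamma> :: "(('a \<Rightarrow> 'a) \<Rightarrow> 'a) \<Rightarrow> 'a \<times> ('a \<Rightarrow> 'a) set \<Rightarrow>\<^sub>0 int" where
  "\<gamma> h = (\<Sum>a\<in>A. frag_of (a, cls (\<lambda>c\<in>carrier C. h (DB.emb a c))))"

lemma comp_emb: "\<lbrakk>h \<in> mod_hom R (dual P) J1; a \<in> A\<rbrakk> \<Longrightarrow> (\<lambda>c\<in>carrier C. h (DB.emb a c)) \<in> mod_hom R CR J1"
  using mod_hom_compose[OF DB.emb_hom _ CR D J1] by simp

lemma emb_closed: "\<lbrakk>a \<in> A; c \<in> carrier C\<rbrakk> \<Longrightarrow> DB.emb a c \<in> carrier (dual P)"
  using hom_simps(1)[OF DB.emb_hom CR D] by simp

lemma cls_comp_emb: "\<lbrakk>h \<in> mod_hom R (dual P) J1; a \<in> A\<rbrakk> \<Longrightarrow> cls (\<lambda>c\<in>carrier C. h (DB.emb a c)) \<in> carrier N"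
  by (rule cls_simps(1)[OF comp_emb])

lemma \<gamma>_keys: "h \<in> mod_hom R (dual P) J1 \<Longrightarrow> Poly_Mapping.keys (\<gamma> h) \<subseteq> carrier P \<times> carrier N"
  unfolding \<gamma>_def
  by (rule pairing_sum(1)[OF DB.P \<beta> DB.fin DB.Ac cls_comp_emb mod_simps(2)[OF D]])

lemma \<gamma>_diff:
  assumes h: "h \<in> mod_hom R (dual P) J1" and k: "k \<in> mod_hom R (dual P) J1" and m: "m \<in> mod_hom R (dual P) J1"
    and eq: "\<And>g. g \<in> carrier (dual P) \<Longrightarrow> m g = h g \<ominus>\<^bsub>J1\<^esub> k g"
  shows "\<gamma> m - (\<gamma> h - \<gamma> k) \<in> tensor_subgroup S P N"
proof -
  let ?c = "\<lambda>h a. cls (\<lambda>c\<in>carrier C. h (DB.emb a c))"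
  have "frag_of (a, ?c h a) - frag_of (a, ?c m a) - frag_of (a, ?c k a) \<in> tensor_subgroup S P N" if a: "a \<in> A" for a
  proof -
    have "(\<lambda>c\<in>carrier C. h (DB.emb a c)) =
        (\<lambda>c\<in>carrier C. m (DB.emb a c)) \<oplus>\<^bsub>star_mod R C J1\<^esub> (\<lambda>c\<in>carrier C. k (DB.emb a c))"
      using emb_closed[OF a] hom_simps(1)[OF h D J1] hom_simps(1)[OF k D J1] mod_simps(11)[OF J1]
      by (auto simp: eq intro!: restrict_ext)
    then have "?c h a = ?c m a \<oplus>\<^bsub>N\<^esub> ?c k a"
      using cls_simps(2)[OF comp_emb[OF m a] comp_emb[OF k a]] by simp
    then show ?thesis
      using TP.K_add_right[OF DB.Ac[OF a] cls_comp_emb[OF m a] cls_comp_emb[OF k a]] by simp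
  qed
  then have "(\<Sum>a\<in>A. frag_of (a, ?c h a) - frag_of (a, ?c m a) - frag_of (a, ?c k a)) \<in> tensor_subgroup S P N"
    by (rule TP.K_sum)
  from TP.K_uminus[OF this] show ?thesis by (simp add: \<gamma>_def sum_subtractf sum.distrib algebra_simps)
qed

text \<open>If h factors through \<eta>, so does each of its components. Their classes in N are then
  zero, and a tensored with 0 is a relation.\<close>

lemma \<gamma>_L:
  assumes h: "h \<in> mod_hom R (dual P) J1" and L: "in_L P h"
  shows "\<gamma> h \<in> tensor_subgroup S P N"
  unfolding \<gamma>_def
proof (rule TP.K_sum)
  fix a assume a: "a \<in> A"
  obtain \<omega> where \<omega>: "\<omega> \<in> mod_hom R (dual P) J0" "\<And>g. g \<in> carrier (dual P) \<Longrightarrow> h g = \<eta> (\<omega> g)"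
    using L unfolding in_L_def by blast
  have w: "(\<lambda>c\<in>carrier CR. \<omega> (DB.emb a c)) \<in> mod_hom R CR J0"
    by (rule mod_hom_compose[OF DB.emb_hom[OF a] \<omega>(1) CR D J0])
  have "(\<lambda>c\<in>carrier C. h (DB.emb a c)) \<in> N0"
    unfolding N0_iff by (rule bexI[OF _ w]) (use emb_closed[OF a] \<omega>(2) in \<open>auto intro!: restrict_ext\<close>)
  then have "cls (\<lambda>c\<in>carrier C. h (DB.emb a c)) = \<zero>\<^bsub>N\<^esub>" using cls_zero[OF comp_emb[OF h a]] by simp
  then show "frag_of (a, cls (\<lambda>c\<in>carrier C. h (DB.emb a c))) \<in> tensor_subgroup S P N"
    using TP.K_frag_zero[OF DB.Ac[OF a]] by simp
qed

text \<open>For a generator (p, X) the component at a has the class f_a(p) X. By balancing, the sum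
  of a \<otimes> f_a(p) X is the sum of a f_a(p) \<otimes> X, and the dual basis identity collapses
  this to p \<otimes> X.\<close>

lemma \<gamma>_pairing:
  assumes "Poly_Mapping.keys u \<subseteq> carrier P \<times> carrier N"
  shows "\<gamma> (\<beta> u) - u \<in> tensor_subgroup S P N"
  using assms
proof (induction u rule: frag_induct_keys)
  case zero
  have "\<gamma> (\<beta> 0) \<in> tensor_subgroup S P N"
    by (rule \<gamma>_L[OF pairing_hom[OF DB.P \<beta>] L_zero[OF DB.P pairing_zero[OF DB.P \<beta>]]]) auto
  then show ?case by simp
next
  case (diff u v)
  note p = pairing_hom[OF DB.P \<beta>]
  have "\<gamma> (\<beta> (u - v)) - (\<gamma> (\<beta> u) - \<gamma> (\<beta> v)) \<in> tensor_subgroup S P N"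
    by (rule \<gamma>_diff[OF p[OF diff(1)] p[OF diff(2)] p[OF keys_Times_diff(1)[OF diff(1,2)]]
          pairing_diff[OF DB.P \<beta> diff(1,2)]])
  from TP.K_add[OF this TP.K_diff[OF diff(3,4)]] show ?case by (simp add: algebra_simps)
next
  case (one x)
  then obtain p X where x: "x = (p, X)" and p: "p \<in> carrier P" and X: "X \<in> carrier N" by auto
  have fc: "DB.emb a c p = rsmult C c (f a p)" if "c \<in> carrier C" for a c
    using that p by (simp add: DB.emb_def)
  have fp: "f a p \<in> carrier S" if "a \<in> A" for a using DB.f_simps(1)[OF that p] by simp
  have "cls (\<lambda>c\<in>carrier C. \<beta> (frag_of (p, X)) (DB.emb a c)) = f a p \<odot>\<^bsub>N\<^esub> X" if a: "a \<in> A" for a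
  proof -
    have "(\<lambda>c\<in>carrier C. \<beta> (frag_of (p, X)) (DB.emb a c)) = f a p \<odot>\<^bsub>star_mod R C J1\<^esub> rep X"
      using pairing_frag[OF DB.P \<beta> p X emb_closed[OF a]] fc by (auto intro!: restrict_ext)
    then show ?thesis using cls_simps(3)[OF fp[OF a] rep(1)[OF X]] rep(2)[OF X] by simp
  qed
  then have 1: "\<gamma> (\<beta> (frag_of x)) = (\<Sum>a\<in>A. frag_of (a, f a p \<odot>\<^bsub>N\<^esub> X))"
    unfolding x \<gamma>_def by (intro sum.cong) auto
  have 2: "(\<Sum>a\<in>A. frag_of (f a p \<odot>\<^bsub>P\<^esub> a, X) - frag_of (a, f a p \<odot>\<^bsub>N\<^esub> X)) \<in> tensor_subgroup S P N"
    by (intro TP.K_sum TP.K_smult fp DB.Ac X)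
  have "frag_of (\<Oplus>\<^bsub>P\<^esub>a\<in>A. f a p \<odot>\<^bsub>P\<^esub> a, X) - (\<Sum>a\<in>A. frag_of (f a p \<odot>\<^bsub>P\<^esub> a, X)) \<in> tensor_subgroup S P N"
    using fp DB.Ac mod_simps(5)[OF DB.P] X by (intro TP.K_finsum DB.fin) auto
  from TP.K_uminus[OF TP.K_add[OF this 2]] show ?case
    unfolding 1 DB.basis[OF p] by (simp add: x sum_subtractf)
qed

text \<open>This is injectivity of the pairing modulo relations: u is congruent to \<gamma> (\<beta>
  u), and \<gamma> sends maps through \<eta> to relations.\<close>

lemma relation_of_L:
  assumes "Poly_Mapping.keys u \<subseteq> carrier P \<times> carrier N" "in_L P (\<beta> u)"
  shows "u \<in> tensor_subgroup S P N"
  using TP.K_diff[OF \<gamma>_L[OF pairing_hom[OF DB.P \<beta> assms(1)] assms(2)] \<gamma>_pairing[OF assms(1)]] by simp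

text \<open>This is surjectivity of the pairing. Each component of h differs from the chosen
  representative of its class by some \<eta> w_a; adding these differences over the basis, after
  evaluation, yields \<omega>.\<close>

lemma pairing_\<gamma>:
  assumes h: "h \<in> mod_hom R (dual P) J1"
  obtains \<omega> where "\<omega> \<in> mod_hom R (dual P) J0"
    "\<And>g. g \<in> carrier (dual P) \<Longrightarrow> \<beta> (\<gamma> h) g = h g \<oplus>\<^bsub>J1\<^esub> \<eta> (\<omega> g)"
proof -
  interpret J1: left_module R J1 by (rule J1)
  let ?k = "\<lambda>a. \<lambda>c\<in>carrier C. h (DB.emb a c)"
  have "\<exists>w\<in>mod_hom R CR J0. \<forall>c\<in>carrier C. rep (cls (?k a)) c = ?k a c \<oplus>\<^bsub>J1\<^esub> \<eta> (w c)" if a: "a \<in> A" for a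
    by (rule cls_eqD[OF rep(1)[OF cls_comp_emb[OF h a]] comp_emb[OF h a] rep(2)[OF cls_comp_emb[OF h a]]]) blast
  then obtain w where w: "\<And>a. a \<in> A \<Longrightarrow> w a \<in> mod_hom R CR J0"
    "\<And>a c. \<lbrakk>a \<in> A; c \<in> carrier C\<rbrakk> \<Longrightarrow> rep (cls (?k a)) c = ?k a c \<oplus>\<^bsub>J1\<^esub> \<eta> (w a c)"
    by metis
  let ?w = "\<lambda>a. \<lambda>g\<in>carrier (dual P). w a ((\<lambda>g\<in>carrier (dual P). g a) g)"
  let ?\<omega> = "\<lambda>g\<in>carrier (dual P). \<Oplus>\<^bsub>J0\<^esub>a\<in>A. ?w a g"
  have wh: "?w a \<in> mod_hom R (dual P) J0" if "a \<in> A" for a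
    by (rule mod_hom_compose[OF eval_hom[OF DB.P DB.Ac[OF that]] w(1)[OF that] D CR J0])
  have "?\<omega> \<in> mod_hom R (dual P) J0" by (rule mod_hom_finsum[OF DB.fin wh D J0])
  moreover have "\<beta> (\<gamma> h) g = h g \<oplus>\<^bsub>J1\<^esub> \<eta> (?\<omega> g)" if g: "g \<in> carrier (dual P)" for g
  proof -
    have ga: "g a \<in> carrier C" if "a \<in> A" for a by (rule dual_apply[OF DB.P g DB.Ac[OF that]])
    have wc: "w a (g a) \<in> carrier J0" if "a \<in> A" for a
      using hom_simps(1)[OF w(1)[OF that] CR J0] ga[OF that] by simp
    have hc: "h (DB.emb a (g a)) \<in> carrier J1" if "a \<in> A" for a
      by (rule hom_simps(1)[OF h D J1 emb_closed[OF that ga[OF that]]])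
    have "\<beta> (\<gamma> h) g = (\<Oplus>\<^bsub>J1\<^esub>a\<in>A. rep (cls (?k a)) (g a))"
      unfolding \<gamma>_def by (rule pairing_sum(2)[OF DB.P \<beta> DB.fin DB.Ac cls_comp_emb[OF h] g])
    also have "\<dots> = (\<Oplus>\<^bsub>J1\<^esub>a\<in>A. h (DB.emb a (g a)) \<oplus>\<^bsub>J1\<^esub> \<eta> (w a (g a)))"
      by (rule J1.finsum_cong') (use w(2) ga hc wc in \<open>auto simp: simps\<close>)
    also have "\<dots> = (\<Oplus>\<^bsub>J1\<^esub>a\<in>A. h (DB.emb a (g a))) \<oplus>\<^bsub>J1\<^esub> (\<Oplus>\<^bsub>J1\<^esub>a\<in>A. \<eta> (w a (g a)))"
      using hc wc by (intro J1.finsum_addf) (auto simp: simps)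
    also have "(\<Oplus>\<^bsub>J1\<^esub>a\<in>A. h (DB.emb a (g a))) = h g" by (rule DB.expand[OF h J1 g, symmetric])
    also have "(\<Oplus>\<^bsub>J1\<^esub>a\<in>A. \<eta> (w a (g a))) = \<eta> (\<Oplus>\<^bsub>J0\<^esub>a\<in>A. w a (g a))"
      by (rule hom_finsum[OF \<eta> J0 J1 DB.fin wc, symmetric])
    finally show ?thesis using g by simp
  qed
  ultimately show thesis by (rule that)
qed

end

section \<open>Tor of the cotranspose in terms of maps out of the dual complex\<close>

context cotranspose_setup
begin

text \<open>Exactness in degree m + 2 of the complex Hom(E, J1) modulo the maps that factor through
  \<eta>.\<close>

definition hom_exact :: "nat \<Rightarrow> bool" where
  "hom_exact m \<longleftrightarrow> (\<forall>\<phi>\<in>mod_hom R (E (Suc (Suc m))) J1.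
     (\<exists>\<psi>\<in>mod_hom R (E (Suc m)) J0. \<forall>g\<in>carrier (E (Suc m)). \<phi> (\<delta> (Suc m) g) = \<eta> (\<psi> g)) \<longrightarrow>
     (\<exists>\<chi>\<in>mod_hom R (E (Suc (Suc (Suc m)))) J1. \<exists>\<omega>\<in>mod_hom R (E (Suc (Suc m))) J0.
        \<forall>g\<in>carrier (E (Suc (Suc m))). \<phi> g = \<chi> (\<delta> (Suc (Suc m)) g) \<oplus>\<^bsub>J1\<^esub> \<eta> (\<omega> g)))"

text \<open>The three degrees involved are positive, so dual bases exist and the pairing is an
  isomorphism onto homomorphisms modulo \<open>in_L\<close> in each of them. By naturality the two
  complexes have the same exactness.\<close>

lemma tor_exact_iff_hom_exact: "tor_exact S Q d N (Suc m) \<longleftrightarrow> hom_exact m"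
proof -
  let ?P1 = "Q (Suc m)" and ?P2 = "Q (Suc (Suc m))" and ?P3 = "Q (Suc (Suc (Suc m)))"
  obtain A1 f1 where b1: "dual_basis R S C ?P1 A1 f1" by (rule basis)
  obtain A2 f2 where b2: "dual_basis R S C ?P2 A2 f2" by (rule basis)
  obtain A3 f3 where b3: "dual_basis R S C ?P3 A3 f3" by (rule basis)
  obtain \<beta>1 where \<beta>1: "is_pairing ?P1 \<beta>1" by (rule pairing_exists[OF Q.mods])
  obtain \<beta>2 where \<beta>2: "is_pairing ?P2 \<beta>2" by (rule pairing_exists[OF Q.mods])
  obtain \<beta>3 where \<beta>3: "is_pairing ?P3 \<beta>3" by (rule pairing_exists[OF Q.mods])
  interpret P1: cotranspose_basis R S C Q d B dB J0 J1 \<eta> ?P1 A1 f1 \<beta>1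
    by (intro cotranspose_basis.intro cotranspose_basis_axioms.intro cotranspose_setup_axioms b1 \<beta>1)
  interpret P2: cotranspose_basis R S C Q d B dB J0 J1 \<eta> ?P2 A2 f2 \<beta>2
    by (intro cotranspose_basis.intro cotranspose_basis_axioms.intro cotranspose_setup_axioms b2 \<beta>2)
  interpret P3: cotranspose_basis R S C Q d B dB J0 J1 \<eta> ?P3 A3 f3 \<beta>3
    by (intro cotranspose_basis.intro cotranspose_basis_axioms.intro cotranspose_setup_axioms b3 \<beta>3)
  note nat1 = pairing_natural[OF Q.mods Q.mods \<beta>2 \<beta>1 Q.homs]
  note nat2 = pairing_natural[OF Q.mods Q.mods \<beta>3 \<beta>2 Q.homs]
  note hom2 = pairing_hom[OF Q.mods \<beta>2] and hom3 = pairing_hom[OF Q.mods \<beta>3]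
  have keys1: "Poly_Mapping.keys (push (d i) u) \<subseteq> carrier (Q i) \<times> carrier N"
    if "Poly_Mapping.keys u \<subseteq> carrier (Q (Suc i)) \<times> carrier N" for i u
    by (rule keys_push[OF that Q.dsimps(1)])
  show ?thesis
  proof
    assume ex: "tor_exact S Q d N (Suc m)"
    show "hom_exact m"
      unfolding hom_exact_def
    proof (intro ballI impI)
      fix \<phi> assume \<phi>: "\<phi> \<in> mod_hom R (E (Suc (Suc m))) J1"
        and "\<exists>\<psi>\<in>mod_hom R (E (Suc m)) J0. \<forall>g\<in>carrier (E (Suc m)). \<phi> (\<delta> (Suc m) g) = \<eta> (\<psi> g)"
      then obtain \<psi> where \<psi>: "\<psi> \<in> mod_hom R (E (Suc m)) J0"
        "\<forall>g\<in>carrier (E (Suc m)). \<phi> (\<delta> (Suc m) g) = \<eta> (\<psi> g)" by (elim bexE)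
      obtain \<omega> where \<omega>: "\<omega> \<in> mod_hom R (E (Suc (Suc m))) J0"
        "\<And>g. g \<in> carrier (E (Suc (Suc m))) \<Longrightarrow> \<beta>2 (P2.\<gamma> \<phi>) g = \<phi> g \<oplus>\<^bsub>J1\<^esub> \<eta> (\<omega> g)"
        by (rule P2.pairing_\<gamma>[OF \<phi>]) (rule that; assumption)
      note u = P2.\<gamma>_keys[OF \<phi>]
      note [simp] = \<delta>_simps simps hom_simps[OF \<phi> E J1] hom_simps[OF \<psi>(1) E J0] hom_simps[OF \<omega>(1) E J0]
      have "in_L ?P1 (\<beta>1 (push (d (Suc m)) (P2.\<gamma> \<phi>)))"
        unfolding in_L_def
        by (rule bexI[OF _ mod_hom_add[OF \<psi>(1) mod_hom_compose[OF \<delta> \<omega>(1) E E J0] E J0]])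
          (use \<psi>(2) \<omega>(2) in \<open>auto simp: nat1[OF u]\<close>)
      then have "push (d (Suc m)) (P2.\<gamma> \<phi>) \<in> tensor_subgroup S ?P1 N"
        by (rule P1.relation_of_L[OF keys1[OF u]])
      then have "\<exists>v. Poly_Mapping.keys v \<subseteq> carrier ?P3 \<times> carrier N \<and>
          P2.\<gamma> \<phi> - push (d (Suc (Suc m))) v \<in> tensor_subgroup S ?P2 N"
        by (rule ex[unfolded tor_exact_def, rule_format, OF u])
      then obtain v where v: "Poly_Mapping.keys v \<subseteq> carrier ?P3 \<times> carrier N"
        "P2.\<gamma> \<phi> - push (d (Suc (Suc m))) v \<in> tensor_subgroup S ?P2 N" by (elim exE conjE)
      have "in_L ?P2 (\<beta>2 (P2.\<gamma> \<phi> - push (d (Suc (Suc m))) v))"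
        by (rule pairing_relations[OF Q.mods \<beta>2 v(2)])
      then obtain w where w: "w \<in> mod_hom R (E (Suc (Suc m))) J0"
        "\<forall>g\<in>carrier (E (Suc (Suc m))). \<beta>2 (P2.\<gamma> \<phi> - push (d (Suc (Suc m))) v) g = \<eta> (w g)"
        unfolding in_L_def by (elim bexE)
      note [simp] = hom_simps[OF w(1) E J0] hom_simps[OF hom3[OF v(1)] E J1]
      \<comment> \<open>\<beta> returns \<phi> from \<gamma> \<phi> up to \<eta> \<omega>, and
        \<gamma> \<phi> agrees with the pushed v up to a relation, which \<beta> sends to \<eta> w.
        Together the corrections give \<eta> (w - \<omega>).\<close>
      have eq: "\<phi> g = \<beta>3 v (\<delta> (Suc (Suc m)) g) \<oplus>\<^bsub>J1\<^esub> \<eta> ((\<lambda>g\<in>carrier (E (Suc (Suc m))). w g \<ominus>\<^bsub>J0\<^esub> \<omega> g) g)"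
        if g: "g \<in> carrier (E (Suc (Suc m)))" for g
      proof -
        interpret J1: left_module R J1 by (rule J1)
        define x where "x = \<beta>3 v (\<delta> (Suc (Suc m)) g)"
        have x: "x \<in> carrier J1" using g by (simp add: x_def)
        have "(\<phi> g \<oplus>\<^bsub>J1\<^esub> \<eta> (\<omega> g)) \<ominus>\<^bsub>J1\<^esub> x = \<eta> (w g)"
          using bspec[OF w(2) g] pairing_diff[OF Q.mods \<beta>2 u keys1[OF v(1)] g] nat2[OF v(1) g] \<omega>(2)[OF g]
          by (simp add: x_def)
        then have "\<phi> g \<oplus>\<^bsub>J1\<^esub> \<eta> (\<omega> g) = \<eta> (w g) \<oplus>\<^bsub>J1\<^esub> x"
          using mod_simps(11)[OF J1, of "\<phi> g \<oplus>\<^bsub>J1\<^esub> \<eta> (\<omega> g)" x] x g by simp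
        then have "\<phi> g = (\<eta> (w g) \<oplus>\<^bsub>J1\<^esub> x) \<ominus>\<^bsub>J1\<^esub> \<eta> (\<omega> g)"
          using mod_simps(12)[OF J1, of "\<phi> g" "\<eta> (\<omega> g)"] g by simp
        also have "\<dots> = x \<oplus>\<^bsub>J1\<^esub> (\<eta> (w g) \<ominus>\<^bsub>J1\<^esub> \<eta> (\<omega> g))"
          using x g by (simp add: a_minus_def J1.a_ac)
        finally show ?thesis using g by (simp add: x_def)
      qed
      show "\<exists>\<chi>\<in>mod_hom R (E (Suc (Suc (Suc m)))) J1. \<exists>\<omega>\<in>mod_hom R (E (Suc (Suc m))) J0.
          \<forall>g\<in>carrier (E (Suc (Suc m))). \<phi> g = \<chi> (\<delta> (Suc (Suc m)) g) \<oplus>\<^bsub>J1\<^esub> \<eta> (\<omega> g)"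
        by (rule bexI[OF _ hom3[OF v(1)]], rule bexI[OF _ mod_hom_diff[OF w(1) \<omega>(1) E J0]], rule ballI, rule eq)
    qed
  next
    assume he: "hom_exact m"
    show "tor_exact S Q d N (Suc m)"
      unfolding tor_exact_def
    proof (intro allI impI)
      fix u assume u: "Poly_Mapping.keys u \<subseteq> carrier ?P2 \<times> carrier N"
        and du: "push (d (Suc m)) u \<in> tensor_subgroup S ?P1 N"
      have "in_L ?P1 (\<beta>1 (push (d (Suc m)) u))"
        by (rule pairing_relations[OF Q.mods \<beta>1 du])
      then have "\<exists>\<psi>\<in>mod_hom R (E (Suc m)) J0. \<forall>g\<in>carrier (E (Suc m)). \<beta>2 u (\<delta> (Suc m) g) = \<eta> (\<psi> g)"
        unfolding in_L_def by (simp add: nat1[OF u])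
      from he[unfolded hom_exact_def, rule_format, OF hom2[OF u] this]
      obtain \<chi> \<omega> where \<chi>: "\<chi> \<in> mod_hom R (E (Suc (Suc (Suc m)))) J1" and \<omega>: "\<omega> \<in> mod_hom R (E (Suc (Suc m))) J0"
        and eq: "\<forall>g\<in>carrier (E (Suc (Suc m))). \<beta>2 u g = \<chi> (\<delta> (Suc (Suc m)) g) \<oplus>\<^bsub>J1\<^esub> \<eta> (\<omega> g)"
        by (elim bexE)
      obtain w where w: "w \<in> mod_hom R (E (Suc (Suc (Suc m)))) J0"
        "\<And>g. g \<in> carrier (E (Suc (Suc (Suc m)))) \<Longrightarrow> \<beta>3 (P3.\<gamma> \<chi>) g = \<chi> g \<oplus>\<^bsub>J1\<^esub> \<eta> (w g)"
        by (rule P3.pairing_\<gamma>[OF \<chi>]) (rule that; assumption)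
      note v = P3.\<gamma>_keys[OF \<chi>]
      note [simp] = \<delta>_simps simps hom_simps[OF \<chi> E J1] hom_simps[OF w(1) E J0] hom_simps[OF \<omega>(1) E J0]
      \<comment> \<open>With v = \<gamma> \<chi>, the pairing sends the pushed v to (\<chi> + \<eta>
        w) \<delta>. The terms \<chi> \<delta> cancel and \<eta> (\<omega> - w \<delta>) is
        left.\<close>
      have eq': "\<beta>2 (u - push (d (Suc (Suc m))) (P3.\<gamma> \<chi>)) g =
          \<eta> ((\<lambda>g\<in>carrier (E (Suc (Suc m))). \<omega> g \<ominus>\<^bsub>J0\<^esub> (\<lambda>g\<in>carrier (E (Suc (Suc m))). w (\<delta> (Suc (Suc m)) g)) g) g)"
        if g: "g \<in> carrier (E (Suc (Suc m)))" for g
      proof -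
        interpret J1: left_module R J1 by (rule J1)
        define x y z where "x = \<chi> (\<delta> (Suc (Suc m)) g)" and "y = \<eta> (\<omega> g)" and "z = \<eta> (w (\<delta> (Suc (Suc m)) g))"
        have c: "x \<in> carrier J1" "y \<in> carrier J1" "z \<in> carrier J1" using g by (simp_all add: x_def y_def z_def)
        have "\<beta>2 (u - push (d (Suc (Suc m))) (P3.\<gamma> \<chi>)) g = (x \<oplus>\<^bsub>J1\<^esub> y) \<ominus>\<^bsub>J1\<^esub> (x \<oplus>\<^bsub>J1\<^esub> z)"
          using pairing_diff[OF Q.mods \<beta>2 u keys1[OF v] g] nat2[OF v g] bspec[OF eq g] w(2)[OF \<delta>_simps(1)[OF g]]
          by (simp add: x_def y_def z_def)
        also have "\<dots> = y \<ominus>\<^bsub>J1\<^esub> z"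
        proof (rule mod_diff_unique[OF J1])
          show "(y \<ominus>\<^bsub>J1\<^esub> z) \<oplus>\<^bsub>J1\<^esub> (x \<oplus>\<^bsub>J1\<^esub> z) = x \<oplus>\<^bsub>J1\<^esub> y"
            using c mod_simps(11)[OF J1 c(2,3)]
            by (metis J1.a_ac J1.minus_closed)
        qed (use c in auto)
        finally show ?thesis using g by (simp add: y_def z_def)
      qed
      have "in_L ?P2 (\<beta>2 (u - push (d (Suc (Suc m))) (P3.\<gamma> \<chi>)))"
        unfolding in_L_def
        by (rule bexI[OF _ mod_hom_diff[OF \<omega> mod_hom_compose[OF \<delta> w(1) E E J0] E J0]]) (rule ballI, rule eq')
      then have "u - push (d (Suc (Suc m))) (P3.\<gamma> \<chi>) \<in> tensor_subgroup S ?P2 N"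
        by (rule P2.relation_of_L[OF keys_Times_diff(1)[OF u keys1[OF v]]])
      with v show "\<exists>v. Poly_Mapping.keys v \<subseteq> carrier ?P3 \<times> carrier N \<and>
          u - push (d (Suc (Suc m))) v \<in> tensor_subgroup S ?P2 N" by blast
    qed
  qed
qed

text \<open>Hom(E, J0) and Hom(E, J1) are exact as J0 and J1 are injective. Passing twice along
  \<open>0 \<rightarrow> K \<rightarrow> J0 \<rightarrow> J1\<close> moves the homology of the
  cokernel complex in degree m + 2 to that of Hom(E, K) in degree m.\<close>

lemma hom_exact_iff_ext_along:
  assumes I0: "injective_module R J0" and I1: "injective_module R J1" and K: "left_module R K"
    and e: "e \<in> mod_hom R K J0" and e_inj: "inj_on e (carrier K)" and e_ker: "e ` carrier K = a_kernel J0 J1 \<eta>"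
  shows "hom_exact m \<longleftrightarrow> ext_along R (E m) (E (Suc m)) (\<delta> m) K"
proof -
  \<comment> \<open>\<eta> need not be onto J1, so its image serves as the third term.\<close>
  let ?I = "J1\<lparr>carrier := \<eta> ` carrier J0\<rparr>"
  have ses: "short_exact R K J0 ?I e \<eta>"
    unfolding short_exact_def
    using e e_inj e_ker mod_hom_restrict_image[OF \<eta>] by (simp add: a_kernel_def')
  have ext: "ext_along R (E i) (E (Suc i)) (\<delta> i) J0" "ext_along R (E i) (E (Suc i)) (\<delta> i) J1" for i
  proof -
    obtain \<iota> :: "('a \<Rightarrow> 'a) \<Rightarrow> 'a" where \<iota>: "inj_on \<iota> (carrier (E (Suc i)))" by (rule E_encoding)
    show "ext_along R (E i) (E (Suc i)) (\<delta> i) J0" "ext_along R (E i) (E (Suc i)) (\<delta> i) J1"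
      by (rule ext_along_injective[OF I0 E E \<delta> \<iota>], rule ext_along_injective[OF I1 E E \<delta> \<iota>])
  qed
  have \<eta>e: "\<eta> (e x) = \<zero>\<^bsub>J1\<^esub>" if "x \<in> carrier K" for x
  proof -
    have "e x \<in> a_kernel J0 J1 \<eta>" unfolding e_ker[symmetric] using that by (rule imageI)
    then show ?thesis by (simp add: a_kernel_iff)
  qed
  have \<delta>\<delta>: "\<delta> (Suc i) (\<delta> i g) = \<zero>\<^bsub>E (Suc (Suc i))\<^esub>" if "g \<in> carrier (E i)" for i g
    using E_exact[OF \<delta>_simps(1)[OF that]] imageI[OF that] by simp
  have ker_im: "\<exists>x\<in>carrier (E i). z = \<delta> i x" if "z \<in> carrier (E (Suc i))" "\<delta> (Suc i) z = \<zero>\<^bsub>E (Suc (Suc i))\<^esub>" for i z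
    using E_exact[OF that(1)] that(2) by auto
  note basic = \<delta>_simps simps mod_simps[OF E] mod_simps[OF K] hom_simps[OF e K J0] \<eta>e \<delta>\<delta>
  show ?thesis
  proof
    assume he: "hom_exact m"
    show "ext_along R (E m) (E (Suc m)) (\<delta> m) K"
      unfolding ext_along_def
    proof (intro ballI impI)
      fix h assume h: "h \<in> mod_hom R (E m) K" and hk: "\<forall>z\<in>carrier (E m). \<delta> m z = \<zero>\<^bsub>E (Suc m)\<^esub> \<longrightarrow> h z = \<zero>\<^bsub>K\<^esub>"
      note [simp] = basic hom_simps[OF h E K]
      obtain \<psi> where \<psi>: "\<psi> \<in> mod_hom R (E (Suc m)) J0" "\<And>z. z \<in> carrier (E m) \<Longrightarrow> \<psi> (\<delta> m z) = e (h z)"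
        using ext_alongD[OF ext(1) mod_hom_compose[OF h e E K J0]] hk by auto
      note [simp] = hom_simps[OF \<psi>(1) E J0]
      have "\<eta> (\<psi> z) = \<zero>\<^bsub>J1\<^esub>" if "z \<in> carrier (E (Suc m))" "\<delta> (Suc m) z = \<zero>\<^bsub>E (Suc (Suc m))\<^esub>" for z
        using ker_im[OF that] \<psi>(2) by auto
      then obtain \<phi> where \<phi>: "\<phi> \<in> mod_hom R (E (Suc (Suc m))) J1"
        "\<And>z. z \<in> carrier (E (Suc m)) \<Longrightarrow> \<phi> (\<delta> (Suc m) z) = \<eta> (\<psi> z)"
        using ext_alongD[OF ext(2) mod_hom_compose[OF \<psi>(1) \<eta> E J0 J1]] by auto
      have "\<exists>\<psi>\<in>mod_hom R (E (Suc m)) J0. \<forall>g\<in>carrier (E (Suc m)). \<phi> (\<delta> (Suc m) g) = \<eta> (\<psi> g)"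
        using \<psi>(1) \<phi>(2) by blast
      from he[unfolded hom_exact_def, rule_format, OF \<phi>(1) this]
      obtain \<chi> \<omega> where \<chi>: "\<chi> \<in> mod_hom R (E (Suc (Suc (Suc m)))) J1" and \<omega>: "\<omega> \<in> mod_hom R (E (Suc (Suc m))) J0"
        and eq: "\<forall>g\<in>carrier (E (Suc (Suc m))). \<phi> g = \<chi> (\<delta> (Suc (Suc m)) g) \<oplus>\<^bsub>J1\<^esub> \<eta> (\<omega> g)"
        by (elim bexE)
      note [simp] = hom_simps[OF \<chi> E J1] hom_simps[OF \<omega> E J0]
      \<comment> \<open>On \<open>E (m + 1)\<close> one has \<eta> \<psi> = \<phi> \<delta> = \<chi>
        \<delta> \<delta> + \<eta> \<omega> \<delta> = \<eta> \<omega> \<delta>. So \<psi> -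
        \<omega> \<delta> takes values in the kernel of \<eta>, which is K, and along \<delta> it
        still restricts to h.\<close>
      let ?k = "\<lambda>g\<in>carrier (E (Suc m)). \<psi> g \<ominus>\<^bsub>J0\<^esub> (\<lambda>g\<in>carrier (E (Suc m)). \<omega> (\<delta> (Suc m) g)) g"
      have k: "?k \<in> mod_hom R (E (Suc m)) J0"
        by (rule mod_hom_diff[OF \<psi>(1) mod_hom_compose[OF \<delta> \<omega> E E J0] E J0])
      have "\<eta> (?k g) = \<zero>\<^bsub>?I\<^esub>" if g: "g \<in> carrier (E (Suc m))" for g
      proof -
        have "\<eta> (\<psi> g) = \<eta> (\<omega> (\<delta> (Suc m) g))"
          using \<phi>(2)[OF g] bspec[OF eq \<delta>_simps(1)[OF g]] g by simp
        then show ?thesis using g by simp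
      qed
      from short_exact_factor[OF ses K J0 E k this]
      obtain k' where k': "k' \<in> mod_hom R (E (Suc m)) K" "\<And>z. z \<in> carrier (E (Suc m)) \<Longrightarrow> e (k' z) = ?k z"
        by blast
      have "k' (\<delta> m z) = h z" if z: "z \<in> carrier (E m)" for z
        by (rule inj_onD[OF e_inj])
          (use z k'(2)[OF \<delta>_simps(1)[OF z]] \<psi>(2)[OF z] hom_simps(1)[OF k'(1) E K] in auto)
      with k'(1) show "\<exists>k\<in>mod_hom R (E (Suc m)) K. \<forall>z\<in>carrier (E m). k (\<delta> m z) = h z" by blast
    qed
  next
    assume K_ext: "ext_along R (E m) (E (Suc m)) (\<delta> m) K"
    show "hom_exact m"
      unfolding hom_exact_def
    proof (intro ballI impI)
      fix \<phi> assume \<phi>: "\<phi> \<in> mod_hom R (E (Suc (Suc m))) J1"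
        and "\<exists>\<psi>\<in>mod_hom R (E (Suc m)) J0. \<forall>g\<in>carrier (E (Suc m)). \<phi> (\<delta> (Suc m) g) = \<eta> (\<psi> g)"
      then obtain \<psi> where \<psi>: "\<psi> \<in> mod_hom R (E (Suc m)) J0"
        "\<forall>g\<in>carrier (E (Suc m)). \<phi> (\<delta> (Suc m) g) = \<eta> (\<psi> g)" by (elim bexE)
      note [simp] = basic hom_simps[OF \<phi> E J1] hom_simps[OF \<psi>(1) E J0]
      have p\<delta>: "(\<lambda>z\<in>carrier (E m). \<psi> (\<delta> m z)) \<in> mod_hom R (E m) J0"
        by (rule mod_hom_compose[OF \<delta> \<psi>(1) E E J0])
      have "\<eta> ((\<lambda>z\<in>carrier (E m). \<psi> (\<delta> m z)) z) = \<zero>\<^bsub>?I\<^esub>" if z: "z \<in> carrier (E m)" for z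
        using bspec[OF \<psi>(2) \<delta>_simps(1)[OF z]] z by simp
      from short_exact_factor[OF ses K J0 E p\<delta> this]
      obtain h where h: "h \<in> mod_hom R (E m) K" "\<And>z. z \<in> carrier (E m) \<Longrightarrow> e (h z) = \<psi> (\<delta> m z)" by auto
      note [simp] = hom_simps[OF h(1) E K]
      have "h z = \<zero>\<^bsub>K\<^esub>" if "z \<in> carrier (E m)" "\<delta> m z = \<zero>\<^bsub>E (Suc m)\<^esub>" for z
        by (rule inj_onD[OF e_inj]) (use that h(2) in auto)
      then obtain \<psi>' where \<psi>': "\<psi>' \<in> mod_hom R (E (Suc m)) K" "\<And>z. z \<in> carrier (E m) \<Longrightarrow> \<psi>' (\<delta> m z) = h z"
        using ext_alongD[OF K_ext h(1)] by auto
      note [simp] = hom_simps[OF \<psi>'(1) E K]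
      \<comment> \<open>\<psi> \<delta> = e h = e \<psi>' \<delta>, so \<psi> - e \<psi>' kills the
        boundaries and extends to \<omega> on the next term. The correction e \<psi>' is invisible
        to \<eta>.\<close>
      let ?r = "\<lambda>z\<in>carrier (E (Suc m)). \<psi> z \<ominus>\<^bsub>J0\<^esub> (\<lambda>z\<in>carrier (E (Suc m)). e (\<psi>' z)) z"
      have r: "?r \<in> mod_hom R (E (Suc m)) J0"
        by (rule mod_hom_diff[OF \<psi>(1) mod_hom_compose[OF \<psi>'(1) e E K J0] E J0])
      have "?r z = \<zero>\<^bsub>J0\<^esub>" if z: "z \<in> carrier (E (Suc m))" "\<delta> (Suc m) z = \<zero>\<^bsub>E (Suc (Suc m))\<^esub>" for z
      proof -
        obtain x where x: "x \<in> carrier (E m)" "z = \<delta> m x" using ker_im[OF z] by blast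
        show ?thesis unfolding x(2) using x(1) h(2) \<psi>'(2) by simp
      qed
      then obtain \<omega> where \<omega>: "\<omega> \<in> mod_hom R (E (Suc (Suc m))) J0"
        "\<And>z. z \<in> carrier (E (Suc m)) \<Longrightarrow> \<omega> (\<delta> (Suc m) z) = ?r z"
        using ext_alongD[OF ext(1) r] by blast
      note [simp] = hom_simps[OF \<omega>(1) E J0]
      \<comment> \<open>On the boundaries \<phi> \<delta> = \<eta> \<psi> = \<eta> \<omega>
        \<delta>, so \<phi> - \<eta> \<omega> kills them and extends along the following
        differential; the extension is \<chi>.\<close>
      let ?s = "\<lambda>z\<in>carrier (E (Suc (Suc m))). \<phi> z \<ominus>\<^bsub>J1\<^esub> (\<lambda>z\<in>carrier (E (Suc (Suc m))). \<eta> (\<omega> z)) z"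
      have s: "?s \<in> mod_hom R (E (Suc (Suc m))) J1"
        by (rule mod_hom_diff[OF \<phi> mod_hom_compose[OF \<omega>(1) \<eta> E J0 J1] E J1])
      have "?s z = \<zero>\<^bsub>J1\<^esub>"
        if z: "z \<in> carrier (E (Suc (Suc m)))" "\<delta> (Suc (Suc m)) z = \<zero>\<^bsub>E (Suc (Suc (Suc m)))\<^esub>" for z
      proof -
        obtain x where x: "x \<in> carrier (E (Suc m))" "z = \<delta> (Suc m) x" using ker_im[OF z] by blast
        show ?thesis unfolding x(2) using x(1) bspec[OF \<psi>(2) x(1)] \<omega>(2)[OF x(1)] by simp
      qed
      then obtain \<chi> where \<chi>: "\<chi> \<in> mod_hom R (E (Suc (Suc (Suc m)))) J1"
        "\<And>z. z \<in> carrier (E (Suc (Suc m))) \<Longrightarrow> \<chi> (\<delta> (Suc (Suc m)) z) = ?s z"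
        using ext_alongD[OF ext(2) s] by blast
      show "\<exists>\<chi>\<in>mod_hom R (E (Suc (Suc (Suc m)))) J1. \<exists>\<omega>\<in>mod_hom R (E (Suc (Suc m))) J0.
          \<forall>g\<in>carrier (E (Suc (Suc m))). \<phi> g = \<chi> (\<delta> (Suc (Suc m)) g) \<oplus>\<^bsub>J1\<^esub> \<eta> (\<omega> g)"
        by (rule bexI[OF _ \<chi>(1)], rule bexI[OF _ \<omega>(1)]) (simp add: \<chi>(2))
    qed
  qed
qed

end

text \<open>The cotranspose is formed with a resolution picked by choice; the given one guarantees
  that the choice succeeds. The right-hand side depends on K alone, so any resolution that may have
  been picked gives the same answer.\<close>

lemma (in dual_complex) cotorsionfree_iff_ctf:
  assumes K: "left_module R K" and res: "minimal_injective_resolution R K I e f"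
  shows "cotorsionfree R S C n K \<longleftrightarrow> ctf n K"
proof -
  define M where "M = (\<lambda>(I, f). \<exists>e. minimal_injective_resolution R K I e f)"
  have "M (I, f)" using res by (auto simp: M_def)
  then have M: "M (Eps M)" by (rule someI)
  obtain I' f' where E: "Eps M = (I', f')" by fastforce
  with M obtain e' where res': "minimal_injective_resolution R K I' e' f'" by (auto simp: M_def)
  have inj: "injective_module R (I' i)" for i using res' by (simp add: minimal_injective_resolution_def)
  have co: "coresolution R K I' e' f'" using res' by (simp add: minimal_injective_resolution_def)
  have I': "left_module R (I' i)" and f': "f' i \<in> mod_hom R (I' i) (I' (Suc i))" for i
    using co by (auto simp: coresolution_def)
  have e': "e' \<in> mod_hom R K (I' 0)" "inj_on e' (carrier K)" "e' ` carrier K = a_kernel (I' 0) (I' 1) (f' 0)"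
    using co by (auto simp: coresolution_def)
  interpret cotranspose_setup R S C Q d B dB "I' 0" "I' 1" "f' 0"
    using f'[of 0]
    by (intro cotranspose_setup.intro cotranspose_setup_axioms.intro dual_complex_axioms I') simp
  have N_eq: "cotranspose R C K = N"
    unfolding cotranspose_def M_def[symmetric] E Let_def prod.case by simp
  have "cotorsionfree R S C n K \<longleftrightarrow> (\<forall>i<n. trivial_group (Tor S (Suc i) CS N))"
    unfolding cotorsionfree_def N_eq
    by (rule ball_one_to_iff)
  then show ?thesis
    unfolding Tor_trivial_iff_tor_exact[OF CS N Q Q0] tor_exact_iff_hom_exact
      hom_exact_iff_ext_along[OF inj inj K e'] ctf_def .
qed

section \<open>Coresolutions\<close>

text \<open>Counts the terms of the coresolution, so it runs one ahead of the index of the last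
  term. The additional value 0, for Y = 0, is where the inductions start.\<close>

primrec Add_length :: "'u ring \<Rightarrow> ('u, 'u) module \<Rightarrow> nat \<Rightarrow> ('u, 'u) module \<Rightarrow> bool" where
  "Add_length R C 0 Y \<longleftrightarrow> carrier Y = {\<zero>\<^bsub>Y\<^esub>}"
| "Add_length R C (Suc n) Y \<longleftrightarrow> (\<exists>(W :: ('u, 'u) module) (Y' :: ('u, 'u) module) a b.
     in_Add R C W \<and> left_module R Y' \<and> short_exact R Y W Y' a b \<and> Add_length R C n Y')"

lemma in_Add_left_module: "in_Add R C W \<Longrightarrow> left_module R W"
  unfolding in_Add_def by (rule conjunct1)

lemma Add_length_SucI:
  "\<lbrakk>in_Add R C W; left_module R Y'; short_exact R Y W Y' a b; Add_length R C n Y'\<rbrakk> \<Longrightarrow>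
    Add_length R C (Suc n) Y"
  unfolding Add_length.simps by blast

lemma Add_length_SucE:
  assumes "Add_length R C (Suc n) Y"
  obtains W Y' a b where "in_Add R C W" "left_module R Y'" "short_exact R Y W Y' a b" "Add_length R C n Y'"
  using assms unfolding Add_length.simps by (elim exE conjE) (rule that)

text \<open>A zero module lies in Add C, so \<open>0 \<rightarrow> Y \<rightarrow> Y \<rightarrow> Y
  \<rightarrow> 0\<close> pads a coresolution at its end. Padding is needed because a bound on the
  infimum yields a coresolution that may be shorter.\<close>

lemma Add_length_Suc:
  assumes C: "left_module R C" and "left_module R Y" "Add_length R C n Y"
  shows "Add_length R C (Suc n) Y"
  using assms(2,3)
proof (induction n arbitrary: Y)
  case 0
  then have Y: "carrier Y = {\<zero>\<^bsub>Y\<^esub>}" and LY: "left_module R Y" by auto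
  let ?i = "\<lambda>y\<in>carrier Y. y"
  have "short_exact R Y Y Y ?i ?i"
    using mod_hom_id[OF LY] Y by (auto simp: short_exact_def a_kernel_def')
  then show ?case
    by (rule Add_length_SucI[OF zero_in_Add[OF C LY Y] LY]) (use Y in simp)
next
  case (Suc n)
  from Suc.prems(2) obtain W Y' a b where W: "in_Add R C W" "left_module R Y'" "short_exact R Y W Y' a b"
    "Add_length R C n Y'" by (rule Add_length_SucE)
  show ?case by (rule Add_length_SucI[OF W(1-3) Suc.IH[OF W(2,4)]])
qed

lemma Add_length_mono:
  assumes "left_module R C" "left_module R Y" "Add_length R C m Y" "m \<le> n"
  shows "Add_length R C n Y"
  using assms(4,3) by (induction rule: dec_induct) (auto simp del: Add_length.simps intro: Add_length_Suc[OF assms(1,2)])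

text \<open>The short sequence ending in Y' is spliced with a coresolution of Y'. As Y' embeds in
  \<open>X 0\<close>, the composite \<open>W \<rightarrow> X 0\<close> has the same kernel as
  \<open>W \<rightarrow> Y'\<close>, and its image is that of Y'.\<close>

lemma coresolution_of_Add_length:
  assumes "left_module R Y" "Add_length R C n Y"
  shows "\<exists>(X :: nat \<Rightarrow> ('u, 'u) module) e f. coresolution R Y X e f \<and>
    (\<forall>i<n. in_Add R C (X i)) \<and> (\<forall>i\<ge>n. carrier (X i) = {\<zero>\<^bsub>X i\<^esub>})"
  using assms
proof (induction n arbitrary: Y)
  case 0
  then have LY: "left_module R Y" and Y: "carrier Y = {\<zero>\<^bsub>Y\<^esub>}" by auto
  let ?i = "\<lambda>y\<in>carrier Y. y"
  have "coresolution R Y (\<lambda>_. Y) ?i (\<lambda>_. ?i) \<and> (\<forall>i<0::nat. in_Add R C Y) \<and> (\<forall>i\<ge>0::nat. carrier Y = {\<zero>\<^bsub>Y\<^esub>})"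
    unfolding coresolution_def using LY mod_hom_id[OF LY] Y by (auto simp: a_kernel_def')
  then show ?case by (intro exI)
next
  case (Suc n)
  from Suc.prems(2) obtain W Y' a b where W: "in_Add R C W" and Y': "left_module R Y'"
    and ses: "short_exact R Y W Y' a b" and len: "Add_length R C n Y'" by (rule Add_length_SucE)
  obtain X e f where X: "coresolution R Y' X e f" "\<forall>i<n. in_Add R C (X i)"
    "\<forall>i\<ge>n. carrier (X i) = {\<zero>\<^bsub>X i\<^esub>}" using Suc.IH[OF Y' len] by blast
  have LW: "left_module R W" by (rule in_Add_left_module[OF W])
  have LX: "left_module R (X i)" and fX: "f i \<in> mod_hom R (X i) (X (Suc i))" for i
    using X(1) by (auto simp: coresolution_def)
  have e: "e \<in> mod_hom R Y' (X 0)" "inj_on e (carrier Y')" "e ` carrier Y' = a_kernel (X 0) (X (Suc 0)) (f 0)"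
    and f: "\<And>i. f i ` carrier (X i) = a_kernel (X (Suc i)) (X (Suc (Suc i))) (f (Suc i))"
    using X(1) by (auto simp: coresolution_def)
  have a: "a \<in> mod_hom R Y W" "inj_on a (carrier Y)" "a ` carrier Y = a_kernel W Y' b"
    and b: "b \<in> mod_hom R W Y'" "b ` carrier W = carrier Y'"
    using ses by (auto simp: short_exact_def)
  let ?g = "\<lambda>w\<in>carrier W. e (b w)"
  have g: "?g \<in> mod_hom R W (X 0)" by (rule mod_hom_compose[OF b(1) e(1) LW Y' LX])
  have "e y = \<zero>\<^bsub>X 0\<^esub> \<longleftrightarrow> y = \<zero>\<^bsub>Y'\<^esub>" if "y \<in> carrier Y'" for y
    using inj_onD[OF e(2), of y "\<zero>\<^bsub>Y'\<^esub>"] hom_simps(4)[OF e(1) Y' LX] mod_simps(2)[OF Y'] that by auto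
  then have ker: "a_kernel W Y' b = a_kernel W (X 0) ?g"
    using hom_simps(1)[OF b(1) LW Y'] by (auto simp: a_kernel_def')
  have "?g ` carrier W = e ` (b ` carrier W)" by auto
  then have im: "?g ` carrier W = a_kernel (X 0) (X (Suc 0)) (f 0)" unfolding b(2) e(3) .
  have "coresolution R Y (case_nat W X) a (case_nat ?g f)"
    unfolding coresolution_def
    using LW LX a ker g fX im f by (auto split: nat.split)
  moreover have "\<forall>i<Suc n. in_Add R C (case_nat W X i)" using W X(2) by (auto split: nat.split)
  moreover have "\<forall>i\<ge>Suc n. carrier (case_nat W X i) = {\<zero>\<^bsub>case_nat W X i\<^esub>}" using X(3) by (auto split: nat.split)
  ultimately show ?case by blast
qed

text \<open>Cuts off the first term. Coresolutions in Add C and injective resolutions are both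
  unrolled this way.\<close>

lemma coresolution_shift:
  fixes X :: "nat \<Rightarrow> ('u, 'u) module"
  assumes res: "coresolution R M X e f" and M: "left_module R M"
  defines "M' \<equiv> (X 1)\<lparr>carrier := f 0 ` carrier (X 0)\<rparr>"
  shows "left_module R M'" and "short_exact R M (X 0) M' e (f 0)"
    and "coresolution R M' (\<lambda>i. X (Suc i)) (\<lambda>x\<in>carrier M'. x) (\<lambda>i. f (Suc i))"
proof -
  have LX: "left_module R (X i)" and fX: "f i \<in> mod_hom R (X i) (X (Suc i))" for i
    using res by (auto simp: coresolution_def)
  have e: "e \<in> mod_hom R M (X 0)" "inj_on e (carrier M)" "e ` carrier M = a_kernel (X 0) (X (Suc 0)) (f 0)"
    and f: "\<And>i. f i ` carrier (X i) = a_kernel (X (Suc i)) (X (Suc (Suc i))) (f (Suc i))"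
    using res by (auto simp: coresolution_def)
  have sub: "submodule (f 0 ` carrier (X 0)) R (X 1)"
    using submodule_image[OF fX LX LX, of 0] by simp
  show M': "left_module R M'"
    unfolding M'_def by (rule left_module_submodule[OF LX sub])
  have "f 0 \<in> mod_hom R (X 0) M'"
    using mod_hom_restrict_image[OF fX[of 0]] by (simp add: M'_def)
  then show "short_exact R M (X 0) M' e (f 0)"
    using e by (simp add: short_exact_def M'_def a_kernel_def')
  have incl: "(\<lambda>x\<in>carrier M'. x) \<in> mod_hom R M' (X (Suc 0))"
    using mod_hom_enlarge[of _ R M' "f 0 ` carrier (X 0)" "X 1"] mod_hom_id[OF M'] submodule_subset[OF sub]
    by (simp add: M'_def)
  have "(\<lambda>x\<in>carrier M'. x) ` carrier M' = f 0 ` carrier (X 0)" by (simp add: M'_def)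
  then have im: "(\<lambda>x\<in>carrier M'. x) ` carrier M' = a_kernel (X (Suc 0)) (X (Suc (Suc 0))) (f (Suc 0))"
    unfolding f .
  have "inj_on (\<lambda>x\<in>carrier M'. x) (carrier M')" by (simp add: inj_on_def)
  then show "coresolution R M' (\<lambda>i. X (Suc i)) (\<lambda>x\<in>carrier M'. x) (\<lambda>i. f (Suc i))"
    unfolding coresolution_def by (intro conjI allI LX fX f incl im)
qed

lemma Add_length_of_coresolution:
  fixes X :: "nat \<Rightarrow> ('u, 'u) module"
  assumes "left_module R Y" "coresolution R Y X e f" "\<forall>i<n. in_Add R C (X i)"
    "\<forall>i\<ge>n. carrier (X i) = {\<zero>\<^bsub>X i\<^esub>}"
  shows "Add_length R C n Y"
  using assms
proof (induction n arbitrary: Y X e f)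
  case 0
  have e: "e \<in> mod_hom R Y (X 0)" "inj_on e (carrier Y)" and X: "left_module R (X 0)"
    using 0(2) by (auto simp: coresolution_def)
  have "y = \<zero>\<^bsub>Y\<^esub>" if "y \<in> carrier Y" for y
  proof (rule inj_onD[OF e(2) _ that mod_simps(2)[OF 0(1)]])
    have "e y \<in> {\<zero>\<^bsub>X 0\<^esub>}" using hom_simps(1)[OF e(1) 0(1) X that] 0(4) by blast
    then show "e y = e \<zero>\<^bsub>Y\<^esub>" using hom_simps(4)[OF e(1) 0(1) X] by simp
  qed
  then have "carrier Y = {\<zero>\<^bsub>Y\<^esub>}" using mod_simps(2)[OF 0(1)] by blast
  then show ?case by simp
next
  case (Suc n)
  note s = coresolution_shift[OF Suc.prems(2,1)]
  have "Add_length R C n ((X 1)\<lparr>carrier := f 0 ` carrier (X 0)\<rparr>)"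
    by (rule Suc.IH[OF s(1,3)]) (use Suc.prems(3,4) in auto)
  moreover have "in_Add R C (X 0)" using Suc.prems(3) by simp
  ultimately show ?case using Add_length_SucI[OF _ s(1,2)] by blast
qed

text \<open>A nonempty set of extended naturals attains its infimum, and the empty set has an
  infinite one; so the bound means that a coresolution with last index at most n - 1 exists. For n
  at least 1 this amounts to n terms.\<close>

lemma Add_id_le_iff:
  assumes C: "left_module R C" and Y: "left_module R Y" and n: "n \<ge> 1"
  shows "Add_id R C Y \<le> enat (n - 1) \<longleftrightarrow> Add_length R C n Y"
proof -
  have len: "Add_coresolution_length R C Y m \<longleftrightarrow> Add_length R C (Suc m) Y" for m
  proof
    assume "Add_coresolution_length R C Y m"
    then obtain X e f where "coresolution R Y X e f" "\<forall>i\<le>m. in_Add R C (X i)"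
      "\<forall>i>m. carrier (X i) = {\<zero>\<^bsub>X i\<^esub>}" unfolding Add_coresolution_length_def by blast
    then show "Add_length R C (Suc m) Y"
      by (intro Add_length_of_coresolution[OF Y]) (auto simp: less_Suc_eq_le Suc_le_eq)
  next
    assume "Add_length R C (Suc m) Y"
    from coresolution_of_Add_length[OF Y this] show "Add_coresolution_length R C Y m"
      unfolding Add_coresolution_length_def less_Suc_eq_le Suc_le_eq .
  qed
  have "Add_id R C Y \<le> enat (n - 1) \<longleftrightarrow> (\<exists>m\<le>n - 1. Add_coresolution_length R C Y m)"
  proof
    let ?A = "{enat m |m. Add_coresolution_length R C Y m}"
    assume le: "Add_id R C Y \<le> enat (n - 1)"
    have "?A \<noteq> {}"
    proof
      assume A: "?A = {}"
      have "Add_id R C Y = \<infinity>" unfolding Add_id_def A by (simp add: Inf_enat_def)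
      with le show False by simp
    qed
    then have "Inf ?A \<in> ?A" unfolding Inf_enat_def by (auto intro: LeastI)
    with le show "\<exists>m\<le>n - 1. Add_coresolution_length R C Y m" by (auto simp: Add_id_def)
  next
    assume "\<exists>m\<le>n - 1. Add_coresolution_length R C Y m"
    then obtain m where "m \<le> n - 1" "Add_coresolution_length R C Y m" by blast
    then show "Add_id R C Y \<le> enat (n - 1)"
      unfolding Add_id_def by (intro Inf_lower2[of "enat m"]) auto
  qed
  also have "\<dots> \<longleftrightarrow> Add_length R C n Y"
    unfolding len
  proof (intro iffI)
    assume "\<exists>m\<le>n - 1. Add_length R C (Suc m) Y"
    then obtain m where m: "m \<le> n - 1" "Add_length R C (Suc m) Y" by blast
    show "Add_length R C n Y" by (rule Add_length_mono[OF C Y m(2)]) (use m(1) n in simp)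
  next
    assume "Add_length R C n Y"
    then show "\<exists>m\<le>n - 1. Add_length R C (Suc m) Y" using n by (intro exI[of _ "n - 1"]) simp
  qed
  finally show ?thesis .
qed

text \<open>Adds M itself as the cosyzygy of index 0, which is where the inductions on n
  begin.\<close>

definition cosyz :: "('u, 'u) module \<Rightarrow> (nat \<Rightarrow> ('u, 'u) module) \<Rightarrow> (nat \<Rightarrow> 'u \<Rightarrow> 'u) \<Rightarrow> nat \<Rightarrow> ('u, 'u) module" where
  "cosyz M I f n = (case n of 0 \<Rightarrow> M | Suc m \<Rightarrow> (I n)\<lparr>carrier := f m ` carrier (I m)\<rparr>)"

lemma cosyz_0 [simp]: "cosyz M I f 0 = M"
  by (simp add: cosyz_def)

text \<open>The form required by the induction hypothesis: the n-th cosyzygy of the first cosyzygy,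
  for the resolution with its first term cut off.\<close>

lemma cosyz_Suc: "cosyz M I f (Suc n) = cosyz (cosyz M I f 1) (\<lambda>i. I (Suc i)) (\<lambda>i. f (Suc i)) n"
  by (cases n) (simp_all add: cosyz_def)

lemma cosyz_cosyzygy: "n \<ge> 1 \<Longrightarrow> cosyzygy I f n = cosyz M I f n"
  by (cases n) (simp_all add: cosyz_def cosyzygy_def)

lemma inj_on_of_kernel:
  assumes "h \<in> mod_hom R A B" "left_module R A" "left_module R B"
    and "\<And>x. \<lbrakk>x \<in> carrier A; h x = \<zero>\<^bsub>B\<^esub>\<rbrakk> \<Longrightarrow> x = \<zero>\<^bsub>A\<^esub>"
  shows "inj_on h (carrier A)"
proof (rule inj_onI)
  note [simp] = hom_simps[OF assms(1-3)] mod_simps[OF assms(2)] mod_simps[OF assms(3)]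
  fix x y assume xy: "x \<in> carrier A" "y \<in> carrier A" "h x = h y"
  then have "x \<ominus>\<^bsub>A\<^esub> y = \<zero>\<^bsub>A\<^esub>" by (intro assms(4)) auto
  then show "x = y" using mod_diff_eq_zero_iff[OF assms(2) xy(1,2)] by simp
qed

lemma ext_along_iso:
  assumes X: "ext_along R Z Z' b X" and g: "g \<in> mod_hom R M X" "bij_betw g (carrier M) (carrier X)"
    and "left_module R M" "left_module R X" "left_module R Z" "left_module R Z'" "b \<in> mod_hom R Z Z'"
  shows "ext_along R Z Z' b M"
  unfolding ext_along_def
proof (intro ballI impI)
  obtain g' where g': "g' \<in> mod_hom R X M" "\<And>x. x \<in> carrier M \<Longrightarrow> g' (g x) = x"
    using mod_hom_inv[OF g assms(4,5)] by metis
  fix h assume h: "h \<in> mod_hom R Z M" and hk: "\<forall>z\<in>carrier Z. b z = \<zero>\<^bsub>Z'\<^esub> \<longrightarrow> h z = \<zero>\<^bsub>M\<^esub>"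
  obtain k where k: "k \<in> mod_hom R Z' X" "\<And>z. z \<in> carrier Z \<Longrightarrow> k (b z) = g (h z)"
    using ext_alongD[OF X mod_hom_compose[OF h g(1) assms(6,4,5)]] hk hom_simps(4)[OF g(1) assms(4,5)] by auto
  show "\<exists>k\<in>mod_hom R Z' M. \<forall>z\<in>carrier Z. k (b z) = h z"
    by (rule bexI[OF _ mod_hom_compose[OF k(1) g'(1) assms(7,5,4)]])
      (use k(2) g'(2) hom_simps(1)[OF assms(8,6,7)] hom_simps(1)[OF h assms(6,4)] in auto)
qed

section \<open>Pullbacks and pushouts of short exact sequences\<close>

lemma short_exactI:
  assumes "left_module R A" "left_module R B" and D: "left_module R D"
    and f: "f \<in> mod_hom R A B" and g: "g \<in> mod_hom R B D"
    and inj: "\<And>x. \<lbrakk>x \<in> carrier A; f x = \<zero>\<^bsub>B\<^esub>\<rbrakk> \<Longrightarrow> x = \<zero>\<^bsub>A\<^esub>"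
    and gf: "\<And>x. x \<in> carrier A \<Longrightarrow> g (f x) = \<zero>\<^bsub>D\<^esub>"
    and ex: "\<And>y. \<lbrakk>y \<in> carrier B; g y = \<zero>\<^bsub>D\<^esub>\<rbrakk> \<Longrightarrow> \<exists>x\<in>carrier A. f x = y"
    and surj: "\<And>z. z \<in> carrier D \<Longrightarrow> \<exists>y\<in>carrier B. g y = z"
  shows "short_exact R A B D f g"
  unfolding short_exact_def
proof (intro conjI f g inj_on_of_kernel[OF f assms(1,2) inj] equalityI subsetI)
  fix y assume "y \<in> f ` carrier A"
  then obtain x where x: "x \<in> carrier A" "y = f x" by (rule imageE)
  show "y \<in> a_kernel B D g"
    unfolding a_kernel_iff x(2) using hom_simps(1)[OF f assms(1,2) x(1)] gf[OF x(1)] by simp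
next
  fix y assume "y \<in> a_kernel B D g"
  then have "y \<in> carrier B" "g y = \<zero>\<^bsub>D\<^esub>" by (simp_all add: a_kernel_iff)
  from ex[OF this] obtain x where x: "x \<in> carrier A" "f x = y" by (rule bexE)
  show "y \<in> f ` carrier A" unfolding x(2)[symmetric] by (rule imageI[OF x(1)])
next
  fix z assume "z \<in> g ` carrier B"
  then obtain y where y: "y \<in> carrier B" "z = g y" by (rule imageE)
  show "z \<in> carrier D" unfolding y(2) by (rule hom_simps(1)[OF g assms(2) D y(1)])
next
  fix z assume "z \<in> carrier D"
  from surj[OF this] obtain y where y: "y \<in> carrier B" "g y = z" by (rule bexE)
  show "z \<in> g ` carrier B" unfolding y(2)[symmetric] by (rule imageI[OF y(1)])
qed

lemma short_exactD:
  assumes s: "short_exact R A B D f g" and A: "left_module R A" and B: "left_module R B"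
  shows "f \<in> mod_hom R A B" and "g \<in> mod_hom R B D"
    and "\<And>x. \<lbrakk>x \<in> carrier A; f x = \<zero>\<^bsub>B\<^esub>\<rbrakk> \<Longrightarrow> x = \<zero>\<^bsub>A\<^esub>"
    and "\<And>x. x \<in> carrier A \<Longrightarrow> g (f x) = \<zero>\<^bsub>D\<^esub>"
    and "\<And>y. \<lbrakk>y \<in> carrier B; g y = \<zero>\<^bsub>D\<^esub>\<rbrakk> \<Longrightarrow> \<exists>x\<in>carrier A. f x = y"
    and "\<And>z. z \<in> carrier D \<Longrightarrow> \<exists>y\<in>carrier B. g y = z"
proof -
  have f: "f \<in> mod_hom R A B" and g: "g \<in> mod_hom R B D" and inj: "inj_on f (carrier A)"
    and ker: "f ` carrier A = a_kernel B D g" and surj: "g ` carrier B = carrier D"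
    using s by (simp_all add: short_exact_def)
  show "f \<in> mod_hom R A B" "g \<in> mod_hom R B D" by (rule f, rule g)
  show "x = \<zero>\<^bsub>A\<^esub>" if "x \<in> carrier A" "f x = \<zero>\<^bsub>B\<^esub>" for x
    by (rule inj_onD[OF inj _ that(1) mod_simps(2)[OF A]]) (simp add: that(2) hom_simps(4)[OF f A B])
  show "g (f x) = \<zero>\<^bsub>D\<^esub>" if x: "x \<in> carrier A" for x
  proof -
    have "f x \<in> a_kernel B D g" unfolding ker[symmetric] using x by (rule imageI)
    then show ?thesis by (simp add: a_kernel_iff)
  qed
  show "\<exists>x\<in>carrier A. f x = y" if "y \<in> carrier B" "g y = \<zero>\<^bsub>D\<^esub>" for y
  proof -
    have "y \<in> f ` carrier A" unfolding ker a_kernel_iff using that by simp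
    then obtain x where "x \<in> carrier A" "y = f x" by (rule imageE)
    then show ?thesis by (intro bexI[of _ x]) simp_all
  qed
  show "\<exists>y\<in>carrier B. g y = z" if "z \<in> carrier D" for z
  proof -
    have "z \<in> g ` carrier B" unfolding surj by (rule that)
    then obtain y where "y \<in> carrier B" "z = g y" by (rule imageE)
    then show ?thesis by (intro bexI[of _ y]) simp_all
  qed
qed

lemma short_exact_kernel:
  assumes h: "h \<in> mod_hom R A B" and A: "left_module R A" and B: "left_module R B"
    and surj: "\<And>z. z \<in> carrier B \<Longrightarrow> \<exists>y\<in>carrier A. h y = z"
  defines "N \<equiv> A\<lparr>carrier := a_kernel A B h\<rparr>"
  shows "left_module R N" and "short_exact R N A B (\<lambda>x\<in>carrier N. x) h"
proof -
  have sub: "submodule (a_kernel A B h) R A" by (rule submodule_kernel[OF h A B])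
  show N: "left_module R N" unfolding N_def by (rule left_module_submodule[OF A sub])
  have car: "carrier N = a_kernel A B h" and zero: "\<zero>\<^bsub>N\<^esub> = \<zero>\<^bsub>A\<^esub>" by (simp_all add: N_def)
  have i: "(\<lambda>x\<in>carrier N. x) \<in> mod_hom R N A"
    using mod_hom_enlarge[of _ R N "a_kernel A B h" A] mod_hom_id[OF N] submodule_subset[OF sub]
    by (simp add: N_def)
  show "short_exact R N A B (\<lambda>x\<in>carrier N. x) h"
    by (rule short_exactI[OF N A B i h _ _ _ surj]) (auto simp: car zero a_kernel_iff)
qed

text \<open>On pairs (w, x) in the product, X is the kernel of a' g x + p w, a pullback up to sign,
  and Y is the kernel of \<open>W \<rightarrow> X' \<rightarrow> Y'\<close>. The projection of X to
  W lands in Y because b' a' = 0. Its kernel consists of the (0, x) with g x = 0, since a' is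
  injective, and so is M.\<close>

lemma pullback_of_cover:
  fixes M I M' X' Y' W U :: "('r, 'u) module"
  assumes s1: "short_exact R M I M' e g" and s2: "short_exact R M' X' Y' a' b'"
    and M: "left_module R M" and I: "left_module R I" and M': "left_module R M'"
    and X': "left_module R X'" and Y': "left_module R Y'" and W: "left_module R W"
    and p: "p \<in> mod_hom R W X'" and psurj: "\<And>x. x \<in> carrier X' \<Longrightarrow> \<exists>w\<in>carrier W. p w = x"
    and U: "is_prod R U W I q r"
  obtains X Y :: "('r, 'u) module" and i \<pi> j c a b where "left_module R X" "left_module R Y"
    "short_exact R X U X' i \<pi>" "short_exact R Y W Y' j c" "short_exact R M X Y a b"
    "\<And>u. u \<in> carrier U \<Longrightarrow> \<pi> u = a' (g (r u)) \<oplus>\<^bsub>X'\<^esub> p (q u)"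
proof -
  note s1 = short_exactD[OF s1 M I] and s2 = short_exactD[OF s2 M' X']
  have LU: "left_module R U" and q: "q \<in> mod_hom R U W" and r: "r \<in> mod_hom R U I"
    using U by (simp_all add: is_prod_def)
  note e = hom_simps[OF s1(1) M I] and g = hom_simps[OF s1(2) I M'] and a' = hom_simps[OF s2(1) M' X']
    and b' = hom_simps[OF s2(2) X' Y'] and ps = hom_simps[OF p W X'] and qs = hom_simps[OF q LU W]
    and rs = hom_simps[OF r LU I]
  define \<pi> where "\<pi> = (\<lambda>u\<in>carrier U. a' (g (r u)) \<oplus>\<^bsub>X'\<^esub> p (q u))"
  have "(\<lambda>u\<in>carrier U. a' ((\<lambda>u\<in>carrier U. g (r u)) u)) \<in> mod_hom R U X'"
    by (rule mod_hom_compose[OF mod_hom_compose[OF r s1(2) LU I M'] s2(1) LU M' X'])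
  from mod_hom_add[OF this mod_hom_compose[OF q p LU W X'] LU X']
  have \<pi>: "\<pi> \<in> mod_hom R U X'" by (simp add: \<pi>_def cong: restrict_cong)
  have \<pi>_apply: "\<pi> u = a' (g (r u)) \<oplus>\<^bsub>X'\<^esub> p (q u)" if "u \<in> carrier U" for u using that by (simp add: \<pi>_def)
  have \<pi>_surj: "\<exists>u\<in>carrier U. \<pi> u = x" if x: "x \<in> carrier X'" for x
  proof -
    obtain w where w: "w \<in> carrier W" "p w = x" using psurj[OF x] by (rule bexE)
    obtain u where u: "u \<in> carrier U" "q u = w" "r u = \<zero>\<^bsub>I\<^esub>"
      using is_prod_ex[OF U w(1) mod_simps(2)[OF I]] by (elim bexE conjE) (rule that; assumption)
    have "\<pi> u = x" unfolding \<pi>_apply[OF u(1)] u(2,3) w(2) g(4) a'(4) by (rule mod_simps(7)[OF X' x])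
    with u(1) show ?thesis by (rule bexI[rotated])
  qed
  define c where "c = (\<lambda>w\<in>carrier W. b' (p w))"
  have c: "c \<in> mod_hom R W Y'" unfolding c_def by (rule mod_hom_compose[OF p s2(2) W X' Y'])
  have c_surj: "\<exists>w\<in>carrier W. c w = y" if y: "y \<in> carrier Y'" for y
  proof -
    obtain x where x: "x \<in> carrier X'" "b' x = y" using s2(6)[OF y] by (rule bexE)
    obtain w where w: "w \<in> carrier W" "p w = x" using psurj[OF x(1)] by (rule bexE)
    show ?thesis by (rule bexI[OF _ w(1)]) (simp add: c_def w x)
  qed
  define X where "X = U\<lparr>carrier := a_kernel U X' \<pi>\<rparr>"
  define Y where "Y = W\<lparr>carrier := a_kernel W Y' c\<rparr>"
  note XX = short_exact_kernel[OF \<pi> LU X' \<pi>_surj, folded X_def]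
    and YY = short_exact_kernel[OF c W Y' c_surj, folded Y_def]
  have Xc: "u \<in> carrier X \<longleftrightarrow> u \<in> carrier U \<and> \<pi> u = \<zero>\<^bsub>X'\<^esub>" for u by (simp add: X_def a_kernel_iff)
  have Yc: "w \<in> carrier Y \<longleftrightarrow> w \<in> carrier W \<and> c w = \<zero>\<^bsub>Y'\<^esub>" for w by (simp add: Y_def a_kernel_iff)
  have qX: "restrict q (carrier X) \<in> mod_hom R X W"
    using mod_hom_restrict_domain[OF q LU W submodule_kernel[OF \<pi> LU X']] by (simp add: X_def)
  have "q u \<in> carrier Y" if u: "u \<in> carrier X" for u
  proof -
    have u: "u \<in> carrier U" "\<pi> u = \<zero>\<^bsub>X'\<^esub>" using u by (simp_all add: Xc)
    have "b' (\<pi> u) = b' (a' (g (r u))) \<oplus>\<^bsub>Y'\<^esub> b' (p (q u))"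
      unfolding \<pi>_apply[OF u(1)] by (intro b'(2) a'(1) g(1) rs(1) ps(1) qs(1) u(1))
    also have "\<dots> = b' (p (q u))"
      unfolding s2(4)[OF g(1)[OF rs(1)[OF u(1)]]]
      by (intro mod_simps(7)[OF Y'] b'(1) ps(1) qs(1) u(1))
    finally show ?thesis unfolding Yc u(2) b'(4) using qs(1)[OF u(1)] by (simp add: c_def)
  qed
  then have "restrict q (carrier X) ` carrier X \<subseteq> a_kernel W Y' c" by (auto simp: Y_def)
  from mod_hom_restrict_image[OF qX this] have b: "restrict q (carrier X) \<in> mod_hom R X Y"
    unfolding Y_def .
  obtain h where h: "h \<in> mod_hom R M U" "\<forall>z\<in>carrier M. q (h z) = (\<lambda>x\<in>carrier M. \<zero>\<^bsub>W\<^esub>) z \<and> r (h z) = e z"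
    using is_prod_pair[OF U W I M mod_hom_zero[OF M W] s1(1)] by (rule bexE)
  have hq: "q (h m) = \<zero>\<^bsub>W\<^esub>" and hr: "r (h m) = e m" and hU: "h m \<in> carrier U" if "m \<in> carrier M" for m
    using h(2) hom_simps(1)[OF h(1) M LU that] that by simp_all
  have hX: "h m \<in> carrier X" if m: "m \<in> carrier M" for m
    unfolding Xc \<pi>_apply[OF hU[OF m]] hq[OF m] hr[OF m] s1(4)[OF m] a'(4) ps(4)
    using hU[OF m] mod_simps(2,7)[OF X'] by simp
  then have "h ` carrier M \<subseteq> a_kernel U X' \<pi>" by (auto simp: X_def)
  from mod_hom_restrict_image[OF h(1) this] have a: "h \<in> mod_hom R M X" unfolding X_def .
  have zero: "\<zero>\<^bsub>X\<^esub> = \<zero>\<^bsub>U\<^esub>" "\<zero>\<^bsub>Y\<^esub> = \<zero>\<^bsub>W\<^esub>" by (simp_all add: X_def Y_def)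
  have "short_exact R M X Y h (restrict q (carrier X))"
  proof (rule short_exactI[OF M XX(1) YY(1) a b])
    fix m assume m: "m \<in> carrier M" "h m = \<zero>\<^bsub>X\<^esub>"
    have "e m = \<zero>\<^bsub>I\<^esub>" unfolding hr[OF m(1), symmetric] m(2) zero by (rule rs(4))
    then show "m = \<zero>\<^bsub>M\<^esub>" by (rule s1(3)[OF m(1)])
  next
    fix m assume m: "m \<in> carrier M"
    show "restrict q (carrier X) (h m) = \<zero>\<^bsub>Y\<^esub>" using hX[OF m] hq[OF m] zero by simp
  next
    fix u assume u: "u \<in> carrier X" "restrict q (carrier X) u = \<zero>\<^bsub>Y\<^esub>"
    have uU: "u \<in> carrier U" "\<pi> u = \<zero>\<^bsub>X'\<^esub>" and qu: "q u = \<zero>\<^bsub>W\<^esub>" using u zero by (simp_all add: Xc)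
    have gr: "g (r u) \<in> carrier M'" by (rule g(1)[OF rs(1)[OF uU(1)]])
    have "a' (g (r u)) = \<zero>\<^bsub>X'\<^esub>"
      using uU(2) unfolding \<pi>_apply[OF uU(1)] qu ps(4) mod_simps(8)[OF X' a'(1)[OF gr]] .
    then have "g (r u) = \<zero>\<^bsub>M'\<^esub>" by (rule s2(3)[OF gr])
    from s1(5)[OF rs(1)[OF uU(1)] this] obtain m where m: "m \<in> carrier M" "e m = r u" by (rule bexE)
    have "h m = u"
      by (rule is_prod_eqI[OF U hU[OF m(1)] uU(1)]) (simp_all add: hq hr m qu)
    with m(1) show "\<exists>m\<in>carrier M. h m = u" by (rule bexI[rotated])
  next
    fix w assume "w \<in> carrier Y"
    then have w: "w \<in> carrier W" "b' (p w) = \<zero>\<^bsub>Y'\<^esub>" by (simp_all add: Yc c_def split: if_splits)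
    obtain m where m: "m \<in> carrier M'" "a' m = p w" using s2(5)[OF ps(1)[OF w(1)] w(2)] by (rule bexE)
    obtain x where x: "x \<in> carrier I" "g x = m" using s1(6)[OF m(1)] by (rule bexE)
    \<comment> \<open>\<pi> adds its two parts, so the second coordinate must be -x for them to
      cancel.\<close>
    have x': "\<zero>\<^bsub>I\<^esub> \<ominus>\<^bsub>I\<^esub> x \<in> carrier I" by (intro mod_simps(2,4)[OF I] x(1))
    obtain u where u: "u \<in> carrier U" "q u = w" "r u = \<zero>\<^bsub>I\<^esub> \<ominus>\<^bsub>I\<^esub> x"
      using is_prod_ex[OF U w(1) x'] by (elim bexE conjE)
    have "a' (g (r u)) = \<zero>\<^bsub>X'\<^esub> \<ominus>\<^bsub>X'\<^esub> p w"
      unfolding u(3) g(5)[OF mod_simps(2)[OF I] x(1)] g(4) x(2) a'(5)[OF mod_simps(2)[OF M'] m(1)] a'(4) m(2) ..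
    then have "\<pi> u = \<zero>\<^bsub>X'\<^esub>"
      unfolding \<pi>_apply[OF u(1)] u(2) using mod_simps(11)[OF X' mod_simps(2)[OF X'] ps(1)[OF w(1)]] by simp
    then have "u \<in> carrier X" using u(1) by (simp add: Xc)
    then show "\<exists>u\<in>carrier X. restrict q (carrier X) u = w" using u(2) by (intro bexI[of _ u]) simp_all
  qed
  from that[OF XX(1) YY(1) XX(2) YY(2) this \<pi>_apply] show thesis .
qed

text \<open>X embeds in the product by (a1 b, \<epsilon>): what a1 b kills comes from M, and there
  \<epsilon> is the injection e. The copy of I in the product meets X exactly in M, so I modulo M,
  which is M', embeds in the cokernel X'. Dividing it out leaves W modulo Y, which is Y'.\<close>

lemma pushout_in_product:
  fixes M I M' X Y Y' W U :: "('r, 'u) module"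
  assumes s1: "short_exact R M I M' e g" and s2: "short_exact R M X Y a b" and s3: "short_exact R Y W Y' a1 b1"
    and M: "left_module R M" and I: "left_module R I" and M': "left_module R M'"
    and X: "left_module R X" and Y: "left_module R Y" and Y': "left_module R Y'" and W: "left_module R W"
    and \<epsilon>: "\<epsilon> \<in> mod_hom R X I" and \<epsilon>a: "\<And>m. m \<in> carrier M \<Longrightarrow> \<epsilon> (a m) = e m"
    and U: "is_prod R U W I q r"
  obtains X' :: "('r, 'u) module" and \<iota> \<pi> a' b' where "left_module R X'"
    "short_exact R X U X' \<iota> \<pi>" "short_exact R M' X' Y' a' b'"
proof -
  note s1 = short_exactD[OF s1 M I] and s2 = short_exactD[OF s2 M X] and s3 = short_exactD[OF s3 Y W]
  have LU: "left_module R U" and q: "q \<in> mod_hom R U W" and r: "r \<in> mod_hom R U I"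
    using U by (simp_all add: is_prod_def)
  note e = hom_simps[OF s1(1) M I] and g = hom_simps[OF s1(2) I M'] and a = hom_simps[OF s2(1) M X]
    and b = hom_simps[OF s2(2) X Y] and a1 = hom_simps[OF s3(1) Y W] and b1 = hom_simps[OF s3(2) W Y']
    and qs = hom_simps[OF q LU W] and rs = hom_simps[OF r LU I] and \<epsilon>s = hom_simps[OF \<epsilon> X I]
  obtain \<iota> where \<iota>: "\<iota> \<in> mod_hom R X U"
    "\<forall>x\<in>carrier X. q (\<iota> x) = (\<lambda>x\<in>carrier X. a1 (b x)) x \<and> r (\<iota> x) = \<epsilon> x"
    using is_prod_pair[OF U W I X mod_hom_compose[OF s2(2) s3(1) X Y W] \<epsilon>] by (rule bexE)
  have \<iota>q: "q (\<iota> x) = a1 (b x)" and \<iota>r: "r (\<iota> x) = \<epsilon> x" if "x \<in> carrier X" for x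
    using \<iota>(2) that by simp_all
  note \<iota>s = hom_simps[OF \<iota>(1) X LU]
  obtain X' :: "('r, 'u) module" and \<pi> where X': "left_module R X'" and \<pi>: "\<pi> \<in> mod_hom R U X'"
    and \<pi>im: "\<pi> ` carrier U = carrier X'"
    and \<pi>ker: "\<And>u. u \<in> carrier U \<Longrightarrow> \<pi> u = \<zero>\<^bsub>X'\<^esub> \<longleftrightarrow> u \<in> \<iota> ` carrier X"
    by (rule quotient_in_universe[OF LU submodule_image[OF \<iota>(1) X LU]]) (rule that; assumption)
  note \<pi>s = hom_simps[OF \<pi> LU X']
  have \<pi>\<iota>: "\<pi> (\<iota> x) = \<zero>\<^bsub>X'\<^esub>" if "x \<in> carrier X" for x
    using \<pi>ker[OF \<iota>s(1)[OF that]] that by simp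
  have \<pi>0: "\<exists>x\<in>carrier X. \<iota> x = u" if "u \<in> carrier U" "\<pi> u = \<zero>\<^bsub>X'\<^esub>" for u
  proof -
    have "u \<in> \<iota> ` carrier X" using \<pi>ker[OF that(1)] that(2) by simp
    then obtain x where "x \<in> carrier X" "u = \<iota> x" by (rule imageE)
    then show ?thesis by (intro bexI[of _ x]) simp_all
  qed
  have \<pi>surj: "\<exists>u\<in>carrier U. \<pi> u = x" if "x \<in> carrier X'" for x
  proof -
    have "x \<in> \<pi> ` carrier U" unfolding \<pi>im by (rule that)
    then obtain u where "u \<in> carrier U" "x = \<pi> u" by (rule imageE)
    then show ?thesis by (intro bexI[of _ u]) simp_all
  qed
  have from_M: "\<exists>m\<in>carrier M. a m = x" if x: "x \<in> carrier X" "a1 (b x) = \<zero>\<^bsub>W\<^esub>" for x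
    by (rule s2(5)[OF x(1) s3(3)[OF b(1)[OF x(1)] x(2)]])
  have sU: "short_exact R X U X' \<iota> \<pi>"
  proof (rule short_exactI[OF X LU X' \<iota>(1) \<pi> _ \<pi>\<iota> \<pi>0 \<pi>surj])
    fix x assume x: "x \<in> carrier X" "\<iota> x = \<zero>\<^bsub>U\<^esub>"
    have ab: "a1 (b x) = \<zero>\<^bsub>W\<^esub>" and ex: "\<epsilon> x = \<zero>\<^bsub>I\<^esub>"
      using \<iota>q[OF x(1)] \<iota>r[OF x(1)] x(2) qs(4) rs(4) by simp_all
    from from_M[OF x(1) ab] obtain m where m: "m \<in> carrier M" "a m = x" by (rule bexE)
    have "m = \<zero>\<^bsub>M\<^esub>" by (rule s1(3)[OF m(1)]) (use \<epsilon>a[OF m(1)] m(2) ex in simp)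
    then show "x = \<zero>\<^bsub>X\<^esub>" using m(2) a(4) by simp
  qed
  obtain j where j: "j \<in> mod_hom R I U"
    "\<forall>x\<in>carrier I. q (j x) = (\<lambda>x\<in>carrier I. \<zero>\<^bsub>W\<^esub>) x \<and> r (j x) = (\<lambda>x\<in>carrier I. x) x"
    using is_prod_pair[OF U W I I mod_hom_zero[OF I W] mod_hom_id[OF I]] by (rule bexE)
  have jq: "q (j x) = \<zero>\<^bsub>W\<^esub>" and jr: "r (j x) = x" if "x \<in> carrier I" for x
    using j(2) that by simp_all
  note js = hom_simps[OF j(1) I LU]
  define J where "J = (\<lambda>x\<in>carrier I. \<pi> (j x))"
  have J: "J \<in> mod_hom R I X'" unfolding J_def by (rule mod_hom_compose[OF j(1) \<pi> I LU X'])
  have J0: "J x = \<zero>\<^bsub>X'\<^esub>" if x: "x \<in> carrier I" "g x = \<zero>\<^bsub>M'\<^esub>" for x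
  proof -
    obtain m where m: "m \<in> carrier M" "e m = x" using s1(5)[OF x] by (rule bexE)
    have "j x = \<iota> (a m)"
      by (rule is_prod_eqI[OF U js(1)[OF x(1)] \<iota>s(1)[OF a(1)[OF m(1)]]])
        (simp_all add: jq[OF x(1)] jr[OF x(1)] \<iota>q[OF a(1)[OF m(1)]] \<iota>r[OF a(1)[OF m(1)]] s2(4)[OF m(1)] a1(4)
          \<epsilon>a[OF m(1)] m(2))
    then show ?thesis using x(1) \<pi>\<iota>[OF a(1)[OF m(1)]] by (simp add: J_def)
  qed
  have "g ` carrier I = carrier M'" using assms(1) by (simp add: short_exact_def)
  from mod_hom_factor[OF s1(2) this J I M' X' J0]
  obtain a' where a': "a' \<in> mod_hom R M' X'" "\<forall>x\<in>carrier I. a' (g x) = J x" by (rule bexE)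
  have a'g: "a' (g x) = \<pi> (j x)" if "x \<in> carrier I" for x using a'(2) that by (simp add: J_def)
  define H where "H = (\<lambda>u\<in>carrier U. b1 (q u))"
  have H: "H \<in> mod_hom R U Y'" unfolding H_def by (rule mod_hom_compose[OF q s3(2) LU W Y'])
  have "H u = \<zero>\<^bsub>Y'\<^esub>" if u: "u \<in> carrier U" "\<pi> u = \<zero>\<^bsub>X'\<^esub>" for u
  proof -
    obtain x where x: "x \<in> carrier X" "\<iota> x = u" using \<pi>0[OF u] by (rule bexE)
    show ?thesis using u(1) \<iota>q[OF x(1)] s3(4)[OF b(1)[OF x(1)]] by (simp add: H_def x(2))
  qed
  from mod_hom_factor[OF \<pi> \<pi>im H LU X' Y' this]
  obtain b' where b': "b' \<in> mod_hom R X' Y'" "\<forall>u\<in>carrier U. b' (\<pi> u) = H u" by (rule bexE)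
  have b'\<pi>: "b' (\<pi> u) = b1 (q u)" if "u \<in> carrier U" for u using b'(2) that by (simp add: H_def)
  have "short_exact R M' X' Y' a' b'"
  proof (rule short_exactI[OF M' X' Y' a'(1) b'(1)])
    fix m assume m: "m \<in> carrier M'" "a' m = \<zero>\<^bsub>X'\<^esub>"
    obtain x where x: "x \<in> carrier I" "g x = m" using s1(6)[OF m(1)] by (rule bexE)
    have "\<pi> (j x) = \<zero>\<^bsub>X'\<^esub>" using a'g[OF x(1)] m(2) x(2) by simp
    from \<pi>0[OF js(1)[OF x(1)] this] obtain y where y: "y \<in> carrier X" "\<iota> y = j x" by (rule bexE)
    have ab: "a1 (b y) = \<zero>\<^bsub>W\<^esub>" and ey: "\<epsilon> y = x"
      using \<iota>q[OF y(1)] \<iota>r[OF y(1)] jq[OF x(1)] jr[OF x(1)] y(2) by simp_all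
    from from_M[OF y(1) ab] obtain n where n: "n \<in> carrier M" "a n = y" by (rule bexE)
    show "m = \<zero>\<^bsub>M'\<^esub>" using s1(4)[OF n(1)] \<epsilon>a[OF n(1)] n(2) ey x(2) by simp
  next
    fix m assume m: "m \<in> carrier M'"
    obtain x where x: "x \<in> carrier I" "g x = m" using s1(6)[OF m] by (rule bexE)
    show "b' (a' m) = \<zero>\<^bsub>Y'\<^esub>"
      using a'g[OF x(1)] b'\<pi>[OF js(1)[OF x(1)]] jq[OF x(1)] b1(4) x(2) by simp
  next
    fix x assume x: "x \<in> carrier X'" "b' x = \<zero>\<^bsub>Y'\<^esub>"
    obtain u where u: "u \<in> carrier U" "\<pi> u = x" using \<pi>surj[OF x(1)] by (rule bexE)
    have "b1 (q u) = \<zero>\<^bsub>Y'\<^esub>" using b'\<pi>[OF u(1)] u(2) x(2) by simp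
    from s3(5)[OF qs(1)[OF u(1)] this] obtain y where y: "y \<in> carrier Y" "a1 y = q u" by (rule bexE)
    obtain z where z: "z \<in> carrier X" "b z = y" using s2(6)[OF y(1)] by (rule bexE)
    \<comment> \<open>Subtracting the image of z removes the W-coordinate and keeps the class in X'.
      What is left comes from I, hence x from M'.\<close>
    let ?v = "u \<ominus>\<^bsub>U\<^esub> \<iota> z"
    have v: "?v \<in> carrier U" by (rule mod_simps(4)[OF LU u(1) \<iota>s(1)[OF z(1)]])
    have qv: "q ?v = \<zero>\<^bsub>W\<^esub>"
      unfolding qs(5)[OF u(1) \<iota>s(1)[OF z(1)]] \<iota>q[OF z(1)] z(2) y(2) by (rule mod_simps(9)[OF W qs(1)[OF u(1)]])
    have "?v = j (r ?v)"
      by (rule is_prod_eqI[OF U v js(1)[OF rs(1)[OF v]]]) (simp_all only: qv jq[OF rs(1)[OF v]] jr[OF rs(1)[OF v]])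
    then have "\<pi> ?v = a' (g (r ?v))" using a'g[OF rs(1)[OF v]] by simp
    moreover have "\<pi> ?v = x"
      unfolding \<pi>s(5)[OF u(1) \<iota>s(1)[OF z(1)]] \<pi>\<iota>[OF z(1)] u(2) by (rule mod_simps(10)[OF X' x(1)])
    ultimately show "\<exists>m\<in>carrier M'. a' m = x" using g(1)[OF rs(1)[OF v]] by (intro bexI) simp_all
  next
    fix y assume y: "y \<in> carrier Y'"
    obtain w where w: "w \<in> carrier W" "b1 w = y" using s3(6)[OF y] by (rule bexE)
    obtain u where u: "u \<in> carrier U" "q u = w" "r u = \<zero>\<^bsub>I\<^esub>"
      using is_prod_ex[OF U w(1) mod_simps(2)[OF I]] by (elim bexE conjE) (rule that; assumption)
    show "\<exists>x\<in>carrier X'. b' x = y"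
      by (rule bexI[OF _ \<pi>s(1)[OF u(1)]]) (simp add: b'\<pi>[OF u(1)] u(2) w(2))
  qed
  from that[OF X' sU this] show thesis .
qed

section \<open>The two inductions\<close>

context dual_complex
begin

text \<open>An element x is a map out of the free module \<open>E 0\<close>. The lowest condition of
  \<open>ctf\<close> extends it along the embedding of \<open>E 0\<close> in \<open>E 1\<close>, and
  the extension lifts through p because \<open>E 1\<close> is a summand of a power of C.\<close>

lemma Add_precover_surj:
  assumes X: "left_module R X" and ctf: "ctf (Suc k) X" and W: "left_module R W"
    and p: "p \<in> mod_hom R W X" and l: "lifts R CR W X p" and x: "x \<in> carrier X"
  shows "\<exists>w\<in>carrier W. p w = x"
proof -
  from E0_hom[OF X x] obtain h where h: "h \<in> mod_hom R (E 0) X" "h idC = x" by (rule bexE)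
  have ext: "ext_along R (E 0) (E (Suc 0)) (\<delta> 0) X" using ctf by (simp add: ctf_def)
  have h0: "h z = \<zero>\<^bsub>X\<^esub>" if z: "z \<in> carrier (E 0)" "\<delta> 0 z = \<zero>\<^bsub>E (Suc 0)\<^esub>" for z
  proof -
    have "z = \<zero>\<^bsub>E 0\<^esub>"
      by (rule inj_onD[OF \<delta>0_inj _ z(1) mod_simps(2)[OF E]]) (simp only: z(2) \<delta>_simps(4))
    then show ?thesis using hom_simps(4)[OF h(1) E X] by simp
  qed
  obtain g where g: "g \<in> mod_hom R (E (Suc 0)) X" "\<And>z. z \<in> carrier (E 0) \<Longrightarrow> g (\<delta> 0 z) = h z"
    by (rule ext_alongD[OF ext h(1) h0]) (assumption | rule that; assumption)+
  obtain A f where "dual_basis R S C (Q (Suc 0)) A f" by (rule basis)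
  then interpret D: dual_basis R S C "Q (Suc 0)" A f .
  obtain g' where g': "g' \<in> mod_hom R (E (Suc 0)) W" "\<And>z. z \<in> carrier (E (Suc 0)) \<Longrightarrow> p (g' z) = g z"
    by (rule liftsD[OF D.dual_lifts[OF W X p l] g(1)]) (rule that; assumption)
  have d: "\<delta> 0 idC \<in> carrier (E (Suc 0))" by (rule \<delta>_simps(1)[OF idC])
  show ?thesis
    by (rule bexI[OF _ hom_simps(1)[OF g'(1) E W d]]) (simp add: g'(2)[OF d] g(2)[OF idC] h(2))
qed

text \<open>k counts degrees held in reserve. The induction hypothesis is applied to the first
  cosyzygy with k + 1. The extra degree makes the precover of X' surjective and is lost on the way
  from X' to X, which in turn gains a degree of cosphericity. For n = 0 take X = M and Y =
  0.\<close>

lemma short_exact_of_cotorsionfree_cosyzygy: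
  fixes M :: "('a, 'a) module" and I :: "nat \<Rightarrow> ('a, 'a) module"
  assumes "left_module R M" "coresolution R M I e f" "\<And>i. injective_module R (I i)"
    "ctf (n + k) (cosyz M I f n)"
  shows "\<exists>(X :: ('a, 'a) module) (Y :: ('a, 'a) module) a b. left_module R X \<and> left_module R Y \<and>
    short_exact R M X Y a b \<and> csph n X \<and> ctf k X \<and> Add_length R CR n Y"
  using assms
proof (induction n arbitrary: M I e f k)
  case 0
  note M = 0(1)
  let ?z = "\<lambda>x\<in>carrier M. \<zero>\<^bsub>M\<^esub>"
  have z: "?z \<in> mod_hom R M M" by (rule mod_hom_zero[OF M M])
  have Y: "left_module R (M\<lparr>carrier := {\<zero>\<^bsub>M\<^esub>}\<rparr>)"
    using left_module_submodule[OF M submodule_image[OF z M M]] mod_simps(2)[OF M]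
    by (simp add: image_constant[of "\<zero>\<^bsub>M\<^esub>"])
  have "?z \<in> mod_hom R M (M\<lparr>carrier := {\<zero>\<^bsub>M\<^esub>}\<rparr>)" by (rule mod_hom_restrict_image[OF z]) auto
  then have "short_exact R M M (M\<lparr>carrier := {\<zero>\<^bsub>M\<^esub>}\<rparr>) (\<lambda>x\<in>carrier M. x) ?z"
    by (intro short_exactI[OF M M Y mod_hom_id[OF M]]) (use mod_simps(2)[OF M] in auto)
  moreover have "csph 0 M" by (simp add: csph_def)
  moreover have "ctf k M" using 0(4) by simp
  moreover have "Add_length R CR 0 (M\<lparr>carrier := {\<zero>\<^bsub>M\<^esub>}\<rparr>)" by simp
  ultimately show ?case using M Y by (intro exI conjI)
next
  case (Suc n)
  note M = Suc.prems(1) and s = coresolution_shift[OF Suc.prems(2,1)]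
  have LI: "left_module R (I 0)" using Suc.prems(3)[of 0] by (simp add: injective_module_def)
  define M1 where "M1 = (I 1)\<lparr>carrier := f 0 ` carrier (I 0)\<rparr>"
  note s = s[folded M1_def]
  have "ctf (n + Suc k) (cosyz M1 (\<lambda>i. I (Suc i)) (\<lambda>i. f (Suc i)) n)"
    using Suc.prems(4) unfolding cosyz_Suc by (simp add: cosyz_def M1_def)
  from Suc.IH[OF s(1,3) Suc.prems(3) this] obtain X' :: "('a, 'a) module" and Y' :: "('a, 'a) module" and a' b'
    where X': "left_module R X'" and Y': "left_module R Y'" and ses: "short_exact R M1 X' Y' a' b'"
    and csph: "csph n X'" and ctf: "ctf (Suc k) X'" and len: "Add_length R CR n Y'"
    by (elim exE conjE) (rule that; assumption)
  obtain W :: "('a, 'a) module" and p where W: "in_Add R CR W" and p: "p \<in> mod_hom R W X'" and l: "lifts R CR W X' p"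
    by (rule Add_precover[OF inf CR X' finitely_generated_hom_separating[OF CR_fg CR X']]) (rule that; assumption)
  have LW: "left_module R W" by (rule in_Add_left_module[OF W])
  obtain U :: "('a, 'a) module" and q r where U: "is_prod R U W (I 0) q r"
    by (rule prod_in_universe[OF inf LW LI]) (rule that; assumption)
  obtain X Y :: "('a, 'a) module" and i \<pi> j c a b where X: "left_module R X" and Y: "left_module R Y"
    and sX: "short_exact R X U X' i \<pi>" and sY: "short_exact R Y W Y' j c" and sM: "short_exact R M X Y a b"
    and \<pi>: "\<And>u. u \<in> carrier U \<Longrightarrow> \<pi> u = a' (f 0 (r u)) \<oplus>\<^bsub>X'\<^esub> p (q u)"
    by (rule pullback_of_cover[OF s(2) ses M LI s(1) X' Y' LW p Add_precover_surj[OF X' ctf LW p l] U])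
      (assumption | rule that; assumption)+
  have LU: "left_module R U" using U by (simp add: is_prod_def)
  note s2 = short_exactD[OF s(2) M LI] and s3 = short_exactD[OF ses s(1) X']
  \<comment> \<open>A map from C to X' lifts to W by the precover property; completed by a zero
    coordinate in I it becomes a lift to U.\<close>
  have l': "lifts R CR U X' \<pi>"
    unfolding lifts_def
  proof (rule ballI)
    fix \<phi> assume \<phi>: "\<phi> \<in> mod_hom R CR X'"
    obtain \<psi> where \<psi>: "\<psi> \<in> mod_hom R CR W" "\<And>z. z \<in> carrier CR \<Longrightarrow> p (\<psi> z) = \<phi> z"
      by (rule liftsD[OF l \<phi>]) (rule that; assumption)
    from is_prod_pair[OF U LW LI CR \<psi>(1) mod_hom_zero[OF CR LI]]
    obtain h where h: "h \<in> mod_hom R CR U"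
      "\<forall>z\<in>carrier CR. q (h z) = \<psi> z \<and> r (h z) = (\<lambda>z\<in>carrier CR. \<zero>\<^bsub>I 0\<^esub>) z" by (rule bexE)
    have "\<pi> (h z) = \<phi> z" if z: "z \<in> carrier CR" for z
    proof -
      have qr: "q (h z) = \<psi> z" "r (h z) = \<zero>\<^bsub>I 0\<^esub>" using h(2) z by simp_all
      show ?thesis
        unfolding \<pi>[OF hom_simps(1)[OF h(1) CR LU z]] qr hom_simps(4)[OF s2(2) LI s(1)]
          hom_simps(4)[OF s3(1) s(1) X'] \<psi>(2)[OF z]
        by (rule mod_simps(7)[OF X' hom_simps(1)[OF \<phi> CR X' z]])
    qed
    with h(1) show "\<exists>\<psi>\<in>mod_hom R CR U. \<forall>z\<in>carrier CR. \<pi> (\<psi> z) = \<phi> z" by (intro bexI ballI)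
  qed
  have sh: "shift R S C Q d B dB X X' U W (I 0) i \<pi> q r"
    by (intro shift.intro shift_axioms.intro dual_complex_axioms sX X X' W Suc.prems(3) U)
  show ?case
    by (intro exI conjI) (rule X, rule Y, rule sM, rule shift.csph_kernel[OF sh l' csph],
      rule shift.ctf_kernel[OF sh l' ctf], rule Add_length_SucI[OF W Y' sY len])
qed

text \<open>Here the reserve k grows along the recursion: compared with X, the cokernel X' has one
  degree of \<open>ctf\<close> more and one of \<open>csph\<close> less. For n = 0 one has Y = 0,
  and M is isomorphic to X.\<close>

lemma cotorsionfree_cosyzygy_of_short_exact:
  fixes M X Y :: "('a, 'a) module" and I :: "nat \<Rightarrow> ('a, 'a) module"
  assumes "left_module R M" "coresolution R M I e f" "\<And>i. injective_module R (I i)"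
    "left_module R X" "left_module R Y" "short_exact R M X Y a b"
    "csph n X" "ctf k X" "Add_length R CR n Y"
  shows "ctf (n + k) (cosyz M I f n)"
  using assms
proof (induction n arbitrary: M I e f k X Y a b)
  case 0
  note M = 0(1) and X = 0(4) and s = short_exactD[OF 0(6) 0(1) 0(4)]
  have Y: "carrier Y = {\<zero>\<^bsub>Y\<^esub>}" using 0(9) by simp
  have "x \<in> a ` carrier M" if x: "x \<in> carrier X" for x
  proof -
    have "b x \<in> {\<zero>\<^bsub>Y\<^esub>}" unfolding Y[symmetric] by (rule hom_simps(1)[OF s(2) X 0(5) x])
    then have "b x = \<zero>\<^bsub>Y\<^esub>" by simp
    from s(5)[OF x this] obtain m where m: "m \<in> carrier M" "a m = x" by (rule bexE)
    show ?thesis unfolding m(2)[symmetric] by (rule imageI[OF m(1)])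
  qed
  then have "a ` carrier M = carrier X" using hom_simps(1)[OF s(1) M X] by (intro equalityI subsetI) auto
  then have a: "bij_betw a (carrier M) (carrier X)"
    using 0(6) by (simp add: bij_betw_def short_exact_def)
  have "ext_along R (E i) (E (Suc i)) (\<delta> i) M" if "i < k" for i
    by (rule ext_along_iso[OF _ s(1) a M X E E \<delta>]) (use 0(8) that in \<open>simp add: ctf_def\<close>)
  then show ?case by (simp add: ctf_def)
next
  case (Suc n)
  note M = Suc.prems(1) and X = Suc.prems(4) and Y = Suc.prems(5)
  note s = coresolution_shift[OF Suc.prems(2,1)]
  have LI: "left_module R (I 0)" using Suc.prems(3)[of 0] by (simp add: injective_module_def)
  define M1 where "M1 = (I 1)\<lparr>carrier := f 0 ` carrier (I 0)\<rparr>"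
  note s = s[folded M1_def]
  note e = short_exactD(1)[OF s(2) M LI]
  obtain W Y' a1 b1 where W: "in_Add R CR W" and Y': "left_module R Y'" and sY: "short_exact R Y W Y' a1 b1"
    and len: "Add_length R CR n Y'"
    using Suc.prems(9) by (rule Add_length_SucE)
  have LW: "left_module R W" by (rule in_Add_left_module[OF W])
  have a: "a \<in> mod_hom R M X" "inj_on a (carrier M)"
    using Suc.prems(6) by (simp_all add: short_exact_def)
  \<comment> \<open>Injectivity of \<open>I 0\<close> extends e along the embedding of M in X; this
    becomes the I-coordinate of the embedding of X in the product.\<close>
  have "\<exists>\<epsilon>\<in>mod_hom R X (I 0). \<forall>m\<in>carrier M. \<epsilon> (a m) = e m"
    using Suc.prems(3)[of 0] M X a e unfolding injective_module_def by blast
  then obtain \<epsilon> where \<epsilon>: "\<epsilon> \<in> mod_hom R X (I 0)" "\<forall>m\<in>carrier M. \<epsilon> (a m) = e m" by (rule bexE)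
  obtain U :: "('a, 'a) module" and q r where U: "is_prod R U W (I 0) q r"
    by (rule prod_in_universe[OF inf LW LI]) (rule that; assumption)
  obtain X' :: "('a, 'a) module" and \<iota> \<pi> a' b' where X': "left_module R X'"
    and sU: "short_exact R X U X' \<iota> \<pi>" and s': "short_exact R M1 X' Y' a' b'"
    by (rule pushout_in_product[OF s(2) Suc.prems(6) sY M LI s(1) X Y Y' LW \<epsilon>(1) bspec[OF \<epsilon>(2)] U])
      (assumption | rule that; assumption)+
  have sh: "shift R S C Q d B dB X X' U W (I 0) \<iota> \<pi> q r"
    by (intro shift.intro shift_axioms.intro dual_complex_axioms sU X X' W Suc.prems(3) U)
  have "ctf (n + Suc k) (cosyz M1 (\<lambda>i. I (Suc i)) (\<lambda>i. f (Suc i)) n)"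
    by (rule Suc.IH[OF s(1,3) Suc.prems(3) X' Y' s' shift.csph_cokernel[OF sh Suc.prems(7)]
          shift.ctf_cokernel[OF sh shift.lifts_of_csph[OF sh Suc.prems(7)] Suc.prems(8)] len])
  then show ?case unfolding cosyz_Suc by (simp add: cosyz_def M1_def)
qed

end

text \<open>Cutting off the first term leaves a minimal injective resolution of the first cosyzygy,
  whose embedding has image that of \<open>f 0\<close>. Its existence makes the choice inside
  \<open>cotranspose\<close> meaningful for cosyzygies.\<close>

lemma minimal_injective_resolution_cosyz:
  fixes M :: "('u, 'u) module"
  assumes "left_module R M" "minimal_injective_resolution R M I e f"
  shows "left_module R (cosyz M I f n) \<and>
    (\<exists>e'. minimal_injective_resolution R (cosyz M I f n) (\<lambda>i. I (n + i)) e' (\<lambda>i. f (n + i)))"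
  using assms
proof (induction n arbitrary: M I e f)
  case 0
  then show ?case by (intro conjI exI[of _ e]) simp_all
next
  case (Suc n)
  note res = Suc.prems(2)[unfolded minimal_injective_resolution_def]
  note s = coresolution_shift[OF conjunct1[OF res] Suc.prems(1)]
  define M1 where "M1 = (I 1)\<lparr>carrier := f 0 ` carrier (I 0)\<rparr>"
  note s = s[folded M1_def]
  have "(\<lambda>x\<in>carrier M1. x) ` carrier M1 = f 0 ` carrier (I 0)" by (simp add: M1_def)
  then have "minimal_injective_resolution R M1 (\<lambda>i. I (Suc i)) (\<lambda>x\<in>carrier M1. x) (\<lambda>i. f (Suc i))"
    unfolding minimal_injective_resolution_def using res s(3) by simp
  from Suc.IH[OF s(1) this] show ?case
    unfolding cosyz_Suc by (simp add: cosyz_def M1_def)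
qed

theorem theorem3p9:
  fixes R S :: "'u ring"
    and C :: "('u, 'u, 'u) bimodule"
    and M :: "('u, 'u) module"
    and I :: "nat \<Rightarrow> ('u, 'u) module"
    and e :: "'u \<Rightarrow> 'u"
    and f :: "nat \<Rightarrow> 'u \<Rightarrow> 'u"
    and n :: nat
  assumes "infinite (UNIV :: 'u set)"
    and "ring R" and "ring S"
    and "semidualizing R S C"
    and "left_module R M"
    and "minimal_injective_resolution R M I e f"
    and "n \<ge> 1"
  shows "cotorsionfree R S C n (cosyzygy I f n) \<longleftrightarrow>
    (\<exists>(X :: ('u, 'u) module) (Y :: ('u, 'u) module) a b.
       left_module R X \<and> left_module R Y \<and> short_exact R M X Y a b \<and>
       cospherical R C n X \<and> Add_id R (left_mod C) Y \<le> enat (n - 1))"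
proof -
  interpret semidualizing_bimodule R S C by (rule semidualizing_bimodule.intro[OF assms(1,4)])
  have fgR: "has_fg_projective_resolution R CR" and fgS: "has_fg_projective_resolution T CS"
    using assms(4) by (simp_all add: semidualizing_def)
  obtain Q d where Q: "aug_res T Q d" "Q 0 = CS" "\<And>i. finitely_generated T (Q i)"
    by (rule fg_augmented_resolution[OF fgS CS]) (rule that; assumption)
  obtain B dB where B: "aug_res R B dB" "B 0 = CR" "\<And>i. finitely_generated R (B i)"
    by (rule fg_augmented_resolution[OF fgR CR]) (rule that; assumption)
  interpret dual_complex R S C Q d B dB
    by (intro dual_complex.intro dual_complex_axioms.intro semidualizing_bimodule_axioms Q B)
  have res: "coresolution R M I e f" and inj: "injective_module R (I i)" for i
    using assms(6) by (simp_all add: minimal_injective_resolution_def)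
  note K = minimal_injective_resolution_cosyz[OF assms(5,6), of n]
  obtain e' where "minimal_injective_resolution R (cosyz M I f n) (\<lambda>i. I (n + i)) e' (\<lambda>i. f (n + i))"
    using conjunct2[OF K] by (rule exE)
  from cotorsionfree_iff_ctf[OF conjunct1[OF K] this]
  have ctf: "cotorsionfree R S C n (cosyzygy I f n) \<longleftrightarrow> ctf n (cosyz M I f n)"
    unfolding cosyz_cosyzygy[OF assms(7), of I f M] .
  note len = Add_id_le_iff[OF CR _ assms(7)]
  show ?thesis
    unfolding ctf
  proof
    assume "ctf n (cosyz M I f n)"
    \<comment> \<open>The case k = 0: no degree of cotorsionfreeness is asked of X.\<close>
    then have "ctf (n + 0) (cosyz M I f n)" by simp
    from short_exact_of_cotorsionfree_cosyzygy[OF assms(5) res inj this]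
    obtain X Y :: "('u, 'u) module" and a b where X: "left_module R X" and Y: "left_module R Y"
      and s: "short_exact R M X Y a b" and c: "csph n X" and l: "Add_length R CR n Y"
      by (elim exE conjE) (rule that; assumption)
    show "\<exists>(X :: ('u, 'u) module) (Y :: ('u, 'u) module) a b.
       left_module R X \<and> left_module R Y \<and> short_exact R M X Y a b \<and>
       cospherical R C n X \<and> Add_id R CR Y \<le> enat (n - 1)"
      by (intro exI conjI)
        (rule X, rule Y, rule s, rule cospherical_iff_csph[OF X, THEN iffD2, OF c], rule len[OF Y, THEN iffD2, OF l])
  next
    assume "\<exists>(X :: ('u, 'u) module) (Y :: ('u, 'u) module) a b.
       left_module R X \<and> left_module R Y \<and> short_exact R M X Y a b \<and>
       cospherical R C n X \<and> Add_id R CR Y \<le> enat (n - 1)"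
    then obtain X Y :: "('u, 'u) module" and a b where X: "left_module R X" and Y: "left_module R Y"
      and s: "short_exact R M X Y a b" and c: "cospherical R C n X" and l: "Add_id R CR Y \<le> enat (n - 1)"
      by (elim exE conjE) (rule that; assumption)
    have "ctf 0 X" by (simp add: ctf_def)
    from cotorsionfree_cosyzygy_of_short_exact[OF assms(5) res inj X Y s
        cospherical_iff_csph[OF X, THEN iffD1, OF c] this len[OF Y, THEN iffD1, OF l]]
    show "ctf n (cosyz M I f n)" by simp
  qed
qed

end
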